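(* Let $\Gamma\le G=G_1\times G_2\times\cdots\times G_n$ ($n\ge 2$) be an irreducible lattice in a product of locally compact second countable groups. If $\Gamma$ acts (by isometries) Roller minimally and Roller non-elementarily on a complete separable irreducible median space $X$ of finite rank, then there exists an $\mathrm{Isom}(X)$-invariant median subspace $Y\subseteq X$ on which the $\Gamma$-action extends to an isometric action of $G$ that factors through the projection onto one of the $G_i$'s.
   Context: A lattice $\Gamma\le G_1\times\cdots\times G_n$ is irreducible if for every $1\le i\le n$ the projection of $\Gamma$ into $\prod_{j\ne i}G_j$ is dense. A metric space $(X,d)$ is a median space if for all $x,y,z\in X$ the intersection $[x,y]\cap[x,z]\cap[y,z]$ is a single point $m(x,y,z)$, where $[a,b]=\{c\in X: d(a,b)=d(a,c)+d(c,b)\}$. A subset $A$ is convex if $[a,b]\subseteq A$ for all $a,b\in A$. A halfspace is a subset $\mathfrak h$ such that $\mathfrak h$ and its complement $\mathfrak h^c$ are convex. Two halfspaces are transverse if each of $\mathfrak h_1,\mathfrak h_1^c$ meets each of $\mathfrak h_2,\mathfrak h_2^c$. The rank is the maximal number of pairwise transverse halfspaces. $X$ is irreducible if it is not the $\ell^1$-product of two median spaces neither of which is a single point. A median subspace is a nonempty subset closed under $m$, with the restricted metric. For $X$ complete of finite rank, intervals are compact, and the Roller compactification $\bar X$ is the closure of the image of $X\to\prod_{a,b\in X}[a,b]$, $x\mapsto(m(x,a,b))_{a,b}$, in the product topology; it is a compact median algebra with coordinatewise median operation, with intervals $[x,y]=\{z: m(x,y,z)=z\}$ and convexity defined via these intervals.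 Isometries of $X$ extend to $\bar X$. An isometric action $\Gamma\curvearrowright X$ (with $X$ not a single point) is Roller minimal if there is no nonempty proper $\Gamma$-invariant closed convex subset of $\bar X$, and Roller non-elementary if there is no finite $\Gamma$-orbit in $\bar X$. *)

theory Defs
  imports
    "HOL-Analysis.Analysis"
    "HOL-Library.Extended_Nat"
    "HOL-Algebra.Group_Action"
    "HOL-Algebra.Left_Coset"
    "HOL-Algebra.Product_Groups"
begin

definition topological_group :: "('g, 'm) monoid_scheme \<Rightarrow> 'g topology \<Rightarrow> bool" where
  "topological_group G T \<longleftrightarrow>
     group G \<and> topspace T = carrier G \<and>
     continuous_map (prod_topology T T) T (\<lambda>(x, y). x \<otimes>\<^bsub>G\<^esub> y) \<and>
     continuous_map T T (\<lambda>x. inv\<^bsub>G\<^esub> x)"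

text \<open>As usual, locally compact groups are understood to be Hausdorff.\<close>

definition lcsc_group :: "('g, 'm) monoid_scheme \<Rightarrow> 'g topology \<Rightarrow> bool" where
  "lcsc_group G T \<longleftrightarrow>
     topological_group G T \<and> Hausdorff_space T \<and> locally_compact_space T \<and> second_countable T"

text \<open>The Borel sigma-algebra of the quotient topology on the space of left cosets of \<open>\<Gamma>\<close>: the
  preimage in the group of a set \<open>U\<close> of cosets is the union of \<open>U\<close>.\<close>

definition coset_borel :: "('g, 'm) monoid_scheme \<Rightarrow> 'g topology \<Rightarrow> 'g set \<Rightarrow> 'g set measure" where
  "coset_borel G T \<Gamma> = sigma (LCOSETS G \<Gamma>) {U. U \<subseteq> LCOSETS G \<Gamma> \<and> openin T (\<Union>U)}"

text \<open>A lattice is a discrete subgroup such that the coset space carries a nonzero finite Borel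
  measure invariant under left translations.\<close>

definition lattice_subgroup :: "('g, 'm) monoid_scheme \<Rightarrow> 'g topology \<Rightarrow> 'g set \<Rightarrow> bool" where
  "lattice_subgroup G T \<Gamma> \<longleftrightarrow>
     subgroup \<Gamma> G \<and> subtopology T \<Gamma> = discrete_topology \<Gamma> \<and>
     (\<exists>\<mu>. sets \<mu> = sets (coset_borel G T \<Gamma>) \<and> finite_measure \<mu> \<and> emeasure \<mu> (space \<mu>) \<noteq> 0 \<and>
        (\<forall>g\<in>carrier G. \<forall>A\<in>sets \<mu>. emeasure \<mu> ((\<lambda>C. l_coset G g C) ` A) = emeasure \<mu> A))"

definition irreducible_lattice ::
  "'i set \<Rightarrow> ('i \<Rightarrow> ('g, 'm) monoid_scheme) \<Rightarrow> ('i \<Rightarrow> 'g topology) \<Rightarrow> ('i \<Rightarrow> 'g) set \<Rightarrow> bool" where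
  "irreducible_lattice I G T \<Gamma> \<longleftrightarrow>
     lattice_subgroup (product_group I G) (product_topology T I) \<Gamma> \<and>
     (\<forall>i\<in>I. product_topology T (I - {i}) closure_of ((\<lambda>g. restrict g (I - {i})) ` \<Gamma>)
              = topspace (product_topology T (I - {i})))"

definition median_interval :: "'a set \<Rightarrow> ('a \<Rightarrow> 'a \<Rightarrow> real) \<Rightarrow> 'a \<Rightarrow> 'a \<Rightarrow> 'a set" where
  "median_interval M d a b = {c \<in> M. d a b = d a c + d c b}"

definition median_space :: "'a set \<Rightarrow> ('a \<Rightarrow> 'a \<Rightarrow> real) \<Rightarrow> bool" where
  "median_space M d \<longleftrightarrow>
     Metric_space M d \<and> M \<noteq> {} \<and>
     (\<forall>x\<in>M. \<forall>y\<in>M. \<forall>z\<in>M.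
        is_singleton (median_interval M d x y \<inter> median_interval M d x z \<inter> median_interval M d y z))"

definition med :: "'a set \<Rightarrow> ('a \<Rightarrow> 'a \<Rightarrow> real) \<Rightarrow> 'a \<Rightarrow> 'a \<Rightarrow> 'a \<Rightarrow> 'a" where
  "med M d x y z =
     the_elem (median_interval M d x y \<inter> median_interval M d x z \<inter> median_interval M d y z)"

definition median_convex :: "'a set \<Rightarrow> ('a \<Rightarrow> 'a \<Rightarrow> real) \<Rightarrow> 'a set \<Rightarrow> bool" where
  "median_convex M d A \<longleftrightarrow> A \<subseteq> M \<and> (\<forall>a\<in>A. \<forall>b\<in>A. median_interval M d a b \<subseteq> A)"

definition halfspace :: "'a set \<Rightarrow> ('a \<Rightarrow> 'a \<Rightarrow> real) \<Rightarrow> 'a set \<Rightarrow> bool" where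
  "halfspace M d h \<longleftrightarrow> median_convex M d h \<and> median_convex M d (M - h)"

definition transverse :: "'a set \<Rightarrow> 'a set \<Rightarrow> 'a set \<Rightarrow> bool" where
  "transverse M h k \<longleftrightarrow>
     h \<inter> k \<noteq> {} \<and> h \<inter> (M - k) \<noteq> {} \<and> (M - h) \<inter> k \<noteq> {} \<and> (M - h) \<inter> (M - k) \<noteq> {}"

definition median_rank :: "'a set \<Rightarrow> ('a \<Rightarrow> 'a \<Rightarrow> real) \<Rightarrow> enat" where
  "median_rank M d =
     Sup {enat (card H) | H. finite H \<and> (\<forall>h\<in>H. halfspace M d h) \<and> pairwise (transverse M) H}"

text \<open>The factors of an \<open>\<ell>\<^sup>1\<close>-product embed in the product, so it is no restriction to look for
  them, up to isometry, among sets of the same element type.\<close>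

definition median_irreducible :: "'a set \<Rightarrow> ('a \<Rightarrow> 'a \<Rightarrow> real) \<Rightarrow> bool" where
  "median_irreducible M d \<longleftrightarrow>
     \<not> (\<exists>(A :: 'a set) dA (B :: 'a set) dB f.
          median_space A dA \<and> \<not> is_singleton A \<and> median_space B dB \<and> \<not> is_singleton B \<and>
          bij_betw f M (A \<times> B) \<and>
          (\<forall>x\<in>M. \<forall>y\<in>M. d x y = dA (fst (f x)) (fst (f y)) + dB (snd (f x)) (snd (f y))))"

definition median_subspace :: "'a set \<Rightarrow> ('a \<Rightarrow> 'a \<Rightarrow> real) \<Rightarrow> 'a set \<Rightarrow> bool" where
  "median_subspace M d Y \<longleftrightarrow>
     Y \<subseteq> M \<and> Y \<noteq> {} \<and> (\<forall>x\<in>Y. \<forall>y\<in>Y. \<forall>z\<in>Y. med M d x y z \<in> Y)"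

definition separable_metric :: "'a set \<Rightarrow> ('a \<Rightarrow> 'a \<Rightarrow> real) \<Rightarrow> bool" where
  "separable_metric M d \<longleftrightarrow>
     (\<exists>S. countable S \<and> S \<subseteq> M \<and> Metric_space.mtopology M d closure_of S = M)"

definition isometries :: "'a set \<Rightarrow> ('a \<Rightarrow> 'a \<Rightarrow> real) \<Rightarrow> ('a \<Rightarrow> 'a) set" where
  "isometries M d = {f \<in> Bij M. \<forall>x\<in>M. \<forall>y\<in>M. d (f x) (f y) = d x y}"

definition isometric_action ::
  "('g, 'm) monoid_scheme \<Rightarrow> 'a set \<Rightarrow> ('a \<Rightarrow> 'a \<Rightarrow> real) \<Rightarrow> ('g \<Rightarrow> 'a \<Rightarrow> 'a) \<Rightarrow> bool" where
  "isometric_action G M d \<phi> \<longleftrightarrow> group_action G M \<phi> \<and> (\<forall>g\<in>carrier G. \<phi> g \<in> isometries M d)"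

definition interval_product_topology ::
  "'a set \<Rightarrow> ('a \<Rightarrow> 'a \<Rightarrow> real) \<Rightarrow> ('a \<times> 'a \<Rightarrow> 'a) topology" where
  "interval_product_topology M d =
     product_topology
       (\<lambda>(a, b). subtopology (Metric_space.mtopology M d) (median_interval M d a b)) (M \<times> M)"

definition roller_embed :: "'a set \<Rightarrow> ('a \<Rightarrow> 'a \<Rightarrow> real) \<Rightarrow> 'a \<Rightarrow> 'a \<times> 'a \<Rightarrow> 'a" where
  "roller_embed M d x = (\<lambda>(a, b)\<in>M \<times> M. med M d x a b)"

definition roller :: "'a set \<Rightarrow> ('a \<Rightarrow> 'a \<Rightarrow> real) \<Rightarrow> ('a \<times> 'a \<Rightarrow> 'a) set" where
  "roller M d = interval_product_topology M d closure_of (roller_embed M d ` M)"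

definition roller_med ::
  "'a set \<Rightarrow> ('a \<Rightarrow> 'a \<Rightarrow> real) \<Rightarrow> ('a \<times> 'a \<Rightarrow> 'a) \<Rightarrow> ('a \<times> 'a \<Rightarrow> 'a) \<Rightarrow> ('a \<times> 'a \<Rightarrow> 'a) \<Rightarrow> 'a \<times> 'a \<Rightarrow> 'a"
  where
  "roller_med M d \<xi> \<eta> \<zeta> = (\<lambda>p\<in>M \<times> M. med M d (\<xi> p) (\<eta> p) (\<zeta> p))"

definition roller_interval ::
  "'a set \<Rightarrow> ('a \<Rightarrow> 'a \<Rightarrow> real) \<Rightarrow> ('a \<times> 'a \<Rightarrow> 'a) \<Rightarrow> ('a \<times> 'a \<Rightarrow> 'a) \<Rightarrow> ('a \<times> 'a \<Rightarrow> 'a) set" where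
  "roller_interval M d \<xi> \<eta> = {\<zeta> \<in> roller M d. roller_med M d \<xi> \<eta> \<zeta> = \<zeta>}"

definition roller_convex ::
  "'a set \<Rightarrow> ('a \<Rightarrow> 'a \<Rightarrow> real) \<Rightarrow> ('a \<times> 'a \<Rightarrow> 'a) set \<Rightarrow> bool" where
  "roller_convex M d A \<longleftrightarrow> A \<subseteq> roller M d \<and> (\<forall>\<xi>\<in>A. \<forall>\<eta>\<in>A. roller_interval M d \<xi> \<eta> \<subseteq> A)"

text \<open>The continuous extension of an isometry \<open>f\<close>; on embedded points it is
  \<open>f (med x (f\<^sup>-\<^sup>1 a) (f\<^sup>-\<^sup>1 b)) = med (f x) a b\<close>.\<close>

definition roller_extend :: "'a set \<Rightarrow> ('a \<Rightarrow> 'a) \<Rightarrow> ('a \<times> 'a \<Rightarrow> 'a) \<Rightarrow> 'a \<times> 'a \<Rightarrow> 'a" where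
  "roller_extend M f \<xi> = (\<lambda>(a, b)\<in>M \<times> M. f (\<xi> (inv_into M f a, inv_into M f b)))"

definition roller_minimal ::
  "('g, 'm) monoid_scheme \<Rightarrow> 'a set \<Rightarrow> ('a \<Rightarrow> 'a \<Rightarrow> real) \<Rightarrow> ('g \<Rightarrow> 'a \<Rightarrow> 'a) \<Rightarrow> bool" where
  "roller_minimal G M d \<phi> \<longleftrightarrow>
     \<not> is_singleton M \<and>
     \<not> (\<exists>A. A \<noteq> {} \<and> A \<subset> roller M d \<and>
          closedin (subtopology (interval_product_topology M d) (roller M d)) A \<and>
          roller_convex M d A \<and>
          (\<forall>g\<in>carrier G. roller_extend M (\<phi> g) ` A \<subseteq> A))"

definition roller_nonelementary ::
  "('g, 'm) monoid_scheme \<Rightarrow> 'a set \<Rightarrow> ('a \<Rightarrow> 'a \<Rightarrow> real) \<Rightarrow> ('g \<Rightarrow> 'a \<Rightarrow> 'a) \<Rightarrow> bool" where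
  "roller_nonelementary G M d \<phi> \<longleftrightarrow>
     \<not> (\<exists>\<xi>\<in>roller M d. finite (orbit G (\<lambda>g. roller_extend M (\<phi> g)) \<xi>))"

end

theory Submission
  imports Defs "HOL-Library.Ramsey"
begin

text \<open>
 The points of a complete median space of finite rank are separated by walls: halfspaces that are
 thick together with their complements (\<open>strict_separation\<close>). Minimality makes every
 wall \<open>h\<close> flippable, that is, some element maps the complement of \<open>h\<close> into \<open>h\<close> (\<open>flip\<close>).
 If the walls split into two mutually transverse classes,
 the space is a product (\<open>reducible\<close>). So irreducibility makes any wall movable into any other one
 (\<open>translate_into\<close>), and finite rank gives two disjoint walls that no wall crosses simultaneously
 (\<open>strongly_separated\<close>). Their translates are chains of walls, each strongly nested in the previous
 one: seen from the complement of the larger wall \<open>h\<close> all points of the smaller wall \<open>k\<close> look alike, as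
 the median of a point of \<open>k\<close> and two points off \<open>h\<close> does not depend on the former. Without three
 disjoint walls the two ends of such a chain would form a finite orbit (\<open>facing_triple\<close>). Hence there
 are as many disjoint translates of a wall as desired, and three disjoint translates of \<open>h\<close> determine
 a point of \<open>X\<close>, their center: the median of any points of the corresponding translates of \<open>k\<close>.

 The dynamical part produces a finite subset of \<open>X\<close> that is preserved by all lattice elements with
 \<open>i\<close>-th coordinate close to the identity, for some \<open>i\<close>. It takes place on the group \<open>G\<close> with a measure
 that is invariant under left translation and under right translation by the lattice. A capacity is a
 measurable function \<open>U\<close> on \<open>G\<close> with values in \<open>[0, 1]\<close>, to be thought of as the mass that an equivariant
 family of measures on \<open>X\<close> gives to a fixed wall. It satisfies \<open>U x + U (x \<gamma>) \<ge> 1\<close> if the wall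
 and its translate by \<open>\<gamma>\<close> cover \<open>X\<close>, and the sum of \<open>U (x \<gamma>)\<close> over \<open>\<gamma>\<close> from a family with disjoint
 translates of the wall is at most two. An equivariant map from \<open>G\<close> to \<open>X\<close> provides a first capacity.

 For each factor the capacity is averaged over left translations by a dense subgroup of the product
 of the other factors (\<open>averaging_step\<close>). The second inequality survives if the averages of a
 certain square integrable equivariant function tend to zero. This function records the centers of
 the triples of disjoint translates that are charged at a point. If its averages do not tend to
 zero, an average of minimal norm is invariant (\<open>invariant_vector\<close>). The places where it is large
 give a finite set \<open>F\<close> and an invariant set \<open>E\<close> of positive measure such that \<open>F\<close> is preserved by every
 lattice element that leads from a point of \<open>E\<close> into \<open>E\<close>. As \<open>E\<close> essentially depends on the \<open>i\<close>-th
 coordinate only, these elements include those with \<open>i\<close>-th coordinate close to the identity. If on the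
 other hand all steps go through, the final capacity is invariant under a dense subgroup of \<open>G\<close>. Then
 it is at least one half almost everywhere by the first inequality, and five disjoint translates
 contradict the second one (\<open>finite_set_fixed_by_neighbourhood\<close>).

 Finally \<open>F\<close> can be moved into any wall. Therefore a lattice element with \<open>i\<close>-th coordinate close to the
 identity returns a point of each of three given walls to its wall, and it fixes the center of the
 three walls if there is one. The centers generate a median subspace \<open>Y\<close> that is invariant under all
 isometries, and each point of \<open>Y\<close> is fixed by all lattice elements with \<open>i\<close>-th coordinate in some
 neighbourhood of the identity. As the lattice is dense in the \<open>i\<close>-th factor, its action on \<open>Y\<close> extends
 to this factor by continuity (\<open>extended_action\<close>).\<close>

section \<open>Median spaces\<close>

locale median =
 fixes M :: "'a set" and d :: "'a => 'a => real"
 assumes median_space: "median_space M d"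
begin

abbreviation I where "I == median_interval M d"
abbreviation m where "m == med M d"
abbreviation cvx where "cvx == median_convex M d"
abbreviation hs where "hs == halfspace M d"

sublocale Metric_space M d using median_space by (simp add: median_space_def)

lemma M_nonempty: "M ~= {}" using median_space by (simp add: median_space_def)

lemma I_iff: "c : I a b \<longleftrightarrow> c : M & d a b = d a c + d c b"
 by (auto simp: median_interval_def)

lemma I_M: "c : I a b ==> c : M" by (simp add: I_iff)

lemma I_sym: "I a b = I b a" by (auto simp: I_iff commute add.commute)

lemma I_self: "a : M ==> a : I a b" "b : M ==> b : I a b" by (auto simp: I_iff)

lemma I_refl: "a : M ==> I a a = {a}"
 by (auto simp: I_iff) (metis commute mdist_zero nonneg add_nonneg_eq_0_iff zero)+

lemma I_trans:
 assumes "a : M" "b : M" "c : I a b" "e : I a c"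
 shows "e : I a b" "c : I e b"
 using assms triangle[of a e b] triangle[of e c b] by (auto simp: I_iff)

lemma med_props:
 assumes "a : M" "b : M" "c : M"
 shows "m a b c : I a b" "m a b c : I a c" "m a b c : I b c" "m a b c : M"
proof -
 have "is_singleton (I a b \<inter> I a c \<inter> I b c)"
  using median_space assms by (auto simp: median_space_def)
 hence "I a b \<inter> I a c \<inter> I b c = {m a b c}"
  by (auto simp: is_singleton_the_elem med_def)
 hence "m a b c : I a b \<inter> I a c \<inter> I b c" by simp
 thus "m a b c : I a b" "m a b c : I a c" "m a b c : I b c" "m a b c : M" by (auto simp: I_M)
qed

lemma med_unique:
 assumes "a : M" "b : M" "c : M" "t : I a b" "t : I a c" "t : I b c"
 shows "m a b c = t"
proof -
 have "is_singleton (I a b \<inter> I a c \<inter> I b c)"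
  using median_space assms by (auto simp: median_space_def)
 hence "I a b \<inter> I a c \<inter> I b c = {m a b c}"
  by (auto simp: is_singleton_the_elem med_def)
 moreover have "t : I a b \<inter> I a c \<inter> I b c" using assms by blast
 ultimately show ?thesis by simp
qed

lemma med_swap12: "m a b c = m b a c" by (simp add: med_def I_sym[of a b] Int_ac)

lemma med_swap23: "m a b c = m a c b" by (simp add: med_def I_sym[of b c] Int_ac)

lemma med_swap13: "m a b c = m c b a" by (metis med_swap12 med_swap23)

lemma med_eq_iff:
 assumes "a : M" "b : M" "c : M"
 shows "m a b c = c \<longleftrightarrow> c : I a b"
 using assms med_props(1)[OF assms] med_unique[OF assms] I_self by auto

lemma med_id:
 assumes "a : M" "b : M"
 shows "m a a b = a" by (rule med_unique) (use assms I_self in auto)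

text \<open>The median \<open>m x b c\<close> is the gate of \<open>x\<close> in \<open>[b, c]\<close>: it lies between \<open>x\<close> and every point \<open>z\<close>
 of the interval. Indeed it does not change if \<open>b\<close> and \<open>c\<close> are replaced by their medians \<open>p\<close>
 and \<open>q\<close> with \<open>x\<close> and \<open>z\<close>, which lie between \<open>x\<close> and \<open>z\<close>.\<close>

lemma med_gate:
 assumes x: "x : M" and b: "b : M" and c: "c : M" and z: "z : I b c"
 shows "m x b c : I x z"
proof -
 have zM: "z : M" using z by (rule I_M)
 define p where "p = m x z b"
 define q where "q = m x z c"
 define u where "u = m x p q"
 note p = med_props[OF x zM b, folded p_def] and q = med_props[OF x zM c, folded q_def]
 note u = med_props[OF x p(4) q(4), folded u_def]
 have bp: "d b z = d b p + d p z" "d x b = d x p + d p b" "d x z = d x p + d p z"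
  and cq: "d c z = d c q + d q z" "d x c = d x q + d q c" "d x z = d x q + d q z"
  and uu: "d x p = d x u + d u p" "d x q = d x u + d u q" "d p q = d p u + d u q"
  and bc: "d b c = d b z + d z c" using p q u z by (auto simp: I_iff commute)
 have "d b c <= d b p + d p q + d q c" "d p q <= d p z + d z q"
  using triangle[OF b p(4) c] triangle[OF p(4) q(4) c] triangle[OF p(4) zM q(4)] by auto
 hence pq: "d p q = d p z + d z q" using bp cq bc by (simp add: commute)
 have "u : I x b" "u : I x c"
  using I_trans(1)[OF x b p(2) u(1)] I_trans(1)[OF x c q(2) u(2)] by auto
 moreover have "u : I b c"
  using triangle[OF b p(4) u(4)] triangle[OF u(4) q(4) c] triangle[OF b u(4) c] bp cq uu bc pq u(4)
  by (auto simp: I_iff commute)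
 ultimately have "m x b c = u" using med_unique x b c by blast
 moreover have "u : I x z" using I_trans(1)[OF x zM p(1) u(1)] .
 ultimately show ?thesis by simp
qed

lemma cvx_I:
 assumes b: "b : M" and c: "c : M"
 shows "cvx (I b c)" unfolding median_convex_def
proof (intro conjI ballI subsetI)
 fix x assume "x : I b c" thus "x : M" by (rule I_M)
next
 fix a a' t assume a: "a : I b c" "a' : I b c" and t: "t : I a a'"
 have M: "a : M" "a' : M" "t : M" using a t I_M by auto
 define g where "g = m t b c"
 have g: "g : I t a" "g : I t a'" "g : I b c" "g : M"
  using med_gate[OF M(3) b c a(1)] med_gate[OF M(3) b c a(2)] med_props[OF M(3) b c]
  unfolding g_def by auto
 have "d a a' = d a g + d g t + (d t g + d g a')" using g t by (auto simp: I_iff commute)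
 hence "d t g <= 0" using triangle[OF M(1) g(4) M(2)] by (simp add: commute)
 hence "t = g" using zero[OF M(3) g(4)] nonneg[of t g] by simp
 thus "t : I b c" using g by simp
qed

lemma cvxD: "cvx A ==> a : A ==> b : A ==> t : I a b ==> t : A" by (auto simp: median_convex_def)

lemma cvx_sub: "cvx A ==> A <= M" by (auto simp: median_convex_def)

lemma cvx_Inter: "(!!A. A : \<A> ==> cvx A) ==> \<A> ~= {} ==> cvx (\<Inter>\<A>)"
 unfolding median_convex_def by blast

lemma cvx_Int: "cvx A ==> cvx B ==> cvx (A \<inter> B)" unfolding median_convex_def by blast

lemma cvx_singleton: "x : M ==> cvx {x}" by (auto simp: median_convex_def I_refl)

lemma cvx_med:
 assumes "cvx A" "a : A" "b : A" "c : M"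
 shows "m a b c : A" "m a c b : A" "m c a b : A"
proof -
 have "a : M" "b : M" using assms cvx_sub by auto
 thus "m a b c : A" using med_props(1) assms cvxD by blast
 thus "m a c b : A" "m c a b : A" by (metis med_swap12 med_swap23)+
qed

text \<open>Peano property: here \<open>s\<close> is the point of \<open>[w, e]\<close> closest to \<open>x\<close>; both \<open>s\<close> and \<open>w\<close> have
 the same gate in \<open>[x, a]\<close>, and comparing their distances to \<open>u\<close> gives \<open>s = w\<close>.\<close>

lemma peano:
 assumes x: "x : M" and a: "a : M" and v: "v : M" and u: "u : I x a" and w: "w : I u v"
 shows "w : I x (m w v a)"
proof -
 have M: "u : M" "w : M" using u w I_M by auto
 define e where "e = m w v a"
 note e = med_props[OF M(2) v a, folded e_def]
 define s where "s = m x w e"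
 note s = med_props[OF x M(2) e(4), folded s_def]
 have sv: "s : I w v" and sa: "s : I w a"
  using I_trans(1)[OF M(2) v e(1) s(3)] I_trans(1)[OF M(2) a e(2) s(3)] by auto
 have 1: "d u s = d u w + d w s"
  using w sv triangle[OF M(1) s(4) v] triangle[OF M(1) M(2) s(4)] by (auto simp: I_iff)
 define r where "r = m s x a"
 note r = med_props[OF s(4) x a, folded r_def]
 have sx: "s : I w x" using s(1) I_sym by auto
 have "s : I w r"
  using sx r(1) triangle[OF M(2) r(4) x] triangle[OF M(2) s(4) r(4)] s(4) by (auto simp: I_iff)
 moreover have "r : I w x" "r : I w a"
  using sx sa r triangle[OF M(2) r(4) x] triangle[OF M(2) s(4) r(4)]
   triangle[OF M(2) r(4) a] by (auto simp: I_iff)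
 hence "m w x a = r" using med_unique[OF M(2) x a] r(3) by blast
 hence "r : I w u" using med_gate[OF M(2) x a u] by simp
 moreover have "r : I s u" using med_gate[OF s(4) x a u] r_def by simp
 ultimately have "d w s <= 0" using 1 by (auto simp: I_iff commute)
 hence "w = s" using zero[OF M(2) s(4)] nonneg[of w s] by simp
 thus ?thesis using s(2) e_def by simp
qed

lemma pasch:
 assumes x: "x : M" and a: "a : M" and c: "c : M" and b: "b : I x a" and e: "e : I x c"
 shows "m b a e : I a e" "m b a e : I b c"
proof -
 have M: "b : M" "e : M" using b e I_M by auto
 define t where "t = m b a e"
 note t = med_props[OF M(1) a M(2), folded t_def]
 show "m b a e : I a e" using t t_def by simp
 have "t : I c (m t b x)" by (rule peano[OF c x M(1), of e]) (use e t I_sym in auto)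
 moreover have "b : I t x" using I_trans(2)[of a x b t] a x b t I_sym by auto
 hence "m t b x = b" using med_unique[OF t(4) M(1) x] I_self M by (metis I_self(1) I_self(2))
 ultimately show "m b a e : I b c" using t_def I_sym by auto
qed

text \<open>The Peano property moves an end of \<open>[u, v]\<close> on the segments from \<open>x\<close> into \<open>C\<close>; it is applied
 to one end after the other.\<close>

lemma cvx_join:
 assumes C: "cvx C" "C ~= {}" and x: "x : M"
 shows "cvx (\<Union>c\<in>C. I x c)" unfolding median_convex_def
proof (intro conjI ballI subsetI)
 fix y assume "y : (\<Union>c\<in>C. I x c)" thus "y : M" using I_M by auto
next
 fix u v w assume "u : (\<Union>c\<in>C. I x c)" "v : (\<Union>c\<in>C. I x c)" and w: "w : I u v"
 then obtain a b where a: "a : C" "u : I x a" and b: "b : C" "v : I x b" by auto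
 have M: "a : M" "b : M" "u : M" "v : M" "w : M" using a b w C cvx_sub I_M by auto
 define a' where "a' = m w v a"
 have a': "w : I x a'" "a' : I v a" "a' : M"
  using peano[OF x M(1) M(4) a(2) w] med_props[OF M(5) M(4) M(1)] a'_def by auto
 define b' where "b' = m a' a b"
 have b': "a' : I x b'" "b' : I a b" "b' : M"
  using peano[OF x M(2) M(1) b(2) a'(2)] med_props[OF a'(3) M(1,2)] b'_def by auto
 have "b' : C" using b' a b C cvxD by blast
 moreover have "w : I x b'" using I_trans(1)[OF x b'(3) b'(1) a'(1)] .
 ultimately show "w : (\<Union>c\<in>C. I x c)" by auto
qed

lemma maximal_cvx_disjoint:
 assumes "cvx A" "A \<inter> B = {}"
 obtains H where "A <= H" "cvx H" "H \<inter> B = {}" "!!K. H <= K ==> cvx K ==> K \<inter> B = {} ==> K = H"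
proof -
 let ?S = "{K. A <= K & cvx K & K \<inter> B = {}}"
 have "EX H:?S. ALL X:?S. H <= X --> X = H"
 proof (rule subset_Zorn_nonempty)
  show "?S ~= {}" using assms by auto
  fix \<C> assume ne: "\<C> ~= {}" and ch: "subset.chain ?S \<C>"
  have sub: "\<C> <= ?S" using ch by (auto simp: subset.chain_def)
  have "cvx (\<Union>\<C>)" unfolding median_convex_def
  proof (intro conjI ballI subsetI)
   fix x assume "x : \<Union>\<C>" thus "x : M" using sub by (auto dest: cvx_sub)
  next
   fix a b t assume "a : \<Union>\<C>" "b : \<Union>\<C>" and t: "t : I a b"
   then obtain U V where UV: "a : U" "b : V" "U : \<C>" "V : \<C>" by auto
   hence "U <= V | V <= U" using ch unfolding subset.chain_def by blast
   then obtain W where "W : \<C>" "a : W" "b : W" using UV by auto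
   moreover have "cvx W" using sub `W : \<C>` by auto
   ultimately have "t : W" using t cvxD by metis
   thus "t : \<Union>\<C>" using `W : \<C>` by auto
  qed
  thus "\<Union>\<C> : ?S" using sub ne by auto
 qed
 thus ?thesis using that by (auto 0 4)
qed

text \<open>Kakutani's separation property: a maximal pair of disjoint convex sets is complementary, since
 a point outside could otherwise be joined to both, against the Pasch property.\<close>

lemma halfspace_separation:
 assumes A: "cvx A" and B: "cvx B" and AB: "A \<inter> B = {}"
 obtains h where "hs h" "A <= h" "B <= M - h"
proof (cases "A = {} | B = {}")
 case True
 have "hs {}" "hs M" by (auto simp: halfspace_def median_convex_def I_M)
 thus ?thesis using True that A B cvx_sub by (metis Diff_cancel Diff_empty empty_subsetI)
next
 case False
 obtain H where H: "A <= H" "cvx H" "H \<inter> B = {}"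
  and Hm: "!!K. H <= K ==> cvx K ==> K \<inter> B = {} ==> K = H"
  using maximal_cvx_disjoint[OF A AB] by metis
 obtain K where K: "B <= K" "cvx K" "K \<inter> H = {}"
  and Km: "!!L. K <= L ==> cvx L ==> L \<inter> H = {} ==> L = K"
  using maximal_cvx_disjoint[OF B, of H] H(3) by (metis Int_commute)
 have ne: "H ~= {}" "K ~= {}" using False H K by auto
 have "M - H = K"
 proof (rule ccontr)
  assume "M - H ~= K"
  then obtain x where x: "x : M" "x ~: H" "x ~: K" using K cvx_sub by blast
  have HM: "H <= M" "K <= M" using H K cvx_sub by auto
  have "H <= (\<Union>c\<in>H. I x c)" "K <= (\<Union>c\<in>K. I x c)" using I_self(2) HM by blast+
  moreover have "x : (\<Union>c\<in>H. I x c)" "x : (\<Union>c\<in>K. I x c)" using I_self x ne by auto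
  ultimately have "(\<Union>c\<in>H. I x c) \<inter> K ~= {}" "(\<Union>c\<in>K. I x c) \<inter> H ~= {}"
   using Hm[OF _ cvx_join[OF H(2) ne(1) x(1)]] Km[OF _ cvx_join[OF K(2) ne(2) x(1)]] x K(1)
   by blast+
  then obtain a b c e where ab: "a : H" "b : K" "b : I x a" "c : K" "e : H" "e : I x c" by auto
  hence "m b a e : I a e" "m b a e : I b c" using pasch[of x a c b e] x HM by auto
  hence "m b a e : H" "m b a e : K" using ab H K cvxD by blast+
  thus False using K by auto
 qed
 thus ?thesis using that[of H] H K by (auto simp: halfspace_def)
qed

lemma hs_compl: "hs h ==> hs (M - h)" by (auto simp: halfspace_def double_diff median_convex_def)

lemma hs_sub: "hs h ==> h <= M" by (auto simp: halfspace_def median_convex_def)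

lemma hs_cvx: "hs h ==> cvx h" "hs h ==> cvx (M - h)" by (auto simp: halfspace_def)

text \<open>Membership of a median in a halfspace is decided by majority; together with the separation of
 points this reduces every median identity to a propositional tautology.\<close>

lemma hs_med:
 assumes "hs h" "a : M" "b : M" "c : M"
 shows "m a b c : h \<longleftrightarrow> (a : h & b : h) | (a : h & c : h) | (b : h & c : h)"
proof -
 have *: "m a b c : k"
  if "hs k" "(a : k & b : k) | (a : k & c : k) | (b : k & c : k)" for k
  using that(2) cvx_med[OF hs_cvx(1)[OF that(1)]] assms(2-4) by metis
 have "m a b c : M - h" if "~ ((a : h & b : h) | (a : h & c : h) | (b : h & c : h))"
  by (rule *[OF hs_compl[OF assms(1)]]) (use that assms(2-4) in auto)
 thus ?thesis using *[OF assms(1)] by auto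
qed

lemma hs_separate_points:
 assumes "x : M" "y : M" "x ~= y"
 obtains h where "hs h" "x : h" "y ~: h"
proof -
 have "{x} \<inter> {y} = {}" using assms by simp
 then obtain h where "hs h" "{x} <= h" "{y} <= M - h"
  using halfspace_separation[OF cvx_singleton cvx_singleton] assms by metis
 thus ?thesis using that by auto
qed

lemma eq_by_hs:
 assumes "x : M" "y : M" "!!h. hs h ==> x : h ==> y : h"
 shows "x = y" using hs_separate_points assms by metis

lemma in_cvx_by_hs:
 assumes "cvx C" "x : M" "!!h. hs h ==> x : h ==> C \<inter> h ~= {}"
 shows "x : C"
proof (rule ccontr)
 assume "x ~: C"
 then obtain h where "hs h" "{x} <= h" "C <= M - h"
  using halfspace_separation[of "{x}" C] cvx_singleton assms by auto
 thus False using assms(3)[of h] by auto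
qed

lemma in_I_by_hs:
 assumes "x : M" "a : M" "b : M" "!!h. hs h ==> x : h ==> a : h | b : h"
 shows "x : I a b"
proof (rule in_cvx_by_hs[OF cvx_I[OF assms(2,3)] assms(1)])
 fix h assume "hs h" "x : h"
 thus "I a b \<inter> h ~= {}" using assms(2,3) assms(4)[of h] I_self by blast
qed

lemma hs_I:
 assumes "hs h" "x : I a b" "x : h" "a : M" "b : M"
 shows "a : h | b : h" using cvxD[OF hs_cvx(2)[OF assms(1)], of a b x] assms by auto

lemma med_distrib:
 assumes "x : M" "y : M" "z : M" "a : M" "b : M"
 shows "m (m x y z) a b = m (m x a b) (m y a b) (m z a b)"
 by (rule eq_by_hs) (use assms in "auto simp: hs_med med_props(4)")

lemma med_interval:
 assumes "x : M" "y : M" "a : M" "b : M" "z : I x y"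
 shows "m z a b : I (m x a b) (m y a b)"
proof -
 have zM: "z : M" using assms(5) by (rule I_M)
 show ?thesis
 proof (rule in_I_by_hs)
  fix h assume h: "hs h" "m z a b : h"
  thus "m x a b : h | m y a b : h"
   using hs_I[OF h(1) assms(5) _ assms(1,2)] assms(1-4) zM by (auto simp: hs_med)
 qed (use assms(1-4) zM in "auto simp: med_props(4)")
qed

lemma med_lipschitz:
 assumes x: "x : M" and y: "y : M" and b: "b : M" and c: "c : M"
 shows "d (m x b c) (m y b c) <= d x y"
proof -
 note px = med_props[OF x b c] and py = med_props[OF y b c]
 have "m x b c : I x (m y b c)" "m y b c : I y (m x b c)"
  using med_gate[OF x b c py(3)] med_gate[OF y b c px(3)] by auto
 thus ?thesis using triangle[OF x y py(4)] triangle[OF y x px(4)] by (auto simp: I_iff commute)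
qed

lemma med_lipschitz3:
 assumes "x : M" "y : M" "z : M" "x' : M" "y' : M" "z' : M"
 shows "d (m x y z) (m x' y' z') <= d x x' + d y y' + d z z'"
proof -
 have "d (m x y z) (m x' y z) <= d x x'" using med_lipschitz assms by auto
 moreover have "d (m x' y z) (m x' y' z) <= d y y'"
  using med_lipschitz[of y y' x' z] assms by (simp add: med_swap12)
 moreover have "d (m x' y' z) (m x' y' z') <= d z z'"
  using med_lipschitz[of z z' y' x'] assms by (simp add: med_swap13)
 ultimately show ?thesis
  using triangle[of "m x y z" "m x' y z" "m x' y' z'"] triangle[of "m x' y z" "m x' y' z" "m x' y' z'"]
   assms med_props(4) by smt
qed

text \<open>Helly's theorem for median spaces: three pairwise meeting convex sets contain the median of
 their pairwise common points.\<close>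

lemma helly:
 assumes "finite \<F>" "\<F> ~= {}" "!!A. A : \<F> ==> cvx A" "!!A B. A : \<F> ==> B : \<F> ==> A \<inter> B ~= {}"
 shows "\<Inter>\<F> ~= {}" using assms
proof (induction "card \<F>" arbitrary: \<F> rule: less_induct)
 case (less \<F>)
 show ?case
 proof (cases "EX A B. \<F> = {A, B}")
  case True thus ?thesis using less.prems(4) by auto
 next
  case False
  obtain A where A: "A : \<F>" using less.prems by auto
  then obtain B where B: "B : \<F>" "B ~= A" using False by blast
  let ?G = "insert (A \<inter> B) (\<F> - {A, B})"
  have "\<F> = insert A (insert B (\<F> - {A, B}))" using A B by auto
  hence "card \<F> = Suc (Suc (card (\<F> - {A, B})))"
   using less.prems(1) B(2) by (metis Diff_iff card_insert_disjoint finite_Diff finite_insert insertE insertI1 insertI2)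
  moreover have "card ?G <= Suc (card (\<F> - {A, B}))"
   using less.prems by (simp add: card_insert_if)
  ultimately have le: "card ?G < card \<F>" by simp
  have meet: "(A \<inter> B) \<inter> D ~= {}" if D: "D : \<F>" for D
  proof -
   obtain p q r where *: "p : A" "p : B" "q : B" "q : D" "r : A" "r : D"
    using less.prems(4)[OF A B(1)] less.prems(4)[OF B(1) D] less.prems(4)[OF A D] by blast
   have c: "cvx A" "cvx B" "cvx D" using less.prems(3) A B(1) D by auto
   hence "p : M" "q : M" "r : M" using * cvx_sub by auto
   hence "m p q r : A" "m p q r : B" "m p q r : D"
    using * cvx_med[OF c(1), of p r q] cvx_med[OF c(2), of p q r] cvx_med[OF c(3), of q r p] by simp_all
   thus ?thesis by auto
  qed
  have AB: "A \<inter> B ~= {}" using less.prems(4) A B by auto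
  have "\<Inter>?G ~= {}"
  proof (rule less.hyps[OF le])
   show "cvx D" if "D : ?G" for D using that less.prems(3) A B cvx_Int by auto
   show "D \<inter> E ~= {}" if DE: "D : ?G" "E : ?G" for D E
   proof -
    consider "D = A \<inter> B" "E = A \<inter> B" | "D = A \<inter> B" "E : \<F>" | "E = A \<inter> B" "D : \<F>"
     | "D : \<F>" "E : \<F>" using DE by auto
    thus ?thesis using AB meet less.prems(4) by cases (auto simp: Int_commute)
   qed
  qed (use less.prems in auto)
  thus ?thesis using A B by auto
 qed
qed

end

section \<open>Closed convex sets and finite rank\<close>

context median
begin

definition cl :: "'a set => 'a set" where
 "cl A = {x : M. ALL e>0. EX a:A. d x a < e}"

lemma cl_sub: "cl A <= M" by (auto simp: cl_def)

lemma cl_incl: "A <= M ==> A <= cl A" unfolding cl_def by (auto intro!: bexI)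

lemma cl_mono: "A <= B ==> cl A <= cl B" unfolding cl_def by blast

lemma cl_cl: "A <= M ==> cl (cl A) <= cl A"
proof
 fix x assume A: "A <= M" and x: "x : cl (cl A)"
 have "EX a:A. d x a < e" if "e > 0" for e
 proof -
  have "e/2 > 0" using that by simp
  then obtain b where b: "b : cl A" "d x b < e/2" using x unfolding cl_def by blast
  then obtain a where a: "a : A" "d b a < e/2" using `e/2 > 0` unfolding cl_def by blast
  have "d x a <= d x b + d b a" using x a b A by (intro triangle) (auto simp: cl_def)
  thus ?thesis using a b by (intro bexI[of _ a]) auto
 qed
 thus "x : cl A" using x by (auto simp: cl_def)
qed

definition cclosed :: "'a set => bool" where
 "cclosed A \<longleftrightarrow> cvx A & cl A <= A"

lemma cvx_cl:
 assumes A: "cvx A"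
 shows "cvx (cl A)" unfolding median_convex_def
proof (intro conjI ballI subsetI)
 fix x assume "x : cl A" thus "x : M" by (simp add: cl_def)
next
 fix a b t assume a: "a : cl A" and b: "b : cl A" and t: "t : I a b"
 have M: "a : M" "b : M" "t : M" using a b I_M[OF t] cl_sub[of A] by auto
 have "EX c:A. d t c < e" if "e > 0" for e
 proof -
  have e: "e/2 > 0" using that by simp
  obtain a' where a': "a' : A" "d a a' < e/2" using a e unfolding cl_def by blast
  obtain b' where b': "b' : A" "d b b' < e/2" using b e unfolding cl_def by blast
  have M': "a' : M" "b' : M" using a' b' A cvx_sub by auto
  have "d (m a b t) (m a' b' t) <= d a a' + d b b' + d t t" using med_lipschitz3 M M' by blast
  moreover have "m a b t = t" using med_eq_iff M t by simp
  ultimately have "d t (m a' b' t) < e" using a' b' M by simp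
  thus ?thesis using cvx_med(1)[OF A a'(1) b'(1) M(3)] by blast
 qed
 thus "t : cl A" using M by (auto simp: cl_def)
qed

lemma cclosed_cl: "cvx A ==> cclosed (cl A)" using cvx_cl cl_cl cvx_sub by (auto simp: cclosed_def)

lemma cclosed_Inter:
 assumes "!!A. A : \<A> ==> cclosed A" "\<A> ~= {}"
 shows "cclosed (\<Inter>\<A>)"
proof -
 have "cvx (\<Inter>\<A>)" using assms cvx_Inter by (auto simp: cclosed_def)
 moreover have "cl (\<Inter>\<A>) <= A" if "A : \<A>" for A
  using cl_mono[of "\<Inter>\<A>" A] assms that by (auto simp: cclosed_def)
 ultimately show ?thesis by (auto simp: cclosed_def)
qed

lemma cclosed_I:
 assumes a: "a : M" and b: "b : M"
 shows "cclosed (I a b)" unfolding cclosed_def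
proof (intro conjI subsetI)
 fix x assume x: "x : cl (I a b)"
 hence xM: "x : M" by (simp add: cl_def)
 note g = med_props[OF xM a b]
 have "d x (m x a b) <= e" if "e > 0" for e
 proof -
  obtain y where y: "y : I a b" "d x y < e" using x `e > 0` unfolding cl_def by blast
  have "m x a b : I x y" using med_gate[OF xM a b y(1)] .
  hence "d x (m x a b) <= d x y" by (simp add: I_iff)
  thus ?thesis using y by linarith
 qed
 hence "d x (m x a b) <= 0" by (metis add.left_neutral field_le_epsilon)
 hence "x = m x a b" using zero[OF xM g(4)] nonneg[of x "m x a b"] by linarith
 thus "x : I a b" using g(3) by simp
qed (rule cvx_I[OF a b])

lemma I_le: "c : I a b ==> d a c <= d a b" "c : I a b ==> d c b <= d a b" by (auto simp: I_iff)

definition mhull :: "'a set => 'a set" where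
 "mhull S = \<Inter>{C. median_convex M d C & S <= C}"

lemma cvx_M: "cvx M" by (auto simp: median_convex_def I_M)

lemma mhull_props:
 assumes "S <= M"
 shows "cvx (mhull S)" "S <= mhull S" "mhull S <= M"
  "!!C. cvx C ==> S <= C ==> mhull S <= C"
proof -
 have "{C. cvx C & S <= C} ~= {}" using assms cvx_M by blast
 thus "cvx (mhull S)" unfolding mhull_def by (intro cvx_Inter) auto
 thus "mhull S <= M" using cvx_sub by auto
qed (auto simp: mhull_def)

lemma mhull_mono: "S <= T ==> mhull S <= mhull T" by (auto simp: mhull_def)

text \<open>The union of the hulls of the finite subsets is directed, hence convex.\<close>

lemma hull_finitary:
 assumes S: "S <= M" and z: "z : mhull S"
 obtains F where "finite F" "F <= S" "z : mhull F"
proof -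
 let ?U = "\<Union>(mhull ` {F. finite F & F <= S})"
 have "cvx ?U" unfolding median_convex_def
 proof (intro conjI ballI subsetI)
  fix x assume "x : ?U" thus "x : M" using mhull_props(3) S by (metis (mono_tags, lifting) UN_E mem_Collect_eq subset_iff)
 next
  fix a b t assume "a : ?U" "b : ?U" and t: "t : I a b"
  then obtain F G where FG: "finite F" "F <= S" "finite G" "G <= S" "a : mhull F" "b : mhull G" by auto
  hence "a : mhull (F \<union> G)" "b : mhull (F \<union> G)" using mhull_mono[of F "F \<union> G"] mhull_mono[of G "F \<union> G"] by auto
  moreover have "F \<union> G <= M" using FG S by auto
  ultimately have "t : mhull (F \<union> G)" using cvxD[OF mhull_props(1)] t by blast
  thus "t : ?U" using FG by (intro UN_I[of "F \<union> G"]) auto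
 qed
 moreover have "S <= ?U"
 proof
  fix s assume s: "s : S"
  hence "s : mhull {s}" using S mhull_props(2)[of "{s}"] by auto
  thus "s : ?U" using s by (intro UN_I[of "{s}"]) auto
 qed
 ultimately have "z : ?U" using mhull_props(4)[OF S] z by blast
 thus ?thesis using that by auto
qed

text \<open>Every halfspace around \<open>z\<close> contains \<open>g\<close> or one of the points of \<open>T\<close>, so \<open>z\<close> is an iterated
 join of points of \<open>T\<close> towards \<open>z\<close>, and the distance to \<open>g\<close> is subadditive under joins.\<close>

lemma hull_interval_dist:
 assumes g: "g : M" and z: "z : M" and T: "finite T" "T <= I g z" and zh: "z : mhull (insert g T)"
 shows "d g z <= (\<Sum>t\<in>T. d g t)"
proof -
 have "EX j. j : I g z & d g j <= (\<Sum>t\<in>T. d g t) &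
   (ALL h. hs h --> z : h --> insert g T \<inter> h ~= {} --> j : h)" using T
 proof (induction T rule: finite_induct)
  case empty
  thus ?case using g z I_self by (intro exI[of _ g]) auto
 next
  case (insert t T)
  then obtain j where j: "j : I g z" "d g j <= (\<Sum>t\<in>T. d g t)"
   and jh: "!!h. hs h ==> z : h ==> insert g T \<inter> h ~= {} ==> j : h" by auto
  have M: "j : M" "t : M" using j insert.prems I_M by auto
  have t: "t : I g z" using insert.prems by auto
  let ?j = "m j t z"
  have M': "?j : M" using med_props M z by auto
  have "?j : I g z" using cvx_med[OF cvx_I[OF g z] j(1) t z] by simp
  moreover have "d g ?j <= (\<Sum>t\<in>insert t T. d g t)"
  proof -
   have "m g z j = j" using med_eq_iff g z M j by simp
   hence "m j g z = j" by (metis med_swap12 med_swap23)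
   hence "d j ?j <= d g t" using med_lipschitz3[of j g z j t z] M g z by (simp add: M z)
   hence "d g ?j <= d g j + d g t" using triangle[OF g M(1) M'] by simp
   thus ?thesis using j insert.hyps by simp
  qed
  moreover have "?j : h" if "hs h" "z : h" "insert g (insert t T) \<inter> h ~= {}" for h
   using that jh[of h] M z by (auto simp: hs_med)
  ultimately show ?case by blast
 qed
 then obtain j where j: "j : I g z" "d g j <= (\<Sum>t\<in>T. d g t)"
   and jh: "!!h. hs h ==> z : h ==> insert g T \<inter> h ~= {} ==> j : h" by auto
 have sub: "insert g T <= M" using g T I_M by auto
 have "z = j"
 proof (rule eq_by_hs)
  fix h assume h: "hs h" "z : h"
  have "~ insert g T <= M - h"
   using mhull_props(4)[OF sub hs_cvx(2)[OF h(1)]] h zh by blast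
  thus "j : h" using jh[OF h] sub by blast
 qed (use z j I_M in auto)
 thus ?thesis using j by simp
qed

definition nbh :: "real => 'a set => 'a set" where
 "nbh e C = {s : M. EX c:C. d s c < e}"

lemma nbh_sub: "nbh e C <= M" by (auto simp: nbh_def)

end

locale cmedian = median +
 fixes r :: nat
 assumes complete: "mcomplete"
  and rank: "!!H. finite H ==> (!!h. h : H ==> hs h) ==> pairwise (transverse M) H ==> card H <= r"
begin

lemma Cauchy_limit:
 fixes x :: "nat => 'a"
 assumes x: "!!n. x n : M" and c: "!!e. e > 0 ==> EX N. \<forall>n\<ge>N. \<forall>k\<ge>n. d (x n) (x k) < e"
 obtains l where "l : M" "!!e. e > 0 ==> EX N. \<forall>n\<ge>N. d (x n) l < e"
proof -
 have "MCauchy x" unfolding MCauchy_def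
 proof (intro conjI allI impI)
  show "range x <= M" using x by auto
  fix e :: real assume "e > 0"
  then obtain N where N: "\<forall>n\<ge>N. \<forall>k\<ge>n. d (x n) (x k) < e" using c by blast
  have "d (x n) (x k) < e" if "n >= N" "k >= N" for n k using N that by (metis commute nle_le)
  thus "EX N. ALL n n'. N <= n --> N <= n' --> d (x n) (x n') < e" by blast
 qed
 then obtain l where "limitin mtopology x l sequentially"
  using complete by (auto simp: mcomplete_def)
 hence "l : M" "ALL e>0. EX N. \<forall>n\<ge>N. x n : M & d (x n) l < e"
  by (simp_all add: limit_metric_sequentially)
 thus ?thesis by (intro that[of l]) meson+
qed

lemma inverse_eventually_small: "e > 0 ==> EX N. \<forall>n\<ge>N. 1 / (real n + 1) < e" for e :: real
proof -
 assume "e > 0"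
 then obtain N :: nat where N: "1 / real (Suc N) < e" by (rule nat_approx_posE)
 have "1 / (real n + 1) < e" if "n >= N" for n
  using N frac_le[of 1 1 "real (Suc N)" "real n + 1"] that by simp
 thus ?thesis by blast
qed

text \<open>A sequence in \<open>C\<close> that minimises the distance to \<open>x\<close> is Cauchy, because the median of \<open>x\<close>
 and two of its points is in \<open>C\<close>, too.\<close>

lemma gate_exists:
 assumes C: "cclosed C" "C ~= {}" and x: "x : M"
 obtains g where "g : C" "!!c. c : C ==> g : I x c"
proof -
 have CM: "C <= M" using C cvx_sub by (auto simp: cclosed_def)
 have cC: "cvx C" using C by (simp add: cclosed_def)
 define D where "D = Inf (d x ` C)"
 have bdd: "bdd_below (d x ` C)" by (intro bdd_belowI[of _ 0]) auto
 have Dle: "D <= d x c" if "c : C" for c unfolding D_def using bdd that by (auto intro: cInf_lower)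
 have "EX c:C. d x c < D + 1 / (real n + 1)" for n
 proof -
  have "Inf (d x ` C) < D + 1 / (real n + 1)" by (simp add: D_def)
  thus ?thesis using C cInf_lessD[of "d x ` C"] by blast
 qed
 then obtain c where c: "!!n. c n : C" "!!n. d x (c n) < D + 1 / (real n + 1)" by metis
 have cM: "c n : M" for n using c CM by auto
 have dc: "d (c n) (c k) < 1 / (real n + 1) + 1 / (real k + 1)" for n k
 proof -
  define p where "p = m x (c n) (c k)"
  note p = med_props[OF x cM cM, of n k, folded p_def]
  have "p : C" using cvxD[OF cC c(1) c(1) p(3)] .
  hence "D <= d x p" using Dle by auto
  thus ?thesis using p c(2)[of n] c(2)[of k] by (auto simp: I_iff commute)
 qed
 obtain g where g: "g : M" "!!e. e > 0 ==> EX N. \<forall>n\<ge>N. d (c n) g < e"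
 proof (rule Cauchy_limit[of c])
  fix e :: real assume "e > 0"
  then obtain N where N: "\<forall>n\<ge>N. 1 / (real n + 1) < e/2" using inverse_eventually_small[of "e/2"] by auto
  have "d (c n) (c k) < e" if "n >= N" "k >= n" for n k
   using dc[of n k] N that by (smt (verit) field_sum_of_halves le_trans)
  thus "EX N. \<forall>n\<ge>N. \<forall>k\<ge>n. d (c n) (c k) < e" by blast
 qed (use cM in auto)
 have "EX a:C. d g a < e" if "e > 0" for e
  using g(2)[OF that] c(1) by (metis commute order_refl)
 hence "g : cl C" using g(1) by (auto simp: cl_def)
 hence gC: "g : C" using C by (auto simp: cclosed_def)
 have "d x g <= D"
 proof (rule field_le_epsilon)
  fix e :: real assume "e > 0"
  then obtain N N' where "\<forall>n\<ge>N. d (c n) g < e/2" "\<forall>n\<ge>N'. 1 / (real n + 1) < e/2"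
   using g(2)[of "e/2"] inverse_eventually_small[of "e/2"] by auto
  hence "d (c (max N N')) g < e/2" "1 / (real (max N N') + 1) < e/2" by auto
  thus "d x g <= D + e"
   using triangle[OF x cM g(1), of "max N N'"] c(2)[of "max N N'"] by linarith
 qed
 have "g : I x b" if b: "b : C" for b
 proof -
  have bM: "b : M" using b CM by auto
  note p = med_props[OF x g(1) bM]
  have "D <= d x (m x g b)" using Dle cvxD[OF cC gC b p(3)] by auto
  hence "d (m x g b) g <= 0" using p `d x g <= D` by (auto simp: I_iff)
  hence "m x g b = g" using zero[OF p(4) g(1)] nonneg[of "m x g b" g] by simp
  thus ?thesis using p(2) by simp
 qed
 thus ?thesis using that gC by blast
qed

definition gate :: "'a set => 'a => 'a" where
 "gate C x = (SOME g. g : C & (ALL c:C. g : I x c))"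

lemma gate:
 assumes "cclosed C" "C ~= {}" "x : M"
 shows "gate C x : C" "!!c. c : C ==> gate C x : I x c" "gate C x : M"
proof -
 have "EX g. g : C & (ALL c:C. g : I x c)" using gate_exists[OF assms] by metis
 hence "gate C x : C & (ALL c:C. gate C x : I x c)" unfolding gate_def by (rule someI_ex)
 thus "gate C x : C" "!!c. c : C ==> gate C x : I x c" by auto
 thus "gate C x : M" using assms cvx_sub by (auto simp: cclosed_def)
qed

text \<open>Bounded closed convex sets behave like compact sets for intersections: the gates of a fixed
 point in finite intersections move monotonically away from it, hence converge.\<close>

lemma closed_convex_fip:
 assumes \<F>: "!!A. A : \<F> ==> cclosed A" and ne: "\<F> ~= {}" and x: "x : M"
  and fin: "!!\<G>. finite \<G> ==> \<G> <= \<F> ==> \<G> ~= {} ==> EX z:\<Inter>\<G>. d x z <= R"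
 shows "EX z:M. ALL A:\<F>. z : A"
proof -
 let ?P = "%\<G>. finite \<G> & \<G> <= \<F> & \<G> ~= {}"
 define g where "g \<G> = gate (\<Inter>\<G>) x" for \<G>
 have ok: "cclosed (\<Inter>\<G>)" "\<Inter>\<G> ~= {}" if "?P \<G>" for \<G>
  using cclosed_Inter[of \<G>] fin[of \<G>] that \<F> by blast+
 have gG: "g \<G> : \<Inter>\<G>" "g \<G> : M" "!!c. c : \<Inter>\<G> ==> g \<G> : I x c" if "?P \<G>" for \<G>
  unfolding g_def using gate[OF ok[OF that] x] by auto
 have le: "d x (g \<G>) <= R" if G: "?P \<G>" for \<G>
 proof -
  obtain z where z: "z : \<Inter>\<G>" "d x z <= R" using fin G by blast
  thus ?thesis using I_le(1)[OF gG(3)[OF G z(1)]] by linarith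
 qed
 have mono: "d (g \<G>) (g \<G>') = d x (g \<G>') - d x (g \<G>)" if "?P \<G>" "?P \<G>'" "\<G> <= \<G>'" for \<G> \<G>'
 proof -
  have "g \<G>' : \<Inter>\<G>" using gG(1)[OF that(2)] that(3) by auto
  hence "g \<G> : I x (g \<G>')" using gG(3)[OF that(1)] by auto
  thus ?thesis by (auto simp: I_iff)
 qed
 define S where "S = Sup {d x (g \<G>) |\<G>. ?P \<G>}"
 have bdd: "bdd_above {d x (g \<G>) |\<G>. ?P \<G>}" using le by (intro bdd_aboveI[of _ R]) auto
 have leS: "d x (g \<G>) <= S" if "?P \<G>" for \<G>
  unfolding S_def using that bdd by (intro cSup_upper) auto
 obtain A0 where "A0 : \<F>" using ne by auto
 hence P0: "?P {A0}" by auto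
 have "EX \<G>. ?P \<G> & d x (g \<G>) > S - 1 / (real n + 1)" for n
 proof -
  have "S - 1 / (real n + 1) < S" by simp
  moreover have "{d x (g \<G>) |\<G>. ?P \<G>} ~= {}" using P0 by blast
  ultimately show ?thesis unfolding S_def using less_cSupD by (smt (verit, best) mem_Collect_eq)
 qed
 then obtain \<G> where \<G>: "!!n. ?P (\<G> n)" "!!n. d x (g (\<G> n)) > S - 1 / (real n + 1)" by metis
 define \<H> where "\<H> n = (\<Union>i\<le>n. \<G> i)" for n
 have PH: "?P (\<H> n)" for n using \<G>(1) unfolding \<H>_def by (auto intro!: finite_UN_I)
 have H1: "d x (g (\<H> n)) > S - 1 / (real n + 1)" for n
 proof -
  have "d (g (\<G> n)) (g (\<H> n)) = d x (g (\<H> n)) - d x (g (\<G> n))"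
   by (rule mono[OF \<G>(1) PH]) (auto simp: \<H>_def)
  thus ?thesis using \<G>(2)[of n] nonneg[of "g (\<G> n)" "g (\<H> n)"] by linarith
 qed
 have far: "d (g (\<H> n)) (g \<G>') < 1 / (real n + 1)" if "?P \<G>'" "\<H> n <= \<G>'" for n \<G>'
  using mono[OF PH that] leS[OF that(1)] H1[of n] by linarith
 obtain l where l: "l : M" "!!e. e > 0 ==> EX N. \<forall>n\<ge>N. d (g (\<H> n)) l < e"
 proof (rule Cauchy_limit[of "%n. g (\<H> n)"])
  show "g (\<H> n) : M" for n using gG(2)[OF PH] .
  fix e :: real assume "e > 0"
  then obtain N where N: "\<forall>n\<ge>N. 1 / (real n + 1) < e" using inverse_eventually_small by blast
  have "d (g (\<H> n)) (g (\<H> k)) < e" if "n >= N" "k >= n" for n k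
  proof -
   have "\<H> n <= \<H> k" using that unfolding \<H>_def by (intro UN_mono) auto
   thus ?thesis using far[OF PH] N that by (meson less_trans)
  qed
  thus "EX N. \<forall>n\<ge>N. \<forall>k\<ge>n. d (g (\<H> n)) (g (\<H> k)) < e" by blast
 qed (rule that)
 have "l : A" if A: "A : \<F>" for A
 proof -
  have "EX a:A. d l a < e" if "e > 0" for e
  proof -
   have e: "e/2 > 0" using that by simp
   obtain N where N: "\<forall>n\<ge>N. d (g (\<H> n)) l < e/2" using l(2)[OF e] by blast
   obtain N' where N': "\<forall>n\<ge>N'. 1 / (real n + 1) < e/2" using inverse_eventually_small[OF e] by blast
   define n where "n = max N N'"
   have n: "d (g (\<H> n)) l < e/2" "1 / (real n + 1) < e/2" using N N' by (simp_all add: n_def)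
   have P: "?P (insert A (\<H> n))" using PH A by auto
   have "d (g (\<H> n)) (g (insert A (\<H> n))) < e/2"
    using far[OF P, of n] n(2) less_trans by blast
   moreover have "g (insert A (\<H> n)) : A" using gG(1)[OF P] by auto
   moreover have "d l (g (insert A (\<H> n))) <= d l (g (\<H> n)) + d (g (\<H> n)) (g (insert A (\<H> n)))"
    by (rule triangle[OF l(1) gG(2)[OF PH] gG(2)[OF P]])
   moreover have "d l (g (\<H> n)) < e/2" using n(1) by (simp add: commute)
   ultimately have "d l (g (insert A (\<H> n))) < e" by linarith
   thus ?thesis using `g (insert A (\<H> n)) : A` by blast
  qed
  hence "l : cl A" using l by (auto simp: cl_def)
  thus ?thesis using \<F>[OF A] by (auto simp: cclosed_def)
 qed
 thus ?thesis using l by auto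
qed

text \<open>Finite rank bounds the hull of a neighbourhood of a convex set: an irredundant set of points
 of \<open>[g, z]\<close> whose hull with \<open>g\<close> contains \<open>z\<close> comes with pairwise transverse halfspaces, so
 it has at most \<open>r\<close> points.\<close>

lemma hull_nbh:
 fixes e :: real
 assumes C: "cvx C" "C ~= {}" and e: "e > 0" and z: "z : mhull (nbh e C)"
 shows "EX g:cl C. d g z <= r * e"
proof -
 have CM: "C <= M" using C cvx_sub by auto
 have zM: "z : M" using z mhull_props(3)[OF nbh_sub] by auto
 have ccl: "cclosed (cl C)" "cl C ~= {}" using cclosed_cl C cl_incl[OF CM] by auto
 define g where "g = gate (cl C) z"
 note g = gate[OF ccl zM, folded g_def]
 obtain F where F: "finite F" "F <= nbh e C" "z : mhull F" using hull_finitary[OF nbh_sub z] .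
 have FM: "F <= M" using F nbh_sub by auto
 define t where "t s = m g z s" for s
 have tI: "t s : I g z" "t s : M" if "s : F" for s
  using med_props[OF g(3) zM] that FM unfolding t_def by auto
 have td: "d g (t s) <= e" if s: "s : F" for s
 proof -
  obtain c where c: "c : C" "d s c < e" using F s by (auto simp: nbh_def)
  have cM: "c : M" "s : M" using c CM s FM by auto
  have "g : I z c" using g(2) c cl_incl[OF CM] by auto
  hence "m z c g = g" using med_eq_iff zM cM g(3) by simp
  hence "m g z c = g" by (metis med_swap12 med_swap23)
  moreover have "d (m g z s) (m g z c) <= d s c"
   using med_lipschitz3[of g z s g z c] g(3) zM cM by simp
  ultimately show ?thesis using c unfolding t_def by (simp add: commute)
 qed
 have sub: "insert g (t ` F) <= M" using tI g by auto
 have zT: "z : mhull (insert g (t ` F))"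
 proof (rule in_cvx_by_hs[OF mhull_props(1)[OF sub] zM])
  fix h assume h: "hs h" "z : h"
  have "~ F <= M - h" using mhull_props(4)[OF FM hs_cvx(2)[OF h(1)]] h F by blast
  then obtain s where s: "s : F" "s : h" using FM by auto
  hence "t s : h" using hs_med[OF h(1) g(3) zM] h FM unfolding t_def by auto
  thus "mhull (insert g (t ` F)) \<inter> h ~= {}" using mhull_props(2)[OF sub] s by auto
 qed
 let ?Q = "%T. T <= t ` F & z : mhull (insert g T)"
 obtain T where T: "?Q T" and Tmin: "!!T'. ?Q T' ==> card T <= card T'"
  using ex_has_least_nat[of ?Q "t ` F" card] zT by auto
 have finT: "finite T" using T F finite_subset by blast
 have TM: "insert g T <= M" using T sub by auto
 have "EX h. hs h & z : h & insert g (T - {i}) \<inter> h = {}" if i: "i : T" for i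
 proof -
  have s: "insert g (T - {i}) <= M" using TM by auto
  have "card (T - {i}) < card T" using finT i by (rule card_Diff1_less)
  hence "z ~: mhull (insert g (T - {i}))" using Tmin[of "T - {i}"] T by auto
  hence "mhull (insert g (T - {i})) \<inter> {z} = {}" by auto
  then obtain h where "hs h" "mhull (insert g (T - {i})) <= h" "{z} <= M - h"
   using halfspace_separation[OF mhull_props(1)[OF s] cvx_singleton[OF zM]] by metis
  thus ?thesis using hs_compl[of h] mhull_props(2)[OF s] zM by (intro exI[of _ "M - h"]) auto
 qed
 then obtain h where h: "!!i. i : T ==> hs (h i)" "!!i. i : T ==> z : h i"
  "!!i. i : T ==> insert g (T - {i}) \<inter> h i = {}" by metis
 have ih: "i : h i" if i: "i : T" for i
 proof (rule ccontr)
  assume "i ~: h i"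
  hence "insert g T <= M - h i" using h(3)[OF i] TM by auto
  hence "mhull (insert g T) <= M - h i"
   using mhull_props(4)[OF TM hs_cvx(2)[OF h(1)[OF i]]] by auto
  thus False using T h(2)[OF i] by auto
 qed
 have nin: "j ~: h i" if "i : T" "j : T" "i ~= j" for i j using h(3)[OF that(1)] that by auto
 have inj: "inj_on h T" using ih nin by (metis inj_onI)
 have "pairwise (transverse M) (h ` T)"
 proof (rule pairwiseI)
  fix k l assume "k : h ` T" "l : h ` T" "k ~= l"
  then obtain i j where ij: "i : T" "j : T" "k = h i" "l = h j" "i ~= j" by auto
  hence "z : k \<inter> l" "i : k \<inter> (M - l)" "j : (M - k) \<inter> l" "g : (M - k) \<inter> (M - l)"
   using h ih nin TM by auto
  thus "transverse M k l" unfolding transverse_def by blast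
 qed
 hence "card (h ` T) <= r" using rank[of "h ` T"] finT h by auto
 hence "card T <= r" using card_image[OF inj] by simp
 have "d g z <= (\<Sum>t\<in>T. d g t)" by (rule hull_interval_dist) (use g zM finT T tI in auto)
 also have "... <= (\<Sum>t\<in>T. e)" using T td by (intro sum_mono) auto
 also have "... = card T * e" by simp
 also have "... <= r * e" using `card T <= r` e by (intro mult_right_mono) auto
 finally show ?thesis using g(1) by auto
qed

text \<open>The hulls of the two neighbourhoods stay near \<open>C\<close> and \<open>D\<close>, so they are disjoint.\<close>

lemma separated_by_thick:
 fixes e :: real
 assumes C: "cvx C" "C ~= {}" and D: "cvx D" "D ~= {}" and e: "e > 0"
  and far: "!!a b. a : C ==> b : D ==> d a b > 2 * r * e + e"
 obtains h where "hs h" "nbh e C <= h" "nbh e D <= M - h"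
proof -
 have "mhull (nbh e C) \<inter> mhull (nbh e D) = {}"
 proof (rule ccontr)
  assume "mhull (nbh e C) \<inter> mhull (nbh e D) ~= {}"
  then obtain z where z: "z : mhull (nbh e C)" "z : mhull (nbh e D)" by auto
  obtain g g' where g: "g : cl C" "d g z <= r * e" "g' : cl D" "d g' z <= r * e"
   using hull_nbh C D e z by meson
  have e2: "e/2 > 0" using e by simp
  obtain c c' where c: "c : C" "d g c < e/2" "c' : D" "d g' c' < e/2"
   using g e2 unfolding cl_def by blast
  have M: "z : M" "g : M" "g' : M" "c : M" "c' : M"
   using z g c mhull_props(3)[OF nbh_sub] cl_sub C D cvx_sub by blast+
  have "d c c' <= d c g + d g z + d z g' + d g' c'"
   using triangle[OF M(4,2,5)] triangle[OF M(2,1,5)] triangle[OF M(1,3,5)] by linarith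
  thus False using far[OF c(1,3)] g c by (simp add: commute)
 qed
 then obtain h where h: "hs h" "mhull (nbh e C) <= h" "mhull (nbh e D) <= M - h"
  using halfspace_separation mhull_props(1)[OF nbh_sub] by metis
 thus ?thesis using that mhull_props(2)[OF nbh_sub] by blast
qed

end

section \<open>Walls\<close>

context median
begin

lemma isoD:
 assumes "f : isometries M d"
 shows "x : M ==> f x : M" "x : M ==> y : M ==> d (f x) (f y) = d x y" "f ` M = M" "inj_on f M"
 using assms by (auto simp: isometries_def Bij_def bij_betw_def)

lemma iso_I:
 assumes f: "f : isometries M d" and "a : M" "b : M" "c : M"
 shows "f c : I (f a) (f b) \<longleftrightarrow> c : I a b"
 using assms isoD[OF f] by (simp add: I_iff)

lemma iso_med:
 assumes f: "f : isometries M d" and "a : M" "b : M" "c : M"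
 shows "f (m a b c) = m (f a) (f b) (f c)"
 using med_props[OF assms(2-)] isoD(1)[OF f] iso_I[OF f] assms by (intro med_unique[symmetric]) auto

lemma iso_Diff:
 assumes f: "f : isometries M d" and "A <= M"
 shows "f ` (M - A) = M - f ` A"
 using inj_on_image_set_diff[OF isoD(4)[OF f], of M A] isoD(3)[OF f] assms by auto

lemma iso_cvx:
 assumes f: "f : isometries M d" and A: "cvx A"
 shows "cvx (f ` A)" unfolding median_convex_def
proof (intro conjI ballI subsetI)
 have AM: "A <= M" using A cvx_sub by auto
 fix x assume "x : f ` A" thus "x : M" using AM isoD(1)[OF f] by auto
next
 have AM: "A <= M" using A cvx_sub by auto
 fix a b t assume "a : f ` A" "b : f ` A" and t: "t : I a b"
 then obtain a' b' where ab: "a' : A" "a = f a'" "b' : A" "b = f b'" by auto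
 obtain t' where t': "t' : M" "t = f t'" using I_M[OF t] isoD(3)[OF f] by auto
 hence "t' : I a' b'" using iso_I[OF f] ab t AM by auto
 thus "t : f ` A" using cvxD[OF A ab(1,3)] t' by auto
qed

lemma iso_hs:
 assumes f: "f : isometries M d" and h: "hs h"
 shows "hs (f ` h)"
 using iso_cvx[OF f hs_cvx(1)[OF h]] iso_cvx[OF f hs_cvx(2)[OF h]] iso_Diff[OF f hs_sub[OF h]]
 by (simp add: halfspace_def)

lemma iso_cl:
 assumes f: "f : isometries M d" and A: "A <= M" and x: "x : M"
 shows "f x : cl (f ` A) \<longleftrightarrow> x : cl A"
 using isoD(1,2)[OF f] A x by (auto simp: cl_def subset_iff)

text \<open>A halfspace that is thick together with its complement. A dense halfspace cannot be told
 from the whole space by its closure.\<close>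

definition wall :: "'a set => bool" where
 "wall h \<longleftrightarrow> hs h & (EX x:M. x ~: cl (M - h)) & (EX y:M. y ~: cl h)"

text \<open>Strict separation is detected by closures of halfspaces.\<close>

definition ssep :: "'a set => 'a => 'a => bool" where
 "ssep h x y \<longleftrightarrow> x : M & y : M & x ~: cl (M - h) & y ~: cl h"

abbreviation tr where "tr == transverse M"

lemma wall_hs: "wall h ==> hs h" by (simp add: wall_def)

lemma wall_sub: "wall h ==> h <= M" by (simp add: wall_def hs_sub)

lemma wall_compl: "wall h ==> wall (M - h)"
 using hs_sub[of h] hs_compl[of h] by (auto simp: wall_def double_diff)

lemma compl_compl: "wall h ==> M - (M - h) = h" using wall_sub by (auto simp: double_diff)

lemma wall_ne:
 assumes "wall h" shows "h ~= {}" "M - h ~= {}" "h ~= M"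
proof -
 have "h <= M" using assms wall_sub by auto
 obtain x y where xy: "x : M" "x ~: cl (M - h)" "y : M" "y ~: cl h" using assms by (auto simp: wall_def)
 hence "x : h" "y : M - h" using cl_incl[of "M - h"] cl_incl[of h] `h <= M` by auto
 thus "h ~= {}" "M - h ~= {}" "h ~= M" by auto
qed

lemma ssep_in: "ssep h x y ==> h <= M ==> x : h & y ~: h"
 using cl_incl[of "M - h"] cl_incl[of h] by (auto simp: ssep_def)

lemma ssep_wall: "hs h ==> ssep h x y ==> wall h" by (auto simp: ssep_def wall_def)

lemma ssep_sym: "h <= M ==> ssep (M - h) x y \<longleftrightarrow> ssep h y x"
 by (auto simp: ssep_def double_diff)

lemma iso_wall:
 assumes f: "f : isometries M d" and h: "wall h"
 shows "wall (f ` h)"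
proof -
 obtain x y where xy: "x : M" "x ~: cl (M - h)" "y : M" "y ~: cl h" using h by (auto simp: wall_def)
 have hM: "h <= M" using h wall_sub by auto
 have "f x ~: cl (M - f ` h)" using iso_cl[OF f, of "M - h" x] xy iso_Diff[OF f hM] by auto
 moreover have "f y ~: cl (f ` h)" using iso_cl[OF f hM] xy by auto
 ultimately show ?thesis
  using xy isoD(1)[OF f] iso_hs[OF f wall_hs[OF h]] unfolding wall_def by blast
qed

lemma nbh_notin_cl:
 assumes "nbh e A <= M - B" "B <= M" "e > 0" "a : A" "A <= M"
 shows "a ~: cl B"
proof
 assume "a : cl B"
 then obtain b where "b : B" "d a b < e" using assms by (auto simp: cl_def)
 hence "b : nbh e A" using assms by (auto simp: nbh_def commute)
 thus False using assms `b : B` by auto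
qed

text \<open>Two sets are nested if one of the four sectors they cut out is empty.\<close>

lemma not_tr_cases:
 assumes "~ tr h k" "h <= M" "k <= M"
 obtains "h \<inter> k = {}" | "h <= k" | "k <= h" | "M - h <= k"
 using assms unfolding transverse_def by blast

lemma tr_sym: "tr h k \<longleftrightarrow> tr k h" by (auto simp: transverse_def)

lemma tr_compl: "k <= M ==> tr h (M - k) \<longleftrightarrow> tr h k" "h <= M ==> tr (M - h) k \<longleftrightarrow> tr h k"
 by (auto simp: transverse_def double_diff)

lemma trD: "tr h k ==> ~ h <= k" "tr h k ==> ~ k <= h" "tr h k ==> h \<inter> k ~= {}"
 "tr h k ==> ~ M - h <= k" "tr h k ==> ~ M - k <= h"
 "tr h k ==> h <= M ==> ~ h <= M - k" "tr h k ==> k <= M ==> ~ k <= M - h"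
 by (auto simp: transverse_def)

lemma tr_mono:
 assumes "tr h a" "tr h b" "a <= k" "k <= b"
 shows "tr h k" using assms unfolding transverse_def by blast

lemma tr_cut:
 assumes "a \<inter> v ~= {}" "a \<inter> (M - v) ~= {}" "b \<inter> v ~= {}" "b \<inter> (M - v) ~= {}" "a <= k" "b \<inter> k = {}" "b <= M"
 shows "tr v k" using assms unfolding transverse_def by blast

lemma iso_tr:
 assumes f: "f : isometries M d" and "h <= M" "k <= M"
 shows "tr (f ` h) (f ` k) \<longleftrightarrow> tr h k"
proof -
 have inj: "inj_on f M" using isoD[OF f] by auto
 have "f ` A \<inter> f ` B = f ` (A \<inter> B)" if "A <= M" "B <= M" for A B
  using inj_on_image_Int[OF inj that] by simp
 thus ?thesis
  unfolding transverse_def iso_Diff[OF f assms(2), symmetric] iso_Diff[OF f assms(3), symmetric]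
  using assms by auto
qed

end

context cmedian
begin

lemma separated_by_wall:
 assumes C: "cvx C" "C ~= {}" and D: "cvx D" "D ~= {}" and K: "K > 0"
  and far: "!!a b. a : C ==> b : D ==> d a b >= K"
 obtains h e where "wall h" "e > 0" "nbh e C <= h" "nbh e D <= M - h" "!!a b. a : C ==> b : D ==> ssep h a b"
proof -
 \<comment> \<open>small enough that the hulls of the two neighbourhoods remain disjoint\<close>
 define e where "e = K / (2 * (2 * r + 1))"
 have e: "e > 0" using K by (simp add: e_def)
 have "(2 * r + 1) * e = K / 2" by (simp add: e_def field_simps)
 hence "2 * r * e + e = K / 2" by (simp add: algebra_simps)
 hence far': "d a b > 2 * r * e + e" if "a : C" "b : D" for a b using far[OF that] K by linarith
 obtain h where h: "hs h" "nbh e C <= h" "nbh e D <= M - h"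
  using separated_by_thick[OF C D e far'] by metis
 have hM: "h <= M" using h hs_sub by auto
 have CD: "C <= M" "D <= M" using C D cvx_sub by auto
 have s: "ssep h a b" if "a : C" "b : D" for a b
  using nbh_notin_cl[of e C "M - h" a] nbh_notin_cl[of e D h b] h hM e that CD
  by (auto simp: ssep_def double_diff)
 hence "wall h" using ssep_wall[OF h(1)] C D by blast
 thus ?thesis using that e h s by blast
qed

lemma strict_separation:
 assumes "x : M" "y : M" "x ~= y"
 obtains h where "wall h" "ssep h x y"
proof -
 have far: "d x y <= d a b" if "a : {x}" "b : {y}" for a b using that by simp
 have "d x y > 0" using assms by simp
 from separated_by_wall[OF cvx_singleton[OF assms(1)] _ cvx_singleton[OF assms(2)] _ this far]
 obtain h e where "wall h" "ssep h x y" by (metis insertI1 insert_not_empty)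
 thus ?thesis using that by auto
qed

text \<open>Separate a point at positive distance from the complement of \<open>h\<close> from this complement: the
 separating wall keeps clear of both.\<close>

lemma wall_gap:
 assumes h: "wall h"
 obtains k e where "wall k" "e > 0" "k <= h" "!!a b. a : k ==> b : M - h ==> d a b >= e"
proof -
 obtain x where x: "x : M" "x ~: cl (M - h)" using h by (auto simp: wall_def)
 then obtain K where K: "K > 0" "!!b. b : M - h ==> d x b >= K" by (auto simp: cl_def not_less)
 have "cvx (M - h)" "M - h ~= {}" using hs_cvx[OF wall_hs[OF h]] wall_ne[OF h] by auto
 have far: "K <= d a b" if "a : {x}" "b : M - h" for a b using that K(2) by auto
 from separated_by_wall[OF cvx_singleton[OF x(1)] _ `cvx (M - h)` `M - h ~= {}` K(1) far]
 obtain k e where k: "wall k" "e > 0" "nbh e {x} <= k" "nbh e (M - h) <= M - k"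
  by (metis insert_not_empty)
 have kM: "k <= M" using k wall_sub by auto
 have "d a b >= e" if ab: "a : k" "b : M - h" for a b
 proof (rule ccontr)
  assume "~ d a b >= e"
  hence "a : nbh e (M - h)" unfolding nbh_def using ab kM by (intro CollectI conjI bexI[of _ b]) auto
  thus False using k ab by auto
 qed
 moreover have "k <= h"
 proof
  fix a assume a: "a : k"
  show "a : h"
  proof (rule ccontr)
   assume "a ~: h"
   hence "a : nbh e (M - h)" using a kM k(2) by (auto simp: nbh_def intro!: bexI[of _ a])
   thus False using k a by auto
  qed
 qed
 ultimately show ?thesis using that k by blast
qed

end

section \<open>The Roller compactification\<close>

context median
begin

text \<open>Closure in the Roller compactification, in terms of finitely many coordinates.\<close>

definition rcl :: "'a set => ('a \<times> 'a => 'a) set" where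
 "rcl S = {\<xi> : (\<Pi>\<^sub>E p\<in>M \<times> M. I (fst p) (snd p)). ALL F e. finite F --> F <= M \<times> M --> e > 0 -->
   (EX s:S. ALL p:F. d (\<xi> p) (m s (fst p) (snd p)) < e)}"

lemma closure_of_roller:
 assumes S: "S <= M"
 shows "interval_product_topology M d closure_of (roller_embed M d ` S) = rcl S"
proof -
 define X where "X = (%p::'a\<times>'a. subtopology mtopology (I (fst p) (snd p)))"
 have T: "interval_product_topology M d = product_topology X (M \<times> M)"
  by (simp add: interval_product_topology_def X_def case_prod_unfold)
 have IM: "I a b <= M" for a b using I_M by auto
 have tX: "topspace (X p) = I (fst p) (snd p)" for p using IM by (auto simp: X_def)
 have emb: "roller_embed M d s p = m s (fst p) (snd p)" if "p : M \<times> M" for s p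
  using that by (auto simp: roller_embed_def)
 have embE: "roller_embed M d s : (\<Pi>\<^sub>E p\<in>M \<times> M. I (fst p) (snd p))" if "s : M" for s
  using that med_props(3) by (auto simp: roller_embed_def)
 show ?thesis
 proof (intro subset_antisym subsetI)
  fix \<xi> assume "\<xi> : interval_product_topology M d closure_of (roller_embed M d ` S)"
  hence \<xi>: "\<xi> : (\<Pi>\<^sub>E p\<in>M \<times> M. I (fst p) (snd p))"
   and op: "!!U. \<xi> : U ==> openin (product_topology X (M \<times> M)) U ==> EX s:S. roller_embed M d s : U"
   by (auto simp: T in_closure_of tX)
  have "EX s:S. ALL p:F. d (\<xi> p) (m s (fst p) (snd p)) < e"
   if F: "finite F" "F <= M \<times> M" and e: "e > 0" for F e
  proof -
   define U where "U = (%p. if p : F then mball (\<xi> p) e \<inter> I (fst p) (snd p) else I (fst p) (snd p))"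
   have "openin (product_topology X (M \<times> M)) (PiE (M \<times> M) U)"
    unfolding openin_PiE_gen
   proof (intro disjI2 conjI ballI)
    show "finite {i : M \<times> M. U i ~= topspace (X i)}"
     by (rule finite_subset[OF _ F(1)]) (auto simp: U_def tX)
    fix p show "openin (X p) (U p)" using openin_topspace[of "X p"] unfolding U_def tX
     by (auto simp: X_def intro!: openin_subtopology_Int)
   qed
   moreover have "\<xi> : PiE (M \<times> M) U"
   proof (rule PiE_I)
    fix p assume p: "p : M \<times> M"
    hence "\<xi> p : I (fst p) (snd p)" using PiE_mem[OF \<xi>] by simp
    moreover have "\<xi> p : M" using calculation IM by blast
    ultimately show "\<xi> p : U p" using e by (auto simp: U_def in_mball)
   qed (rule PiE_arb[OF \<xi>])
   ultimately obtain s where s: "s : S" "roller_embed M d s : PiE (M \<times> M) U" using op by blast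
   have "d (\<xi> p) (m s (fst p) (snd p)) < e" if "p : F" for p
   proof -
    have pM: "p : M \<times> M" using that F by auto
    hence "roller_embed M d s p : U p" using PiE_mem[OF s(2)] by simp
    thus ?thesis using emb[OF pM] that by (simp add: U_def in_mball)
   qed
   thus ?thesis using s(1) by blast
  qed
  thus "\<xi> : rcl S" using \<xi> by (simp add: rcl_def)
 next
  fix \<xi> assume "\<xi> : rcl S"
  hence \<xi>: "\<xi> : (\<Pi>\<^sub>E p\<in>M \<times> M. I (fst p) (snd p))"
   and ap: "!!F e. finite F ==> F <= M \<times> M ==> e > 0 ==> EX s:S. ALL p:F. d (\<xi> p) (m s (fst p) (snd p)) < e"
   by (auto simp: rcl_def)
  show "\<xi> : interval_product_topology M d closure_of (roller_embed M d ` S)"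
   unfolding T in_closure_of
  proof (intro conjI allI impI)
   show "\<xi> : topspace (product_topology X (M \<times> M))" using \<xi> by (simp add: tX)
   fix O' assume "\<xi> : O' & openin (product_topology X (M \<times> M)) O'"
   hence "EX U. finite {i : M \<times> M. U i ~= topspace (X i)} & (ALL i:M \<times> M. openin (X i) (U i)) &
     \<xi> : PiE (M \<times> M) U & PiE (M \<times> M) U <= O'"
    unfolding openin_product_topology_alt by blast
   then obtain U where U: "finite {i : M \<times> M. U i ~= topspace (X i)}" "!!i. i : M \<times> M ==> openin (X i) (U i)"
    "\<xi> : PiE (M \<times> M) U" "PiE (M \<times> M) U <= O'"
    by (elim exE conjE) (rule that, auto)
   define F where "F = {i : M \<times> M. U i ~= topspace (X i)}"
   have "EX e>0. ALL z. z : I (fst p) (snd p) --> d (\<xi> p) z < e --> z : U p" if "p : F" for p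
   proof -
    have pM: "p : M \<times> M" using that by (auto simp: F_def)
    obtain V where V: "openin mtopology V" "U p = V \<inter> I (fst p) (snd p)"
     using U(2)[OF pM] by (auto simp: X_def openin_subtopology)
    have "\<xi> p : V" using PiE_mem[OF U(3) pM] V by simp
    then obtain e where "e > 0" "mball (\<xi> p) e <= V" using V by (auto simp: openin_mtopology)
    moreover have "\<xi> p : M" using PiE_mem[OF \<xi> pM] IM by blast
    ultimately show ?thesis using V IM by (intro exI[of _ e]) (auto simp: in_mball subset_iff)
   qed
   then obtain e where e: "!!p. p : F ==> e p > 0"
    "!!p z. p : F ==> z : I (fst p) (snd p) ==> d (\<xi> p) z < e p ==> z : U p" by metis
   define e0 where "e0 = Min (insert 1 (e ` F))"
   have fF: "finite F" "F <= M \<times> M" using U by (auto simp: F_def)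
   have e0: "e0 > 0" "!!p. p : F ==> e0 <= e p"
    using fF e by (auto simp: e0_def Min_gr_iff intro: Min_le)
   obtain s where s: "s : S" "!!p. p : F ==> d (\<xi> p) (m s (fst p) (snd p)) < e0"
    using ap[OF fF e0(1)] by auto
   have sM: "s : M" using s S by auto
   have "roller_embed M d s : PiE (M \<times> M) U"
   proof (rule PiE_I)
    fix p assume p: "p : M \<times> M"
    have in_I: "m s (fst p) (snd p) : I (fst p) (snd p)" using med_props(3)[OF sM] p by auto
    show "roller_embed M d s p : U p"
    proof (cases "p : F")
     case True
     hence "d (\<xi> p) (m s (fst p) (snd p)) < e p" using s(2) e0(2) by (meson less_le_trans)
     thus ?thesis using e(2)[OF True in_I] emb[OF p] by simp
    next
     case False
     hence "U p = I (fst p) (snd p)" using p tX by (auto simp: F_def)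
     thus ?thesis using in_I emb[OF p] by simp
    qed
   qed (rule PiE_arb[OF embE[OF sM]])
   thus "EX y. y : roller_embed M d ` S & y : O'" using U(4) s by auto
  qed
 qed
qed

lemma roller_eq: "roller M d = rcl M" by (simp add: roller_def closure_of_roller)

lemma rcl_mono:
 assumes "A <= B" shows "rcl A <= rcl B"
proof
 fix \<xi> assume "\<xi> : rcl A"
 hence 1: "\<xi> : (\<Pi>\<^sub>E p\<in>M \<times> M. I (fst p) (snd p))"
  and 2: "!!F e. finite F ==> F <= M \<times> M ==> e > 0 ==> EX s:A. ALL p:F. d (\<xi> p) (m s (fst p) (snd p)) < e"
  by (simp_all add: rcl_def)
 have "EX s:B. ALL p:F. d (\<xi> p) (m s (fst p) (snd p)) < e"
  if "finite F" "F <= M \<times> M" "e > 0" for F e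
  using 2[OF that] assms by (meson subset_iff)
 with 1 show "\<xi> : rcl B" by (simp add: rcl_def)
qed

lemma rclD:
 assumes "\<xi> : rcl A" "p : M \<times> M"
 shows "\<xi> p : I (fst p) (snd p)" "\<xi> p : M"
proof -
 have "\<xi> : (\<Pi>\<^sub>E p\<in>M \<times> M. I (fst p) (snd p))" using assms(1) by (simp add: rcl_def)
 from PiE_mem[OF this assms(2)] show "\<xi> p : I (fst p) (snd p)" "\<xi> p : M" using I_M by auto
qed

lemma rcl_approx:
 assumes "\<xi> : rcl A" "finite F" "F <= M \<times> M" "e > 0"
 obtains s where "s : A" "!!p. p : F ==> d (\<xi> p) (m s (fst p) (snd p)) < e"
proof -
 have "EX s:A. ALL p:F. d (\<xi> p) (m s (fst p) (snd p)) < e" using assms by (simp add: rcl_def)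
 thus ?thesis using that by blast
qed

lemma roller_embed_rcl:
 assumes s: "s : A" and A: "A <= M"
 shows "roller_embed M d s : rcl A"
proof -
 have sM: "s : M" using s A by blast
 have "roller_embed M d s : (\<Pi>\<^sub>E p\<in>M \<times> M. I (fst p) (snd p))"
  using med_props(3)[OF sM] by (auto simp: roller_embed_def)
 moreover have "d (roller_embed M d s p) (m s (fst p) (snd p)) < e" if "p : M \<times> M" "e > 0" for p e
  using that med_props(4)[OF sM] by (auto simp: roller_embed_def)
 ultimately show ?thesis using s unfolding rcl_def
  by (intro CollectI conjI allI impI bexI[of _ s]) auto
qed

lemma closedin_rcl:
 assumes "A <= M" shows "closedin (interval_product_topology M d) (rcl A)"
 unfolding closure_of_roller[OF assms, symmetric] by (rule closedin_closure_of)

text \<open>Closures of convex subsets are convex: the median of approximants in the set approximates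
 the median of limits.\<close>

lemma roller_convex_rcl:
 assumes A: "cvx A"
 shows "roller_convex M d (rcl A)" unfolding roller_convex_def
proof (intro conjI ballI subsetI)
 have AM: "A <= M" using A cvx_sub by auto
 fix x assume "x : rcl A" thus "x : roller M d" using rcl_mono[OF AM] roller_eq by auto
next
 have AM: "A <= M" using A cvx_sub by auto
 fix \<xi> \<eta> \<zeta> assume \<xi>: "\<xi> : rcl A" and \<eta>: "\<eta> : rcl A" and "\<zeta> : roller_interval M d \<xi> \<eta>"
 hence \<zeta>: "\<zeta> : rcl M" and eq: "roller_med M d \<xi> \<eta> \<zeta> = \<zeta>"
  by (auto simp: roller_interval_def roller_eq)
 have "EX s:A. ALL p:F. d (\<zeta> p) (m s (fst p) (snd p)) < e"
  if F: "finite F" "F <= M \<times> M" and e: "e > 0" for F e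
 proof -
  have e3: "e/3 > 0" using e by simp
  obtain x where x: "x : A" "!!p. p : F ==> d (\<xi> p) (m x (fst p) (snd p)) < e/3"
   using rcl_approx[OF \<xi> F e3] by metis
  obtain y where y: "y : A" "!!p. p : F ==> d (\<eta> p) (m y (fst p) (snd p)) < e/3"
   using rcl_approx[OF \<eta> F e3] by metis
  obtain z where z: "z : M" "!!p. p : F ==> d (\<zeta> p) (m z (fst p) (snd p)) < e/3"
   using rcl_approx[OF \<zeta> F e3] by metis
  have M: "x : M" "y : M" "z : M" using x y z AM by auto
  have "d (\<zeta> p) (m (m x y z) (fst p) (snd p)) < e" if p: "p : F" for p
  proof -
   have pM: "p : M \<times> M" using p F by auto
   then obtain a b where ab: "p = (a, b)" "a : M" "b : M" by auto
   have "\<zeta> p = m (\<xi> p) (\<eta> p) (\<zeta> p)"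
    using fun_cong[OF eq, of p] pM by (simp add: roller_med_def)
   moreover have "m (m x y z) a b = m (m x a b) (m y a b) (m z a b)"
    by (rule med_distrib) (use M ab in auto)
   moreover have "d (m (\<xi> p) (\<eta> p) (\<zeta> p)) (m (m x a b) (m y a b) (m z a b)) \<le>
     d (\<xi> p) (m x a b) + d (\<eta> p) (m y a b) + d (\<zeta> p) (m z a b)"
    by (rule med_lipschitz3) (use rclD(2)[OF \<xi> pM] rclD(2)[OF \<eta> pM] rclD(2)[OF \<zeta> pM] M ab med_props(4) in auto)
   ultimately show ?thesis using x(2)[OF p] y(2)[OF p] z(2)[OF p] ab by simp
  qed
  thus ?thesis using cvx_med(1)[OF A x(1) y(1) z(1)] by blast
 qed
 thus "\<zeta> : rcl A" using \<zeta> by (simp add: rcl_def)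
qed

end

section \<open>Minimal actions flip walls\<close>

context median
begin

lemma roller_extend_rcl:
 assumes f: "f : isometries M d" and A: "A <= M" and \<xi>: "\<xi> : rcl A"
 shows "roller_extend M f \<xi> : rcl (f ` A)"
proof -
 define g where "g = inv_into M f"
 have g: "f (g a) = a" "g a : M" if "a : M" for a
  unfolding g_def using isoD(3)[OF f] that f_inv_into_f[of a f M] inv_into_into[of a f M] by simp_all
 define G where "G p = (g (fst p), g (snd p))" for p
 have GM: "G p : M \<times> M" if "p : M \<times> M" for p
  using that g(2)[of "fst p"] g(2)[of "snd p"] by (simp add: G_def mem_Times_iff)
 have ext: "roller_extend M f \<xi> p = f (\<xi> (G p))" if "p : M \<times> M" for p
  using that by (simp add: roller_extend_def G_def g_def case_prod_unfold)
 have "roller_extend M f \<xi> p : I (fst p) (snd p)" if p: "p : M \<times> M" for p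
 proof -
  have "\<xi> (G p) : I (g (fst p)) (g (snd p))" using rclD(1)[OF \<xi> GM[OF p]] by (simp add: G_def)
  hence "f (\<xi> (G p)) : I (f (g (fst p))) (f (g (snd p)))"
   using iso_I[OF f, of "g (fst p)" "g (snd p)" "\<xi> (G p)"] p g(2) rclD(2)[OF \<xi> GM[OF p]]
   by (simp add: mem_Times_iff)
  thus ?thesis using ext[OF p] p g(1) by (simp add: mem_Times_iff)
 qed
 moreover have "roller_extend M f \<xi> : extensional (M \<times> M)" by (simp add: roller_extend_def)
 moreover have "EX s:f ` A. ALL p:F. d (roller_extend M f \<xi> p) (m s (fst p) (snd p)) < e"
  if F: "finite F" "F <= M \<times> M" and e: "e > 0" for F e
 proof -
  have GF: "finite (G ` F)" "G ` F <= M \<times> M" using F GM by blast+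
  obtain s where s: "s : A" "!!p. p : G ` F ==> d (\<xi> p) (m s (fst p) (snd p)) < e"
   using rcl_approx[OF \<xi> GF e] by metis
  have "d (roller_extend M f \<xi> p) (m (f s) (fst p) (snd p)) < e" if p: "p : F" for p
  proof -
   have pM: "p : M \<times> M" using p F by blast
   hence pM': "fst p : M" "snd p : M" by (simp_all add: mem_Times_iff)
   have M: "s : M" "g (fst p) : M" "g (snd p) : M" using s(1) A pM' g(2) by blast+
   have "f (m s (g (fst p)) (g (snd p))) = m (f s) (f (g (fst p))) (f (g (snd p)))"
    by (rule iso_med[OF f M])
   also have "... = m (f s) (fst p) (snd p)" using pM' g(1) by simp
   finally have "d (f (\<xi> (G p))) (m (f s) (fst p) (snd p)) = d (\<xi> (G p)) (m s (g (fst p)) (g (snd p)))"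
    using isoD(2)[OF f rclD(2)[OF \<xi> GM[OF pM]] med_props(4)[OF M]] by simp
   thus ?thesis using s(2)[of "G p"] p ext[OF pM] by (simp add: G_def)
  qed
  thus ?thesis using s(1) by blast
 qed
 moreover have "roller_extend M f \<xi> : (\<Pi>\<^sub>E p\<in>M \<times> M. I (fst p) (snd p))"
  using calculation(1,2) unfolding PiE_iff by blast
 ultimately show ?thesis by (simp add: rcl_def)
qed

end

locale median_action = cmedian M d r + group_action \<Gamma> M \<phi>
 for M :: "'a set" and d :: "'a => 'a => real" and r :: nat
  and \<Gamma> :: "('g, 'e) monoid_scheme" (structure) and \<phi> :: "'g => 'a => 'a" +
 assumes iso: "!!g. g : carrier \<Gamma> ==> \<phi> g : isometries M d"
  and countable_carrier: "countable (carrier \<Gamma>)"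
  and minimal: "roller_minimal \<Gamma> M d \<phi>"
  and nonelementary: "roller_nonelementary \<Gamma> M d \<phi>"
begin

lemma group_Gamma: "group \<Gamma>" using group_hom group_hom.axioms(1) by auto

sublocale Gm: group \<Gamma> by (rule group_Gamma)

lemma act_M: "g : carrier \<Gamma> ==> x : M ==> \<phi> g x : M" using isoD(1)[OF iso] .

lemma act_one: "x : M ==> \<phi> \<one> x = x" using id_eq_one by (metis restrict_apply')

lemma act_mult_image:
 "A <= M ==> g : carrier \<Gamma> ==> k : carrier \<Gamma> ==> \<phi> (g \<otimes> k) ` A = \<phi> g ` \<phi> k ` A"
 using composition_rule by (force simp: image_def)

lemma act_one_image: "A <= M ==> \<phi> \<one> ` A = A"
 using act_one by (force simp: image_def subset_iff)

lemma act_inv_image: "A <= M ==> g : carrier \<Gamma> ==> \<phi> (inv g) ` \<phi> g ` A = A"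
 "A <= M ==> g : carrier \<Gamma> ==> \<phi> g ` \<phi> (inv g) ` A = A"
 using act_mult_image[of A "inv g" g] act_mult_image[of A g "inv g"] act_one_image by auto

lemma act_sub: "g : carrier \<Gamma> ==> A <= M ==> \<phi> g ` A <= M"
 using act_M by auto

lemma act_Diff: "g : carrier \<Gamma> ==> A <= M ==> \<phi> g ` (M - A) = M - \<phi> g ` A"
 using iso_Diff[OF iso] .

lemma act_Int: "g : carrier \<Gamma> ==> A <= M ==> B <= M ==> \<phi> g ` A \<inter> \<phi> g ` B = \<phi> g ` (A \<inter> B)"
 using inj_on_image_Int[OF isoD(4)[OF iso]] by auto

lemma act_subset_iff: "g : carrier \<Gamma> ==> A <= M ==> B <= M ==> \<phi> g ` A <= \<phi> g ` B \<longleftrightarrow> A <= B"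
 using inj_on_image_subset_iff[OF isoD(4)[OF iso]] by auto

lemma act_wall: "g : carrier \<Gamma> ==> wall h ==> wall (\<phi> g ` h)" using iso_wall[OF iso] .

lemma act_tr: "g : carrier \<Gamma> ==> wall h ==> wall k ==> tr (\<phi> g ` h) (\<phi> g ` k) \<longleftrightarrow> tr h k"
 using iso_tr[OF iso] wall_sub by auto

text \<open>If no translate of the complement \<open>k\<close> of \<open>h\<close> avoids \<open>k\<close>, then all translates meet pairwise, and
 the gates of a fixed point in growing finite intersections converge in the Roller compactification
 to a point of the intersection of their closures. That intersection contradicts minimality.\<close>

lemma flip:
 assumes h: "wall h"
 shows "EX g:carrier \<Gamma>. \<phi> g ` (M - h) <= h"
proof (rule ccontr)
 assume neg: "~ ?thesis"
 define k where "k = M - h"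
 have k: "wall k" "k <= M" "k ~= {}" "cvx k" using h wall_compl wall_sub wall_ne hs_cvx wall_hs
  by (auto simp: k_def)
 have meet1: "\<phi> g ` k \<inter> k ~= {}" if "g : carrier \<Gamma>" for g
  using neg that act_sub[OF that k(2)] unfolding k_def by blast
 have meet: "\<phi> g ` k \<inter> \<phi> g' ` k ~= {}" if g: "g : carrier \<Gamma>" "g' : carrier \<Gamma>" for g g'
 proof -
  have c: "inv g \<otimes> g' : carrier \<Gamma>" using g by auto
  have "g' = g \<otimes> (inv g \<otimes> g')" using g by (simp add: Gm.m_assoc[symmetric])
  hence "\<phi> g' ` k = \<phi> g ` \<phi> (inv g \<otimes> g') ` k" using act_mult_image[OF k(2) g(1) c] by simp
  hence "\<phi> g ` k \<inter> \<phi> g' ` k = \<phi> g ` (k \<inter> \<phi> (inv g \<otimes> g') ` k)"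
   using act_Int[OF g(1) k(2) act_sub[OF c k(2)]] by simp
  thus ?thesis using meet1[OF c] by auto
 qed
 define A where "A g = cl (\<phi> g ` k)" for g
 have kg: "\<phi> g ` k <= M" "cvx (\<phi> g ` k)" if "g : carrier \<Gamma>" for g
  using act_sub[OF that k(2)] iso_cvx[OF iso[OF that] k(4)] by auto
 have A: "cclosed (A g)" "\<phi> g ` k <= A g" if "g : carrier \<Gamma>" for g
  using kg[OF that] cclosed_cl cl_incl by (auto simp: A_def)
 define e where "e = from_nat_into (carrier \<Gamma>)"
 have e: "e n : carrier \<Gamma>" for n unfolding e_def by (rule from_nat_into) (use Gm.one_closed in blast)
 have e_surj: "EX n. e n = g" if "g : carrier \<Gamma>" for g
  unfolding e_def using from_nat_into_surj[OF countable_carrier that] .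
 define B where "B n = \<Inter>(A ` e ` {..n})" for n
 have B: "cclosed (B n)" for n unfolding B_def using A e by (intro cclosed_Inter) auto
 have Bne: "B n ~= {}" for n unfolding B_def
 proof (rule helly)
  fix P Q assume "P : A ` e ` {..n}" "Q : A ` e ` {..n}"
  then obtain i j where "P = A (e i)" "Q = A (e j)" by auto
  thus "P \<inter> Q ~= {}" using meet[OF e e, of i j] A(2)[OF e, of i] A(2)[OF e, of j] by blast
 qed (use A e in "auto simp: cclosed_def")
 obtain p0 where p0: "p0 : M" using M_nonempty by auto
 define x where "x n = gate (B n) p0" for n
 note x = gate[OF B Bne p0, folded x_def]
 have BA: "x i : A (e n)" if "n <= i" for i n using x(1)[of i] that by (auto simp: B_def)
 have mono: "x n : I p0 (x l)" if "n <= l" for n l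
 proof -
  have "B l <= B n" using that by (auto simp: B_def)
  thus ?thesis using x(2)[of "x l" n] x(1)[of l] by auto
 qed
 have "EX l:M. ALL \<epsilon>>0. EX N. \<forall>n\<ge>N. d (m (x n) a b) l < \<epsilon>" if ab: "a : M" "b : M" for a b
 proof -
  define q where "q = m p0 a b"
  define p where "p n = m (x n) a b" for n
  have q: "q : I a b" "q : M" and p: "!!n. p n : I a b" "!!n. p n : M"
   using med_props p0 x(3) ab unfolding q_def p_def by auto
  have pm: "p n : I q (p l)" if "n <= l" for n l
   unfolding p_def q_def by (rule med_interval) (use p0 x(3) ab mono[OF that] in auto)
  have dd: "d (p n) (p l) = d q (p l) - d q (p n)" if "n <= l" for n l
   using pm[OF that] by (simp add: I_iff)
  have "d q (p n) <= 2 * d a b" for n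
   using triangle[OF q(2) ab(1) p(2), of n] I_le(1)[OF q(1)] I_le(1)[OF p(1)[of n]] by (simp add: commute)
  moreover have "incseq (%n. d q (p n))"
  proof (rule incseq_SucI)
   show "d q (p n) <= d q (p (Suc n))" for n
    using dd[of n "Suc n"] nonneg[of "p n" "p (Suc n)"] by linarith
  qed
  ultimately obtain L where "(%n. d q (p n)) \<longlonglongrightarrow> L"
   using incseq_convergent[of "%n. d q (p n)" "2 * d a b"] by blast
  hence "Cauchy (%n. d q (p n))" by (rule LIMSEQ_imp_Cauchy)
  hence "EX N. \<forall>n\<ge>N. \<forall>l\<ge>N. \<bar>d q (p n) - d q (p l)\<bar> < \<epsilon>" if "\<epsilon> > 0" for \<epsilon>
   using that unfolding Cauchy_def dist_real_def by blast
  hence ca: "EX N. \<forall>n\<ge>N. \<forall>l\<ge>n. d (p n) (p l) < \<epsilon>" if "\<epsilon> > 0" for \<epsilon>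
   using that dd by (smt (verit) le_trans)
  show ?thesis using Cauchy_limit[of p, OF p(2) ca] unfolding p_def by metis
 qed
 then obtain l where l: "!!a b. a : M ==> b : M ==> l a b : M"
  "!!a b \<epsilon>. a : M ==> b : M ==> \<epsilon> > 0 ==> EX N. \<forall>n\<ge>N. d (m (x n) a b) (l a b) < \<epsilon>"
  by metis
 define \<xi> where "\<xi> = (\<lambda>p\<in>M \<times> M. l (fst p) (snd p))"
 have l_I: "l a b : I a b" if ab: "a : M" "b : M" for a b
 proof -
  have "EX c:I a b. d (l a b) c < \<epsilon>" if "\<epsilon> > 0" for \<epsilon>
   using l(2)[OF ab that] med_props(3)[OF x(3) ab] by (metis commute order_refl)
  hence "l a b : cl (I a b)" using l(1)[OF ab] by (simp add: cl_def)
  thus ?thesis using cclosed_I[OF ab] by (auto simp: cclosed_def)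
 qed
 have \<xi>A: "\<xi> : rcl (\<phi> g ` k)" if g: "g : carrier \<Gamma>" for g unfolding rcl_def
 proof (intro CollectI conjI allI impI)
  show "\<xi> : (\<Pi>\<^sub>E p\<in>M \<times> M. I (fst p) (snd p))" using l_I by (auto simp: \<xi>_def)
  fix F and \<epsilon> :: real assume F: "finite F" "F <= M \<times> M" and \<epsilon>: "\<epsilon> > 0"
  have e2: "\<epsilon>/2 > 0" using \<epsilon> by simp
  have "EX N. \<forall>n\<ge>N. d (m (x n) (fst p) (snd p)) (\<xi> p) < \<epsilon>/2" if "p : F" for p
  proof -
   have p: "p : M \<times> M" using that F by blast
   hence "fst p : M" "snd p : M" by auto
   thus ?thesis using l(2)[OF _ _ e2] p by (simp only: \<xi>_def restrict_apply' if_True)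
  qed
  then obtain N where N: "!!p n. p : F ==> n >= N p ==> d (m (x n) (fst p) (snd p)) (\<xi> p) < \<epsilon>/2" by metis
  obtain j where j: "e j = g" using e_surj[OF g] by auto
  define n where "n = Max (insert j (N ` F))"
  have n: "n >= j" "!!p. p : F ==> n >= N p" using F(1) by (auto simp: n_def)
  have "x n : A g" using BA[OF n(1)] j by simp
  hence "ALL e>0. EX s:\<phi> g ` k. d (x n) s < e" by (simp add: A_def cl_def del: bex_simps)
  then obtain s where s: "s : \<phi> g ` k" "d (x n) s < \<epsilon>/2" using e2 by blast
  have sM: "s : M" using s kg[OF g] by auto
  have "d (\<xi> p) (m s (fst p) (snd p)) < \<epsilon>" if p: "p : F" for p
  proof -
   have pM: "fst p : M" "snd p : M" "p : M \<times> M" using subsetD[OF F(2) p] by (auto simp: mem_Times_iff)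
   have M: "\<xi> p : M" "m (x n) (fst p) (snd p) : M" "m s (fst p) (snd p) : M"
    using pM l(1) med_props(4) x(3) sM by (auto simp: \<xi>_def)
   have "d (\<xi> p) (m s (fst p) (snd p)) <= d (\<xi> p) (m (x n) (fst p) (snd p)) +
     d (m (x n) (fst p) (snd p)) (m s (fst p) (snd p))" by (rule triangle[OF M])
   also have "... < \<epsilon>/2 + \<epsilon>/2"
    using N[OF p n(2)[OF p]] med_lipschitz[OF x(3) sM pM(1,2), of n] s(2) by (simp add: commute)
   finally show ?thesis by simp
  qed
  thus "EX s:\<phi> g ` k. ALL p:F. d (\<xi> p) (m s (fst p) (snd p)) < \<epsilon>" using s by blast
 qed
 define K where "K = (\<Inter>g\<in>carrier \<Gamma>. rcl (\<phi> g ` k))"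
 have one: "\<one> : carrier \<Gamma>" by simp
 have Kk: "K <= rcl k" using act_one_image[OF k(2)] one unfolding K_def by (metis INF_lower)
 obtain y where y: "y : M" "y ~: cl k" using k(1) by (auto simp: wall_def)
 have clk: "cclosed (cl k)" "cl k ~= {}" using cclosed_cl[OF k(4)] cl_incl[OF k(2)] k(3) by auto
 define w where "w = gate (cl k) y"
 note w = gate[OF clk y(1), folded w_def]
 have "roller_embed M d y ~: rcl k"
 proof
  assume "roller_embed M d y : rcl k"
  moreover have "d y w > 0" using y w by auto
  ultimately obtain s where s: "s : k" "d (roller_embed M d y (y, w)) (m s y w) < d y w"
   using rcl_approx[of "roller_embed M d y" k "{(y, w)}" "d y w"] y w by auto
  have sM: "s : M" using s k by auto
  have "w : I y s" using w(2) s cl_incl[OF k(2)] by auto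
  hence "m s y w = w" using med_eq_iff sM y w I_sym by metis
  moreover have "roller_embed M d y (y, w) = y" using y w med_id by (simp add: roller_embed_def)
  ultimately show False using s by simp
 qed
 moreover have "roller_embed M d y : roller M d" using roller_embed_rcl[of y M] y roller_eq by auto
 moreover have "K <= roller M d" using Kk rcl_mono[OF k(2)] roller_eq by auto
 ultimately have "K \<subset> roller M d" using Kk by auto
 moreover have "K ~= {}" using \<xi>A by (auto simp: K_def)
 moreover have "closedin (subtopology (interval_product_topology M d) (roller M d)) K"
 proof (rule closedin_subset_topspace)
  show "closedin (interval_product_topology M d) K"
   unfolding K_def using closedin_rcl kg one by (intro closedin_INT) auto
 qed (use `K <= roller M d` in auto)
 moreover have "roller_convex M d K" unfolding roller_convex_def
 proof (intro conjI ballI subsetI)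
  fix \<eta>1 \<eta>2 \<zeta> assume *: "\<eta>1 : K" "\<eta>2 : K" "\<zeta> : roller_interval M d \<eta>1 \<eta>2"
  have "\<zeta> : rcl (\<phi> g ` k)" if g: "g : carrier \<Gamma>" for g
  proof -
   have "\<eta>1 : rcl (\<phi> g ` k)" "\<eta>2 : rcl (\<phi> g ` k)" using * g by (simp_all add: K_def)
   thus ?thesis using roller_convex_rcl[OF kg(2)[OF g]] *(3) unfolding roller_convex_def by (meson subsetD)
  qed
  thus "\<zeta> : K" by (simp add: K_def)
 qed (use `K <= roller M d` in auto)
 moreover have "roller_extend M (\<phi> g) ` K <= K" if g: "g : carrier \<Gamma>" for g
 proof (rule image_subsetI)
  fix \<eta> assume \<eta>: "\<eta> : K"
  show "roller_extend M (\<phi> g) \<eta> : K" unfolding K_def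
  proof (rule INT_I)
   fix g' assume g': "g' : carrier \<Gamma>"
   have c: "inv g \<otimes> g' : carrier \<Gamma>" using g g' by auto
   have "g' = g \<otimes> (inv g \<otimes> g')" using g g' by (simp add: Gm.m_assoc[symmetric])
   hence eq: "\<phi> g' ` k = \<phi> g ` \<phi> (inv g \<otimes> g') ` k" using act_mult_image[OF k(2) g c] by simp
   have "\<eta> : rcl (\<phi> (inv g \<otimes> g') ` k)" using \<eta> c by (auto simp: K_def)
   thus "roller_extend M (\<phi> g) \<eta> : rcl (\<phi> g' ` k)"
    unfolding eq by (rule roller_extend_rcl[OF iso[OF g] kg(1)[OF c]])
  qed
 qed
 ultimately have "EX A. A ~= {} & A \<subset> roller M d &
   closedin (subtopology (interval_product_topology M d) (roller M d)) A & roller_convex M d A &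
   (ALL g:carrier \<Gamma>. roller_extend M (\<phi> g) ` A <= A)"
  by (intro exI[of _ K] conjI ballI)
 thus False using minimal by (simp add: roller_minimal_def)
qed

end

section \<open>Transverse classes of walls and products\<close>

context median
begin

lemma cvx_median_space:
 assumes C: "cvx C" "C ~= {}"
 shows "median_space C d" unfolding median_space_def
proof (intro conjI ballI)
 have CM: "C <= M" using C cvx_sub by auto
 show "Metric_space C d" using CM by (rule subspace)
 show "C ~= {}" by fact
 fix x y z assume xyz: "x : C" "y : C" "z : C"
 have eq: "median_interval C d a b = I a b" if "a : C" "b : C" for a b
  using cvxD[OF C(1) that] CM by (auto simp: median_interval_def)
 have "is_singleton (I x y \<inter> I x z \<inter> I y z)"
  using median_space xyz CM by (auto simp: median_space_def)
 thus "is_singleton (median_interval C d x y \<inter> median_interval C d x z \<inter> median_interval C d y z)"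
  using eq xyz by simp
qed

definition eqv :: "'a set set => 'a => 'a => bool" where
 "eqv U p z \<longleftrightarrow> p : M & z : M & (ALL u:U. p : cl u --> z : cl u)"

lemma eqv_refl: "p : M ==> eqv U p p" by (simp add: eqv_def)
lemma eqv_trans: "eqv U p q ==> eqv U q z ==> eqv U p z" by (auto simp: eqv_def)
lemma eqv_M: "eqv U p z ==> p : M" "eqv U p z ==> z : M" by (auto simp: eqv_def)

lemma eqv_not_ssep:
 assumes "eqv U p z" "u : U" "wall u" shows "~ ssep u p z"
 using assms ssep_in[of u p z] wall_sub[of u] cl_incl[of u] by (auto simp: eqv_def ssep_def)

end

text \<open>A splitting of the walls into two mutually transverse classes. The relation \<open>eqv U\<close> says that
 two points agree in all \<open>U\<close>-coordinates.\<close>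

locale splitting = cmedian +
 fixes U V :: "'a set set"
 assumes U: "!!u. u : U ==> wall u" and V: "!!v. v : V ==> wall v"
  and cover: "!!h. wall h ==> h : U | h : V"
  and cU: "!!u. u : U ==> M - u : U" and cV: "!!v. v : V ==> M - v : V"
  and UV: "!!u v. u : U ==> v : V ==> tr u v"
begin

lemma swap: "splitting M d r V U"
proof unfold_locales
 show "tr v u" if "v : V" "u : U" for v u using UV[OF that(2,1)] tr_sym by blast
qed (use U V cover cU cV in blast)+

text \<open>If \<open>z\<close> is off \<open>cl u\<close> and \<open>p\<close> is on it, separate \<open>z\<close> strictly from its gate in \<open>cl u\<close>. The separating
 wall cannot be transverse to \<open>u\<close>, hence lies in \<open>U\<close>, and it separates \<open>z\<close> strictly from \<open>p\<close>.\<close>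

lemma not_eqv_ssep:
 assumes p: "p : M" and z: "z : M" and n: "~ eqv U p z"
 obtains w where "w : U" "ssep w p z"
proof -
 obtain u where u: "u : U" "p : cl u" "z ~: cl u" using assms by (auto simp: eqv_def)
 have wu: "wall u" using U u by auto
 have uM: "u <= M" using wall_sub wu by auto
 have cc: "cclosed (cl u)" "cl u ~= {}" using cclosed_cl[OF hs_cvx(1)[OF wall_hs[OF wu]]] u by auto
 define q where "q = gate (cl u) z"
 note q = gate[OF cc z, folded q_def]
 have "q ~= z" using q u by auto
 then obtain w where w: "wall w" "ssep w q z" using strict_separation[OF q(3) z] by metis
 have wM: "w <= M" using w wall_sub by auto
 have in_w: "q : w" "z : M - w" using ssep_in[OF w(2) wM] z by auto
 have cvw: "cvx (M - w)" using hs_cvx(2)[OF wall_hs[OF w(1)]] .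
 have zcl: "z : cl (M - w)" using in_w cl_incl[of "M - w"] by auto
 have "p ~: cl (M - w)"
 proof
  assume "p : cl (M - w)"
  hence "q : cl (M - w)" using cvxD[OF cvx_cl[OF cvw] zcl] q(2)[OF u(2)] by auto
  thus False using w by (simp add: ssep_def)
 qed
 hence sp: "ssep w p z" using w p by (simp add: ssep_def)
 have "w : U"
 proof (rule ccontr)
  assume "w ~: U"
  hence "tr u w" using cover[OF w(1)] UV[OF u(1)] by auto
  then obtain s where s: "s : u" "s : M - w" by (auto simp: transverse_def)
  define t where "t = m z s p"
  have "t : M - w" unfolding t_def by (rule cvx_med(1)[OF cvw in_w(2) s(2) p])
  moreover have "t : cl u" unfolding t_def
   using cvx_med(3)[OF cvx_cl[OF hs_cvx(1)[OF wall_hs[OF wu]]] _ u(2) z, of s]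
    subsetD[OF cl_incl[OF uM] s(1)] by simp
  ultimately have "q : M - w" using q(2)[of t] cvxD[OF cvw in_w(2), of t q] by blast
  thus False using in_w by auto
 qed
 thus ?thesis using that sp by blast
qed

lemma eqv_sym: "eqv U p z ==> eqv U z p"
proof (rule ccontr)
 assume e: "eqv U p z" and n: "~ eqv U z p"
 then obtain w where w: "w : U" "ssep w z p" using not_eqv_ssep eqv_M by metis
 hence "ssep (M - w) p z" using ssep_sym wall_sub U by auto
 thus False using eqv_not_ssep[OF e cU[OF w(1)]] U cU w by auto
qed

lemma eqv_both: "eqv U p z ==> eqv V p z ==> p = z"
 using strict_separation[of p z] eqv_M cover eqv_not_ssep U V by metis

text \<open>The closures of the walls that prescribe the \<open>U\<close>-coordinates of \<open>x\<close> and the \<open>V\<close>-coordinates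
 of \<open>y\<close> meet pairwise, since walls from the two classes are transverse. Helly's theorem and
 the finite intersection property produce a common point.\<close>

lemma mix_exists:
 assumes x: "x : M" and y: "y : M"
 shows "EX z. eqv U x z & eqv V y z & z : I x y"
proof -
 let ?FU = "cl ` {u : U. x : cl u}" and ?FV = "cl ` {v : V. y : cl v}"
 let ?F = "insert (I x y) (?FU \<union> ?FV)"
 have cc: "cclosed A" if "A : ?F" for A
  using that cclosed_I[OF x y] cclosed_cl hs_cvx(1) wall_hs U V by auto
 have xy: "x : I x y" "y : I x y" using I_self x y by auto
 have UVne: "cl u \<inter> cl v ~= {}" if "u : U" "v : V" for u v
  using trD(3)[OF UV[OF that]] cl_incl[OF wall_sub[OF U[OF that(1)]]] cl_incl[OF wall_sub[OF V[OF that(2)]]]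
  by blast
 have meet: "A \<inter> B ~= {}" if "A : ?F" "B : ?F" for A B
 proof -
  have c: "A = I x y | A : ?FU | A : ?FV" "B = I x y | B : ?FU | B : ?FV" using that by auto
  have *: "D : ?FU ==> x : D" "D : ?FV ==> y : D" for D by auto
  have **: "D : ?FU ==> E : ?FV ==> D \<inter> E ~= {}" for D E using UVne by auto
  show ?thesis
   using c *(1)[of A] *(1)[of B] *(2)[of A] *(2)[of B] **[of A B] **[of B A] xy by (elim disjE) auto
 qed
 have "EX z:M. ALL A:?F. z : A"
 proof (rule closed_convex_fip[OF cc _ x, of ?F "d x y"])
  fix \<G> assume G: "finite \<G>" "\<G> <= ?F" "\<G> ~= {}"
  have "\<Inter>(insert (I x y) \<G>) ~= {}"
  proof (rule helly)
   show "cvx A" if "A : insert (I x y) \<G>" for A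
    using cc[of A] that G(2) by (auto simp: cclosed_def)
   show "A \<inter> B ~= {}" if "A : insert (I x y) \<G>" "B : insert (I x y) \<G>" for A B
    using meet[of A B] that G(2) by blast
  qed (use G in auto)
  then obtain z where "z : I x y" "z : \<Inter>\<G>" by auto
  thus "EX z:\<Inter>\<G>. d x z <= d x y" using I_le(1) by blast
 qed auto
 then obtain z where "z : M" "ALL A:?F. z : A" by blast
 thus ?thesis using x y by (intro exI[of _ z]) (auto simp: eqv_def)
qed

definition mix where "mix x y = (SOME z. eqv U x z & eqv V y z & z : I x y)"

lemma mix:
 assumes "x : M" "y : M"
 shows "eqv U x (mix x y)" "eqv V y (mix x y)" "mix x y : I x y" "mix x y : M"
 using someI_ex[OF mix_exists[OF assms]] I_M unfolding mix_def by auto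

end

context splitting
begin

lemma eqvV_sym: "eqv V p z ==> eqv V z p" using splitting.eqv_sym[OF swap] .

lemma mix_eqI:
 assumes "eqv U x z" "eqv V y z"
 shows "mix x y = z"
proof -
 have M: "x : M" "y : M" using assms eqv_M by auto
 show ?thesis using eqv_both[of "mix x y" z] mix[OF M] assms eqv_sym eqvV_sym eqv_trans by metis
qed

text \<open>A wall that strictly separates \<open>x\<close> from its median with \<open>mix x y\<close> and \<open>mix y x\<close> would be in
 one of the two classes, but one of the two points has the same coordinates as \<open>x\<close> there. So
 \<open>x\<close>, \<open>mix x y\<close>, \<open>y\<close>, \<open>mix y x\<close> are the corners of an \<open>\<ell>\<^sup>1\<close>-rectangle.\<close>

lemma rectangle1:
 assumes x: "x : M" and y: "y : M"
 shows "x : I (mix x y) (mix y x)"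
proof -
 define z z' where zz: "z = mix x y" "z' = mix y x"
 note z = mix[OF x y, folded zz] and z' = mix[OF y x, folded zz]
 define t where "t = m x z z'"
 note t = med_props[OF x z(4) z'(4), folded t_def]
 have "t = x"
 proof (rule ccontr)
  assume "t ~= x"
  then obtain w where w: "wall w" "ssep w t x" using strict_separation[OF t(4) x] by metis
  have cw: "cvx (cl (M - w))" using cvx_cl[OF hs_cvx(2)[OF wall_hs[OF w(1)]]] .
  have xw: "x : cl (M - w)" using ssep_in[OF w(2) wall_sub[OF w(1)]] x cl_incl[of "M - w"] by auto
  have "t : cl (M - w)"
  proof (cases "w : U")
   case True
   hence "z : cl (M - w)" using z(1) cU xw by (auto simp: eqv_def)
   thus ?thesis using cvxD[OF cw xw] t(1) by blast
  next
   case False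
   hence "w : V" using cover w by auto
   hence "z' : cl (M - w)" using z'(2) cV xw by (auto simp: eqv_def)
   thus ?thesis using cvxD[OF cw xw] t(2) by blast
  qed
  thus False using w by (simp add: ssep_def)
 qed
 thus ?thesis using t(3) zz by simp
qed

lemma rectangle:
 assumes x: "x : M" and y: "y : M"
 shows "d x y = d x (mix x y) + d x (mix y x)" "d x (mix y x) = d y (mix x y)" "d x (mix x y) = d y (mix y x)"
 using mix(3)[OF x y] mix(3)[OF y x] rectangle1[OF x y] rectangle1[OF y x]
 by (auto simp: I_iff commute)

lemma dist_invariant_U:
 assumes xx: "eqv U x x'" and y: "y : M"
 shows "d x (mix y x) = d x' (mix y x')"
proof -
 have x: "x : M" "x' : M" using xx eqv_M by auto
 define a' where "a' = mix y x'"
 note a' = mix[OF y x(2), folded a'_def]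
 have "mix x a' = x'" by (rule mix_eqI[OF xx eqvV_sym[OF a'(2)]])
 moreover have "mix a' x = mix y x"
  using mix_eqI[of a' "mix y x" x] mix[OF y x(1)] eqv_trans[OF eqv_sym[OF a'(1)]] by auto
 ultimately show ?thesis using rectangle(2)[OF x(1) a'(4)] a'_def by (simp add: commute)
qed

lemma mix_swap: "x : M ==> y : M ==> splitting.mix M d V U x y = mix y x"
 by (rule mix_eqI[symmetric]; rule splitting.mix[OF swap])

lemma dist_invariant_V: "eqv V x x' ==> y : M ==> d x (mix x y) = d x' (mix x' y)"
 using splitting.dist_invariant_U[OF swap, of x x' y] mix_swap[of y] eqv_M by metis

lemma mix_class_nontrivial:
 assumes p: "p : M" and u: "u : U"
 shows "~ is_singleton {a : M. eqv V p a}"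
proof
 assume "is_singleton {a : M. eqv V p a}"
 then obtain s where s: "{a : M. eqv V p a} = {s}" by (auto simp: is_singleton_def)
 obtain x y where xy: "x : M" "y : M" "ssep u x y" using U[OF u] by (auto simp: wall_def ssep_def)
 have "mix x p : {a : M. eqv V p a}" "mix y p : {a : M. eqv V p a}"
  using mix[OF xy(1) p] mix[OF xy(2) p] by auto
 hence "mix x p = mix y p" using s by auto
 hence "eqv U x y" using mix(1)[OF xy(1) p] eqv_sym[OF mix(1)[OF xy(2) p]] eqv_trans by metis
 thus False using eqv_not_ssep u U xy by auto
qed

lemma cvx_class:
 assumes p: "p : M" and W: "!!w. w : W ==> wall w"
 shows "cvx {a : M. eqv W p a}" unfolding median_convex_def
proof (intro conjI ballI subsetI)
 fix a b t assume ab: "a : {a : M. eqv W p a}" "b : {a : M. eqv W p a}" and t: "t : I a b"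
 have "t : cl w" if "w : W" "p : cl w" for w
  using cvxD[OF cvx_cl[OF hs_cvx(1)[OF wall_hs[OF W[OF that(1)]]]] _ _ t] ab that by (auto simp: eqv_def)
 thus "t : {a : M. eqv W p a}" using I_M[OF t] p by (auto simp: eqv_def)
qed auto

text \<open>The classes of a point under the two relations are the factors.\<close>

lemma reducible:
 assumes "U ~= {}" "V ~= {}"
 shows "~ median_irreducible M d"
proof -
 obtain p where p: "p : M" using M_nonempty by auto
 obtain u v where uv: "u : U" "v : V" using assms by auto
 define A where "A = {a : M. eqv V p a}"
 define B where "B = {a : M. eqv U p a}"
 define f where "f x = (mix x p, mix p x)" for x
 have ne: "p : A" "p : B" using p eqv_refl by (auto simp: A_def B_def)
 have "median_space A d" "median_space B d"
  using cvx_median_space cvx_class[OF p V] cvx_class[OF p U] ne unfolding A_def B_def by blast+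
 moreover have "~ is_singleton A" "~ is_singleton B"
  using mix_class_nontrivial[OF p uv(1)] splitting.mix_class_nontrivial[OF swap p uv(2)]
  by (simp_all add: A_def B_def)
 moreover have "bij_betw f M (A \<times> B)" unfolding bij_betw_def
 proof (intro conjI inj_onI subset_antisym subsetI)
  fix x y assume xy: "x : M" "y : M" "f x = f y"
  hence "mix x p = mix y p" "mix p x = mix p y" by (auto simp: f_def)
  hence "eqv U x y" "eqv V x y"
   using eqv_trans[OF mix(1)[OF xy(1) p], of y] eqv_sym[OF mix(1)[OF xy(2) p]]
    eqv_trans[OF mix(2)[OF p xy(1)], of y] eqvV_sym[OF mix(2)[OF p xy(2)]] by simp_all
  thus "x = y" by (rule eqv_both)
 next
  fix z assume "z : f ` M"
  thus "z : A \<times> B" using mix p by (auto simp: f_def A_def B_def)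
 next
  fix z assume "z : A \<times> B"
  then obtain a b where ab: "z = (a, b)" "a : M" "b : M" "eqv V p a" "eqv U p b" by (auto simp: A_def B_def)
  note x = mix[OF ab(2,3)]
  have "f (mix a b) = z"
   using mix_eqI[OF eqv_sym[OF x(1)] ab(4)] mix_eqI[OF ab(5) eqvV_sym[OF x(2)]] ab(1) by (simp add: f_def)
  thus "z : f ` M" using x(4) by auto
 qed
 moreover have "d x y = d (fst (f x)) (fst (f y)) + d (snd (f x)) (snd (f y))" if xy: "x : M" "y : M" for x y
 proof -
  note xp = mix[OF xy(1) p] and px = mix[OF p xy(1)] and yp = mix[OF xy(2) p] and py = mix[OF p xy(2)]
  have "mix y (mix x p) = mix y p"
   by (rule mix_eqI[OF yp(1) eqv_trans[OF eqvV_sym[OF xp(2)] yp(2)]])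
  hence 1: "d x (mix y x) = d (mix x p) (mix y p)" using dist_invariant_U[OF xp(1) xy(2)] by simp
  have "mix (mix p x) y = mix p y"
   by (rule mix_eqI[OF eqv_trans[OF eqv_sym[OF px(1)] py(1)] py(2)])
  hence 2: "d x (mix x y) = d (mix p x) (mix p y)" using dist_invariant_V[OF px(2) xy(2)] by simp
  show ?thesis using rectangle(1)[OF xy] 1 2 by (simp add: f_def)
 qed
 ultimately show ?thesis unfolding median_irreducible_def by blast
qed

end

locale irreducible_action = median_action +
 assumes irreducible: "median_irreducible M d"
begin

lemma no_splitting:
 assumes "!!u. u : U ==> wall u" "!!v. v : V ==> wall v" "!!h. wall h ==> h : U | h : V"
  "!!u. u : U ==> M - u : U" "!!v. v : V ==> M - v : V"
  "!!u v. u : U ==> v : V ==> tr u v" "U ~= {}"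
 shows "V = {}"
proof -
 have "splitting M d r U V" by unfold_locales (use assms in blast)+
 thus ?thesis using splitting.reducible irreducible assms(7) by blast
qed

lemma nested_translate:
 assumes h: "wall h" and k: "wall k" and g: "g : carrier \<Gamma>" and nt: "~ tr (\<phi> g ` h) k"
 shows "EX g:carrier \<Gamma>. \<phi> g ` h <= k"
proof -
 have hM: "h <= M" "k <= M" using h k wall_sub by auto
 obtain \<delta> where \<delta>: "\<delta> : carrier \<Gamma>" "\<phi> \<delta> ` (M - k) <= k" using flip[OF k] by auto
 obtain \<sigma> where \<sigma>: "\<sigma> : carrier \<Gamma>" "\<phi> \<sigma> ` h <= M - h"
  using flip[OF wall_compl[OF h]] by (auto simp: compl_compl[OF h])
 have *: "\<phi> (\<delta> \<otimes> x) ` h <= k" if "x : carrier \<Gamma>" "\<phi> x ` h <= M - k" for x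
  using act_mult_image[OF hM(1) \<delta>(1) that(1)] \<delta>(2) that(2) by blast
 have **: "\<phi> (g \<otimes> \<sigma>) ` h <= M - \<phi> g ` h"
 proof -
  have "\<phi> (g \<otimes> \<sigma>) ` h = \<phi> g ` \<phi> \<sigma> ` h" by (rule act_mult_image[OF hM(1) g \<sigma>(1)])
  also have "... <= \<phi> g ` (M - h)" using \<sigma>(2) by (rule image_mono)
  finally show ?thesis using act_Diff[OF g hM(1)] by simp
 qed
 have gs: "g \<otimes> \<sigma> : carrier \<Gamma>" using g \<sigma> by auto
 from nt act_sub[OF g hM(1)] hM(2) show ?thesis
 proof (cases rule: not_tr_cases)
  case 1
  hence "\<phi> g ` h <= M - k" using act_sub[OF g hM(1)] by auto
  thus ?thesis using *[OF g] \<delta>(1) g by blast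
 next
  case 2 thus ?thesis using g by auto
 next
  case 3
  hence "\<phi> (g \<otimes> \<sigma>) ` h <= M - k" using ** by auto
  thus ?thesis using *[OF gs] \<delta>(1) gs by blast
 next
  case 4
  hence "\<phi> (g \<otimes> \<sigma>) ` h <= k" using ** by auto
  thus ?thesis using gs by blast
 qed
qed

text \<open>Being movable into each other is an equivalence relation on walls, and inequivalent walls are
 transverse; so irreducibility leaves a single class.\<close>

lemma translate_into:
 assumes h: "wall h" and k: "wall k"
 shows "EX g:carrier \<Gamma>. \<phi> g ` h <= k"
proof -
 define R where "R a b \<longleftrightarrow> (EX g:carrier \<Gamma>. \<phi> g ` a <= b)" for a b :: "'a set"
 let ?U = "{k. wall k & R h k}" and ?V = "{k. wall k & ~ R h k}"
 have one: "\<one> : carrier \<Gamma>" by simp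
 have nt: "R a b" if "wall a" "wall b" "~ tr a b" for a b
  using nested_translate[OF that(1,2) one] act_one_image[OF wall_sub[OF that(1)]] that(3) by (simp add: R_def)
 have trans: "R a e" if ab: "R a b" and be: "R b e" and aM: "a <= M" for a b e
 proof -
  obtain g g' where "g : carrier \<Gamma>" "\<phi> g ` a <= b" "g' : carrier \<Gamma>" "\<phi> g' ` b <= e"
   using ab be unfolding R_def by blast
  moreover from this have "\<phi> (g' \<otimes> g) ` a <= e"
   using act_mult_image[OF aM, of g' g] image_mono[of "\<phi> g ` a" b "\<phi> g'"] by auto
  ultimately show ?thesis unfolding R_def by (intro bexI[of _ "g' \<otimes> g"]) auto
 qed
 have compl: "R h (M - k)" if wk: "wall k" and hk: "R h k" for k
 proof -
  obtain g where g: "g : carrier \<Gamma>" "\<phi> g ` h <= k" using hk by (auto simp: R_def)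
  have "~ tr (\<phi> g ` h) (M - k)" using g(2) by (auto simp: transverse_def)
  thus ?thesis using nested_translate[OF h wall_compl[OF wk] g(1)] by (simp add: R_def)
 qed
 have "?V = {}"
 proof (rule no_splitting[of ?U])
  show "M - u : ?U" if "u : ?U" for u using that compl wall_compl by auto
  show "M - v : ?V" if "v : ?V" for v using that compl[of "M - v"] wall_compl compl_compl by auto
  show "tr u v" if "u : ?U" "v : ?V" for u v
   using nt[of u v] trans[of h u v] that wall_sub[OF h] by auto
  have "R h h" unfolding R_def using one act_one_image[OF wall_sub[OF h]] by blast
  thus "?U ~= {}" using h by blast
 qed auto
 thus ?thesis using k by (auto simp: R_def)
qed

text \<open>If all walls inside \<open>a\<close> were transverse to \<open>k\<close>, then moving \<open>M - c\<close> over and over into the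
 current translate of \<open>a\<close> would give infinitely many pairwise transverse translates of \<open>k\<close>.\<close>

lemma nested_wall_inside:
 assumes a: "wall a" and k: "wall k" and c: "wall c" and ck: "c <= k" and ac: "a \<inter> c = {}"
 shows "EX w. wall w & w <= a & ~ tr w k"
proof (rule ccontr)
 assume neg: "~ ?thesis"
 have sub: "a <= M" "k <= M" "c <= M" using a k c wall_sub by auto
 have "EX g':carrier \<Gamma>. \<phi> g' ` (M - c) <= \<phi> g ` a" if "g : carrier \<Gamma>" for g
  by (rule translate_into[OF wall_compl[OF c] act_wall[OF that a]])
 then obtain F where F: "!!g. g : carrier \<Gamma> ==> F g : carrier \<Gamma>"
  "!!g. g : carrier \<Gamma> ==> \<phi> (F g) ` (M - c) <= \<phi> g ` a" by metis
 define \<gamma> where "\<gamma> n = (F ^^ n) \<one>" for n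
 have \<gamma>: "\<gamma> n : carrier \<Gamma>" for n by (induction n) (auto simp: \<gamma>_def F)
 have step: "\<phi> (\<gamma> (Suc n)) ` (M - c) <= \<phi> (\<gamma> n) ` a" for n
  using F(2)[OF \<gamma>[of n]] by (simp add: \<gamma>_def)
 have aMc: "a <= M - c" using ac sub by auto
 have dec: "\<phi> (\<gamma> (Suc n)) ` a <= \<phi> (\<gamma> n) ` a" for n
  using image_mono[OF aMc, of "\<phi> (\<gamma> (Suc n))"] step[of n] by (rule subset_trans)
 have deep: "\<phi> (\<gamma> n) ` (M - c) <= \<phi> (\<gamma> i) ` a" if "i < n" for i n
 proof -
  have "\<phi> (\<gamma> (n - 1)) ` a <= \<phi> (\<gamma> i) ` a"
   using lift_Suc_antimono_le[of "%n. \<phi> (\<gamma> n) ` a" i "n - 1"] dec that by auto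
  thus ?thesis using step[of "n - 1"] that by auto
 qed
 have tr1: "tr (\<phi> (\<gamma> n) ` k) (\<phi> (\<gamma> i) ` k)" if "i < n" for i n
 proof -
  let ?g = "inv (\<gamma> i) \<otimes> \<gamma> n"
  have g: "?g : carrier \<Gamma>" using \<gamma> by auto
  have "\<phi> ?g ` (M - k) = \<phi> (inv (\<gamma> i)) ` \<phi> (\<gamma> n) ` (M - k)"
   using act_mult_image[of "M - k" "inv (\<gamma> i)" "\<gamma> n"] \<gamma> by auto
  also have "... <= \<phi> (inv (\<gamma> i)) ` \<phi> (\<gamma> n) ` (M - c)" using ck by (intro image_mono) auto
  also have "... <= \<phi> (inv (\<gamma> i)) ` \<phi> (\<gamma> i) ` a" using deep[OF that] by (rule image_mono)
  also have "... = a" by (rule act_inv_image(1)[OF sub(1) \<gamma>])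
  finally have "tr (\<phi> ?g ` (M - k)) k" using neg act_wall[OF g wall_compl[OF k]] by blast
  hence "tr (\<phi> (\<gamma> i) ` \<phi> ?g ` (M - k)) (\<phi> (\<gamma> i) ` k)"
   using act_tr[OF \<gamma> act_wall[OF g wall_compl[OF k]] k] by blast
  moreover have "\<phi> (\<gamma> i) ` \<phi> ?g ` (M - k) = \<phi> (\<gamma> n) ` (M - k)"
  proof -
   have "\<phi> (\<gamma> i) ` \<phi> ?g ` (M - k) = \<phi> (\<gamma> i \<otimes> ?g) ` (M - k)"
    using act_mult_image[of "M - k" "\<gamma> i" ?g] \<gamma> g by auto
   also have "\<gamma> i \<otimes> ?g = \<gamma> n" using \<gamma> by (simp add: Gm.m_assoc[symmetric])
   finally show ?thesis .
  qed
  ultimately show ?thesis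
   using act_Diff[OF \<gamma> sub(2)] tr_compl(2) act_sub[OF \<gamma> sub(2)] by metis
 qed
 hence tr2: "tr (\<phi> (\<gamma> n) ` k) (\<phi> (\<gamma> i) ` k)" if "i ~= n" for i n
  using that tr_sym by (metis nat_neq_iff)
 have inj: "inj (%n. \<phi> (\<gamma> n) ` k)"
 proof (rule injI)
  fix i j assume eq: "\<phi> (\<gamma> i) ` k = \<phi> (\<gamma> j) ` k"
  show "i = j"
  proof (rule ccontr)
   assume "i ~= j"
   hence "tr (\<phi> (\<gamma> j) ` k) (\<phi> (\<gamma> j) ` k)" using tr2[of i j] eq by simp
   thus False by (auto simp: transverse_def)
  qed
 qed
 have "card ((%n. \<phi> (\<gamma> n) ` k) ` {..r}) <= r"
 proof (rule rank)
  show "pairwise tr ((%n. \<phi> (\<gamma> n) ` k) ` {..r})"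
  proof (rule pairwise_imageI)
   show "tr (\<phi> (\<gamma> i) ` k) (\<phi> (\<gamma> j) ` k)" if "i ~= j" for i j using tr2[of j i] that by simp
  qed
 qed (use act_wall[OF \<gamma> k] wall_hs in auto)
 moreover have "card ((%n. \<phi> (\<gamma> n) ` k) ` {..r}) = Suc r"
  using card_image[OF inj_on_subset[OF inj subset_UNIV], of "{..r}"] by simp
 ultimately show False by simp
qed

end

section \<open>Strongly separated walls\<close>

context irreducible_action
begin

lemma nested_signs:
 assumes "wall a" "wall h" "~ tr a h"
 obtains a' h' where "a' = a | a' = M - a" "h' = h | h' = M - h" "a' <= h'" "wall a'" "wall h'"
proof -
 have sub: "a <= M" "h <= M" using assms wall_sub by auto
 note w = assms(1,2) wall_compl[OF assms(1)] wall_compl[OF assms(2)]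
 from assms(3) sub show ?thesis
 proof (cases rule: not_tr_cases)
  case 1 hence "a <= M - h" using sub by auto
  thus ?thesis using that[of a "M - h"] w by auto
 next
  case 2 thus ?thesis using that[of a h] w by auto
 next
  case 3 hence "M - a <= M - h" by auto
  thus ?thesis using that[of "M - a" "M - h"] w by auto
 next
  case 4 thus ?thesis using that[of "M - a" h] w by auto
 qed
qed

text \<open>Were \<open>a\<close> and \<open>c\<close> not transverse, \<open>h\<close>, \<open>a\<close>, \<open>c\<close>, \<open>k\<close> would be a path of walls without
 transverse neighbours. One of the inner walls, or a wall inside \<open>a\<close>, then shortens it.\<close>

lemma no_long_path_aux:
 assumes w: "wall h" "wall k" "wall a" "wall c" and hk: "tr h k"
  and bad: "!!w. wall w ==> ~ tr w h ==> ~ tr w k ==> False"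
  and ah: "a <= h" and ck: "c <= k"
 shows "tr a c"
proof (rule ccontr)
 assume n: "~ tr a c"
 have sub: "a <= M" "c <= M" using w wall_sub by auto
 have nt: "~ tr x y" if "x <= y" for x y using that by (auto simp: transverse_def)
 from n sub show False
 proof (cases rule: not_tr_cases)
  case 1
  then obtain x where "wall x" "x <= a" "~ tr x k" using nested_wall_inside[OF w(3,2,4) ck] by auto
  thus False using bad[of x] nt[of x h] ah by auto
 next
  case 2
  hence "a <= k" using ck by auto
  thus False using bad[OF w(3)] nt ah by auto
 next
  case 3
  hence "c <= h" using ah by auto
  thus False using bad[OF w(4)] nt ck by auto
 next
  case 4
  hence "M - h <= k" using ah ck by auto
  thus False using trD(4)[OF hk] by auto
 qed
qed

lemma no_long_path:
 assumes w: "wall h" "wall k" "wall a" "wall c" and hk: "tr h k"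
  and bad: "!!w. wall w ==> ~ tr w h ==> ~ tr w k ==> False"
  and ah: "~ tr a h" and ck: "~ tr c k"
 shows "tr a c"
proof -
 have sub: "a <= M" "c <= M" "h <= M" "k <= M" using w wall_sub by auto
 obtain a' h' where a': "a' = a | a' = M - a" "h' = h | h' = M - h" "a' <= h'" "wall a'" "wall h'"
  using nested_signs[OF w(3,1) ah] .
 obtain c' k' where c': "c' = c | c' = M - c" "k' = k | k' = M - k" "c' <= k'" "wall c'" "wall k'"
  using nested_signs[OF w(4,2) ck] .
 have eq: "tr x h' = tr x h" "tr x k' = tr x k" for x
  using a'(2) c'(2) tr_compl(1)[OF sub(3)] tr_compl(1)[OF sub(4)] by auto
 have "tr h' k" using hk a'(2) tr_compl(2)[OF sub(3), of k] by (elim disjE) simp_all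
 hence "tr h' k'" using eq(2) by simp
 hence "tr a' c'"
  by (rule no_long_path_aux[OF a'(5) c'(5) a'(4) c'(4) _ _ a'(3) c'(3)]) (use bad eq in auto)
 thus ?thesis using a'(1) c'(1) tr_compl(1)[OF sub(2)] tr_compl(2)[OF sub(1)] by auto
qed

text \<open>Non-transversality is connected on walls by irreducibility, and paths can be shortened to
 length two.\<close>

lemma common_nested_wall:
 assumes h: "wall h" and k: "wall k"
 shows "EX w. wall w & ~ tr w h & ~ tr w k"
proof -
 let ?P = "%w. EX x. wall x & ~ tr x h & ~ tr x w"
 have nt: "~ tr x x" for x by (auto simp: transverse_def)
 have "{w. wall w & ~ ?P w} = {}"
 proof (rule no_splitting[of "{w. wall w & ?P w}"])
  fix u assume "u : {w. wall w & ?P w}"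
  thus "M - u : {w. wall w & ?P w}" using tr_compl(1)[OF wall_sub[of u]] wall_compl by auto
 next
  fix u assume "u : {w. wall w & ~ ?P w}"
  thus "M - u : {w. wall w & ~ ?P w}" using tr_compl(1)[OF wall_sub[of u]] wall_compl by auto
 next
  fix u v assume u: "u : {w. wall w & ?P w}" and v: "v : {w. wall w & ~ ?P w}"
  then obtain x where x: "wall x" "~ tr x h" "~ tr x u" by auto
  have uv: "wall u" "wall v" "~ ?P v" using u v by auto
  show "tr u v"
  proof (rule ccontr)
   assume n: "~ tr u v"
   have "tr h v" using uv(3) h nt by blast
   hence "tr x u" using no_long_path[OF h uv(2) x(1) uv(1) _ _ x(2) n] uv(3) by blast
   thus False using x by auto
  qed
 next
  show "{w. wall w & ?P w} ~= {}" using h nt by auto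
 qed auto
 thus ?thesis using k by blast
qed

definition inside :: "'a set => 'a set => bool" where
 "inside b D \<longleftrightarrow> (EX w. wall w & w <= b & w <= D)"

lemma inside_sym: "inside b D \<longleftrightarrow> inside D b" by (auto simp: inside_def)

lemma inside_mono: "inside b D ==> b <= b' ==> inside b' D"
 unfolding inside_def by (meson subset_trans)

lemma inside_other_side:
 assumes b: "wall b" and v: "wall v" and t: "tr v b" and i: "inside (M - b) v | inside (M - b) (M - v)"
 shows "inside b v | inside b (M - v)"
proof -
 have sub: "b <= M" "v <= M" using b v wall_sub by auto
 obtain k c where k: "k = v | k = M - v" "wall k" and c: "wall c" "c <= M - b" "c <= k"
  using i v wall_compl[OF v] unfolding inside_def by blast
 have "b \<inter> c = {}" using c by auto
 then obtain w where w: "wall w" "w <= b" "~ tr w k" using nested_wall_inside[OF b k(2) c(1,3)] by auto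
 hence "~ tr w v" using k(1) tr_compl(1)[OF sub(2)] by auto
 thus ?thesis using wall_sub[OF w(1)] sub(2)
 proof (cases rule: not_tr_cases)
  case 1 hence "w <= M - v" using wall_sub[OF w(1)] by auto
  thus ?thesis using w unfolding inside_def by blast
 next
  case 2 thus ?thesis using w unfolding inside_def by blast
 next
  case 3 thus ?thesis using trD(1)[OF t] w by auto
 next
  case 4 hence "M - v <= w" by auto
  thus ?thesis using trD(4)[OF t] w by auto
 qed
qed

text \<open>Two transverse walls cut out four sectors; those containing walls always include a pair of
 opposite ones.\<close>

lemma sectors:
 assumes b: "wall b" and v: "wall v" and t: "tr v b"
 shows "inside b v | inside b (M - v)" "inside (M - b) v | inside (M - b) (M - v)"
  "inside b v | inside (M - b) v" "inside b (M - v) | inside (M - b) (M - v)"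
proof -
 have sub: "b <= M" "v <= M" using b v wall_sub by auto
 note cb = wall_compl[OF b] and cv = wall_compl[OF v] and bb = compl_compl[OF b] and vv = compl_compl[OF v]
 have some: "inside b v | inside b (M - v) | inside (M - b) v | inside (M - b) (M - v)"
 proof -
  obtain w where w: "wall w" "~ tr w b" "~ tr w v" using common_nested_wall[OF b v] by auto
  obtain w1 b' where 1: "w1 = w | w1 = M - w" "b' = b | b' = M - b" "w1 <= b'" "wall w1"
   using nested_signs[OF w(1) b w(2)] by metis
  obtain w2 v' where 2: "w2 = w | w2 = M - w" "v' = v | v' = M - v" "w2 <= v'" "wall w2"
   using nested_signs[OF w(1) v w(3)] by metis
  have "w1 = w2"
  proof (rule ccontr)
   assume "w1 ~= w2"
   hence "w2 = M - w1" using 1(1) 2(1) compl_compl[OF w(1)] by auto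
   hence "M - b' <= v'" using 1(3) 2(3) by auto
   moreover have "tr b' v'" using t 1(2) 2(2) tr_compl sub tr_sym by metis
   ultimately show False using trD(4) by blast
  qed
  hence "inside b' v'" using 1 2 unfolding inside_def by blast
  thus ?thesis using 1(2) 2(2) by auto
 qed
 have t2: "tr v (M - b)" "tr b v" "tr b (M - v)" using t tr_compl sub tr_sym by metis+
 note A = inside_other_side[OF b v t] and B = inside_other_side[OF cb v t2(1)]
  and C = inside_other_side[OF v b t2(2)] and D = inside_other_side[OF cv b t2(3)]
 show "inside b v | inside b (M - v)" using some A by blast
 show "inside (M - b) v | inside (M - b) (M - v)" using some B bb by auto
 show "inside b v | inside (M - b) v" using some C inside_sym by metis
 show "inside b (M - v) | inside (M - b) (M - v)" using some D vv inside_sym by metis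
qed

text \<open>As the wall \<open>v\<close> crosses all of \<open>b1 \<subseteq> b0 \<subseteq> b2\<close>, two consecutive ones
 leave walls on opposite sides of \<open>v\<close>, one inside the smaller and one outside the larger.\<close>

lemma opposite_sides:
 assumes w: "wall b1" "wall b0" "wall b2" and v: "wall v" and t: "tr v b1" "tr v b0" "tr v b2"
  and sub: "b1 <= b0" "b0 <= b2"
 shows "EX D. (D = v | D = M - v) & ((inside b1 D & inside (M - b0) (M - D)) | (inside b0 D & inside (M - b2) (M - D)))"
proof -
 note s1 = sectors[OF w(1) v t(1)] and s0 = sectors[OF w(2) v t(2)] and s2 = sectors[OF w(3) v t(3)]
 have m: "inside b1 D ==> inside b0 D" "inside (M - b2) D ==> inside (M - b0) D" for D
  using inside_mono[of b1 D b0] inside_mono[of "M - b2" D "M - b0"] sub by auto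
 have vv: "M - (M - v) = v" using compl_compl[OF v] .
 have "(inside b1 v & inside (M - b0) (M - v)) | (inside b0 v & inside (M - b2) (M - v)) |
  (inside b1 (M - v) & inside (M - b0) v) | (inside b0 (M - v) & inside (M - b2) v)"
  using s1(1) s0 s2(2) m[of v] m[of "M - v"] by argo
 thus ?thesis using vv by metis
qed

text \<open>Walls at positive distance, and families of pairwise transverse walls crossing both.\<close>

definition apart :: "'a set => 'a set => bool" where
 "apart A B \<longleftrightarrow> wall A & wall B & A \<inter> B = {} & (EX e>0. ALL a:A. ALL b:B. d a b >= e)"

definition crossing :: "'a set => 'a set => 'a set set => bool" where
 "crossing A B F \<longleftrightarrow> finite F & pairwise tr F & (ALL f:F. wall f & tr f A & tr f B)"

lemma apart_mono: "apart A B ==> wall A' ==> wall B' ==> A' <= A ==> B' <= B ==> apart A' B'"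
 unfolding apart_def by (meson disjoint_iff subset_iff)

lemma crossing_card: "crossing A B F ==> card F <= r"
 using rank wall_hs by (auto simp: crossing_def)

lemma crossing_act:
 assumes F: "crossing A B F" and g: "g : carrier \<Gamma>" and AB: "wall A" "wall B"
 shows "crossing (\<phi> g ` A) (\<phi> g ` B) ((`) (\<phi> g) ` F)" "card ((`) (\<phi> g) ` F) = card F"
proof -
 have FM: "f <= M" "wall f" if "f : F" for f using that F wall_sub by (auto simp: crossing_def)
 show "crossing (\<phi> g ` A) (\<phi> g ` B) ((`) (\<phi> g) ` F)" unfolding crossing_def
 proof (intro conjI ballI)
  show "finite ((`) (\<phi> g) ` F)" using F by (auto simp: crossing_def)
  show "pairwise tr ((`) (\<phi> g) ` F)"
  proof (rule pairwise_imageI)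
   fix x y assume "x : F" "y : F" "x ~= y"
   thus "tr (\<phi> g ` x) (\<phi> g ` y)"
    using F act_tr[OF g FM(2) FM(2)] by (auto simp: crossing_def pairwise_def)
  qed
  fix f assume "f : (`) (\<phi> g) ` F"
  then obtain f' where "f' : F" "f = \<phi> g ` f'" by auto
  thus "wall f" "tr f (\<phi> g ` A)" "tr f (\<phi> g ` B)"
   using F act_wall[OF g] act_tr[OF g] AB by (auto simp: crossing_def)
 qed
 have "inj_on ((`) (\<phi> g)) F"
  using FM(1) inj_on_image_eq_iff[OF inj_prop[OF g]] by (auto intro!: inj_onI)
 thus "card ((`) (\<phi> g) ` F) = card F" by (rule card_image)
qed

lemma crossing_extend:
 assumes F: "crossing x x' F" and x: "x <= M" "x' <= M" and A: "x <= A" "x' \<inter> A = {}" and B: "x' <= B" "x \<inter> B = {}"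
  and v: "wall v" "tr v A" "tr v B" and D: "D = v | D = M - v" "x <= D" "x' <= M - D"
 shows "crossing A B (insert v F)" "card (insert v F) = Suc (card F)"
proof -
 have cut: "x \<inter> u ~= {}" "x \<inter> (M - u) ~= {}" "x' \<inter> u ~= {}" "x' \<inter> (M - u) ~= {}" if "u : F" for u
  using F that by (auto simp: crossing_def transverse_def)
 have uA: "tr u A" if "u : F" for u using tr_cut[OF cut[OF that] A x(2)] .
 have uB: "tr u B" if "u : F" for u using tr_cut[OF cut(3,4,1,2)[OF that] B x(1)] .
 have "x' \<inter> D = {}" using D by auto
 hence "tr u D" if "u : F" for u using tr_cut[OF cut[OF that] D(2) _ x(2)] by auto
 hence uv: "tr u v" if "u : F" for u using that D(1) tr_compl(1)[OF wall_sub[OF v(1)]] by metis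
 have "v ~: F" using uv by (auto simp: transverse_def)
 thus "card (insert v F) = Suc (card F)" using F by (auto simp: crossing_def)
 have vu: "tr v u" if "u : F" for u using uv[OF that] by (simp add: tr_sym[of v u])
 have "pairwise tr (insert v F)" using F uv vu by (simp add: crossing_def pairwise_insert)
 thus "crossing A B (insert v F)" using F uA uB v by (simp add: crossing_def)
qed

text \<open>A pair of walls apart crossed by as few transverse walls as possible is crossed by none:
 otherwise push the pair along a translation, and split it by one of the crossing walls into a smaller
 pair, whose crossing walls together with the splitting one are too many.\<close>

lemma strongly_separated:
 assumes "wall h"
 obtains A B where "apart A B" "!!f. wall f ==> tr f A ==> tr f B ==> False"
proof -
 let ?Q = "%p. EX A B. apart A B & (ALL F. crossing A B F --> card F <= p)"
 obtain k e where k: "wall k" "e > 0" "k <= h" "!!a b. a : k ==> b : M - h ==> d a b >= e"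
  using wall_gap[OF assms] by metis
 have "apart k (M - h)" unfolding apart_def using k wall_compl[OF assms] by auto
 hence Qr: "?Q r" using crossing_card by meson
 define p where "p = (LEAST p. ?Q p)"
 have p: "?Q p" unfolding p_def by (rule LeastI[of ?Q, OF Qr])
 have pl: "~ ?Q q" if "q < p" for q using not_less_Least[of q ?Q] that unfolding p_def by blast
 obtain A B where AB: "apart A B" "!!F. crossing A B F ==> card F <= p" using p by blast
 have w: "wall A" "wall B" "A \<inter> B = {}" using AB by (auto simp: apart_def)
 have sub: "A <= M" "B <= M" using w wall_sub by auto
 show ?thesis
 proof (cases "p = 0")
  case True
  have "False" if "wall f" "tr f A" "tr f B" for f
   using AB(2)[of "{f}"] that True by (auto simp: crossing_def)
  thus ?thesis using that AB(1) by blast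
 next
  case False
  have many: "EX F. crossing A' B' F & card F >= p" if "apart A' B'" for A' B'
  proof (rule ccontr)
   assume n: "~ ?thesis"
   have "card F <= p - 1" if "crossing A' B' F" for F
   proof -
    have "~ p <= card F" using n that by blast
    thus ?thesis by linarith
   qed
   hence "?Q (p - 1)" using `apart A' B'` by (intro exI[of _ A'] exI[of _ B'] conjI allI impI)
   thus False using pl[of "p - 1"] False by simp
  qed
  obtain g where g: "g : carrier \<Gamma>" "\<phi> g ` (M - B) <= A" using translate_into[OF wall_compl[OF w(2)] w(1)] by auto
  define A1 B1 where AB1: "A1 = \<phi> g ` A" "B1 = \<phi> g ` B"
  have w1: "wall A1" "wall B1" using act_wall g w AB1 by auto
  have sub1: "A1 <= M" "B1 <= M" using w1 wall_sub by auto
  have A1: "A1 <= M - B1" "M - B1 <= A" "A <= M - B"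
  proof -
   show "A <= M - B" using w sub by auto
   hence "\<phi> g ` A <= \<phi> g ` (M - B)" by (rule image_mono)
   thus "A1 <= M - B1" "M - B1 <= A" using g act_Diff[OF g(1) sub(2)] AB1 by auto
  qed
  have "apart A1 B" using apart_mono[OF AB(1) w1(1) w(2)] A1 by auto
  then obtain F where F: "crossing A1 B F" "card F >= p" using many by blast
  then obtain v where "v : F" using False by (metis card.empty ex_in_conv le_zero_eq)
  hence v: "wall v" "tr v A1" "tr v B" using F by (auto simp: crossing_def)
  have vB: "tr v (M - B)" using v(3) tr_compl(1)[OF sub(2)] by auto
  have vA: "tr v A" using tr_mono[OF v(2) vB] A1 by auto
  have "tr v (M - B1)" using tr_mono[OF v(2) vA] A1 by auto
  hence vB1: "tr v B1" using tr_compl(1)[OF sub1(2)] by auto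
  have "A1 <= A" using A1 by auto
  obtain D where D: "D = v | D = M - v"
   "(inside A1 D & inside (M - A) (M - D)) | (inside A D & inside (M - (M - B)) (M - D))"
   using opposite_sides[OF w1(1) w(1) wall_compl[OF w(2)] v(1,2) vA vB `A1 <= A` A1(3)] by auto
  from D(2) show ?thesis
  proof
   assume "inside A1 D & inside (M - A) (M - D)"
   then obtain x x' where x: "wall x" "x <= A1" "x <= D" "wall x'" "x' <= M - A" "x' <= M - D"
    unfolding inside_def by blast
   have xB: "x' <= B1" using x(5) A1(2) by auto
   have "apart A1 B1" unfolding apart_def
   proof (intro conjI)
    show "A1 \<inter> B1 = {}" using A1(1) by auto
    obtain e where e: "e > 0" "!!a b. a : A ==> b : B ==> d a b >= e" using AB(1) by (auto simp: apart_def)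
    have "d a b >= e" if ab: "a : A1" "b : B1" for a b
    proof -
     obtain a' b' where "a' : A" "a = \<phi> g a'" "b' : B" "b = \<phi> g b'" using ab AB1 by auto
     thus ?thesis using e(2) isoD(2)[OF iso[OF g(1)]] sub by (metis subsetD)
    qed
    thus "EX e>0. ALL a:A1. ALL b:B1. e <= d a b" using e(1) by blast
   qed (use w1 in auto)
   hence "apart x x'" using apart_mono x xB by blast
   then obtain F' where F': "crossing x x' F'" "card F' >= p" using many by blast
   have "x' \<inter> A1 = {}" "x \<inter> B1 = {}" using x A1 by auto
   note E = crossing_extend[OF F'(1) wall_sub[OF x(1)] wall_sub[OF x(4)] x(2) this(1) xB this(2) v(1,2) vB1 D(1) x(3,6)]
   have gi: "inv g : carrier \<Gamma>" using g by auto
   have "crossing (\<phi> (inv g) ` A1) (\<phi> (inv g) ` B1) ((`) (\<phi> (inv g)) ` insert v F')"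
    and c: "card ((`) (\<phi> (inv g)) ` insert v F') = card (insert v F')"
    using crossing_act[OF E(1) gi w1] by auto
   hence "crossing A B ((`) (\<phi> (inv g)) ` insert v F')"
    using act_inv_image(1)[OF sub(1) g(1)] act_inv_image(1)[OF sub(2) g(1)] AB1 by simp
   hence "Suc (card F') <= p" using AB(2) c E(2) by metis
   thus ?thesis using F' by simp
  next
   assume "inside A D & inside (M - (M - B)) (M - D)"
   then obtain x x' where x: "wall x" "x <= A" "x <= D" "wall x'" "x' <= B" "x' <= M - D"
    unfolding inside_def compl_compl[OF w(2)] by blast
   have "apart x x'" using apart_mono[OF AB(1)] x by auto
   then obtain F' where F': "crossing x x' F'" "card F' >= p" using many by blast
   have "x' \<inter> A = {}" "x \<inter> B = {}" using x w(3) by auto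
   note E = crossing_extend[OF F'(1) wall_sub[OF x(1)] wall_sub[OF x(4)] x(2) this(1) x(5) this(2) v(1) vA v(3) D(1) x(3,6)]
   hence "Suc (card F') <= p" using AB(2) by metis
   thus ?thesis using F' by simp
  qed
 qed
qed

end

section \<open>Strongly nested chains and disjoint walls\<close>

context median
begin

text \<open>\<open>k\<close> is strongly nested in \<open>h\<close> if all points of \<open>k\<close> look the same from the complement of \<open>h\<close>.\<close>

definition SN :: "'a set => 'a set => bool" where
 "SN k h \<longleftrightarrow> k <= h & h <= M & (ALL a:k. ALL a':k. ALL b:M - h. ALL c:M - h. m a b c = m a' b c)"

lemma SN_D: "SN k h ==> a : k ==> a' : k ==> b : M - h ==> c : M - h ==> m a b c = m a' b c"
 unfolding SN_def by blast

lemma SN_mono: "SN k h ==> k' <= k ==> SN k' h" unfolding SN_def by (meson subset_iff)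

lemma iso_SN:
 assumes f: "f : isometries M d" and "SN k h"
 shows "SN (f ` k) (f ` h)" unfolding SN_def
proof (intro conjI ballI)
 have s: "k <= h" "h <= M" using assms by (auto simp: SN_def)
 show "f ` k <= f ` h" using s by auto
 show "f ` h <= M" using isoD(1)[OF f] s by auto
 fix a a' b c assume "a : f ` k" "a' : f ` k" and bc: "b : M - f ` h" "c : M - f ` h"
 then obtain x x' where x: "x : k" "x' : k" "a = f x" "a' = f x'" by auto
 obtain y z where y: "y : M - h" "z : M - h" "b = f y" "c = f z"
  using bc unfolding iso_Diff[OF f s(2), symmetric] by auto
 have "m x y z = m x' y z" using SN_D[OF assms(2) x(1,2) y(1,2)] .
 thus "m a b c = m a' b c" using iso_med[OF f] x y s by (metis Diff_iff subsetD)
qed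

text \<open>A point of the Roller compactification is the limit of a chain of sets if each of its coordinates
 is eventually the constant coordinate of the sets.\<close>

definition tends :: "(nat => 'a set) => ('a \<times> 'a => 'a) => bool" where
 "tends C \<xi> \<longleftrightarrow> \<xi> : rcl M & (ALL a:M. ALL b:M. EX q. ALL s:C q. m s a b = \<xi> (a, b))"

text \<open>Once two points are outside a member of the chain, their medians with the points of the next
 member are constant.\<close>

lemma chain_limit:
 assumes C: "decseq C" "!!q. C q ~= {}" "!!q. SN (C (Suc q)) (C q)" "!!x. x : M ==> EX q. x ~: C q"
 shows "EX \<xi>. tends C \<xi>"
proof -
 have CM: "C q <= M" for q using C(3)[of q] by (simp add: SN_def)
 have "EX v q. ALL s:C q. m s a b = v" if ab: "a : M" "b : M" for a b
 proof -
  obtain q1 q2 where "a ~: C q1" "b ~: C q2" using C(4) ab by meson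
  hence "a : M - C (max q1 q2)" "b : M - C (max q1 q2)"
   using decseqD[OF C(1), of q1 "max q1 q2"] decseqD[OF C(1), of q2 "max q1 q2"] ab by auto
  moreover obtain s0 where "s0 : C (Suc (max q1 q2))" using C(2) by blast
  ultimately have "ALL s:C (Suc (max q1 q2)). m s a b = m s0 a b"
   using SN_D[OF C(3)] by blast
  thus ?thesis by blast
 qed
 then obtain v q where vq: "!!a b s. a : M ==> b : M ==> s : C (q a b) ==> m s a b = v a b" by metis
 define \<xi> where "\<xi> = (\<lambda>p\<in>M \<times> M. v (fst p) (snd p))"
 have "\<xi> : rcl M" unfolding rcl_def
 proof (intro CollectI conjI allI impI)
  have "v a b : I a b" if ab: "a : M" "b : M" for a b
  proof -
   obtain s where "s : C (q a b)" using C(2) by blast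
   thus ?thesis using vq[OF ab] med_props(3)[OF _ ab] CM by (metis subsetD)
  qed
  thus "\<xi> : (\<Pi>\<^sub>E p\<in>M \<times> M. I (fst p) (snd p))" by (auto simp: \<xi>_def)
  fix F and e :: real assume F: "finite F" "F <= M \<times> M" and e: "0 < e"
  define n where "n = Max (insert 0 ((%p. q (fst p) (snd p)) ` F))"
  obtain s where s: "s : C n" using C(2) by blast
  have "d (\<xi> p) (m s (fst p) (snd p)) < e" if p: "p : F" for p
  proof -
   have pM: "p : M \<times> M" using F p by blast
   have "q (fst p) (snd p) <= n" using F p by (auto simp: n_def)
   hence "s : C (q (fst p) (snd p))" using decseqD[OF C(1)] s by blast
   hence "m s (fst p) (snd p) = \<xi> p" using vq pM by (simp add: \<xi>_def mem_Times_iff)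
   moreover have "m s (fst p) (snd p) : M" using med_props(4) pM s CM by (metis mem_Times_iff subsetD)
   ultimately show ?thesis using e by simp
  qed
  thus "EX s:M. ALL p:F. d (\<xi> p) (m s (fst p) (snd p)) < e" using s CM by blast
 qed
 moreover have "ALL s:C (q a b). m s a b = \<xi> (a, b)" if "a : M" "b : M" for a b
  using vq that by (simp add: \<xi>_def)
 ultimately show ?thesis unfolding tends_def by blast
qed

lemma tends_image:
 assumes f: "f : isometries M d" and C: "!!q. C q <= M" and t: "tends C \<xi>"
 shows "tends (%q. f ` C q) (roller_extend M f \<xi>)"
proof -
 have r: "\<xi> : rcl M" using t by (simp add: tends_def)
 have "roller_extend M f \<xi> : rcl M"
  using roller_extend_rcl[OF f subset_refl r] isoD(3)[OF f] by simp
 moreover have "EX q. ALL s:f ` C q. m s a b = roller_extend M f \<xi> (a, b)" if ab: "a : M" "b : M" for a b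
 proof -
  define a' b' where ab': "a' = inv_into M f a" "b' = inv_into M f b"
  have M: "a' : M" "b' : M" "f a' = a" "f b' = b"
   using ab isoD(3)[OF f] f_inv_into_f[of _ f M] inv_into_into[of _ f M] unfolding ab' by simp_all
  obtain q where q: "ALL s:C q. m s a' b' = \<xi> (a', b')" using t M(1,2) unfolding tends_def by blast
  have "m (f s) a b = roller_extend M f \<xi> (a, b)" if s: "s : C q" for s
  proof -
   have "s : M" using s C by auto
   hence "f (m s a' b') = m (f s) a b" using iso_med[OF f _ M(1,2)] M by simp
   thus ?thesis using q s ab by (simp add: roller_extend_def ab')
  qed
  thus ?thesis by auto
 qed
 ultimately show ?thesis unfolding tends_def by blast
qed

lemma tends_eq:
 assumes t: "tends C \<xi>" "tends C' \<xi>'" and C': "decseq C'" "!!q. C' q ~= {}" and sub: "!!n. EX q. C' q <= C n"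
 shows "\<xi> = \<xi>'"
proof (rule PiE_ext)
 show "\<xi> : (\<Pi>\<^sub>E p\<in>M \<times> M. I (fst p) (snd p))" "\<xi>' : (\<Pi>\<^sub>E p\<in>M \<times> M. I (fst p) (snd p))"
  using t by (simp_all add: tends_def rcl_def)
 fix p assume p: "p : M \<times> M"
 then obtain a b where ab: "p = (a, b)" "a : M" "b : M" by auto
 obtain n where n: "ALL s:C n. m s a b = \<xi> (a, b)" using t(1) ab(2,3) unfolding tends_def by blast
 obtain n' where n': "ALL s:C' n'. m s a b = \<xi>' (a, b)" using t(2) ab(2,3) unfolding tends_def by blast
 obtain q where q: "C' q <= C n" using sub by blast
 obtain s where s: "s : C' (max q n')" using C'(2) by blast
 have "s : C n" "s : C' n'"
  using s decseqD[OF C'(1), of q "max q n'"] decseqD[OF C'(1), of n' "max q n'"] q by auto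
 thus "\<xi> p = \<xi>' p" using n n' ab(1) by auto
qed

end

context irreducible_action
begin

text \<open>A finite space has a finite Roller compactification.\<close>

lemma M_infinite: "infinite M"
proof
 assume fin: "finite M"
 have "finite (roller M d)"
 proof (rule finite_subset)
  show "roller M d <= (\<Pi>\<^sub>E p\<in>M \<times> M. M)"
  proof
   fix \<xi> assume "\<xi> : roller M d"
   hence "\<xi> : (\<Pi>\<^sub>E p\<in>M \<times> M. I (fst p) (snd p))" by (simp add: roller_eq rcl_def)
   thus "\<xi> : (\<Pi>\<^sub>E p\<in>M \<times> M. M)" by (rule subsetD[OF PiE_mono, rotated]) (auto simp: I_M)
  qed
  show "finite (\<Pi>\<^sub>E p\<in>M \<times> M. M)" using fin by (intro finite_PiE) auto
 qed
 moreover obtain x where "x : M" using M_nonempty by auto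
 hence x: "roller_embed M d x : roller M d" using roller_embed_rcl[of x M] roller_eq by auto
 have "orbit \<Gamma> (%g. roller_extend M (\<phi> g)) (roller_embed M d x) <= roller M d"
 proof
  fix \<eta> assume "\<eta> : orbit \<Gamma> (%g. roller_extend M (\<phi> g)) (roller_embed M d x)"
  then obtain g where "g : carrier \<Gamma>" "\<eta> = roller_extend M (\<phi> g) (roller_embed M d x)"
   by (auto simp: orbit_def)
  thus "\<eta> : roller M d"
   using roller_extend_rcl[OF iso subset_refl] x isoD(3)[OF iso] by (simp add: roller_eq)
 qed
 ultimately show False using nonelementary x finite_subset unfolding roller_nonelementary_def by blast
qed

lemma two_points: "EX x:M. EX y:M. x ~= y"
proof -
 obtain x where x: "x : M" using M_nonempty by auto
 have "M - {x} ~= {}" using infinite_remove[OF M_infinite, of x] by (metis finite.emptyI)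
 thus ?thesis using x by auto
qed

text \<open>Otherwise no wall contains another one, and then \<open>h\<close> and its complement are the only walls,
 which do not separate more than two points.\<close>

lemma proper_subwall:
 assumes h: "wall h"
 obtains k where "wall k" "k \<subset> h"
proof (rule ccontr)
 assume n: "~ thesis"
 have eq: "k = l" if kl: "wall k" "wall l" "k <= l" for k l
 proof -
  obtain g where g: "g : carrier \<Gamma>" "\<phi> g ` l <= h" using translate_into[OF kl(2) h] by auto
  have sub: "\<phi> g ` k <= \<phi> g ` l" using kl by auto
  have max: "y = h" if "wall y" "y <= h" for y using n `!!k. wall k ==> k \<subset> h ==> thesis` that by blast
  have "\<phi> g ` k = h" "\<phi> g ` l = h"
   using max[OF act_wall[OF g(1) kl(1)]] max[OF act_wall[OF g(1) kl(2)]] sub g(2) by auto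
  thus ?thesis using inj_on_image_eq_iff[OF inj_prop[OF g(1)], of k l] wall_sub kl by auto
 qed
 have two: "k = h | k = M - h" if k: "wall k" for k
 proof -
  obtain w where w: "wall w" "~ tr w h" "~ tr w k" using common_nested_wall[OF h k] by auto
  have *: "l = w | l = M - w" if l: "wall l" "~ tr w l" for l
  proof -
   obtain w' l' where wl: "w' = w | w' = M - w" "l' = l | l' = M - l" "w' <= l'" "wall w'" "wall l'"
    using nested_signs[OF w(1) l] .
   have "w' = l'" using eq wl by auto
   thus ?thesis using wl(1,2) compl_compl[OF w(1)] compl_compl[OF l(1)] by auto
  qed
  show ?thesis using *[OF h w(2)] *[OF k w(3)] compl_compl[OF w(1)] by auto
 qed
 obtain x y where xy: "x : M" "y : M" "x ~= y" using two_points by auto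
 have "M <= {x, y}"
 proof
  fix z assume z: "z : M"
  have sep: "(a : h) ~= (b : h)" if ab: "a : M" "b : M" "a ~= b" for a b
  proof -
   obtain w where w: "wall w" "ssep w a b" using strict_separation ab by metis
   hence "a : w" "b ~: w" using ssep_in[OF w(2) wall_sub[OF w(1)]] by auto
   thus ?thesis using two[OF w(1)] ab by auto
  qed
  show "z : {x, y}" using sep[OF xy] sep[OF xy(1) z] sep[OF xy(2) z] by auto
 qed
 thus False using M_infinite finite_subset by blast
qed

lemma strongly_separated_pair:
 "wall h ==> EX A B. apart A B & (ALL f. wall f --> tr f A --> tr f B --> False)"
 by (erule strongly_separated) blast

text \<open>The translates \<open>H q\<close> of a wall under the powers of an isometry that maps the complement of
 \<open>B\<close> into \<open>A\<close>, for \<open>A\<close> and \<open>B\<close> without a common transverse wall. A wall that separates two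
 medians \<open>m a b c\<close> and \<open>m a' b c\<close> with \<open>a\<close>, \<open>a'\<close> in one of them and \<open>b\<close>, \<open>c\<close> in the other
 would cross both.\<close>

lemma chain_exists:
 assumes "wall h"
 shows "EX H :: int => 'a set. EX e>0. ALL q. wall (H q) & H (q + 1) \<subset> H q & SN (H (q + 1)) (H q) &
  SN (M - H q) (M - H (q + 1)) &
  (ALL f. wall f --> tr f (H q) --> tr f (H (q + 1)) --> False) & (ALL a:H (q + 1). ALL b:M - H q. d a b >= e)"
proof -
 obtain A0 B where AB0: "apart A0 B" "!!f. wall f ==> tr f A0 ==> tr f B ==> False"
  using strongly_separated_pair[OF assms] by blast
 have "wall A0" using AB0(1) by (simp add: apart_def)
 \<comment> \<open>the smaller wall makes the chain strictly decreasing\<close>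
 then obtain A where A: "wall A" "A \<subset> A0" by (rule proper_subwall)
 have w: "wall B" "A0 \<inter> B = {}" "wall A0" using AB0 by (auto simp: apart_def)
 obtain e where e: "e > 0" "!!a b. a : A0 ==> b : B ==> d a b >= e" using AB0(1) by (auto simp: apart_def)
 have sub: "A <= M" "B <= M" "A0 <= M" "A <= M - B" "A0 <= M - B" using A w wall_sub by auto
 have nocross: False if "wall f" "tr f A" "tr f B" for f
 proof -
  have "tr f (M - B)" using that(3) tr_compl(1)[OF sub(2)] by auto
  hence "tr f A0" using tr_mono[OF that(2)] A(2) sub(5) by auto
  thus False using AB0(2) that by auto
 qed
 have const: "m a b c = m a' b c" if "a : P" "a' : P" "b : Q" "c : Q" "P = A & Q = B | P = B & Q = A" for a a' b c P Q
 proof (rule ccontr)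
  assume ne: "m a b c ~= m a' b c"
  have M: "a : M" "a' : M" "b : M" "c : M" and PQ: "P \<inter> Q = {}" "P <= M" "Q <= M"
   using that sub w A by auto
  obtain f where f: "wall f" "ssep f (m a b c) (m a' b c)"
   using strict_separation[OF _ _ ne] med_props(4) M by metis
  have "m a b c : f" "m a' b c ~: f" using ssep_in[OF f(2) wall_sub[OF f(1)]] by auto
  hence *: "a : f & a' ~: f" "(b : f & c ~: f) | (b ~: f & c : f)"
   using hs_med[OF wall_hs[OF f(1)]] M by auto
  have cut: "P \<inter> f ~= {}" "P \<inter> (M - f) ~= {}" "Q \<inter> f ~= {}" "Q \<inter> (M - f) ~= {}"
   using * that M by blast+
  have "tr f P" using tr_cut[OF cut subset_refl] PQ by auto
  moreover have "tr f Q" using tr_cut[OF cut(3,4,1,2) subset_refl] PQ by auto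
  ultimately show False using nocross f(1) that(5) by auto
 qed
 have SN': "SN P (M - Q)" if PQ: "P = A & Q = B | P = B & Q = A" for P Q unfolding SN_def
 proof (intro conjI ballI)
  show "P <= M - Q" using PQ sub by auto
  have "M - (M - Q) = Q" using PQ sub by (auto simp: double_diff)
  thus "m a b c = m a' b c" if "a : P" "a' : P" "b : M - (M - Q)" "c : M - (M - Q)" for a a' b c
   using const[OF that(1,2) _ _ PQ] that(3,4) by simp
 qed simp
 have SN1: "SN A (M - B)" and SN2: "SN B (M - A)" using SN' by simp_all
 obtain g where g: "g : carrier \<Gamma>" "\<phi> g ` (M - B) <= A" using translate_into[OF wall_compl[OF w(1)] A(1)] by auto
 define G where "G q = g [^]\<^bsub>\<Gamma>\<^esub> (q::int)" for q
 have G: "G q : carrier \<Gamma>" for q using g by (simp add: G_def)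
 define H where "H q = \<phi> (G q) ` (M - B)" for q
 have H1: "H (q + 1) <= \<phi> (G q) ` A" for q
 proof -
  have "G (q + 1) = G q \<otimes> G 1" unfolding G_def using g(1) by (rule Gm.int_pow_mult)
  also have "G 1 = g" unfolding G_def by (rule Gm.int_pow_1[OF g(1)])
  finally have "G (q + 1) = G q \<otimes> g" .
  hence "H (q + 1) = \<phi> (G q) ` \<phi> g ` (M - B)"
   unfolding H_def using act_mult_image[OF Diff_subset G g(1)] by simp
  thus ?thesis using g(2) by auto
 qed
 have HM: "wall (H q)" "H q <= M" for q using act_wall[OF G wall_compl[OF w(1)]] wall_sub by (auto simp: H_def)
 have comp: "M - H q = \<phi> (G q) ` B" for q
  unfolding H_def using act_Diff[OF G, of "M - B"] sub by (auto simp: double_diff)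
 have AH: "\<phi> (G q) ` A \<subset> H q" for q
 proof -
  have "~ \<phi> (G q) ` A0 <= \<phi> (G q) ` A" using act_subset_iff[OF G sub(3) sub(1)] A(2) by blast
  moreover have "\<phi> (G q) ` A <= \<phi> (G q) ` A0" using A(2) by blast
  moreover have "\<phi> (G q) ` A0 <= H q" unfolding H_def using sub(5) by (rule image_mono)
  ultimately show ?thesis by blast
 qed
 have "wall (H q) & H (q + 1) \<subset> H q & SN (H (q + 1)) (H q) & SN (M - H q) (M - H (q + 1)) &
  (ALL f. wall f --> tr f (H q) --> tr f (H (q + 1)) --> False) & (ALL a:H (q + 1). ALL b:M - H q. d a b >= e)" for q
 proof (intro conjI allI impI ballI)
  show "wall (H q)" by (rule HM)
  show "H (q + 1) \<subset> H q" using H1 AH by blast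
  have "SN (\<phi> (G q) ` A) (H q)" unfolding H_def by (rule iso_SN[OF iso[OF G] SN1])
  thus "SN (H (q + 1)) (H q)" using H1 by (rule SN_mono)
  have "SN (\<phi> (G q) ` B) (\<phi> (G q) ` (M - A))" by (rule iso_SN[OF iso[OF G] SN2])
  hence "SN (M - H q) (M - \<phi> (G q) ` A)" using comp act_Diff[OF G sub(1)] by simp
  thus "SN (M - H q) (M - H (q + 1))"
   unfolding SN_def using H1[of q] HM(2)[of "q+1"] AH[of q] by (smt (verit) Diff_iff Diff_subset psubsetE subset_iff)
  fix f assume f: "wall f" "tr f (H q)" "tr f (H (q + 1))"
  have fA: "tr f (\<phi> (G q) ` A)" using tr_mono[OF f(3,2) H1] AH by auto
  have fB: "tr f (\<phi> (G q) ` B)" using f(2) comp tr_compl(1)[OF HM(2)] by metis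
  have gi: "inv (G q) : carrier \<Gamma>" using G by auto
  have "tr (\<phi> (inv (G q)) ` f) (\<phi> (inv (G q)) ` \<phi> (G q) ` A)"
   using act_tr[OF gi f(1) act_wall[OF G[of q] A(1)]] fA by blast
  hence "tr (\<phi> (inv (G q)) ` f) A" by (simp only: act_inv_image(1)[OF sub(1) G])
  moreover have "tr (\<phi> (inv (G q)) ` f) (\<phi> (inv (G q)) ` \<phi> (G q) ` B)"
   using act_tr[OF gi f(1) act_wall[OF G[of q] w(1)]] fB by blast
  hence "tr (\<phi> (inv (G q)) ` f) B" by (simp only: act_inv_image(1)[OF sub(2) G])
  ultimately show False using nocross act_wall[OF gi f(1)] by blast
 next
  fix a b assume ab: "a : H (q + 1)" "b : M - H q"
  obtain a' where a': "a' : A" "a = \<phi> (G q) a'" using ab H1 by auto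
  obtain b' where b': "b' : B" "b = \<phi> (G q) b'" using ab comp by auto
  have "a' : M" "b' : M" using subsetD[OF sub(1) a'(1)] subsetD[OF sub(2) b'(1)] by simp_all
  hence "d a b = d a' b'" using isoD(2)[OF iso[OF G[of q]]] a'(2) b'(2) by simp
  moreover have "a' : A0" using a' A by auto
  ultimately show "e <= d a b" using e(2) b' by auto
 qed
 thus ?thesis using e(1) by blast
qed

text \<open>Without three disjoint walls every wall would be nested along the chain, so the group would permute
 the two ends of the chain, against non-elementarity.\<close>

lemma facing_triple:
 "EX x y z. wall x & wall y & wall z & x \<inter> y = {} & x \<inter> z = {} & y \<inter> z = {}"
proof (rule ccontr)
 assume neg: "~ ?thesis"
 have noface: False if "wall x" "wall y" "wall z" "x \<inter> y = {}" "x \<inter> z = {}" "y \<inter> z = {}" for x y z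
  using that neg by blast
 have "EX h. wall h"
 proof -
  obtain x y where "x : M" "y : M" "x ~= y" using two_points by auto
  thus ?thesis using strict_separation by metis
 qed
 then obtain H e where e: "e > 0" and H: "!!q::int. wall (H q)" "!!q. H (q + 1) \<subset> H q" "!!q. SN (H (q + 1)) (H q)"
  "!!q. SN (M - H q) (M - H (q + 1))"
  "!!q f. wall f ==> tr f (H q) ==> tr f (H (q + 1)) ==> False"
  "!!q a b. a : H (q + 1) ==> b : M - H q ==> d a b >= e" using chain_exists by metis
 have HM: "H q <= M" for q using H(1) wall_sub by auto
 have dec: "H q' <= H q" if "q <= q'" for q q'
  using that by (induction q' rule: int_ge_induct) (use H(2) in blast)+
 have far: "d x y >= (real n + 1) * e" if "x : M - H q" "y : H (q + 2 * int n + 1)" for x y n q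
  using that(2)
 proof (induction n arbitrary: y)
  case 0
  thus ?case using H(6)[of y q x] that(1) by (simp add: commute)
 next
  case (Suc n)
  let ?q = "q + 2 * int n + 1"
  obtain z where z: "z : H ?q" "z ~: H (?q + 1)" using H(2)[of ?q] by blast
  have y: "y : H (?q + 1 + 1)" using Suc.prems by (simp add: algebra_simps)
  have M: "x : M" "y : M" "z : M" using that(1) y z HM by auto
  have "y : H ?q" "y : H (?q + 1)" using y dec[of ?q "?q + 1 + 1"] dec[of "?q+1" "?q + 1 + 1"] by auto
  moreover have "x ~: H (?q + 1)" using that(1) dec[of q "?q + 1"] by auto
  ultimately have z': "m x y z : H ?q" "m x y z : M - H (?q + 1)"
   using hs_med[OF wall_hs[OF H(1)]] M z med_props(4) by auto
  have "d x y = d x (m x y z) + d (m x y z) y" using med_props(1)[OF M] by (simp add: I_iff)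
  moreover have "d (m x y z) y >= e" using H(6)[OF y z'(2)] by (simp add: commute)
  ultimately show ?case using Suc.IH[OF z'(1)] by (simp add: algebra_simps)
 qed
 have arch: "EX n. (real n + 1) * e > D" for D
 proof -
  obtain n where "D < real n * e" using reals_Archimedean3[OF e] by auto
  thus ?thesis using e by (intro exI[of _ n]) (simp add: algebra_simps)
 qed
 have inter: "EX n. x ~: H (int n)" if x: "x : M" for x
 proof (rule ccontr)
  assume n: "~ ?thesis"
  obtain y where y: "y : M - H 0" using wall_ne(2)[OF H(1)] by blast
  note neg = n
  obtain n where "(real n + 1) * e > d y x" using arch by blast
  moreover have "x : H (int (2 * n + 1))" using neg by blast
  moreover have "int (2 * n + 1) = 0 + 2 * int n + 1" by simp
  ultimately show False using far[OF y, of x n] by (metis linorder_not_less)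
 qed
 have union: "EX n. x : H (- int n)" if x: "x : M" for x
 proof (rule ccontr)
  assume n: "~ ?thesis"
  obtain y where y: "y : H 0" using wall_ne(1)[OF H(1)] by blast
  note neg = n
  obtain n where 1: "(real n + 1) * e > d x y" using arch by blast
  have "x : M - H (- int (2 * n + 1))" using neg x by blast
  moreover have "- int (2 * n + 1) + 2 * int n + 1 = 0" by simp
  ultimately show False using far[of x "- int (2 * n + 1)" y n] y 1 by simp
 qed
 define P where "P n = H (int n)" for n
 define N where "N n = M - H (- int n)" for n
 have ne: "P n ~= {}" "N n ~= {}" for n using wall_ne[OF H(1)] by (auto simp: P_def N_def)
 have PM: "P n <= M" "N n <= M" for n using HM by (auto simp: P_def N_def)
 have decP: "decseq P" unfolding P_def by (auto simp: decseq_def intro!: dec)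
 have decN: "decseq N" unfolding N_def decseq_def using dec by (metis Diff_mono le_imp_neg_le of_nat_le_iff subset_refl)
 have "EX \<xi>. tends P \<xi>"
 proof (rule chain_limit[OF decP ne(1)])
  show "SN (P (Suc q)) (P q)" for q using H(3)[of "int q"] by (simp add: P_def add.commute)
  show "EX q. x ~: P q" if "x : M" for x using inter[OF that] by (simp add: P_def)
 qed
 then obtain \<xi> where \<xi>: "tends P \<xi>" by blast
 have "EX \<eta>. tends N \<eta>"
 proof (rule chain_limit[OF decN ne(2)])
  show "SN (N (Suc q)) (N q)" for q using H(4)[of "- 1 - int q"] by (simp add: N_def)
  show "EX q. x ~: N q" if "x : M" for x using union[OF that] by (simp add: N_def)
 qed
 then obtain \<eta> where \<eta>: "tends N \<eta>" by blast
 have orbit: "roller_extend M (\<phi> g) \<xi> : {\<xi>, \<eta>}" if g: "g : carrier \<Gamma>" for g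
 proof -
  define C where "C q = \<phi> g ` P q" for q
  have tC: "tends C (roller_extend M (\<phi> g) \<xi>)" unfolding C_def by (rule tends_image[OF iso[OF g] PM(1) \<xi>])
  have decC: "decseq C" using decP unfolding C_def decseq_def by blast
  have neC: "C q ~= {}" for q using ne by (auto simp: C_def)
  have wC: "wall (C q)" "C q <= M" for q using act_wall[OF g H(1)] wall_sub by (auto simp: C_def P_def)
  have outC: "EX q. x ~: C q" if x: "x : M" for x
  proof -
   obtain x' where x': "x' : M" "x = \<phi> g x'" using surj_prop[OF g] x by blast
   obtain q where "x' ~: P q" using inter[OF x'(1)] by (auto simp: P_def)
   hence "x ~: C q" using x' PM(1)[of q] inj_prop[OF g] by (auto simp: C_def dest: inj_onD)
   thus ?thesis by blast
  qed
  have dich: "EX q. C q <= H n | C q <= M - H (n + 1)" for n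
  proof -
   obtain a b where ab: "a : M - H n" "b : H (n + 1)" using wall_ne[OF H(1)] by blast
   have abM: "a : M" "b : M" using ab HM by auto
   obtain q1 q2 where "a ~: C q1" "b ~: C q2" using outC abM by meson
   hence q: "a ~: C (max q1 q2)" "b ~: C (max q1 q2)"
    using decseqD[OF decC, of q1 "max q1 q2"] decseqD[OF decC, of q2 "max q1 q2"] by auto
   have key: "C (max q1 q2) <= H i | C (max q1 q2) <= M - H i"
    if "~ tr (C (max q1 q2)) (H i)" "a ~: H i" "b : H i" for i using that(1) wC(2) HM[of i]
   proof (cases rule: not_tr_cases)
    case 1 thus ?thesis using wC(2) by blast
   next
    case 4 thus ?thesis using abM that q by blast
   qed (use q that in blast)+
   have "~ tr (C (max q1 q2)) (H n) | ~ tr (C (max q1 q2)) (H (n + 1))" using H(5)[OF wC(1)] by blast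
   thus ?thesis
   proof
    assume "~ tr (C (max q1 q2)) (H n)"
    hence "C (max q1 q2) <= H n | C (max q1 q2) <= M - H n"
     using key[of n] ab H(2)[of n] by auto
    moreover have "M - H n <= M - H (n + 1)" using H(2)[of n] by auto
    ultimately show ?thesis by (meson subset_trans)
   next
    assume "~ tr (C (max q1 q2)) (H (n + 1))"
    hence "C (max q1 q2) <= H (n + 1) | C (max q1 q2) <= M - H (n + 1)"
     using key[of "n + 1"] ab H(2)[of n] by auto
    moreover have "H (n + 1) <= H n" using H(2)[of n] by auto
    ultimately show ?thesis by (meson subset_trans)
   qed
  qed
  show ?thesis
  proof (cases "ALL n. EX q. C q <= H n")
   case True
   hence "\<xi> = roller_extend M (\<phi> g) \<xi>" by (intro tends_eq[OF \<xi> tC decC neC]) (simp add: P_def)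
   thus ?thesis by simp
  next
   case n1: False
   show ?thesis
   proof (cases "ALL n. EX q. C q <= M - H n")
    case True
    hence "\<eta> = roller_extend M (\<phi> g) \<xi>" by (intro tends_eq[OF \<eta> tC decC neC]) (simp add: N_def)
    thus ?thesis by simp
   next
    case False
    then obtain n2 where n2: "!!q. ~ C q <= M - H n2" by blast
    obtain n1 where n1: "!!q. ~ C q <= H n1" using n1 by blast
    obtain q1 where q1: "C q1 <= M - H (n1 + 1)" using dich[of n1] n1 by blast
    obtain q2 where q2: "C q2 <= H (n2 - 1)" using dich[of "n2 - 1"] n2 by auto
    have "n2 - 1 < n1"
    proof (rule ccontr)
     assume "~ n2 - 1 < n1"
     hence "H (n2 - 1) <= H n1" by (intro dec) simp
     thus False using q2 n1 by blast
    qed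
    hence sub: "H (n1 + 1) <= H (n2 - 1)" by (intro dec) simp
    let ?C = "C (max q1 q2)"
    have "?C <= M - H (n1 + 1)" "?C <= H (n2 - 1)"
     using decseqD[OF decC, of q1 "max q1 q2"] decseqD[OF decC, of q2 "max q1 q2"] q1 q2 by auto
    hence "?C \<inter> H (n1 + 1) = {}" "?C \<inter> (M - H (n2 - 1)) = {}" "H (n1 + 1) \<inter> (M - H (n2 - 1)) = {}"
     using sub by auto
    thus ?thesis using noface[OF wC(1) H(1) wall_compl[OF H(1)]] by blast
   qed
  qed
 qed
 have "\<xi> : roller M d" using \<xi> by (simp add: tends_def roller_eq)
 moreover have "finite (orbit \<Gamma> (%g. roller_extend M (\<phi> g)) \<xi>)"
  by (rule finite_subset[of _ "{\<xi>, \<eta>}"]) (use orbit in "auto simp: orbit_def")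
 ultimately show False using nonelementary unfolding roller_nonelementary_def by blast
qed

text \<open>A member of a disjoint family is replaced by two disjoint walls inside it, which come from a
 triple of disjoint walls.\<close>

lemma disjoint_walls:
 "EX F. finite F & card F = Suc N & (ALL w:F. wall w) & (ALL w:F. ALL w':F. w ~= w' --> w \<inter> w' = {})"
proof (induction N)
 case 0
 obtain x where "wall x" using facing_triple by metis
 thus ?case by (intro exI[of _ "{x}"]) auto
next
 case (Suc N)
 then obtain F where F: "finite F" "card F = Suc N" "!!w. w : F ==> wall w"
  "!!w w'. w : F ==> w' : F ==> w ~= w' ==> w \<inter> w' = {}" by auto
 then obtain x where x: "x : F" by fastforce
 obtain a b c where abc: "wall a" "wall b" "wall c" "a \<inter> b = {}" "a \<inter> c = {}" "b \<inter> c = {}"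
  using facing_triple by metis
 obtain g where g: "g : carrier \<Gamma>" "\<phi> g ` (M - a) <= x" using translate_into[OF wall_compl[OF abc(1)] F(3)[OF x]] by auto
 define b' c' where bc: "b' = \<phi> g ` b" "c' = \<phi> g ` c"
 have s: "a <= M" "b <= M" "c <= M" using abc wall_sub by auto
 have w: "wall b'" "wall c'" using act_wall[OF g(1)] abc bc by auto
 have dj: "b' \<inter> c' = {}" using act_Int[OF g(1) s(2,3)] abc(6) bc by simp
 have in_x: "b' <= x" "c' <= x" using g(2) abc s bc by blast+
 have ne: "b' ~= {}" "c' ~= {}" using wall_ne w by auto
 have notin: "b' ~: F - {x}" "c' ~: F - {x}" "b' ~= c'" using F(4)[OF x] in_x ne dj by blast+
 have "card (insert b' (insert c' (F - {x}))) = Suc (Suc (card (F - {x})))"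
  using notin F(1) by simp
 also have "... = Suc (Suc N)" using F(1,2) x by simp
 finally have "card (insert b' (insert c' (F - {x}))) = Suc (Suc N)" .
 moreover have "w \<inter> w' = {}" if ww: "w : insert b' (insert c' (F - {x}))" "w' : insert b' (insert c' (F - {x}))" "w ~= w'" for w w'
 proof -
  have *: "u \<inter> x = {}" "x \<inter> u = {}" if "u : F - {x}" for u using F(4)[of u x] x that by auto
  have A: "u \<inter> u' = {}" if "u : {b', c'}" "u' : F - {x}" for u u'
   using *(2)[OF that(2)] in_x that(1) by blast
  consider "w : {b', c'}" "w' : {b', c'}" | "w : {b', c'}" "w' : F - {x}" | "w : F - {x}" "w' : {b', c'}"
   | "w : F" "w' : F" using ww(1,2) by blast
  thus ?thesis
  proof cases
   case 1 thus ?thesis using ww(3) dj by auto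
  next
   case 2 thus ?thesis by (rule A)
  next
   case 3 thus ?thesis using A by blast
  next
   case 4 thus ?thesis using F(4) ww(3) by blast
  qed
 qed
 ultimately show ?case using F(1,3) w by (intro exI[of _ "insert b' (insert c' (F - {x}))"]) auto
qed

lemma disjoint_translates:
 assumes k: "wall k"
 shows "\<exists>G\<subseteq>carrier \<Gamma>. finite G & card G = Suc N & (ALL g:G. ALL g':G. g ~= g' --> \<phi> g ` k \<inter> \<phi> g' ` k = {})"
proof -
 obtain F where F: "finite F" "card F = Suc N" "!!w. w : F ==> wall w"
  "!!w w'. w : F ==> w' : F ==> w ~= w' ==> w \<inter> w' = {}" using disjoint_walls[of N] by auto
 obtain f where f: "!!w. w : F ==> f w : carrier \<Gamma>" "!!w. w : F ==> \<phi> (f w) ` k <= w"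
  using translate_into[OF k F(3)] by metis
 have ne: "\<phi> (f w) ` k ~= {}" for w using wall_ne(1)[OF k] by auto
 have inj: "inj_on f F"
 proof (rule inj_onI)
  fix w w' assume "w : F" "w' : F" "f w = f w'"
  thus "w = w'" using f(2)[of w] f(2)[of w'] F(4)[of w w'] ne[of w] by auto
 qed
 have "\<phi> (f w) ` k \<inter> \<phi> (f w') ` k = {}" if "w : F" "w' : F" "f w ~= f w'" for w w'
  using f(2)[of w] f(2)[of w'] F(4)[of w w'] that by blast
 thus ?thesis using f(1) F(1,2) card_image[OF inj] by (intro exI[of _ "f ` F"]) auto
qed

text \<open>There are more disjoint translates of the complement of \<open>B\<close> than points of \<open>Z\<close>, so one of
 them misses \<open>Z\<close>.\<close>

lemma push_finite_into:
 assumes B: "wall B" and Z: "finite Z" "Z <= M"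
 shows "EX g:carrier \<Gamma>. \<phi> g ` Z <= B"
proof -
 note cB = wall_compl[OF B]
 obtain G where G: "G <= carrier \<Gamma>" "finite G" "card G = Suc (card Z)"
  "!!g g'. g : G ==> g' : G ==> g ~= g' ==> \<phi> g ` (M - B) \<inter> \<phi> g' ` (M - B) = {}"
  using disjoint_translates[OF cB, of "card Z"] by auto
 have "EX g:G. \<phi> g ` (M - B) \<inter> Z = {}"
 proof (rule ccontr)
  assume "~ ?thesis"
  hence "ALL g:G. EX x. x : \<phi> g ` (M - B) & x : Z" by blast
  then obtain z where z: "ALL g:G. z g : \<phi> g ` (M - B) & z g : Z" by (rule bchoice[THEN exE])
  have "inj_on z G"
  proof (rule inj_onI, rule ccontr)
   fix g g' assume g: "g : G" "g' : G" "z g = z g'" "g ~= g'"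
   have "z g : \<phi> g ` (M - B)" using bspec[OF z g(1)] by (rule conjunct1)
   moreover have "z g : \<phi> g' ` (M - B)" unfolding g(3) using bspec[OF z g(2)] by (rule conjunct1)
   ultimately have "z g : \<phi> g ` (M - B) \<inter> \<phi> g' ` (M - B)" by (rule IntI)
   thus False unfolding G(4)[OF g(1,2,4)] by (rule emptyE)
  qed
  hence "card G <= card Z" using z Z(1) by (intro card_inj_on_le[of z]) auto
  thus False using G(3) by simp
 qed
 then obtain g where g: "g : G" "\<phi> g ` (M - B) \<inter> Z = {}" by auto
 have gc: "g : carrier \<Gamma>" "inv g : carrier \<Gamma>" using g G by auto
 have "Z <= \<phi> g ` B" using g(2) Z(2) act_Diff[OF gc(1) wall_sub[OF B]] by auto
 hence "\<phi> (inv g) ` Z <= \<phi> (inv g) ` \<phi> g ` B" by (rule image_mono)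
 thus ?thesis using act_inv_image(1)[OF wall_sub[OF B] gc(1)] gc(2) by auto
qed

text \<open>The combinatorial input of the dynamical part: a chain of strongly nested walls, a flip of the
 innermost one, and five disjoint translates of the outermost one.\<close>

proposition strongly_nested_chain:
 "EX h. (ALL q. wall (h q) & SN (h (Suc q)) (h q)) &
  (EX g:carrier \<Gamma>. h L \<union> \<phi> g ` h L = M) &
  (\<exists>G\<subseteq>carrier \<Gamma>. finite G & card G = 5 & (ALL g:G. ALL g':G. g ~= g' --> \<phi> g ` h (0::nat) \<inter> \<phi> g' ` h 0 = {}))"
proof -
 obtain x a b where "wall x" using facing_triple by blast
 from chain_exists[OF this] obtain H where "ALL q::int. wall (H q) & SN (H (q + 1)) (H q)" by blast
 hence H: "!!q::int. wall (H q)" "!!q. SN (H (q + 1)) (H q)" by simp_all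
 define h where "h q = H (int q)" for q
 have h1: "wall (h q)" for q using H(1) by (simp add: h_def)
 have h2: "SN (h (Suc q)) (h q)" for q using H(2)[of "int q"] by (simp add: h_def add.commute)
 have hM: "h L <= M" using h1 by (rule wall_sub)
 obtain g where g: "g : carrier \<Gamma>" "\<phi> g ` (M - h L) <= h L" using flip[OF h1[of L]] by auto
 have "M - \<phi> g ` h L <= h L" using act_Diff[OF g(1) hM] g(2) by simp
 hence "h L \<union> \<phi> g ` h L = M" using act_sub[OF g(1) hM] hM by blast
 hence fl: "EX g:carrier \<Gamma>. h L \<union> \<phi> g ` h L = M" using g(1) by (rule bexI)
 have "Suc 4 = (5::nat)" by simp
 hence "\<exists>G\<subseteq>carrier \<Gamma>. finite G & card G = 5 &
   (ALL g:G. ALL g':G. g ~= g' --> \<phi> g ` h 0 \<inter> \<phi> g' ` h 0 = {})"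
  using disjoint_translates[OF h1[of 0], of 4] by (simp only:)
 thus ?thesis using h1 h2 fl by (intro exI[of _ h] conjI allI)
qed

end

section \<open>Borel maps and square integrable functions\<close>

definition bor :: "'a topology => 'a measure" where
 "bor T = sigma (topspace T) {U. openin T U}"

lemma space_bor [simp]: "space (bor T) = topspace T"
 unfolding bor_def by (rule space_measure_of) (auto dest: openin_subset)

lemma sets_bor: "sets (bor T) = sigma_sets (topspace T) {U. openin T U}"
 unfolding bor_def by (rule sets_measure_of) (auto dest: openin_subset)

lemma open_in_bor: "openin T U ==> U : sets (bor T)" by (simp add: sets_bor sigma_sets.Basic)

lemma continuous_map_bor:
 assumes "continuous_map T T' f"
 shows "f : measurable (bor T) (bor T')" unfolding bor_def[of T']
proof (rule measurable_measure_of)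
 show "{U. openin T' U} <= Pow (topspace T')" by (auto dest: openin_subset)
 show "f : space (bor T) \<rightarrow> topspace T'" using assms by (auto simp: continuous_map_def)
 fix V assume "V : {U. openin T' U}"
 hence "openin T {x : topspace T. f x : V}" using assms by (simp add: continuous_map_def)
 moreover have "f -` V \<inter> space (bor T) = {x : topspace T. f x : V}" by auto
 ultimately show "f -` V \<inter> space (bor T) : sets (bor T)" by (simp add: open_in_bor)
qed

lemma second_countable_base:
 assumes "second_countable T"
 obtains B where "countable B" "!!V. V : B ==> openin T V"
  "!!U x. openin T U ==> x : U ==> EX V. V : B & x : V & V <= U"
proof -
 obtain B where B: "countable B" "ALL V:B. openin T V"
  "ALL U x. openin T U & x : U --> (EX V:B. x : V & V <= U)"
  using assms unfolding second_countable_def by (elim exE conjE)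
 show thesis
 proof (rule that[OF B(1)])
  show "openin T V" if "V : B" for V using B(2) that by (rule bspec)
  show "EX V. V : B & x : V & V <= U" if "openin T U" "x : U" for U x
   using B(3)[rule_format, OF conjI[OF that]] by (simp only: Bex_def)
 qed
qed

lemma open_prod_sets:
 assumes T: "second_countable T" "second_countable T'" and W: "openin (prod_topology T T') W"
 shows "W : sets (bor T \<Otimes>\<^sub>M bor T')"
proof -
 obtain B where B: "countable B" "!!V. V : B ==> openin T V"
  "!!U x. openin T U ==> x : U ==> EX V. V : B & x : V & V <= U"
  using second_countable_base[OF T(1)] by metis
 obtain B' where B': "countable B'" "!!V. V : B' ==> openin T' V"
  "!!U x. openin T' U ==> x : U ==> EX V. V : B' & x : V & V <= U"
  using second_countable_base[OF T(2)] by metis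
 define R where "R = {p : B \<times> B'. fst p \<times> snd p <= W}"
 have "W <= (\<Union>p\<in>R. fst p \<times> snd p)"
 proof
  fix z assume z: "z : W"
  have "EX U V. openin T U & openin T' V & fst z : U & snd z : V & U \<times> V <= W"
   using W[unfolded openin_prod_topology_alt, rule_format, of "fst z" "snd z"] z by simp
  then obtain U V where UV: "openin T U" "openin T' V" "fst z : U" "snd z : V" "U \<times> V <= W" by (elim exE conjE)
  obtain b where b: "b : B" "fst z : b" "b <= U" using B(3)[OF UV(1,3)] by (elim exE conjE)
  obtain b' where b': "b' : B'" "snd z : b'" "b' <= V" using B'(3)[OF UV(2,4)] by (elim exE conjE)
  from b b' have "(b, b') : R" "z : b \<times> b'" using UV(5) by (auto simp: R_def mem_Times_iff)
  thus "z : (\<Union>p\<in>R. fst p \<times> snd p)" by force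
 qed
 moreover have "(\<Union>p\<in>R. fst p \<times> snd p) <= W" by (auto simp: R_def)
 moreover have "(\<Union>p\<in>R. fst p \<times> snd p) : sets (bor T \<Otimes>\<^sub>M bor T')"
 proof (rule sets.countable_UN'')
  show "countable R" using B(1) B'(1) by (intro countable_subset[of R "B \<times> B'"]) (auto simp: R_def)
  fix p assume "p : R"
  thus "fst p \<times> snd p : sets (bor T \<Otimes>\<^sub>M bor T')"
   using B(2) B'(2) by (intro pair_measureI open_in_bor) (auto simp: R_def)
 qed
 ultimately show ?thesis by (simp add: subset_antisym)
qed

lemma continuous_map_prod_bor:
 assumes T: "second_countable T" "second_countable T'" and f: "continuous_map (prod_topology T T') T'' f"
 shows "f : measurable (bor T \<Otimes>\<^sub>M bor T') (bor T'')" unfolding bor_def[of T'']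
proof (rule measurable_measure_of)
 show "{U. openin T'' U} <= Pow (topspace T'')" by (auto dest: openin_subset)
 show "f : space (bor T \<Otimes>\<^sub>M bor T') \<rightarrow> topspace T''"
  using f by (auto simp: continuous_map_def space_pair_measure)
 fix V assume "V : {U. openin T'' U}"
 hence "openin (prod_topology T T') {x : topspace (prod_topology T T'). f x : V}"
  using f by (simp only: continuous_map_def mem_Collect_eq)
 moreover have "f -` V \<inter> space (bor T \<Otimes>\<^sub>M bor T') = {x : topspace (prod_topology T T'). f x : V}"
  by (auto simp: space_pair_measure)
 ultimately show "f -` V \<inter> space (bor T \<Otimes>\<^sub>M bor T') : sets (bor T \<Otimes>\<^sub>M bor T')"
  using open_prod_sets[OF T] by simp
qed

text \<open>The increments satisfy \<open>\<bar>u (k + 1) x - u k x\<bar> \<le> C x / 2 ^ k\<close> almost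
 everywhere, since the squares are summable even with the weights \<open>4 ^ k\<close>.\<close>

lemma AE_convergent_of_summable_squares:
 fixes u :: "nat => 'a => real"
 assumes u [measurable]: "!!k. u k : borel_measurable M"
  and b: "!!k. (\<integral>\<^sup>+x. ennreal ((u (Suc k) x - u k x)\<^sup>2) \<partial>M) <= ennreal ((1/16) ^ k)"
 shows "AE x in M. convergent (%k. u k x)"
proof -
 define w where "w k x = ennreal (4 ^ k) * ennreal ((u (Suc k) x - u k x)\<^sup>2)" for k x
 have wm [measurable]: "w k : borel_measurable M" for k unfolding w_def by measurable
 have "(\<integral>\<^sup>+x. (\<Sum>k. w k x) \<partial>M) = (\<Sum>k. (\<integral>\<^sup>+x. w k x \<partial>M))" by (rule nn_integral_suminf) measurable
 also have "... <= (\<Sum>k. ennreal ((1/4) ^ k))"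
 proof (rule suminf_le)
  fix k
  have "(\<integral>\<^sup>+x. w k x \<partial>M) = ennreal (4 ^ k) * (\<integral>\<^sup>+x. ennreal ((u (Suc k) x - u k x)\<^sup>2) \<partial>M)"
   unfolding w_def by (rule nn_integral_cmult) measurable
  also have "... <= ennreal (4 ^ k) * ennreal ((1/16) ^ k)" by (rule mult_left_mono[OF b]) simp
  also have "... = ennreal ((1/4) ^ k)" by (simp add: ennreal_mult[symmetric] power_mult_distrib[symmetric])
  finally show "(\<integral>\<^sup>+x. w k x \<partial>M) <= ennreal ((1/4) ^ k)" .
 qed simp_all
 also have "... = ennreal (\<Sum>k. (1/4) ^ k)" by (rule suminf_ennreal2) (simp_all add: summable_geometric)
 also have "... < \<infinity>" by simp
 finally have "(\<integral>\<^sup>+x. (\<Sum>k. w k x) \<partial>M) ~= \<infinity>" by simp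
 hence "AE x in M. (\<Sum>k. w k x) ~= \<infinity>" by (intro nn_integral_PInf_AE) measurable
 thus ?thesis
 proof eventually_elim
  case (elim x)
  obtain S where S: "(\<Sum>k. w k x) = ennreal S" "S >= 0" using elim by (cases "\<Sum>k. w k x") auto
  have "norm (u (Suc k) x - u k x) <= sqrt S * (1/2) ^ k" for k
  proof -
   have "w k x <= ennreal S" unfolding S(1)[symmetric] using sum_le_suminf[of "%k. w k x" "{k}"] by simp
   hence "4 ^ k * (u (Suc k) x - u k x)\<^sup>2 <= S"
    using S(2) by (simp add: w_def ennreal_mult[symmetric])
   hence "(u (Suc k) x - u k x)\<^sup>2 <= S * (1/4) ^ k" by (simp add: field_simps power_divide)
   also have "... = (sqrt S * (1/2) ^ k)\<^sup>2" using S(2) by (simp add: power_mult_distrib power2_eq_square[of "(1/2) ^ k"] power_mult_distrib[symmetric])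
   finally show ?thesis using S(2) by (simp add: abs_le_square_iff[symmetric])
  qed
  hence "summable (%k. u (Suc k) x - u k x)"
   by (rule summable_comparison_test'[rotated]) (intro summable_mult summable_geometric, simp)
  hence "convergent (%n. \<Sum>k<n. u (Suc k) x - u k x)" by (simp add: summable_iff_convergent)
  hence "convergent (%n. u n x - u 0 x)" by (simp only: sum_lessThan_telescope[of "%k. u k x"])
  thus ?case by (simp only: convergent_diff_const_right_iff)
 qed
qed

definition nsq :: "'a measure => ('a => real) => ennreal" where
 "nsq M f = (\<integral>\<^sup>+x. ennreal ((f x)\<^sup>2) \<partial>M)"

lemma nsq_parallelogram:
 assumes [measurable]: "f : borel_measurable M" "g : borel_measurable M"
 shows "nsq M (%x. f x - g x) + 4 * nsq M (%x. (f x + g x) / 2) = 2 * nsq M f + 2 * nsq M g"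
proof -
 have "nsq M (%x. f x - g x) + 4 * nsq M (%x. (f x + g x) / 2) =
   (\<integral>\<^sup>+x. ennreal ((f x - g x)\<^sup>2) + 4 * ennreal (((f x + g x) / 2)\<^sup>2) \<partial>M)"
  unfolding nsq_def by (subst nn_integral_add) (auto simp: nn_integral_cmult)
 also have "... = (\<integral>\<^sup>+x. 2 * ennreal ((f x)\<^sup>2) + 2 * ennreal ((g x)\<^sup>2) \<partial>M)"
 proof (rule nn_integral_cong)
  fix x
  have "ennreal ((f x - g x)\<^sup>2) + 4 * ennreal (((f x + g x) / 2)\<^sup>2) = ennreal ((f x - g x)\<^sup>2 + 4 * ((f x + g x) / 2)\<^sup>2)"
   by (simp add: ennreal_plus ennreal_mult)
  also have "(f x - g x)\<^sup>2 + 4 * ((f x + g x) / 2)\<^sup>2 = 2 * (f x)\<^sup>2 + 2 * (g x)\<^sup>2"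
   by (simp add: power2_eq_square algebra_simps)
  finally show "ennreal ((f x - g x)\<^sup>2) + 4 * ennreal (((f x + g x) / 2)\<^sup>2) = 2 * ennreal ((f x)\<^sup>2) + 2 * ennreal ((g x)\<^sup>2)"
   by (simp add: ennreal_plus ennreal_mult)
 qed
 also have "... = 2 * nsq M f + 2 * nsq M g"
  unfolding nsq_def by (subst nn_integral_add) (auto simp: nn_integral_cmult)
 finally show ?thesis .
qed

lemma nsq_near_minimum:
 assumes f: "f : borel_measurable M" "g : borel_measurable M"
  and r: "nsq M f <= ennreal (r + e)" "nsq M g <= ennreal (r + e)" "0 <= r" "0 <= e" "0 <= e'"
  and m: "nsq M (%x. (f x + g x) / 2) >= ennreal (r - e')"
 shows "nsq M (%x. f x - g x) <= ennreal (4 * (e + e'))"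
proof -
 let ?n = "nsq M (%x. f x - g x)" and ?m = "nsq M (%x. (f x + g x) / 2)"
 have eq: "?n + 4 * ?m = 2 * nsq M f + 2 * nsq M g" by (rule nsq_parallelogram[OF f])
 obtain a b where ab: "nsq M f = ennreal a" "nsq M g = ennreal b" "a >= 0" "b >= 0" "a <= r + e" "b <= r + e"
  using r by (cases "nsq M f"; cases "nsq M g") (auto simp: top_unique ennreal_plus[symmetric] simp del: ennreal_plus)
 have rhs: "2 * nsq M f + 2 * nsq M g = ennreal (2 * a + 2 * b)"
  using ab by (simp add: ennreal_plus ennreal_mult)
 have "?n ~= \<infinity>" "?m ~= \<infinity>" using eq rhs by (auto simp: ennreal_mult_eq_top_iff)
 then obtain p q where pq: "?n = ennreal p" "?m = ennreal q" "p >= 0" "q >= 0"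
  by (cases ?n; cases ?m) auto
 have "ennreal (p + 4 * q) = ennreal (2 * a + 2 * b)" using eq rhs pq by (simp add: ennreal_plus ennreal_mult)
 hence "p + 4 * q = 2 * a + 2 * b" using pq ab by (subst (asm) ennreal_inj) auto
 moreover have "q >= r - e'" using m pq by (simp add: ennreal_le_iff)
 ultimately have "p <= 4 * (e + e')" using ab by simp
 thus ?thesis using pq by (simp add: ennreal_leI)
qed

text \<open>Near the minimum of the norm on a convex set everything is close together, by the parallelogram
 law. Only midpoints enter, so midpoint convexity is what is asked for. A decreasing sequence of sets
 costs nothing extra and turns the statement into Mazur's trick of passing to convex combinations.\<close>

proposition convex_selection:
 fixes C :: "nat => ('a => real) set"
 assumes meas: "!!f. f : C 0 ==> f : borel_measurable M"
  and dec: "decseq C" and ne: "!!k. C k ~= {}"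
  and mid: "!!k f g. f : C k ==> g : C k ==> (%x. (f x + g x) / 2) : C k"
  and bd: "!!f. f : C 0 ==> nsq M f <= ennreal R"
 obtains x where "!!k. x k : C k" "AE w in M. convergent (%k. x k w)"
  "!!j k. k <= j ==> nsq M (%w. x j w - x k w) <= ennreal ((1/16) ^ k)"
proof -
 have C0: "C k <= C 0" for k using decseqD[OF dec, of 0 k] by simp
 define q where "q f = enn2real (nsq M f)" for f
 have q: "nsq M f = ennreal (q f)" "0 <= q f" if "f : C k" for f k
  using bd[of f] C0[of k] that by (auto simp: q_def top_unique less_top[symmetric] ennreal_enn2real_if)
 define r where "r k = Inf (q ` C k)" for k
 have bdd: "bdd_below (q ` C k)" for k by (intro bdd_belowI[of _ 0]) (use q in auto)
 have r_le: "r k <= q f" if "f : C k" for f k unfolding r_def using that bdd by (intro cInf_lower) auto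
 have r0: "0 <= r k" for k unfolding r_def using ne q by (intro cInf_greatest) auto
 have rinc: "incseq r" unfolding incseq_def r_def
 proof (intro allI impI)
  fix m n :: nat assume "m <= n"
  hence "q ` C n <= q ` C m" using decseqD[OF dec] by (intro image_mono)
  thus "Inf (q ` C m) <= Inf (q ` C n)" using ne bdd by (intro cInf_superset_mono) auto
 qed
 have "r k <= max R 0" for k
 proof -
  obtain f where f: "f : C k" using ne by auto
  have "ennreal (q f) <= ennreal R" using bd[of f] q(1)[OF f] f C0 by auto
  hence "q f <= max R 0" using q(2)[OF f] by (cases "R >= 0") (auto simp: ennreal_neg)
  thus ?thesis using r_le[OF f] by simp
 qed
 then obtain l where l: "r \<longlonglongrightarrow> l" "!!k. r k <= l" using incseq_convergent[OF rinc] by blast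
 define e where "e k = (1/16::real) ^ k / 8" for k
 have e: "e k > 0" for k by (simp add: e_def)
 have "\<exists>p\<ge>k. l - e k <= r p" for k
 proof -
  have "\<forall>\<^sub>F p in sequentially. l - e k < r p" using order_tendstoD(1)[OF l(1)] e by simp
  then obtain N where "\<forall>p\<ge>N. l - e k < r p" by (auto simp: eventually_sequentially)
  thus ?thesis by (intro exI[of _ "max k N"]) (simp add: less_imp_le)
 qed
 then obtain p where p: "!!k. p k >= k" "!!k. l - e k <= r (p k)" by metis
 have "EX f:C (p k). q f < r (p k) + e k" for k
  using cInf_lessD[of "q ` C (p k)" "r (p k) + e k"] ne e[of k] by (auto simp: r_def)
 then obtain x where x: "!!k. x k : C (p k)" "!!k. q (x k) < r (p k) + e k" by metis
 have close: "nsq M (%w. x j w - x k w) <= ennreal ((1/16) ^ k)" if kj: "k <= j" for j k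
 proof -
  have ee: "e j <= e k" using kj by (simp add: e_def power_decreasing)
  define i where "i = min (p j) (p k)"
  have xi: "x j : C i" "x k : C i" using x(1)[of j] x(1)[of k] decseqD[OF dec, of i "p j"] decseqD[OF dec, of i "p k"]
   by (auto simp: i_def)
  have "l - e k <= r i" using p(2)[of j] p(2)[of k] ee by (auto simp: i_def min_def)
  also have "... <= q (%w. (x j w + x k w) / 2)" using r_le mid[OF xi] by blast
  finally have m: "ennreal (l - e k) <= nsq M (%w. (x j w + x k w) / 2)"
   using q(1)[OF mid[OF xi]] by (simp add: ennreal_leI)
  have "q (x k) <= l + e k" "q (x j) <= l + e k"
   using x(2)[of k] x(2)[of j] l(2)[of "p k"] l(2)[of "p j"] ee by auto
  hence "nsq M (x j) <= ennreal (l + e k)" "nsq M (x k) <= ennreal (l + e k)"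
   using q(1) x(1) by (metis ennreal_leI)+
  hence "nsq M (%w. x j w - x k w) <= ennreal (4 * (e k + e k))"
   using r0[of 0] l(2)[of 0] e[of k] m meas x(1) C0
   by (intro nsq_near_minimum[where r = l]) (auto simp: subset_eq)
  thus ?thesis by (simp add: e_def)
 qed
 have "x k : C k" for k using x(1) decseqD[OF dec p(1)] by auto
 moreover have "AE w in M. convergent (%k. x k w)"
  using meas x(1) C0 close unfolding nsq_def by (intro AE_convergent_of_summable_squares) (auto simp: subset_eq)
 ultimately show thesis using close that by blast
qed

lemma nsq_midpoint:
 assumes "f : borel_measurable M" "g : borel_measurable M" "nsq M f <= c" "nsq M g <= c"
 shows "nsq M (%x. (f x + g x) / 2) <= c"
proof (cases "c = \<infinity>")
 case False
 have "4 * nsq M (%x. (f x + g x) / 2) <= nsq M (%x. f x - g x) + 4 * nsq M (%x. (f x + g x) / 2)" by simp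
 also have "... = 2 * nsq M f + 2 * nsq M g" by (rule nsq_parallelogram[OF assms(1,2)])
 also have "... <= 2 * c + 2 * c" by (intro add_mono mult_left_mono assms) auto
 also have "... = 4 * c" by (simp add: mult_2[symmetric] mult.assoc[symmetric] flip: distrib_right)
 finally have "4 * nsq M (%x. (f x + g x) / 2) <= 4 * c" .
 thus ?thesis using ennreal_mult_le_mult_iff[of 4] by simp
qed simp

lemma nsq_add_le:
 assumes [measurable]: "f : borel_measurable M" "g : borel_measurable M"
 shows "nsq M (%x. f x + g x) <= 2 * nsq M f + 2 * nsq M g"
proof -
 have "nsq M (%x. f x + g x) <= (\<integral>\<^sup>+x. 2 * ennreal ((f x)\<^sup>2) + 2 * ennreal ((g x)\<^sup>2) \<partial>M)"
  unfolding nsq_def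
 proof (rule nn_integral_mono)
  fix x
  have "(f x + g x)\<^sup>2 <= 2 * (f x)\<^sup>2 + 2 * (g x)\<^sup>2"
   using zero_le_power2[of "f x - g x"] by (simp add: power2_eq_square algebra_simps)
  hence "ennreal ((f x + g x)\<^sup>2) <= ennreal (2 * (f x)\<^sup>2 + 2 * (g x)\<^sup>2)" by (rule ennreal_leI)
  thus "ennreal ((f x + g x)\<^sup>2) <= 2 * ennreal ((f x)\<^sup>2) + 2 * ennreal ((g x)\<^sup>2)"
   by (simp add: ennreal_plus ennreal_mult)
 qed
 also have "... = 2 * nsq M f + 2 * nsq M g"
  unfolding nsq_def by (subst nn_integral_add) (auto simp: nn_integral_cmult)
 finally show ?thesis .
qed

lemma AE_tendsto_zero_of_summable_squares:
 fixes u :: "nat => 'a => real"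
 assumes u [measurable]: "!!k. u k : borel_measurable M" and b: "!!k. nsq M (u k) <= ennreal ((1/16) ^ k)"
 shows "AE x in M. (%k. u k x) \<longlonglongrightarrow> 0"
proof -
 have "(\<integral>\<^sup>+x. (\<Sum>k. ennreal ((u k x)\<^sup>2)) \<partial>M) = (\<Sum>k. nsq M (u k))" unfolding nsq_def by (rule nn_integral_suminf) measurable
 also have "... <= (\<Sum>k. ennreal ((1/16) ^ k))" by (rule suminf_le[OF b]) simp_all
 also have "... = ennreal (\<Sum>k. (1/16) ^ k)" by (rule suminf_ennreal2) (simp_all add: summable_geometric)
 also have "... < \<infinity>" by simp
 finally have "(\<integral>\<^sup>+x. (\<Sum>k. ennreal ((u k x)\<^sup>2)) \<partial>M) ~= \<infinity>" by simp
 hence "AE x in M. (\<Sum>k. ennreal ((u k x)\<^sup>2)) ~= \<infinity>" by (intro nn_integral_PInf_AE) measurable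
 thus ?thesis
 proof eventually_elim
  case (elim x)
  hence "summable (%k. (u k x)\<^sup>2)" by (intro summable_suminf_not_top) auto
  hence "(%k. (u k x)\<^sup>2) \<longlonglongrightarrow> 0" by (rule summable_LIMSEQ_zero)
  hence "(%k. sqrt ((u k x)\<^sup>2)) \<longlonglongrightarrow> sqrt 0" by (rule tendsto_real_sqrt)
  thus ?case by (simp add: tendsto_rabs_zero_iff)
 qed
qed

section \<open>The measure on the group\<close>

locale lattice_measure =
 fixes P :: "'g monoid" (structure) and T :: "'g topology" and \<Delta> :: "'g set" and \<mu> :: "'g set measure"
 assumes tg: "topological_group P T" and sc: "second_countable T"
  and sub: "subgroup \<Delta> P" and disc: "subtopology T \<Delta> = discrete_topology \<Delta>"
  and sets_mu: "sets \<mu> = sets (coset_borel P T \<Delta>)"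
  and fin: "finite_measure \<mu>" and nz: "emeasure \<mu> (space \<mu>) ~= 0"
  and inv_mu: "!!g A. g : carrier P ==> A : sets \<mu> ==> emeasure \<mu> ((%C. l_coset P g C) ` A) = emeasure \<mu> A"

sublocale lattice_measure \<subseteq> group P using tg by (simp add: topological_group_def)
sublocale lattice_measure \<subseteq> finite_measure \<mu> by (rule fin)

context lattice_measure
begin

abbreviation "\<B> == bor T"
abbreviation "Q == LCOSETS P \<Delta>"

lemma topspace: "topspace T = carrier P" using tg by (simp add: topological_group_def)
lemma cont_mult: "continuous_map (prod_topology T T) T (%(x, y). x \<otimes> y)" using tg by (simp add: topological_group_def)
lemma cont_inv: "continuous_map T T (%x. inv x)" using tg by (simp add: topological_group_def)

lemma cont_left:
 assumes "a : carrier P" shows "continuous_map T T (%x. a \<otimes> x)"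
proof -
 have "continuous_map T (prod_topology T T) (%x. (a, x))"
  using assms by (intro continuous_map_pairedI) (simp_all add: topspace)
 from continuous_map_compose[OF this cont_mult] show ?thesis by (simp add: o_def)
qed

lemma cont_right:
 assumes "a : carrier P" shows "continuous_map T T (%x. x \<otimes> a)"
proof -
 have "continuous_map T (prod_topology T T) (%x. (x, a))"
  using assms by (intro continuous_map_pairedI) (simp_all add: topspace)
 from continuous_map_compose[OF this cont_mult] show ?thesis by (simp add: o_def)
qed

lemma cont_quot: "continuous_map (prod_topology T T) T (%z. inv (fst z) \<otimes> snd z)"
 using continuous_map_compose[OF continuous_map_pairedI[OF
   continuous_map_compose[OF continuous_map_fst cont_inv] continuous_map_snd] cont_mult] by (simp add: o_def)

lemma open_left: "a : carrier P ==> openin T U ==> openin T {x : carrier P. a \<otimes> x : U}"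
 using cont_left[of a] by (simp add: continuous_map_def topspace)
lemma open_right: "a : carrier P ==> openin T U ==> openin T {x : carrier P. x \<otimes> a : U}"
 using cont_right[of a] by (simp add: continuous_map_def topspace)

lemma meas_left [measurable]: "a : carrier P ==> (%x. a \<otimes> x) : measurable \<B> \<B>"
 by (rule continuous_map_bor[OF cont_left])
lemma meas_right [measurable]: "a : carrier P ==> (%x. x \<otimes> a) : measurable \<B> \<B>"
 by (rule continuous_map_bor[OF cont_right])
lemma meas_inv [measurable]: "(%x. inv x) : measurable \<B> \<B>"
 by (rule continuous_map_bor[OF cont_inv])

lemma D_sub: "\<gamma> : \<Delta> ==> \<gamma> : carrier P" using subgroup.mem_carrier[OF sub] by auto

lemma D_countable: "countable \<Delta>"
 using second_countable_subtopology[OF sc, of \<Delta>] unfolding disc second_countable_discrete_topology .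

text \<open>Open sets that meet each coset at most once.\<close>

definition small :: "'g set => bool" where
 "small U \<longleftrightarrow> openin T U & (ALL x:U. ALL y:U. inv x \<otimes> y : \<Delta> --> x = y)"

lemma small_nbhd:
 assumes g: "g : carrier P"
 shows "EX U. small U & g : U"
proof -
 have "openin (subtopology T \<Delta>) {\<one>}" using subgroup.one_closed[OF sub] by (simp add: disc)
 then obtain V where V: "openin T V" "{\<one>} = V \<inter> \<Delta>" by (auto simp: openin_subtopology)
 let ?Z = "{z : topspace (prod_topology T T). inv (fst z) \<otimes> snd z : V}"
 have "openin (prod_topology T T) ?Z" using cont_quot V(1) unfolding continuous_map_def by blast
 moreover have "(\<one>, \<one>) : ?Z" using V(2) by (auto simp: topspace)
 ultimately have "EX U1 U2. openin T U1 & openin T U2 & \<one> : U1 & \<one> : U2 & U1 \<times> U2 <= ?Z"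
  by (simp only: openin_prod_topology_alt)
 then obtain U1 U2 where U: "openin T U1" "openin T U2" "\<one> : U1" "\<one> : U2" "U1 \<times> U2 <= ?Z"
  by (elim exE conjE)
 define W where "W = U1 \<inter> U2"
 have W: "openin T W" "\<one> : W" using U by (auto simp: W_def)
 have WD: "x = y" if "x : W" "y : W" "inv x \<otimes> y : \<Delta>" for x y
 proof -
  have "(x, y) : U1 \<times> U2" using that by (auto simp: W_def)
  hence "inv x \<otimes> y : V" "x : carrier P" "y : carrier P" using U(5) by (auto simp: topspace)
  moreover from this have "inv x \<otimes> y = \<one>" using V(2) that(3) by auto
  ultimately show ?thesis by (metis inv_equality inv_inv inv_closed)
 qed
 define U where "U = {x : carrier P. inv g \<otimes> x : W}"
 have "openin T U" unfolding U_def using g W(1) by (intro open_left) auto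
 moreover have "x = y" if "x : U" "y : U" "inv x \<otimes> y : \<Delta>" for x y
 proof -
  have xy: "x : carrier P" "y : carrier P" using that by (auto simp: U_def)
  have "g \<otimes> (inv g \<otimes> y) = y" using xy g by (simp add: m_assoc[symmetric])
  hence "inv (inv g \<otimes> x) \<otimes> (inv g \<otimes> y) = inv x \<otimes> y"
   using xy g by (simp add: inv_mult_group m_assoc)
  hence "inv g \<otimes> x = inv g \<otimes> y" using WD that by (auto simp: U_def)
  thus ?thesis using xy g by simp
 qed
 ultimately have "small U" by (simp add: small_def)
 moreover have "g : U" using g W by (simp add: U_def)
 ultimately show ?thesis by blast
qed

lemma small_cover: "EX O'. (ALL k. small (O' (k::nat))) & (\<Union>k. O' k) = carrier P"
proof -
 obtain B where B: "countable B" "!!V. V : B ==> openin T V"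
  "!!U x. openin T U ==> x : U ==> EX V. V : B & x : V & V <= U" using second_countable_base[OF sc] by metis
 define B' where "B' = {V : B. small V}"
 have cov: "EX V:B'. g : V" if g: "g : carrier P" for g
 proof -
  obtain U where U: "small U" "g : U" using small_nbhd[OF g] by blast
  hence "openin T U" by (simp add: small_def)
  from B(3)[OF this U(2)] obtain V where V: "V : B" "g : V" "V <= U" by blast
  have "small V" using V U(1) B(2)[OF V(1)] unfolding small_def by (meson subsetD)
  thus ?thesis using V by (auto simp: B'_def)
 qed
 have ne: "B' ~= {}" using cov[OF one_closed] by auto
 have "countable B'" using B(1) by (simp add: B'_def)
 hence r: "range (from_nat_into B') = B'" using ne by simp
 have sm: "small (from_nat_into B' k)" for k using from_nat_into[OF ne, of k] by (simp add: B'_def)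
 have "(\<Union>k. from_nat_into B' k) = carrier P"
 proof
  show "(\<Union>k. from_nat_into B' k) <= carrier P"
   using sm openin_subset[of T] by (intro UN_least) (simp add: small_def topspace)
  show "carrier P <= (\<Union>k. from_nat_into B' k)" unfolding r using cov by auto
 qed
 with sm show ?thesis by (intro exI[of _ "from_nat_into B'"]) simp
qed

definition Op :: "nat => 'g set" where
 "Op = (SOME O'. (ALL k. small (O' k)) & (\<Union>k. O' k) = carrier P)"

lemma Op: "small (Op k)" "(\<Union>k. Op k) = carrier P"
 using someI_ex[OF small_cover] unfolding Op_def[symmetric] by simp_all

lemma Op_open: "openin T (Op k)" using Op(1) by (simp add: small_def)
lemma Op_inj: "x : Op k ==> y : Op k ==> inv x \<otimes> y : \<Delta> ==> x = y" using Op(1)[of k] unfolding small_def by blast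

lemma space_mu: "space \<mu> = Q"
proof -
 have "space (coset_borel P T \<Delta>) = Q" unfolding coset_borel_def by (rule space_measure_of) auto
 thus ?thesis using sets_eq_imp_space_eq[OF sets_mu] by simp
qed

lemma sets_mu_sigma: "sets \<mu> = sigma_sets Q {U. U <= Q & openin T (\<Union>U)}"
 unfolding sets_mu coset_borel_def by (rule sets_measure_of) auto

lemma measurable_mu: "measurable M \<mu> = measurable M (sigma Q {U. U <= Q & openin T (\<Union>U)})"
 by (rule measurable_cong_sets) (simp_all add: sets_mu coset_borel_def)

lemma Q_carrier: "C : Q ==> x : C ==> x : carrier P" using lcosets_part_G[OF sub] by auto

lemma Q_ex: "x : carrier P ==> EX C:Q. x : C" using lcosets_part_G[OF sub] by auto

lemma Q_coset: "C : Q ==> x : C ==> C = x <# \<Delta>"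
 using l_repr_independence[OF _ _ sub] by (auto simp: LCOSETS_def)

lemma coset_Q: "x : carrier P ==> x <# \<Delta> : Q" by (auto simp: LCOSETS_def)

lemma Q_ne: "C : Q ==> EX x. x : C" using lcos_self[OF _ sub] by (auto simp: LCOSETS_def)

lemma Q_mult: "C : Q ==> x : C ==> \<gamma> : \<Delta> ==> x \<otimes> \<gamma> : C"
 using Q_coset[of C x] by (auto simp: l_coset_def)

lemma Q_rel: assumes "C : Q" "x : C" "y : C" shows "inv x \<otimes> y : \<Delta>"
proof -
 have "y : x <# \<Delta>" using Q_coset assms by auto
 then obtain \<gamma> where "\<gamma> : \<Delta>" "y = x \<otimes> \<gamma>" by (auto simp: l_coset_def)
 thus ?thesis using Q_carrier assms D_sub by (simp add: m_assoc[symmetric])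
qed

lemma Q_bij: assumes "C : Q" "x : C" shows "bij_betw (%\<gamma>. x \<otimes> \<gamma>) \<Delta> C"
 unfolding bij_betw_def
proof
 show "inj_on (%\<gamma>. x \<otimes> \<gamma>) \<Delta>" using Q_carrier[OF assms] D_sub by (intro inj_onI) simp
 show "(%\<gamma>. x \<otimes> \<gamma>) ` \<Delta> = C" using Q_coset[OF assms] by (auto simp: l_coset_def)
qed

definition pr :: "'g set => 'g set set" where "pr E = {C : Q. C \<inter> E ~= {}}"

lemma pr_open: assumes "openin T E" shows "pr E : sets \<mu>"
proof -
 have "\<Union>(pr E) = (\<Union>\<gamma>\<in>\<Delta>. {x : carrier P. x \<otimes> \<gamma> : E})"
 proof
  show "\<Union>(pr E) <= (\<Union>\<gamma>\<in>\<Delta>. {x : carrier P. x \<otimes> \<gamma> : E})"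
  proof
   fix x assume "x : \<Union>(pr E)"
   then obtain C e where C: "C : Q" "x : C" "e : C" "e : E" by (auto simp: pr_def)
   have "x \<otimes> (inv x \<otimes> e) = e" using Q_carrier C by (simp add: m_assoc[symmetric])
   thus "x : (\<Union>\<gamma>\<in>\<Delta>. {x : carrier P. x \<otimes> \<gamma> : E})" using Q_rel[OF C(1,2,3)] Q_carrier[OF C(1,2)] C(4)
    by (intro UN_I[of "inv x \<otimes> e"]) auto
  qed
  show "(\<Union>\<gamma>\<in>\<Delta>. {x : carrier P. x \<otimes> \<gamma> : E}) <= \<Union>(pr E)"
  proof
   fix x assume "x : (\<Union>\<gamma>\<in>\<Delta>. {x : carrier P. x \<otimes> \<gamma> : E})"
   then obtain \<gamma> where g: "\<gamma> : \<Delta>" "x : carrier P" "x \<otimes> \<gamma> : E" by auto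
   obtain C where C: "C : Q" "x : C" using Q_ex[OF g(2)] by auto
   hence "C : pr E" using Q_mult[OF C g(1)] g(3) by (auto simp: pr_def)
   thus "x : \<Union>(pr E)" using C by auto
  qed
 qed
 moreover have "openin T (\<Union>\<gamma>\<in>\<Delta>. {x : carrier P. x \<otimes> \<gamma> : E})" using open_right D_sub assms by (intro openin_Union) auto
 ultimately have "openin T (\<Union>(pr E))" by simp
 thus ?thesis unfolding sets_mu_sigma by (intro sigma_sets.Basic) (auto simp: pr_def)
qed

lemma Op_pr: assumes "C : Q" "x : C" "x : Op k" shows "C \<inter> Op k = {x}"
 using Op_inj[of x k] Q_rel[OF assms(1,2)] assms by auto

lemma pr_Op: assumes "E : sets \<B>" shows "pr (Op k \<inter> E) : sets \<mu>"
 using assms unfolding sets_bor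
proof (induction E rule: sigma_sets.induct)
 case (Basic E)
 thus ?case by (intro pr_open openin_Int Op_open) simp
next
 case Empty
 thus ?case by (simp add: pr_def)
next
 case (Compl E)
 have "pr (Op k \<inter> (topspace T - E)) = pr (Op k) - pr (Op k \<inter> E)"
 proof
  show "pr (Op k \<inter> (topspace T - E)) <= pr (Op k) - pr (Op k \<inter> E)"
  proof
   fix C assume "C : pr (Op k \<inter> (topspace T - E))"
   then obtain x where x: "C : Q" "x : C" "x : Op k" "x ~: E" by (auto simp: pr_def)
   thus "C : pr (Op k) - pr (Op k \<inter> E)" using Op_pr[OF x(1-3)] by (auto simp: pr_def)
  qed
  show "pr (Op k) - pr (Op k \<inter> E) <= pr (Op k \<inter> (topspace T - E))"
   using Q_carrier by (auto simp: pr_def topspace)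
 qed
 thus ?case using Compl.IH pr_open[OF Op_open] by auto
next
 case (Union A)
 have "pr (Op k \<inter> (\<Union>i. A i)) = (\<Union>i. pr (Op k \<inter> A i))" by (auto simp: pr_def)
 thus ?case using Union.IH by auto
qed

text \<open>A Borel section of the quotient map: the point of the coset in the first of the small sets
 that it meets.\<close>

definition idx :: "'g set => nat" where "idx C = (LEAST k. C \<inter> Op k ~= {})"
definition sec :: "'g set => 'g" where "sec C = (SOME x. x : C \<inter> Op (idx C))"

lemma idx: assumes "C : Q" shows "C \<inter> Op (idx C) ~= {}" "j < idx C ==> C \<inter> Op j = {}"
proof -
 obtain x where "x : C" using Q_ne[OF assms] by auto
 then obtain k where "C \<inter> Op k ~= {}" using Op(2) Q_carrier[OF assms] by blast
 thus "C \<inter> Op (idx C) ~= {}" unfolding idx_def by (rule LeastI)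
 show "C \<inter> Op j = {}" if "j < idx C" using not_less_Least[of j "%k. C \<inter> Op k ~= {}"] that unfolding idx_def by auto
qed

lemma sec: assumes "C : Q" shows "sec C : C" "sec C : Op (idx C)" "sec C : carrier P"
proof -
 have "sec C : C \<inter> Op (idx C)" unfolding sec_def by (rule someI_ex) (use idx(1)[OF assms] in blast)
 thus "sec C : C" "sec C : Op (idx C)" "sec C : carrier P" using Q_carrier[OF assms] by auto
qed

lemma meas_sec [measurable]: "sec : measurable \<mu> \<B>"
proof (rule measurableI)
 show "sec C : space \<B>" if "C : space \<mu>" for C using that sec(3) by (simp add: space_mu topspace)
 fix E assume E: "E : sets \<B>"
 have "sec -` E \<inter> space \<mu> = (\<Union>k. pr (Op k \<inter> E) - (\<Union>j<k. pr (Op j)))" (is "?L = ?R")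
 proof
  show "?L <= ?R"
  proof
   fix C assume "C : ?L"
   hence C: "C : Q" "sec C : E" by (auto simp: space_mu)
   have "C : pr (Op (idx C) \<inter> E)" using C sec[OF C(1)] by (auto simp: pr_def)
   moreover have "C ~: (\<Union>j<idx C. pr (Op j))" using idx(2)[OF C(1)] by (auto simp: pr_def)
   ultimately show "C : ?R" by blast
  qed
  show "?R <= ?L"
  proof
   fix C assume "C : ?R"
   then obtain k where k: "C : pr (Op k \<inter> E)" "C ~: (\<Union>j<k. pr (Op j))" by blast
   hence C: "C : Q" by (auto simp: pr_def)
   obtain x where x: "x : C" "x : Op k" "x : E" using k(1) by (auto simp: pr_def)
   have "idx C = k" unfolding idx_def
    using k(2) x C by (intro Least_equality) (auto simp: pr_def not_less[symmetric])
   hence "sec C = x" using Op_pr[OF C x(1,2)] sec[OF C] by auto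
   thus "C : ?L" using x C by (auto simp: space_mu)
  qed
 qed
 moreover have "?R : sets \<mu>" using pr_Op[OF E] pr_open[OF Op_open] by auto
 ultimately show "sec -` E \<inter> space \<mu> : sets \<mu>" by simp
qed

text \<open>Summation over the points of the cosets turns the measure on the coset space into a left
 invariant measure on the group, which is also invariant under right translation by the lattice.\<close>

definition \<nu> :: "'g measure" where
 "\<nu> = distr (count_space \<Delta> \<Otimes>\<^sub>M \<mu>) \<B> (%(\<gamma>, C). sec C \<otimes> \<gamma>)"

lemma space_nu: "space \<nu> = carrier P" and sets_nu [measurable_cong]: "sets \<nu> = sets \<B>"
 by (simp_all add: \<nu>_def topspace)

lemma meas_par: "(%(\<gamma>, C). sec C \<otimes> \<gamma>) : measurable (count_space \<Delta> \<Otimes>\<^sub>M \<mu>) \<B>"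
proof (rule measurable_pair_measure_countable1[OF D_countable])
 fix \<gamma> assume "\<gamma> : \<Delta>"
 hence "(%C. sec C \<otimes> \<gamma>) : measurable \<mu> \<B>" using D_sub by measurable
 thus "(%C. case (\<gamma>, C) of (\<gamma>, C) => sec C \<otimes> \<gamma>) : measurable \<mu> \<B>" by simp
qed

lemma sigma_finite_D: "sigma_finite_measure (count_space \<Delta>)"
 by (rule sigma_finite_measure_count_space_countable[OF D_countable])

lemma pair_sf: "pair_sigma_finite (count_space \<Delta>) \<mu>"
 using sigma_finite_D by (simp add: pair_sigma_finite_def sigma_finite_measure_axioms)

lemma nn_integral_nu:
 assumes f [measurable]: "f : borel_measurable \<B>"
 shows "(\<integral>\<^sup>+x. f x \<partial>\<nu>) = (\<integral>\<^sup>+C. (\<integral>\<^sup>+x. f x \<partial>count_space C) \<partial>\<mu>)"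
  and "(%C. \<integral>\<^sup>+x. f x \<partial>count_space C) : borel_measurable \<mu>"
proof -
 note [measurable] = meas_par
 interpret pair_sigma_finite "count_space \<Delta>" \<mu> by (rule pair_sf)
 have *: "(\<integral>\<^sup>+\<gamma>. f (sec C \<otimes> \<gamma>) \<partial>count_space \<Delta>) = (\<integral>\<^sup>+x. f x \<partial>count_space C)" if "C : Q" for C
  by (rule nn_integral_bij_count_space[OF Q_bij[OF that sec(1)[OF that]]])
 have m: "(%z. f (case z of (\<gamma>, C) => sec C \<otimes> \<gamma>)) : borel_measurable (count_space \<Delta> \<Otimes>\<^sub>M \<mu>)"
  by (rule measurable_compose[OF meas_par f])
 have "(\<integral>\<^sup>+x. f x \<partial>\<nu>) = (\<integral>\<^sup>+z. f (case z of (\<gamma>, C) => sec C \<otimes> \<gamma>) \<partial>(count_space \<Delta> \<Otimes>\<^sub>M \<mu>))"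
  unfolding \<nu>_def by (rule nn_integral_distr[OF meas_par]) simp
 also have "... = (\<integral>\<^sup>+C. (\<integral>\<^sup>+\<gamma>. f (sec C \<otimes> \<gamma>) \<partial>count_space \<Delta>) \<partial>\<mu>)"
  using nn_integral_snd[OF m] by simp
 also have "... = (\<integral>\<^sup>+C. (\<integral>\<^sup>+x. f x \<partial>count_space C) \<partial>\<mu>)"
  by (rule nn_integral_cong) (simp add: * space_mu)
 finally show "(\<integral>\<^sup>+x. f x \<partial>\<nu>) = (\<integral>\<^sup>+C. (\<integral>\<^sup>+x. f x \<partial>count_space C) \<partial>\<mu>)" .
 have "(%C. \<integral>\<^sup>+\<gamma>. f (sec C \<otimes> \<gamma>) \<partial>count_space \<Delta>) : borel_measurable \<mu>"
  using sigma_finite_measure.borel_measurable_nn_integral_fst[OF sigma_finite_D measurable_compose[OF measurable_pair_swap' m]] by simp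
 thus "(%C. \<integral>\<^sup>+x. f x \<partial>count_space C) : borel_measurable \<mu>"
  by (subst measurable_cong[where g = "%C. \<integral>\<^sup>+\<gamma>. f (sec C \<otimes> \<gamma>) \<partial>count_space \<Delta>"]) (simp_all add: * space_mu)
qed

lemma coset_image: assumes "w : carrier P" "C : Q"
 shows "w <# C = (%x. w \<otimes> x) ` C" "w <# C : Q" "bij_betw (%x. w \<otimes> x) C (w <# C)"
proof -
 show 1: "w <# C = (%x. w \<otimes> x) ` C" by (auto simp: l_coset_def)
 obtain x where x: "x : C" using Q_ne[OF assms(2)] by auto
 have "w <# C = (w \<otimes> x) <# \<Delta>"
  unfolding Q_coset[OF assms(2) x] using assms(1) Q_carrier[OF assms(2) x] subgroup.subset[OF sub] by (simp add: lcos_m_assoc)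
 thus "w <# C : Q" using coset_Q[of "w \<otimes> x"] assms(1) Q_carrier[OF assms(2) x] by simp
 show "bij_betw (%x. w \<otimes> x) C (w <# C)"
  unfolding bij_betw_def 1 using assms(1) Q_carrier[OF assms(2)] by (auto intro!: inj_onI)
qed

lemma coset_inverse: assumes "w : carrier P" "C : Q" shows "inv w <# (w <# C) = C" "w <# (inv w <# C) = C"
proof -
 have s: "C <= carrier P" using Q_carrier[OF assms(2)] by auto
 show "inv w <# (w <# C) = C" "w <# (inv w <# C) = C" using assms(1) s by (simp_all add: lcos_m_assoc lcos_mult_one)
qed

lemma meas_shift: assumes w: "w : carrier P" shows "(%C. w <# C) : measurable \<mu> \<mu>"
proof -
 have "(%C. w <# C) : measurable \<mu> (sigma Q {U. U <= Q & openin T (\<Union>U)})"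
 proof (rule measurable_measure_of)
  show "(%C. w <# C) : space \<mu> \<rightarrow> Q" using coset_image(2)[OF w] by (simp add: space_mu)
  fix U assume "U : {U. U <= Q & openin T (\<Union>U)}"
  hence U: "U <= Q" "openin T (\<Union>U)" by auto
  define V where "V = (%C. w <# C) -` U \<inter> space \<mu>"
  have V: "V <= Q" by (auto simp: V_def space_mu)
  have "\<Union>V = {x : carrier P. w \<otimes> x : \<Union>U}"
  proof
   show "\<Union>V <= {x : carrier P. w \<otimes> x : \<Union>U}"
   proof
    fix x assume "x : \<Union>V"
    then obtain C where C: "C : Q" "w <# C : U" "x : C" by (auto simp: V_def space_mu)
    have "w \<otimes> x : w <# C" using C(3) by (auto simp: l_coset_def)
    thus "x : {x : carrier P. w \<otimes> x : \<Union>U}" using C Q_carrier[OF C(1,3)] by auto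
   qed
   show "{x : carrier P. w \<otimes> x : \<Union>U} <= \<Union>V"
   proof
    fix x assume "x : {x : carrier P. w \<otimes> x : \<Union>U}"
    then obtain C' where x: "x : carrier P" "w \<otimes> x : C'" "C' : U" by auto
    obtain C where C: "C : Q" "x : C" using Q_ex[OF x(1)] by auto
    have "w \<otimes> x : w <# C" using C(2) by (auto simp: l_coset_def)
    hence "w <# C = C'" using Q_coset[OF coset_image(2)[OF w C(1)]] Q_coset[of C'] x U(1) by blast
    thus "x : \<Union>V" using C x by (auto simp: V_def space_mu)
   qed
  qed
  hence "openin T (\<Union>V)" using open_left[OF w U(2)] by simp
  hence "V : sets \<mu>" using V unfolding sets_mu_sigma by (intro sigma_sets.Basic) simp
  thus "(%C. w <# C) -` U \<inter> space \<mu> : sets \<mu>" by (simp add: V_def)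
 qed auto
 thus ?thesis unfolding measurable_mu .
qed

lemma mu_shift: assumes w: "w : carrier P" shows "distr \<mu> \<mu> (%C. w <# C) = \<mu>"
proof (rule measure_eqI)
 fix A assume "A : sets (distr \<mu> \<mu> (%C. w <# C))"
 hence A: "A : sets \<mu>" by simp
 hence AQ: "A <= Q" using sets.sets_into_space space_mu by auto
 have "(%C. w <# C) -` A \<inter> space \<mu> = (%C. inv w <# C) ` A"
 proof
  show "(%C. w <# C) -` A \<inter> space \<mu> <= (%C. inv w <# C) ` A"
   using coset_inverse(1)[OF w] by (auto simp: space_mu intro!: image_eqI)
  show "(%C. inv w <# C) ` A <= (%C. w <# C) -` A \<inter> space \<mu>"
   using coset_inverse(2)[OF w] coset_image(2)[of "inv w"] w AQ by (auto simp: space_mu)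
 qed
 thus "emeasure (distr \<mu> \<mu> (%C. w <# C)) A = emeasure \<mu> A"
  using inv_mu[of "inv w" A] w A by (simp add: emeasure_distr meas_shift)
qed simp

lemma nn_integral_shift:
 assumes "w : carrier P" "F : borel_measurable \<mu>"
 shows "(\<integral>\<^sup>+C. F (w <# C) \<partial>\<mu>) = (\<integral>\<^sup>+C. F C \<partial>\<mu>)"
 using nn_integral_distr[OF meas_shift[OF assms(1)], of F] assms(2) mu_shift[OF assms(1)] by simp

lemma nu_left: assumes w: "w : carrier P" shows "distr \<nu> \<B> (%x. w \<otimes> x) = \<nu>"
proof (rule measure_eqI)
 fix A assume "A : sets (distr \<nu> \<B> (%x. w \<otimes> x))"
 hence A [measurable]: "A : sets \<B>" by simp
 have ind: "(%x. indicator A (w \<otimes> x) :: ennreal) : borel_measurable \<B>" using w by measurable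
 have "emeasure (distr \<nu> \<B> (%x. w \<otimes> x)) A = (\<integral>\<^sup>+x. indicator A x \<partial>distr \<nu> \<B> (%x. w \<otimes> x))" by simp
 also have "... = (\<integral>\<^sup>+x. indicator A (w \<otimes> x) \<partial>\<nu>)" using w by (intro nn_integral_distr) simp_all
 also have "... = (\<integral>\<^sup>+C. (\<integral>\<^sup>+x. indicator A (w \<otimes> x) \<partial>count_space C) \<partial>\<mu>)" by (rule nn_integral_nu(1)[OF ind])
 also have "... = (\<integral>\<^sup>+C. (\<integral>\<^sup>+x. indicator A x \<partial>count_space (w <# C)) \<partial>\<mu>)"
  by (rule nn_integral_cong) (simp add: nn_integral_bij_count_space[OF coset_image(3)[OF w]] space_mu)
 also have "... = (\<integral>\<^sup>+C. (\<integral>\<^sup>+x. indicator A x \<partial>count_space C) \<partial>\<mu>)"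
  by (rule nn_integral_shift[OF w nn_integral_nu(2)]) simp
 also have "... = (\<integral>\<^sup>+x. indicator A x \<partial>\<nu>)" by (rule nn_integral_nu(1)[symmetric]) simp
 also have "... = emeasure \<nu> A" by (simp add: sets_nu)
 finally show "emeasure (distr \<nu> \<B> (%x. w \<otimes> x)) A = emeasure \<nu> A" .
qed (simp add: sets_nu)

lemma coset_vimage:
 assumes U: "U <= Q" shows "(%x. x <# \<Delta>) -` U \<inter> space \<B> = \<Union>U"
proof (intro subset_antisym subsetI)
 fix x assume "x : (%x. x <# \<Delta>) -` U \<inter> space \<B>"
 thus "x : \<Union>U" using lcos_self[OF _ sub, of x] by (auto simp: topspace)
next
 fix x assume "x : \<Union>U"
 then obtain C where C: "C : U" "C : Q" "x : C" using U by auto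
 thus "x : (%x. x <# \<Delta>) -` U \<inter> space \<B>" using Q_coset[of C x] Q_carrier[of C x] by (simp add: topspace)
qed

lemma meas_coset: "(%x. x <# \<Delta>) : measurable \<B> \<mu>" unfolding measurable_mu
proof (rule measurable_measure_of)
 show "(%x. x <# \<Delta>) : space \<B> \<rightarrow> Q" using coset_Q by (simp add: topspace)
 fix U assume "U : {U. U <= Q & openin T (\<Union>U)}"
 thus "(%x. x <# \<Delta>) -` U \<inter> space \<B> : sets \<B>" using coset_vimage[of U] by (simp add: open_in_bor)
qed auto

lemma AE_nu_iff: "(AE x in \<nu>. R x) \<longleftrightarrow> (AE C in \<mu>. ALL x:C. R x)"
proof
 assume "AE x in \<nu>. R x"
 then obtain N where N: "N : sets \<B>" "emeasure \<nu> N = 0" "{x : carrier P. ~ R x} <= N"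
  by (auto simp: eventually_ae_filter null_sets_def space_nu sets_nu)
 have "(\<integral>\<^sup>+C. (\<integral>\<^sup>+x. indicator N x \<partial>count_space C) \<partial>\<mu>) = (\<integral>\<^sup>+x. indicator N x \<partial>\<nu>)"
  using N(1) by (intro nn_integral_nu(1)[symmetric]) simp
 also have "... = 0" using N by (simp add: sets_nu)
 finally have "AE C in \<mu>. (\<integral>\<^sup>+x. indicator N x \<partial>count_space C) = 0"
  using N(1) by (subst (asm) nn_integral_0_iff_AE) (intro nn_integral_nu(2), simp)
 thus "AE C in \<mu>. ALL x:C. R x"
 proof (rule AE_mp, intro AE_I2 impI ballI)
  fix C x assume C: "C : space \<mu>" "(\<integral>\<^sup>+x. indicator N x \<partial>count_space C) = 0" "x : C"
  have "AE x in count_space C. indicator N x = (0::ennreal)"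
   using C(2) by (subst (asm) nn_integral_0_iff_AE) simp_all
  hence "x ~: N" using C(3) by (auto simp: AE_count_space indicator_def)
  thus "R x" using N(3) Q_carrier C by (auto simp: space_mu)
 qed
next
 assume "AE C in \<mu>. ALL x:C. R x"
 then obtain N where N: "N : sets \<mu>" "emeasure \<mu> N = 0" "{C : Q. ~ (ALL x:C. R x)} <= N"
  by (auto simp: eventually_ae_filter null_sets_def space_mu)
 have NQ: "N <= Q" using sets.sets_into_space[OF N(1)] by (simp add: space_mu)
 define E where "E = \<Union>N"
 have E: "E : sets \<B>" unfolding E_def coset_vimage[OF NQ, symmetric] by (rule measurable_sets[OF meas_coset N(1)])
 have "emeasure \<nu> E = (\<integral>\<^sup>+x. indicator E x \<partial>\<nu>)" using E by (simp add: sets_nu)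
 also have "... = (\<integral>\<^sup>+C. (\<integral>\<^sup>+x. indicator E x \<partial>count_space C) \<partial>\<mu>)" using E by (intro nn_integral_nu(1)) simp
 also have "... = (\<integral>\<^sup>+C. 0 \<partial>\<mu>)"
 proof (rule nn_integral_cong_AE)
  have "AE C in \<mu>. C ~: N" using N by (intro AE_not_in) auto
  thus "AE C in \<mu>. (\<integral>\<^sup>+x. indicator E x \<partial>count_space C) = 0"
  proof (rule AE_mp, intro AE_I2 impI)
   fix C assume C: "C : space \<mu>" "C ~: N"
   have "x ~: E" if "x : C" for x
   proof
    assume "x : E"
    then obtain C' where C': "C' : N" "x : C'" by (auto simp: E_def)
    hence "C' : Q" using NQ by auto
    hence "C' = C" using Q_coset[of C' x] Q_coset[of C x] C' C that by (simp add: space_mu)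
    thus False using C' C by simp
   qed
   hence "(\<integral>\<^sup>+x. indicator E x \<partial>count_space C) = (\<integral>\<^sup>+x. (0::ennreal) \<partial>count_space C)"
    by (intro nn_integral_cong) (simp add: indicator_def)
   thus "(\<integral>\<^sup>+x. indicator E x \<partial>count_space C) = (0::ennreal)" by simp
  qed
 qed
 finally have "emeasure \<nu> E = 0" by simp
 moreover have "{x : space \<nu>. ~ R x} <= E"
 proof
  fix x assume "x : {x : space \<nu>. ~ R x}"
  hence x: "x : carrier P" "~ R x" by (auto simp: space_nu)
  obtain C where "C : Q" "x : C" using Q_ex[OF x(1)] by auto
  thus "x : E" using N(3) x by (auto simp: E_def)
 qed
 ultimately show "AE x in \<nu>. R x" using E by (intro AE_I[of _ _ E]) (auto simp: sets_nu)
qed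

lemma AE_left: assumes w: "w : carrier P" and R: "AE x in \<nu>. R x" shows "AE x in \<nu>. R (w \<otimes> x)"
proof (rule AE_distrD[of "%x. w \<otimes> x" \<nu> \<B> R])
 show "(%x. w \<otimes> x) : measurable \<nu> \<B>" using meas_left[OF w] by (simp only: measurable_cong_sets[OF sets_nu refl])
 show "AE x in distr \<nu> \<B> (%x. w \<otimes> x). R x" unfolding nu_left[OF w] by (rule R)
qed

lemma AE_right: assumes "\<gamma> : \<Delta>" "AE x in \<nu>. R x" shows "AE x in \<nu>. R (x \<otimes> \<gamma>)"
 using assms(2) unfolding AE_nu_iff
 by (rule AE_mp) (intro AE_I2 impI ballI, use Q_mult[OF _ _ assms(1)] in "auto simp: space_mu")

lemma nu_Op: "emeasure \<nu> (Op k) < \<infinity>"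
proof -
 have "emeasure \<nu> (Op k) = (\<integral>\<^sup>+x. indicator (Op k) x \<partial>\<nu>)" using open_in_bor[OF Op_open] by (simp add: sets_nu)
 also have "... = (\<integral>\<^sup>+C. (\<integral>\<^sup>+x. indicator (Op k) x \<partial>count_space C) \<partial>\<mu>)"
  using open_in_bor[OF Op_open] by (intro nn_integral_nu(1)) simp
 also have "... <= (\<integral>\<^sup>+C. 1 \<partial>\<mu>)"
 proof (rule nn_integral_mono)
  fix C assume "C : space \<mu>"
  hence C: "C : Q" by (simp add: space_mu)
  show "(\<integral>\<^sup>+x. indicator (Op k) x \<partial>count_space C) <= (1::ennreal)"
  proof (cases "C \<inter> Op k = {}")
   case True
   hence "(\<integral>\<^sup>+x. indicator (Op k) x \<partial>count_space C) = (\<integral>\<^sup>+x. (0::ennreal) \<partial>count_space C)"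
    by (intro nn_integral_cong) (auto simp: indicator_def)
   thus ?thesis by simp
  next
   case False
   then obtain x where x: "x : C" "x : Op k" by auto
   have "(\<integral>\<^sup>+x. indicator (Op k) x \<partial>count_space C) = (\<integral>\<^sup>+y. indicator {x} y \<partial>count_space C :: ennreal)"
    using Op_pr[OF C x] by (intro nn_integral_cong) (auto simp: indicator_def)
   also have "... = 1" using x by simp
   finally show ?thesis by simp
  qed
 qed
 also have "... = emeasure \<mu> (space \<mu>)" by simp
 also have "... < \<infinity>" using emeasure_finite by (simp add: less_top[symmetric])
 finally show ?thesis .
qed

sublocale nu: sigma_finite_measure \<nu>
proof
 show "EX A. countable A & A <= sets \<nu> & \<Union>A = space \<nu> & (ALL a:A. emeasure \<nu> a ~= \<infinity>)"
  using open_in_bor[OF Op_open] Op(2) nu_Op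
  by (intro exI[of _ "range Op"]) (auto simp: sets_nu space_nu less_top[symmetric])
qed

lemma nu_not_null: "~ (AE x in \<nu>. False)"
proof
 assume "AE x in \<nu>. False"
 hence "AE C in \<mu>. ALL x:C. False" by (simp only: AE_nu_iff)
 hence "AE C in \<mu>. False" by (rule AE_mp) (intro AE_I2 impI, use Q_ne in "auto simp: space_mu")
 thus False using nz by (simp add: AE_iff_measurable[OF sets.top])
qed

end

section \<open>Continuity of translation and invariant sets\<close>

lemma ennreal_tendsto_zeroI:
 fixes f :: "nat => ennreal"
 assumes "!!e::real. e > 0 ==> \<forall>\<^sub>F k in sequentially. f k < ennreal e"
 shows "f \<longlonglongrightarrow> 0"
proof (rule order_tendstoI)
 fix a :: ennreal assume a: "0 < a"
 have "EX e>0. ennreal e <= a"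
 proof (cases a)
  case (real r)
  thus ?thesis using a by (intro exI[of _ r]) auto
 next
  case top
  thus ?thesis by (intro exI[of _ 1]) simp
 qed
 then obtain e where "e > 0" "ennreal e <= a" by blast
 thus "\<forall>\<^sub>F k in sequentially. f k < a" using assms[of e] by (auto elim: eventually_mono)
qed simp

text \<open>Dominated convergence for indicators, with values in the extended nonnegative reals.\<close>

lemma emeasure_tendsto_zero:
 assumes A: "!!k. A k : sets M" "!!k. A k <= W" and W: "W : sets M" "emeasure M W < \<infinity>"
  and ev: "!!x. x : W ==> \<forall>\<^sub>F k in sequentially. x ~: A k"
 shows "(%k. emeasure M (A k)) \<longlonglongrightarrow> 0"
proof -
 define B where "B k = (\<Union>j\<in>{k..}. A j)" for k :: nat
 have B: "B k : sets M" "B k <= W" for k using A by (auto simp: B_def)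
 have dec: "decseq B" unfolding B_def decseq_def by (intro allI impI UN_mono) auto
 have "(\<Inter>k. B k) = {}"
 proof -
  have "x ~: (\<Inter>k. B k)" for x
  proof
   assume x: "x : (\<Inter>k. B k)"
   hence "x : W" using B by auto
   from ev[OF this] obtain N where "\<forall>k\<ge>N. x ~: A k" by (auto simp: eventually_sequentially)
   thus False using x by (auto simp: B_def)
  qed
  thus ?thesis by auto
 qed
 moreover have "(%k. emeasure M (B k)) \<longlonglongrightarrow> emeasure M (\<Inter>k. B k)"
 proof (rule Lim_emeasure_decseq)
  show "range B <= sets M" using B by auto
  show "emeasure M (B k) ~= \<infinity>" for k using emeasure_mono[OF B(2) W(1)] W(2) by (metis leD)
 qed (rule dec)
 ultimately have lim: "(%k. emeasure M (B k)) \<longlonglongrightarrow> 0" by simp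
 have "A k <= B k" for k by (auto simp: B_def)
 hence ev: "\<forall>\<^sub>F k in sequentially. emeasure M (A k) <= emeasure M (B k)"
  by (intro always_eventually allI emeasure_mono B(1))
 show ?thesis by (rule tendsto_sandwich[OF _ ev tendsto_const lim]) simp
qed

lemma (in group) endo_inv: "f : hom G G ==> x : carrier G ==> f (inv x) = inv (f x)"
 by (rule group_hom.hom_inv) (simp_all add: group_hom_def group_hom_axioms_def group_axioms)

context lattice_measure
begin

definition to_one :: "(nat => 'g) => bool" where
 "to_one u \<longleftrightarrow> range u <= carrier P & (ALL U. openin T U --> \<one> : U --> (\<forall>\<^sub>F k in sequentially. u k : U))"

lemma to_one_D: "to_one u ==> u k : carrier P"
 "to_one u ==> openin T U ==> \<one> : U ==> \<forall>\<^sub>F k in sequentially. u k : U"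
 by (auto simp: to_one_def)

lemma to_one_inv: assumes "to_one u" shows "to_one (%k. inv (u k))" unfolding to_one_def
proof (intro conjI allI impI)
 show "range (%k. inv (u k)) <= carrier P" using to_one_D(1)[OF assms] by auto
 fix U assume U: "openin T U" "\<one> : U"
 have "openin T {x : carrier P. inv x : U}" using cont_inv U(1) by (simp add: continuous_map_def topspace)
 moreover have "\<one> : {x : carrier P. inv x : U}" using U(2) by simp
 ultimately have "\<forall>\<^sub>F k in sequentially. u k : {x : carrier P. inv x : U}" by (rule to_one_D(2)[OF assms])
 thus "\<forall>\<^sub>F k in sequentially. inv (u k) : U" by (rule eventually_mono) simp
qed

lemma to_one_mult:
 assumes u: "to_one u" and U: "openin T U" "x : U"
 shows "\<forall>\<^sub>F k in sequentially. u k \<otimes> x : U"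
proof -
 have x: "x : carrier P" using U openin_subset[of T U] by (auto simp: topspace)
 have "openin T {v : carrier P. v \<otimes> x : U}" by (rule open_right[OF x U(1)])
 moreover have "\<one> : {v : carrier P. v \<otimes> x : U}" using x U(2) by simp
 ultimately have "\<forall>\<^sub>F k in sequentially. u k : {v : carrier P. v \<otimes> x : U}" by (rule to_one_D(2)[OF u])
 thus ?thesis by (rule eventually_mono) simp
qed

lemma meas_Coll: assumes "w : carrier P" "K : sets \<B>" shows "{x : carrier P. w \<otimes> x : K} : sets \<B>"
 using measurable_sets[OF meas_left[OF assms(1)] assms(2)] by (simp add: vimage_def Int_def topspace conj_commute)

lemma nu_translate: assumes w: "w : carrier P" and A: "A : sets \<B>"
 shows "emeasure \<nu> {x : carrier P. w \<otimes> x : A} = emeasure \<nu> A"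
proof -
 have "emeasure (distr \<nu> \<B> (%x. w \<otimes> x)) A = emeasure \<nu> ((%x. w \<otimes> x) -` A \<inter> space \<nu>)"
  using meas_left[OF w] A by (intro emeasure_distr) (simp_all add: measurable_cong_sets[OF sets_nu refl])
 thus ?thesis unfolding nu_left[OF w] by (simp add: vimage_def Int_def space_nu conj_commute)
qed

text \<open>The set of points of \<open>W\<close> at which the translate of \<open>K\<close> differs from \<open>K\<close>. It is small for
 small translations: this holds for open \<open>K\<close> by dominated convergence and passes to the
 generated \<open>\<sigma>\<close>-algebra.\<close>

definition dif :: "'g set => 'g set => 'g => 'g set" where
 "dif W K u = {x : W. (x : K) ~= (u \<otimes> x : K)}"

lemma dif_sets: assumes "u : carrier P" "W : sets \<B>" "K : sets \<B>" shows "dif W K u : sets \<B>"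
proof -
 have W: "W <= carrier P" using sets.sets_into_space[OF assms(2)] by (simp add: topspace)
 have "dif W K u = W \<inter> ((K - {x : carrier P. u \<otimes> x : K}) \<union> ({x : carrier P. u \<otimes> x : K} - K))"
  using W by (auto simp: dif_def)
 thus ?thesis using assms meas_Coll[OF assms(1,3)] by auto
qed

lemma half_dif_open:
 assumes u: "to_one u" and W: "openin T W" "emeasure \<nu> W < \<infinity>" and K: "openin T K"
 shows "(%k. emeasure \<nu> {x : W. x : K & u k \<otimes> x ~: K}) \<longlonglongrightarrow> 0"
proof (rule emeasure_tendsto_zero)
 show "W : sets \<nu>" using W(1) by (simp add: sets_nu open_in_bor)
 show "emeasure \<nu> W < \<infinity>" by (rule W(2))
 show "{x : W. x : K & u k \<otimes> x ~: K} <= W" for k by auto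
 have "{x : W. x : K & u k \<otimes> x ~: K} = W \<inter> (K - {x : carrier P. u k \<otimes> x : K})" for k
  using openin_subset[OF W(1)] by (auto simp: topspace)
 thus "{x : W. x : K & u k \<otimes> x ~: K} : sets \<nu>" for k
  using open_in_bor[OF W(1)] open_in_bor[OF K] meas_Coll[OF to_one_D(1)[OF u], of K k] by (auto simp: sets_nu)
 fix x assume "x : W"
 show "\<forall>\<^sub>F k in sequentially. x ~: {x : W. x : K & u k \<otimes> x ~: K}"
 proof (cases "x : K")
  case True
  thus ?thesis using to_one_mult[OF u K] by (auto elim: eventually_mono)
 qed simp
qed

lemma leave_tends:
 assumes u: "to_one u" and W: "openin T W" "emeasure \<nu> W < \<infinity>"
 shows "(%k. emeasure \<nu> {x : W. u k \<otimes> x ~: W}) \<longlonglongrightarrow> 0"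
 using half_dif_open[OF u W W(1)] by simp

lemma dif_tendsto:
 assumes W: "openin T W" "emeasure \<nu> W < \<infinity>" and K: "K : sets \<B>" and u: "to_one u"
 shows "(%k. emeasure \<nu> (dif W K (u k))) \<longlonglongrightarrow> 0"
 using K unfolding sets_bor
proof (induction K rule: sigma_sets.induct)
 case (Basic K)
 hence K: "openin T K" by simp
 define a b c where "a k = emeasure \<nu> {x : W. x : K & u k \<otimes> x ~: K}"
  and "b k = emeasure \<nu> {x : W. x : K & inv (u k) \<otimes> x ~: K}" and "c k = emeasure \<nu> {x : W. u k \<otimes> x ~: W}" for k
 have WP: "W <= carrier P" using openin_subset[OF W(1)] by (simp add: topspace)
 have Wm: "W : sets \<B>" "K : sets \<B>" using W(1) K open_in_bor by auto
 have "(%k. a k + (b k + c k)) \<longlonglongrightarrow> 0 + (0 + 0)" unfolding a_def b_def c_def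
  by (intro tendsto_add half_dif_open[OF u W K] half_dif_open[OF to_one_inv[OF u] W K] leave_tends[OF u W])
 hence lim: "(%k. a k + (b k + c k)) \<longlonglongrightarrow> 0" by simp
 have "emeasure \<nu> (dif W K (u k)) <= a k + (b k + c k)" for k
 proof -
  note uk = to_one_D(1)[OF u, of k]
  define S where "S = {x : W. x : K & inv (u k) \<otimes> x ~: K}"
  define S' where "S' = {x : carrier P. u k \<otimes> x : S}"
  have Ssets: "S : sets \<B>"
  proof -
   have "S = W \<inter> (K - {x : carrier P. inv (u k) \<otimes> x : K})" using WP by (auto simp: S_def)
   thus ?thesis using Wm meas_Coll[OF inv_closed[OF uk] Wm(2)] by auto
  qed
  have sets: "{x : W. x : K & u k \<otimes> x ~: K} : sets \<B>" "S' : sets \<B>" "{x : W. u k \<otimes> x ~: W} : sets \<B>"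
  proof -
   have "{x : W. x : K & u k \<otimes> x ~: K} = W \<inter> (K - {x : carrier P. u k \<otimes> x : K})"
    "{x : W. u k \<otimes> x ~: W} = W - {x : carrier P. u k \<otimes> x : W}" using WP by auto
   thus "{x : W. x : K & u k \<otimes> x ~: K} : sets \<B>" "{x : W. u k \<otimes> x ~: W} : sets \<B>"
    using Wm meas_Coll[OF uk Wm(1)] meas_Coll[OF uk Wm(2)] by auto
   show "S' : sets \<B>" unfolding S'_def by (rule meas_Coll[OF uk Ssets])
  qed
  have "dif W K (u k) <= {x : W. x : K & u k \<otimes> x ~: K} \<union> (S' \<union> {x : W. u k \<otimes> x ~: W})"
  proof
   fix x assume x: "x : dif W K (u k)"
   hence xP: "x : W" "x : carrier P" using WP by (auto simp: dif_def)
   have "inv (u k) \<otimes> (u k \<otimes> x) = x" using uk xP by (simp add: m_assoc[symmetric])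
   thus "x : {x : W. x : K & u k \<otimes> x ~: K} \<union> (S' \<union> {x : W. u k \<otimes> x ~: W})"
    using x xP by (auto simp: dif_def S'_def S_def)
  qed
  hence "emeasure \<nu> (dif W K (u k)) <= emeasure \<nu> ({x : W. x : K & u k \<otimes> x ~: K} \<union> (S' \<union> {x : W. u k \<otimes> x ~: W}))"
   using sets by (intro emeasure_mono) (auto simp: sets_nu)
  also have "... <= a k + emeasure \<nu> (S' \<union> {x : W. u k \<otimes> x ~: W})"
   unfolding a_def using sets by (intro emeasure_subadditive) (auto simp: sets_nu)
  also have "emeasure \<nu> (S' \<union> {x : W. u k \<otimes> x ~: W}) <= emeasure \<nu> S' + c k"
   unfolding c_def using sets by (intro emeasure_subadditive) (auto simp: sets_nu)
  also have "emeasure \<nu> S' = b k" unfolding S'_def b_def S_def[symmetric] by (rule nu_translate[OF uk Ssets])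
  finally show ?thesis by (simp add: add_left_mono)
 qed
 thus ?case by (intro tendsto_sandwich[OF _ _ tendsto_const lim]) (auto intro!: always_eventually)
next
 case Empty
 thus ?case by (simp add: dif_def)
next
 case (Compl K)
 have "dif W (topspace T - K) (u k) = dif W K (u k)" for k
  using openin_subset[OF W(1)] to_one_D(1)[OF u, of k] by (auto simp: dif_def topspace)
 thus ?case using Compl.IH by simp
next
 case (Union A)
 have WP: "W <= carrier P" using openin_subset[OF W(1)] by (simp add: topspace)
 have Wm: "W : sets \<B>" using W(1) open_in_bor by auto
 have Am: "A i : sets \<B>" for i using Union.hyps by (simp add: sets_bor)
 define R where "R n = (\<Union>i. A i) - (\<Union>i<n. A i)" for n :: nat
 have Rm: "R n : sets \<B>" for n using Am by (auto simp: R_def)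
 have Rlim: "(%n. emeasure \<nu> (W \<inter> R n)) \<longlonglongrightarrow> 0"
 proof (rule emeasure_tendsto_zero)
  show "W \<inter> R n : sets \<nu>" "W \<inter> R n <= W" "W : sets \<nu>" "emeasure \<nu> W < \<infinity>" for n
   using Wm Rm W(2) by (auto simp: sets_nu)
  fix x
  show "\<forall>\<^sub>F n in sequentially. x ~: W \<inter> R n"
  proof (cases "EX i. x : A i")
   case True
   then obtain i where "x : A i" by auto
   hence "\<forall>n\<ge>Suc i. x ~: W \<inter> R n" by (auto simp: R_def)
   thus ?thesis unfolding eventually_sequentially by blast
  qed (simp add: R_def)
 qed
 show ?case
 proof (rule ennreal_tendsto_zeroI)
  fix e :: real assume e: "e > 0"
  obtain n where n: "emeasure \<nu> (W \<inter> R n) < ennreal (e/4)"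
   using order_tendstoD(2)[OF Rlim, of "ennreal (e/4)"] e by (auto simp: eventually_sequentially)
  define s where "s k = (\<Sum>i<n. emeasure \<nu> (dif W (A i) (u k))) + emeasure \<nu> {x : W. u k \<otimes> x ~: W}" for k
  have "s \<longlonglongrightarrow> (\<Sum>i<n. 0) + 0"
   unfolding s_def by (intro tendsto_add tendsto_sum Union.IH leave_tends[OF u W])
  hence "s \<longlonglongrightarrow> 0" by simp
  hence "\<forall>\<^sub>F k in sequentially. s k < ennreal (e/4)" using e by (intro order_tendstoD(2)) auto
  thus "\<forall>\<^sub>F k in sequentially. emeasure \<nu> (dif W (\<Union>i. A i) (u k)) < ennreal e"
  proof (rule eventually_mono)
   fix k assume sk: "s k < ennreal (e/4)"
   note uk = to_one_D(1)[OF u, of k]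
   let ?L = "{x : W. u k \<otimes> x ~: W}" and ?R' = "{x : carrier P. u k \<otimes> x : W \<inter> R n}"
   have Lm: "?L : sets \<B>"
   proof -
    have "?L = W - {x : carrier P. u k \<otimes> x : W}" using WP by auto
    thus ?thesis using Wm meas_Coll[OF uk Wm] by auto
   qed
   have R'm: "?R' : sets \<B>" using Wm Rm by (intro meas_Coll[OF uk]) auto
   have dm: "dif W (A i) (u k) : sets \<B>" for i by (rule dif_sets[OF uk Wm Am])
   have "dif W (\<Union>i. A i) (u k) <= (\<Union>i<n. dif W (A i) (u k)) \<union> ?L \<union> (W \<inter> R n) \<union> ?R'"
   proof
    fix x assume x: "x : dif W (\<Union>i. A i) (u k)"
    hence xP: "x : W" "x : carrier P" using WP by (auto simp: dif_def)
    consider "x : (\<Union>i. A i)" "u k \<otimes> x ~: (\<Union>i. A i)" | "x ~: (\<Union>i. A i)" "u k \<otimes> x : (\<Union>i. A i)"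
     using x by (auto simp: dif_def)
    thus "x : (\<Union>i<n. dif W (A i) (u k)) \<union> ?L \<union> (W \<inter> R n) \<union> ?R'"
    proof cases
     case 1
     thus ?thesis using xP by (cases "x : R n") (auto simp: R_def dif_def)
    next
     case 2
     thus ?thesis using xP by (cases "u k \<otimes> x : R n") (auto simp: R_def dif_def)
    qed
   qed
   hence "emeasure \<nu> (dif W (\<Union>i. A i) (u k)) <= emeasure \<nu> ((\<Union>i<n. dif W (A i) (u k)) \<union> ?L \<union> (W \<inter> R n) \<union> ?R')"
    using dm Lm R'm Wm Rm by (intro emeasure_mono) (auto simp: sets_nu)
   also have "... <= emeasure \<nu> ((\<Union>i<n. dif W (A i) (u k)) \<union> ?L \<union> (W \<inter> R n)) + emeasure \<nu> ?R'"
    using dm Lm R'm Wm Rm by (intro emeasure_subadditive) (auto simp: sets_nu)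
   also have "emeasure \<nu> ?R' = emeasure \<nu> (W \<inter> R n)" using Wm Rm by (intro nu_translate[OF uk]) auto
   also have "emeasure \<nu> ((\<Union>i<n. dif W (A i) (u k)) \<union> ?L \<union> (W \<inter> R n)) <= emeasure \<nu> ((\<Union>i<n. dif W (A i) (u k)) \<union> ?L) + emeasure \<nu> (W \<inter> R n)"
    using dm Lm R'm Wm Rm by (intro emeasure_subadditive) (auto simp: sets_nu)
   also have "emeasure \<nu> ((\<Union>i<n. dif W (A i) (u k)) \<union> ?L) <= emeasure \<nu> (\<Union>i<n. dif W (A i) (u k)) + emeasure \<nu> ?L"
    using dm Lm by (intro emeasure_subadditive) (auto simp: sets_nu)
   also have "emeasure \<nu> (\<Union>i<n. dif W (A i) (u k)) <= (\<Sum>i<n. emeasure \<nu> (dif W (A i) (u k)))"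
    using dm by (intro emeasure_subadditive_finite) (auto simp: sets_nu)
   finally have le: "emeasure \<nu> (dif W (\<Union>i. A i) (u k)) <= s k + emeasure \<nu> (W \<inter> R n) + emeasure \<nu> (W \<inter> R n)"
    by (simp add: s_def add_right_mono)
   note le
   also have "s k + emeasure \<nu> (W \<inter> R n) + emeasure \<nu> (W \<inter> R n) <= ennreal (e/4) + ennreal (e/4) + ennreal (e/4)"
    using n sk by (intro add_mono) auto
   also have "... = ennreal (3 * e / 4)" using e by (simp add: ennreal_plus[symmetric] del: ennreal_plus)
   also have "... < ennreal e" using e by (simp add: ennreal_less_iff)
   finally show "emeasure \<nu> (dif W (\<Union>i. A i) (u k)) < ennreal e" .
  qed
 qed
qed

text \<open>The sequence argument gives the statement about neighbourhoods, as there is a decreasing countable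
 base at the identity.\<close>

proposition translation_continuous:
 assumes W: "openin T W" "emeasure \<nu> W < \<infinity>" and K: "K : sets \<B>" and e: "(0::ennreal) < e"
 shows "EX V. openin T V & \<one> : V & (ALL u:V. emeasure \<nu> (dif W K u) < e)"
proof (rule ccontr)
 assume "~ ?thesis"
 hence neg: "EX u. u : V & ~ emeasure \<nu> (dif W K u) < e" if "openin T V" "\<one> : V" for V using that by blast
 obtain B where B: "countable B" "!!V. V : B ==> openin T V"
  "!!U x. openin T U ==> x : U ==> EX V. V : B & x : V & V <= U" using second_countable_base[OF sc] by metis
 define B1 where "B1 = {V : B. \<one> : V}"
 have "B1 ~= {}" using B(3)[OF openin_topspace, of \<one>] by (auto simp: B1_def topspace)
 moreover have "countable B1" using B(1) by (simp add: B1_def)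
 ultimately have r: "range (from_nat_into B1) = B1" by simp
 define b where "b = from_nat_into B1"
 have b: "b k : B1" for k using r by (auto simp: b_def)
 define N where "N k = (\<Inter>j\<le>k. b j)" for k :: nat
 have N: "openin T (N k)" "\<one> : N k" for k
  unfolding N_def using b B(2) by (auto simp: B1_def intro!: openin_Inter)
 have "ALL k. EX u. u : N k & ~ emeasure \<nu> (dif W K u) < e" using neg N by blast
 then obtain u where u: "!!k. u k : N k" "!!k. ~ emeasure \<nu> (dif W K (u k)) < e" by metis
 have "to_one u" unfolding to_one_def
 proof (intro conjI allI impI)
  show "range u <= carrier P" using u(1) N(1) openin_subset[of T] by (auto simp: topspace)
  fix U assume U: "openin T U" "\<one> : U"
  obtain V where V: "V : B" "\<one> : V" "V <= U" using B(3)[OF U] by (elim exE conjE)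
  hence "V : range b" using r by (simp add: B1_def b_def)
  then obtain j where j: "V = b j" by auto
  have "u k : U" if "k >= j" for k using u(1)[of k] V(3) that by (auto simp: N_def j)
  thus "\<forall>\<^sub>F k in sequentially. u k : U" by (auto simp: eventually_sequentially)
 qed
 from order_tendstoD(2)[OF dif_tendsto[OF W K this] e] have "\<forall>\<^sub>F k in sequentially. False"
  using u(2) by simp
 thus False by simp
qed

lemma AE_ex: assumes "AE x in \<nu>. R x" shows "EX x:carrier P. R x"
proof (rule ccontr)
 assume n: "~ ?thesis"
 have "AE x in \<nu>. False"
  using assms by (rule AE_mp) (intro AE_I2 impI, use n in "simp add: space_nu")
 thus False using nu_not_null by simp
qed

text \<open>Fubini for \<open>(x, y) \<mapsto> x\<inverse> y\<close>: a null set pulls back to a null set, whose other slices are left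
 translates of the inverse of the set.\<close>

lemma AE_inv: assumes "AE x in \<nu>. R x" shows "AE x in \<nu>. R (inv x)"
proof -
 obtain N where N: "N : sets \<B>" "emeasure \<nu> N = 0" "{x : carrier P. ~ R x} <= N"
  using assms by (auto simp: eventually_ae_filter null_sets_def space_nu sets_nu)
 have nN: "AE x in \<nu>. x ~: N" using N by (intro AE_not_in) (auto simp: sets_nu)
 interpret pair_sigma_finite \<nu> \<nu> by standard
 have quot: "(%z. inv (fst z) \<otimes> snd z) : measurable (\<nu> \<Otimes>\<^sub>M \<nu>) \<B>"
  using continuous_map_prod_bor[OF sc sc cont_quot] by (simp only: measurable_cong_sets[OF sets_pair_measure_cong[OF sets_nu sets_nu] refl])
 have ms: "{z : space (\<nu> \<Otimes>\<^sub>M \<nu>). inv (fst z) \<otimes> snd z ~: N} : sets (\<nu> \<Otimes>\<^sub>M \<nu>)"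
 proof -
  note [measurable] = quot N(1)
  show ?thesis by measurable
 qed
 have "AE x in \<nu>. AE y in \<nu>. inv x \<otimes> y ~: N"
  by (rule AE_I2) (use AE_left[OF _ nN] in "simp add: space_nu")
 hence "AE y in \<nu>. AE x in \<nu>. inv x \<otimes> y ~: N"
  using AE_commute[of "%x y. inv x \<otimes> y ~: N"] ms by simp
 from AE_ex[OF this] obtain y where y: "y : carrier P" "AE x in \<nu>. inv x \<otimes> y ~: N" by blast
 from AE_left[OF y] show ?thesis
 proof (rule AE_mp, intro AE_I2 impI)
  fix x assume x: "x : space \<nu>" "inv (y \<otimes> x) \<otimes> y ~: N"
  have "inv (y \<otimes> x) \<otimes> y = inv x" using x(1) y(1) by (simp add: space_nu inv_mult_group m_assoc)
  thus "R (inv x)" using x N(3) by (auto simp: space_nu)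
 qed
qed

end

text \<open>\<open>p\<close> is an endomorphism, later the projection to some of the factors of a product, and the
 closure of \<open>H\<close> contains its image.\<close>

locale dense_part = lattice_measure P T \<Delta> \<mu>
 for P :: "'g monoid" (structure) and T \<Delta> \<mu> +
 fixes p :: "'g => 'g" and H :: "'g set"
 assumes p_cont: "continuous_map T T p"
  and p_mult: "!!x y. x : carrier P ==> y : carrier P ==> p (x \<otimes> y) = p x \<otimes> p y"
  and H_sub: "H <= carrier P"
  and H_dense: "!!w U. w : carrier P ==> openin T U ==> p w : U ==> H \<inter> U ~= {}"
begin

lemma p_closed: "x : carrier P ==> p x : carrier P" using p_cont by (auto simp: continuous_map_def topspace)

lemma p_inv: "x : carrier P ==> p (inv x) = inv (p x)"
 by (rule endo_inv) (auto simp: hom_def p_closed p_mult)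

text \<open>Invariance under a dense subgroup is invariance, by continuity of translation.\<close>

lemma invariant_under_closure:
 assumes E: "E : sets \<B>" and inv: "!!h. h : H ==> AE x in \<nu>. (h \<otimes> x : E) = (x : E)" and w: "w : carrier P"
 shows "AE x in \<nu>. (p w \<otimes> x : E) = (x : E)"
proof -
 note pw = p_closed[OF w]
 have *: "emeasure \<nu> (dif (Op k) E (p w)) = 0" for k
 proof (rule ccontr)
  assume "emeasure \<nu> (dif (Op k) E (p w)) ~= 0"
  hence pos: "0 < emeasure \<nu> (dif (Op k) E (p w))" by (simp add: zero_less_iff_neq_zero)
  obtain V where V: "openin T V" "\<one> : V" "ALL u:V. emeasure \<nu> (dif (Op k) E u) < emeasure \<nu> (dif (Op k) E (p w))"
   using translation_continuous[OF Op_open nu_Op E pos] by blast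
  define U where "U = {x : carrier P. inv x \<otimes> p w : V}"
  have "openin T {x : topspace T. inv x : {y : carrier P. y \<otimes> p w : V}}"
   by (rule openin_continuous_map_preimage[OF cont_inv open_right[OF pw V(1)]])
  also have "{x : topspace T. inv x : {y : carrier P. y \<otimes> p w : V}} = U" by (auto simp: U_def topspace)
  finally have "openin T U" .
  moreover have "p w : U" using pw V(2) by (simp add: U_def)
  ultimately have "H \<inter> U ~= {}" by (rule H_dense[OF w])
  then obtain h where h: "h : H" "h : carrier P" "inv h \<otimes> p w : V" by (auto simp: U_def)
  let ?u = "inv h \<otimes> p w"
  have u: "?u : carrier P" "h \<otimes> ?u = p w" using h pw by (simp_all add: m_assoc[symmetric])
  have "AE x in \<nu>. (h \<otimes> (?u \<otimes> x) : E) = (?u \<otimes> x : E)" using AE_left[OF u(1) inv[OF h(1)]] .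
  hence "AE x in \<nu>. (x : dif (Op k) E (p w)) = (x : dif (Op k) E ?u)"
  proof (rule AE_mp, intro AE_I2 impI)
   fix x assume x: "x : space \<nu>" "(h \<otimes> (?u \<otimes> x) : E) = (?u \<otimes> x : E)"
   have "h \<otimes> (?u \<otimes> x) = (h \<otimes> ?u) \<otimes> x"
    by (rule m_assoc[symmetric]) (use x(1) h(2) u(1) in "simp_all only: space_nu")
   hence "h \<otimes> (?u \<otimes> x) = p w \<otimes> x" by (simp only: u(2))
   thus "(x : dif (Op k) E (p w)) = (x : dif (Op k) E ?u)" using x(2) by (simp add: dif_def)
  qed
  hence "emeasure \<nu> (dif (Op k) E (p w)) = emeasure \<nu> (dif (Op k) E ?u)"
   using dif_sets[OF pw open_in_bor[OF Op_open] E] dif_sets[OF u(1) open_in_bor[OF Op_open] E]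
   by (intro emeasure_eq_AE) (auto simp: sets_nu)
  thus False using V(3) h(3) by auto
 qed
 have "AE x in \<nu>. ALL k. x ~: dif (Op k) E (p w)" unfolding AE_all_countable
  using * dif_sets[OF pw open_in_bor[OF Op_open] E] by (intro allI AE_not_in) (auto simp: sets_nu)
 thus ?thesis
 proof (rule AE_mp, intro AE_I2 impI)
  fix x assume x: "x : space \<nu>" "ALL k. x ~: dif (Op k) E (p w)"
  then obtain k where "x : Op k" using Op(2) by (auto simp: space_nu)
  thus "(p w \<otimes> x : E) = (x : E)" using x(2) by (auto simp: dif_def)
 qed
qed

text \<open>Up to inversion and a null set, an invariant set does not depend on the part \<open>p\<close> of its points:
 that part may be replaced by the one of a suitable fixed \<open>t\<close>.\<close>

proposition invariant_set_factors:
 assumes E: "E : sets \<B>" and inv: "!!h. h : H ==> AE x in \<nu>. (h \<otimes> x : E) = (x : E)"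
 shows "EX t:carrier P. AE b in \<nu>. (inv (b \<otimes> p (inv b \<otimes> t)) : E) = (inv b : E)"
proof -
 define B where "B = {b : carrier P. inv b : E}"
 have B: "B : sets \<B>" using measurable_sets[OF meas_inv E] by (simp add: B_def vimage_def Int_def topspace conj_commute)
 have pi: "AE b in \<nu>. (b \<otimes> p w : B) = (b : B)" if w: "w : carrier P" for w
 proof -
  have i: "AE x in \<nu>. (p (inv w) \<otimes> x : E) = (x : E)"
   by (rule invariant_under_closure[OF E inv inv_closed[OF w]])
  show ?thesis using AE_inv[OF i]
 proof (rule AE_mp, intro AE_I2 impI)
  fix b assume b: "b : space \<nu>" "(p (inv w) \<otimes> inv b : E) = (inv b : E)"
  thus "(b \<otimes> p w : B) = (b : B)"
   using p_closed[OF w] w by (simp add: B_def space_nu inv_mult_group p_inv)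
 qed
 qed
 interpret pair_sigma_finite \<nu> \<nu> by standard
 have c2: "continuous_map (prod_topology T T) T (%z. fst z \<otimes> p (snd z))"
  using continuous_map_compose[OF continuous_map_pairedI[OF continuous_map_fst
    continuous_map_compose[OF continuous_map_snd p_cont]] cont_mult] by (simp add: o_def)
 have c3: "continuous_map (prod_topology T T) T (%z. fst z \<otimes> p (inv (fst z) \<otimes> snd z))"
  using continuous_map_compose[OF continuous_map_pairedI[OF continuous_map_fst
    continuous_map_compose[OF cont_quot p_cont]] cont_mult] by (simp add: o_def)
 have m2: "f : measurable (\<nu> \<Otimes>\<^sub>M \<nu>) \<B>" if "continuous_map (prod_topology T T) T f" for f
  using continuous_map_prod_bor[OF sc sc that] by (simp only: measurable_cong_sets[OF sets_pair_measure_cong[OF sets_nu sets_nu] refl])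
 have ms: "{z : space (\<nu> \<Otimes>\<^sub>M \<nu>). (f z : B) = (fst z : B)} : sets (\<nu> \<Otimes>\<^sub>M \<nu>)"
  if f: "continuous_map (prod_topology T T) T f" for f
 proof -
  note [measurable] = m2[OF f] m2[OF continuous_map_fst] B
  show ?thesis by measurable
 qed
 have "AE t in \<nu>. AE b in \<nu>. (b \<otimes> p t : B) = (b : B)" by (rule AE_I2) (use pi in "simp add: space_nu")
 hence bt: "AE b in \<nu>. AE t in \<nu>. (b \<otimes> p t : B) = (b : B)"
  using AE_commute[of "%b t. (b \<otimes> p t : B) = (b : B)"] ms[OF c2] by simp
 have "AE b in \<nu>. AE t in \<nu>. (b \<otimes> p (inv b \<otimes> t) : B) = (b : B)"
 proof (rule AE_mp[OF bt], rule AE_I2, rule impI)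
  fix b assume b: "b : space \<nu>" "AE t in \<nu>. (b \<otimes> p t : B) = (b : B)"
  show "AE t in \<nu>. (b \<otimes> p (inv b \<otimes> t) : B) = (b : B)"
   using AE_left[OF _ b(2), of "inv b"] b(1) by (simp add: space_nu)
 qed
 hence "AE t in \<nu>. AE b in \<nu>. (b \<otimes> p (inv b \<otimes> t) : B) = (b : B)"
  using AE_commute[of "%b t. (b \<otimes> p (inv b \<otimes> t) : B) = (b : B)"] ms[OF c3] by simp
 from AE_ex[OF this] obtain t where t: "t : carrier P" "AE b in \<nu>. (b \<otimes> p (inv b \<otimes> t) : B) = (b : B)"
  by blast
 have "AE b in \<nu>. (inv (b \<otimes> p (inv b \<otimes> t)) : E) = (inv b : E)"
  using t(2) by (rule AE_mp) (intro AE_I2 impI, use t(1) p_closed in "auto simp: space_nu B_def")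
 thus ?thesis using t(1) by blast
qed

end

text \<open>Every element is the product of a part from the image of \<open>q\<close> and one from the image of \<open>p\<close>.\<close>

locale split_part = dense_part P T \<Delta> \<mu> p H
 for P :: "'g monoid" (structure) and T \<Delta> \<mu> p H +
 fixes q :: "'g => 'g"
 assumes q_cont: "continuous_map T T q"
  and q_mult: "!!x y. x : carrier P ==> y : carrier P ==> q (x \<otimes> y) = q x \<otimes> q y"
  and q_q: "!!x. x : carrier P ==> q (q x) = q x"
  and q_p: "!!x. x : carrier P ==> q x \<otimes> p x = x"
begin

lemma q_closed: "x : carrier P ==> q x : carrier P" using q_cont by (auto simp: continuous_map_def topspace)

lemma q_inv: "x : carrier P ==> q (inv x) = inv (q x)"
 by (rule endo_inv) (auto simp: hom_def q_closed q_mult)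

text \<open>After inversion an invariant set depends on the part \<open>q\<close> only, so right translation by an element
 with small part \<open>q\<close> hardly moves it, no matter how large the element is.\<close>

proposition small_part_translate_meets:
 assumes E: "E : sets \<B>" and inv: "!!h. h : H ==> AE x in \<nu>. (h \<otimes> x : E) = (x : E)"
  and pos: "~ (AE x in \<nu>. x ~: E)"
 shows "EX V. openin T V & \<one> : V & (ALL \<gamma>:carrier P. q \<gamma> : V --> ~ (AE x in \<nu>. ~ (x : E & x \<otimes> \<gamma> : E)))"
proof -
 obtain t where t: "t : carrier P" "AE b in \<nu>. (inv (b \<otimes> p (inv b \<otimes> t)) : E) = (inv b : E)"
  using invariant_set_factors[OF E inv] by blast
 define B where "B = {b : carrier P. inv (q b \<otimes> p t) : E}"
 have mix: "b \<otimes> p (inv b \<otimes> t) = q b \<otimes> p t" if b: "b : carrier P" for b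
 proof -
  have "b \<otimes> p (inv b \<otimes> t) = (q b \<otimes> p b) \<otimes> (inv (p b) \<otimes> p t)" using b t(1) by (simp add: q_p p_mult p_inv)
  also have "... = q b \<otimes> (p b \<otimes> (inv (p b) \<otimes> p t))"
   using b t(1) p_closed q_closed by (simp add: m_assoc)
  also have "p b \<otimes> (inv (p b) \<otimes> p t) = p t" using b t(1) p_closed by (simp add: m_assoc[symmetric])
  finally show ?thesis .
 qed
 have BE: "AE b in \<nu>. (b : B) = (inv b : E)"
  by (rule AE_mp[OF t(2)], rule AE_I2, rule impI) (simp add: B_def mix space_nu)
 have Bm: "B : sets \<B>"
 proof -
  note pt = p_closed[OF t(1)]
  note [measurable] = continuous_map_bor[OF q_cont] E
  have "(%b. inv (q b \<otimes> p t)) -` E \<inter> space \<B> : sets \<B>" using pt by measurable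
  thus ?thesis by (simp add: B_def vimage_def Int_def topspace conj_commute)
 qed
 have "EX k. emeasure \<nu> (Op k \<inter> B) ~= 0"
 proof (rule ccontr)
  assume "~ ?thesis"
  hence "AE b in \<nu>. ALL k. b ~: Op k \<inter> B"
   unfolding AE_all_countable using Bm open_in_bor[OF Op_open]
   by (intro allI AE_not_in) (auto simp: null_sets_def sets_nu)
  hence "AE b in \<nu>. b ~: B"
  proof (rule AE_mp, intro AE_I2 impI)
   fix b assume b: "b : space \<nu>" "ALL k. b ~: Op k \<inter> B"
   thus "b ~: B" using Op(2) by (auto simp: space_nu)
  qed
  with BE have "AE b in \<nu>. inv b ~: E" by eventually_elim simp
  from AE_inv[OF this] have "AE b in \<nu>. b ~: E"
   by (rule AE_mp) (intro AE_I2 impI, simp add: space_nu)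
  thus False using pos by simp
 qed
 then obtain k where "0 < emeasure \<nu> (Op k \<inter> B)" by (auto simp: zero_less_iff_neq_zero)
 from translation_continuous[OF Op_open nu_Op Bm this] obtain V0 where V0: "openin T V0" "\<one> : V0"
  "ALL u:V0. emeasure \<nu> (dif (Op k) B u) < emeasure \<nu> (Op k \<inter> B)" by blast
 define V where "V = {x : topspace T. inv x : V0}"
 have "openin T V" unfolding V_def by (rule openin_continuous_map_preimage[OF cont_inv V0(1)])
 moreover have "\<one> : V" using V0(2) by (simp add: V_def topspace)
 moreover have False if g: "\<gamma> : carrier P" "q \<gamma> : V" and nul: "AE x in \<nu>. ~ (x : E & x \<otimes> \<gamma> : E)" for \<gamma>
 proof -
  define u where "u = q (inv \<gamma>)"
  have ig: "inv \<gamma> : carrier P" using g by simp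
  have u: "u : V0" "u : carrier P" using g q_closed by (auto simp: u_def q_inv V_def)
  have ub: "(u \<otimes> b : B) = (inv \<gamma> \<otimes> b : B)" if b: "b : carrier P" for b
  proof -
   have "q (u \<otimes> b) = q (inv \<gamma> \<otimes> b)"
    using q_mult[OF u(2) b] q_mult[OF ig b] q_q[OF ig] by (simp add: u_def)
   thus ?thesis using b u(2) ig by (simp add: B_def)
  qed
  have 1: "AE b in \<nu>. ~ (inv b : E & inv b \<otimes> \<gamma> : E)" using AE_inv[OF nul] .
  have "AE b in \<nu>. ~ (b : B & u \<otimes> b : B)" using 1 BE AE_left[OF ig BE] AE_space
  proof eventually_elim
   case (elim b)
   have b: "b : carrier P" using elim(4) by (simp add: space_nu)
   have "inv (inv \<gamma> \<otimes> b) = inv b \<otimes> \<gamma>" using b g by (simp add: inv_mult_group)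
   thus ?case using elim ub[OF b] by auto
  qed
  hence "AE b in \<nu>. b : Op k \<inter> B --> b : dif (Op k) B u"
   by (rule AE_mp) (intro AE_I2 impI, auto simp: dif_def)
  hence "emeasure \<nu> (Op k \<inter> B) <= emeasure \<nu> (dif (Op k) B u)"
   using dif_sets[OF u(2) open_in_bor[OF Op_open] Bm] by (intro emeasure_mono_AE) (auto simp: sets_nu)
  thus False using V0(3) u(1) by (auto simp: not_less[symmetric])
 qed
 ultimately show ?thesis by blast
qed

end

lemma (in dense_part) invariant_set_trivial:
 assumes p: "!!x. x : carrier P ==> p x = x"
  and E: "E : sets \<B>" and inv: "!!h. h : H ==> AE x in \<nu>. (h \<otimes> x : E) = (x : E)"
 shows "(AE x in \<nu>. x : E) | (AE x in \<nu>. x ~: E)"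
proof -
 obtain t where t: "t : carrier P" "AE b in \<nu>. (inv (b \<otimes> p (inv b \<otimes> t)) : E) = (inv b : E)"
  using invariant_set_factors[OF E inv] by blast
 have "AE b in \<nu>. (inv t : E) = (inv b : E)"
 proof (rule AE_mp[OF t(2)], rule AE_I2, rule impI)
  fix b assume b: "b : space \<nu>" "(inv (b \<otimes> p (inv b \<otimes> t)) : E) = (inv b : E)"
  have "b \<otimes> p (inv b \<otimes> t) = t" using b(1) t(1) p[of "inv b \<otimes> t"] by (simp add: space_nu m_assoc[symmetric])
  thus "(inv t : E) = (inv b : E)" using b(2) by simp
 qed
 from AE_inv[OF this] have "AE b in \<nu>. (inv t : E) = (b : E)"
  by (rule AE_mp) (intro AE_I2 impI, simp add: space_nu)
 thus ?thesis by (cases "inv t : E") auto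
qed

context lattice_measure
begin

text \<open>Finite averages of left translates by elements of \<open>N\<close>, as operators on functions on the group.\<close>

inductive avg :: "'g set => (('g => real) => 'g => real) => bool" for N where
 shift: "w : N ==> avg N (%f x. f (w \<otimes> x))"
| mid: "avg N A ==> avg N B ==> avg N (%f x. (A f x + B f x) / 2)"

context
 fixes N assumes N: "N <= carrier P"
begin

lemma avg_mono: "avg N A ==> x : carrier P ==> (!!y. y : carrier P ==> f y <= g y) ==> A f x <= A g x"
 by (induction rule: avg.induct) (use N in "auto intro!: divide_right_mono add_mono")

lemma avg_cong: "avg N A ==> x : carrier P ==> (!!y. y : carrier P ==> f y = g y) ==> A f x = A g x"
 by (rule antisym; rule avg_mono) auto

lemma avg_const: "avg N A ==> A (%_. c) x = c" by (induction rule: avg.induct) auto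

lemma avg_add: "avg N A ==> A (%y. f y + g y) x = A f x + A g x"
 by (induction rule: avg.induct) (auto simp: field_simps)

lemma avg_cmult: "avg N A ==> A (%y. c * f y) x = c * A f x"
 by (induction rule: avg.induct) (auto simp: field_simps)

lemma avg_sum: assumes "avg N A" shows "A (%y. \<Sum>i\<in>S. f i y) x = (\<Sum>i\<in>S. A (f i) x)"
 by (induction S rule: infinite_finite_induct) (auto simp: avg_add[OF assms] avg_const[OF assms])

lemma avg_meas: "avg N A ==> f : borel_measurable \<B> ==> A f : borel_measurable \<B>"
proof (induction rule: avg.induct)
 case (shift w)
 thus ?case using N by (intro measurable_compose[OF meas_left]) auto
next
 case (mid A B)
 thus ?case by (intro borel_measurable_divide borel_measurable_add) auto
qed

lemma avg_right: "avg N A ==> x : carrier P ==> y : carrier P ==> A f (x \<otimes> y) = A (%z. f (z \<otimes> y)) x"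
 by (induction rule: avg.induct) (use N in "auto simp: m_assoc subset_eq")

lemma avg_shift:
 assumes "avg N A" and w: "w : N" and cl: "!!x y. x : N ==> y : N ==> x \<otimes> y : N"
 shows "EX B. avg N B & (ALL f. ALL x:carrier P. A f (w \<otimes> x) = B f x)"
 using assms(1)
proof (induction rule: avg.induct)
 case (shift v)
 thus ?case using avg.shift[OF cl[OF shift w]] N w
  by (intro exI[of _ "%f x. f ((v \<otimes> w) \<otimes> x)"]) (auto simp: m_assoc subset_eq)
next
 case (mid A B)
 then obtain A' B' where "avg N A'" "ALL f. ALL x:carrier P. A f (w \<otimes> x) = A' f x"
  "avg N B'" "ALL f. ALL x:carrier P. B f (w \<otimes> x) = B' f x" by blast
 thus ?case using avg.mid[of N A' B'] by (intro exI[of _ "%f x. (A' f x + B' f x) / 2"]) simp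
qed

end

lemma avg_mono_AE:
 assumes N: "N <= carrier P" and A: "avg N A" and le: "AE x in \<nu>. f x <= g x"
 shows "AE x in \<nu>. A f x <= A g x" using A
proof (induction rule: avg.induct)
 case (shift w)
 thus ?case using AE_left[OF _ le, of w] N by auto
next
 case (mid A B)
 from mid.IH show ?case by eventually_elim (simp add: divide_right_mono add_mono)
qed

text \<open>Translates of an \<open>L\<close>-invariant function by elements that normalise \<open>L\<close> are \<open>L\<close>-invariant.\<close>

lemma avg_invariant:
 assumes N: "N <= carrier P" and L: "L <= carrier P" and A: "avg N A"
  and nrm: "!!w l. w : N ==> l : L ==> EX l':L. w \<otimes> l = l' \<otimes> w"
  and inv: "!!l. l : L ==> AE x in \<nu>. f (l \<otimes> x) = f x"
 shows "ALL l:L. AE x in \<nu>. A f (l \<otimes> x) = A f x" using A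
proof (induction rule: avg.induct)
 case (shift w)
 show ?case
 proof
  fix l assume l: "l : L"
  obtain l' where l': "l' : L" "w \<otimes> l = l' \<otimes> w" using nrm[OF shift l] by blast
  have P: "w : carrier P" "l : carrier P" "l' : carrier P" using shift l l' N L by auto
  show "AE x in \<nu>. f (w \<otimes> (l \<otimes> x)) = f (w \<otimes> x)"
   using AE_left[OF P(1) inv[OF l'(1)]] AE_space
  proof eventually_elim
   case (elim x)
   hence "x : carrier P" by (simp add: space_nu)
   hence "w \<otimes> (l \<otimes> x) = l' \<otimes> (w \<otimes> x)" using P l'(2) by (metis m_assoc)
   thus ?case using elim(1) by simp
  qed
 qed
next
 case (mid A B)
 show ?case
 proof
  fix l assume "l : L"
  hence "AE x in \<nu>. A f (l \<otimes> x) = A f x" "AE x in \<nu>. B f (l \<otimes> x) = B f x" using mid.IH by auto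
  thus "AE x in \<nu>. (A f (l \<otimes> x) + B f (l \<otimes> x)) / 2 = (A f x + B f x) / 2" by eventually_elim simp
 qed
qed

lemma avg_commute:
 assumes N: "N <= carrier P" and A: "avg N A" and h: "h : carrier P" "!!w. w : N ==> w \<otimes> h = h \<otimes> w"
  and x: "x : carrier P"
 shows "A f (h \<otimes> x) = A (%y. f (h \<otimes> y)) x" using A
proof (induction rule: avg.induct)
 case (shift w)
 hence "w \<otimes> (h \<otimes> x) = h \<otimes> (w \<otimes> x)" using h x N by (metis m_assoc subsetD)
 thus ?case by simp
qed simp

end

section \<open>Equivariant functions and invariant vectors\<close>

locale equivariant = lattice_measure P T \<Delta> \<mu>
 for P :: "'g monoid" (structure) and T \<Delta> \<mu> +
 fixes Z :: "'z set" and act :: "'g => 'z => 'z"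
 assumes Z_countable: "countable Z"
  and act_bij: "!!\<gamma>. \<gamma> : \<Delta> ==> bij_betw (act \<gamma>) Z Z"
begin

text \<open>Measurable functions from the group to the functions on \<open>Z\<close>, equivariant under the lattice.\<close>

definition eqv :: "('g => 'z => real) => bool" where
 "eqv v \<longleftrightarrow> (ALL z:Z. (%x. v x z) : borel_measurable \<B>) &
  (ALL x:carrier P. ALL \<gamma>:\<Delta>. ALL z:Z. v (x \<otimes> \<gamma>) z = v x (act \<gamma> z))"

lemma eqv_meas: "eqv v ==> z : Z ==> (%x. v x z) : borel_measurable \<B>" by (simp add: eqv_def)
lemma eqv_act: "eqv v ==> x : carrier P ==> \<gamma> : \<Delta> ==> z : Z ==> v (x \<otimes> \<gamma>) z = v x (act \<gamma> z)" by (simp add: eqv_def)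

abbreviation "\<Omega> == count_space Z \<Otimes>\<^sub>M \<mu>"

text \<open>An equivariant function is determined by its values on the section.\<close>

definition lift :: "('g => 'z => real) => 'z \<times> 'g set => real" where
 "lift v = (%(z, C). v (sec C) z)"

text \<open>The square of the norm of an equivariant function \<open>v\<close>, an element of \<open>L\<^sup>2\<close> of the bundle over the
 coset space with fibre \<open>Z\<close>.\<close>

definition sq :: "('g => 'z => real) => ennreal" where "sq v = nsq \<Omega> (lift v)"

lemma lift_meas: "eqv v ==> lift v : borel_measurable \<Omega>" unfolding lift_def
 by (rule measurable_pair_measure_countable1[OF Z_countable])
  (use measurable_compose[OF meas_sec eqv_meas] in simp)

lemma sf_Z: "sigma_finite_measure (count_space Z)"
 by (rule sigma_finite_measure_count_space_countable[OF Z_countable])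

lemma sf_pair: "pair_sigma_finite (count_space Z) \<mu>"
 using sf_Z by (simp add: pair_sigma_finite_def sigma_finite_measure_axioms)

lemma sq_iterated:
 assumes v: "eqv v"
 shows "sq v = (\<integral>\<^sup>+C. (\<integral>\<^sup>+z. ennreal ((v (sec C) z)\<^sup>2) \<partial>count_space Z) \<partial>\<mu>)"
  and "(%C. \<integral>\<^sup>+z. ennreal ((v (sec C) z)\<^sup>2) \<partial>count_space Z) : borel_measurable \<mu>"
proof -
 have m: "(%y. ennreal ((lift v y)\<^sup>2)) : borel_measurable \<Omega>" using lift_meas[OF v] by measurable
 show "sq v = (\<integral>\<^sup>+C. (\<integral>\<^sup>+z. ennreal ((v (sec C) z)\<^sup>2) \<partial>count_space Z) \<partial>\<mu>)"
  using pair_sigma_finite.nn_integral_snd[OF sf_pair m] by (simp add: sq_def nsq_def lift_def)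
 show "(%C. \<integral>\<^sup>+z. ennreal ((v (sec C) z)\<^sup>2) \<partial>count_space Z) : borel_measurable \<mu>"
  using sigma_finite_measure.borel_measurable_nn_integral_fst[OF sf_Z measurable_compose[OF measurable_pair_swap' m]]
  by (simp add: lift_def)
qed

lemma eqv_shift: assumes v: "eqv v" and w: "w : carrier P" shows "eqv (%x. v (w \<otimes> x))"
 unfolding eqv_def
proof (intro conjI ballI)
 show "(%x. v (w \<otimes> x) z) : borel_measurable \<B>" if "z : Z" for z
  by (rule measurable_compose[OF meas_left[OF w] eqv_meas[OF v that]])
 show "v (w \<otimes> (x \<otimes> \<gamma>)) z = v (w \<otimes> x) (act \<gamma> z)" if "x : carrier P" "\<gamma> : \<Delta>" "z : Z" for x \<gamma> z
  using eqv_act[OF v, of "w \<otimes> x" \<gamma> z] that w D_sub by (simp add: m_assoc)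
qed

text \<open>Translation permutes the cosets and changes their representatives by lattice elements, which
 act on \<open>Z\<close> by bijections.\<close>

lemma sq_shift: assumes v: "eqv v" and w: "w : carrier P" shows "sq (%x. v (w \<otimes> x)) = sq v"
proof -
 define F where "F C = (\<integral>\<^sup>+z. ennreal ((v (sec C) z)\<^sup>2) \<partial>count_space Z)" for C
 have "sq (%x. v (w \<otimes> x)) = (\<integral>\<^sup>+C. (\<integral>\<^sup>+z. ennreal ((v (w \<otimes> sec C) z)\<^sup>2) \<partial>count_space Z) \<partial>\<mu>)"
  by (rule sq_iterated(1)[OF eqv_shift[OF v w]])
 also have "... = (\<integral>\<^sup>+C. F (w <# C) \<partial>\<mu>)"
 proof (rule nn_integral_cong)
  fix C assume "C : space \<mu>"
  hence C: "C : Q" by (simp add: space_mu)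
  note wC = coset_image[OF w C]
  have "w \<otimes> sec C : w <# C" using sec(1)[OF C] wC(1) by auto
  from Q_rel[OF wC(2) sec(1)[OF wC(2)] this] have g: "inv (sec (w <# C)) \<otimes> (w \<otimes> sec C) : \<Delta>" .
  define \<gamma> where "\<gamma> = inv (sec (w <# C)) \<otimes> (w \<otimes> sec C)"
  have sC: "sec (w <# C) : carrier P" "sec C : carrier P" using sec(3) wC(2) C by auto
  have eq: "w \<otimes> sec C = sec (w <# C) \<otimes> \<gamma>" using sC w by (simp add: \<gamma>_def m_assoc[symmetric])
  have "(\<integral>\<^sup>+z. ennreal ((v (w \<otimes> sec C) z)\<^sup>2) \<partial>count_space Z) =
    (\<integral>\<^sup>+z. ennreal ((v (sec (w <# C)) (act \<gamma> z))\<^sup>2) \<partial>count_space Z)"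
   unfolding eq by (rule nn_integral_cong) (use eqv_act[OF v sC(1) g[folded \<gamma>_def]] in simp)
  also have "... = F (w <# C)"
   unfolding F_def by (rule nn_integral_bij_count_space[OF act_bij[OF g[folded \<gamma>_def]]])
  finally show "(\<integral>\<^sup>+z. ennreal ((v (w \<otimes> sec C) z)\<^sup>2) \<partial>count_space Z) = F (w <# C)" .
 qed
 also have "... = (\<integral>\<^sup>+C. F C \<partial>\<mu>)"
  by (rule nn_integral_shift[OF w]) (use sq_iterated(2)[OF v] in "simp add: F_def")
 also have "... = sq v" unfolding F_def by (rule sq_iterated(1)[OF v, symmetric])
 finally show ?thesis .
qed

text \<open>Equivariant statements need only be checked on the section.\<close>

lemma AE_Omega:
 assumes R: "AE y in \<Omega>. R (fst y) (sec (snd y))"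
  and eq: "!!x \<gamma> z. x : carrier P ==> \<gamma> : \<Delta> ==> z : Z ==> R (act \<gamma> z) x ==> R z (x \<otimes> \<gamma>)"
 shows "AE x in \<nu>. ALL z:Z. R z x" unfolding AE_nu_iff
proof -
 have "AE z in count_space Z. AE C in \<mu>. R z (sec C)" using pair_sigma_finite.AE_pair[OF sf_pair R] by simp
 hence "ALL z:Z. AE C in \<mu>. R z (sec C)" by (simp add: AE_count_space)
 hence "AE C in \<mu>. ALL z:Z. R z (sec C)" by (simp add: AE_ball_countable[OF Z_countable])
 thus "AE C in \<mu>. ALL x:C. ALL z:Z. R z x"
 proof (rule AE_mp, intro AE_I2 impI ballI)
  fix C x z assume C: "C : space \<mu>" "ALL z:Z. R z (sec C)" "x : C" "z : Z"
  have CQ: "C : Q" using C by (simp add: space_mu)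
  have g: "inv (sec C) \<otimes> x : \<Delta>" using Q_rel[OF CQ sec(1)[OF CQ] C(3)] .
  have "sec C \<otimes> (inv (sec C) \<otimes> x) = x" using sec(3)[OF CQ] Q_carrier[OF CQ C(3)] by (simp add: m_assoc[symmetric])
  moreover have "act (inv (sec C) \<otimes> x) z : Z" using act_bij[OF g] C(4) by (auto simp: bij_betw_def)
  ultimately show "R z x" using eq[OF sec(3)[OF CQ] g C(4)] C(2) by simp
 qed
qed

definition av :: "(('g => real) => 'g => real) => ('g => 'z => real) => 'g => 'z => real" where
 "av A v x z = A (%y. v y z) x"

lemma eqv_av: assumes N: "N <= carrier P" and A: "avg N A" and v: "eqv v" shows "eqv (av A v)"
 unfolding eqv_def
proof (intro conjI ballI)
 show "(%x. av A v x z) : borel_measurable \<B>" if "z : Z" for z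
  unfolding av_def by (rule avg_meas[OF N A eqv_meas[OF v that]])
 fix x \<gamma> z assume x: "x : carrier P" "\<gamma> : \<Delta>" "z : Z"
 have "A (%y. v y z) (x \<otimes> \<gamma>) = A (%y. v (y \<otimes> \<gamma>) z) x" using avg_right[OF N A x(1)] D_sub[OF x(2)] by simp
 also have "... = A (%y. v y (act \<gamma> z)) x" by (rule avg_cong[OF N A x(1)]) (rule eqv_act[OF v _ x(2,3)])
 finally show "av A v (x \<otimes> \<gamma>) z = av A v x (act \<gamma> z)" by (simp add: av_def)
qed

lemma lift_mid: "lift (av (%f x. (A f x + B f x) / 2) v) = (%y. (lift (av A v) y + lift (av B v) y) / 2)"
 by (auto simp: lift_def av_def)

lemma sq_av_le: assumes N: "N <= carrier P" and A: "avg N A" and v: "eqv v" shows "sq (av A v) <= sq v"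
 using A
proof (induction rule: avg.induct)
 case (shift w)
 thus ?case using sq_shift[OF v, of w] N by (auto simp: av_def)
next
 case (mid A B)
 thus ?case unfolding sq_def lift_mid
  using lift_meas[OF eqv_av[OF N _ v]] by (intro nsq_midpoint) (auto simp: sq_def)
qed

text \<open>If the averages of \<open>v\<close> do not come close to zero, their closure contains an element of minimal norm;
 it is invariant because its translates are in the closure and have the same norm.\<close>

proposition invariant_vector:
 assumes N: "N <= carrier P" "N ~= {}" "!!x y. x : N ==> y : N ==> x \<otimes> y : N"
  and v: "eqv v" and fin: "sq v < \<infinity>"
  and pos: "e > 0" "!!A. avg N A ==> ennreal e <= sq (av A v)"
 shows "EX x. eqv x & sq x < \<infinity> & sq x ~= 0 & (ALL w:N. AE g in \<nu>. ALL z:Z. x (w \<otimes> g) z = x g z)"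
proof -
 obtain w0 where w0: "w0 : N" using N(2) by auto
 define S where "S = {A. avg N A}"
 have SA: "avg N A" if "A : S" for A using that by (simp add: S_def)
 define val where "val A = enn2real (sq (av A v))" for A
 have val: "sq (av A v) = ennreal (val A)" "0 <= val A" if "A : S" for A
  using sq_av_le[OF N(1) SA[OF that] v] fin by (auto simp: val_def less_top[symmetric] top_unique ennreal_enn2real_if)
 define r where "r = Inf (val ` S)"
 have Sne: "S ~= {}" using avg.shift[OF w0] by (auto simp: S_def)
 have bdd: "bdd_below (val ` S)" using val(2) by (intro bdd_belowI[of _ 0]) auto
 have r_le: "r <= val A" if "A : S" for A unfolding r_def using bdd that by (intro cInf_lower) auto
 have "e <= val A" if "A : S" for A using pos(2)[OF SA[OF that]] val[OF that] by simp
 hence "e <= r" unfolding r_def using Sne by (intro cInf_greatest) auto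
 hence r: "r > 0" using pos by simp
 define \<delta> where "\<delta> k = (1/16::real) ^ k" for k :: nat
 have d: "\<delta> k > 0" "\<delta> (Suc k) <= \<delta> k" for k by (simp_all add: \<delta>_def)
 have ddec: "\<delta> j <= \<delta> k" if "k <= j" for j k unfolding \<delta>_def using that by (rule power_decreasing) auto
 define C where "C k = {lift (av A v) | A. A : S & sq (av A v) <= ennreal (r + \<delta> k)}" for k
 have lm: "lift (av A v) : borel_measurable \<Omega>" if "A : S" for A using lift_meas[OF eqv_av[OF N(1) SA[OF that] v]] .
 obtain x' where x': "!!k. x' k : C k" "AE y in \<Omega>. convergent (%k. x' k y)"
  "!!j k. k <= j ==> nsq \<Omega> (%y. x' j y - x' k y) <= ennreal ((1/16) ^ k)"
 proof (rule convex_selection[of C \<Omega> "r + \<delta> 0"])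
  show "f : borel_measurable \<Omega>" if "f : C 0" for f using that lm by (auto simp: C_def)
  show "decseq C"
  proof (unfold decseq_def, intro allI impI)
   fix m n :: nat assume "m <= n"
   hence "ennreal (r + \<delta> n) <= ennreal (r + \<delta> m)" using ddec by (intro ennreal_leI) auto
   thus "C n <= C m" unfolding C_def using order_trans by blast
  qed
  show "C k ~= {}" for k
  proof -
   obtain A where A: "A : S" "val A < r + \<delta> k"
    using cInf_lessD[of "val ` S" "r + \<delta> k"] Sne d(1)[of k] by (auto simp: r_def)
   have "sq (av A v) <= ennreal (r + \<delta> k)" unfolding val(1)[OF A(1)] using A(2) by (intro ennreal_leI) simp
   hence "lift (av A v) : C k" using A(1) unfolding C_def by blast
   thus ?thesis by auto
  qed
  show "(%y. (f y + g y) / 2) : C k" if fg: "f : C k" "g : C k" for k f g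
  proof -
   obtain A where A: "A : S" "f = lift (av A v)" "sq (av A v) <= ennreal (r + \<delta> k)" using fg(1) unfolding C_def by blast
   obtain B where B: "B : S" "g = lift (av B v)" "sq (av B v) <= ennreal (r + \<delta> k)" using fg(2) unfolding C_def by blast
   define D where "D = (%f x. (A f x + B f x) / 2)"
   have "D : S" using avg.mid[OF SA[OF A(1)] SA[OF B(1)]] by (simp add: S_def D_def)
   moreover have "lift (av D v) = (%y. (f y + g y) / 2)" unfolding D_def lift_mid A(2) B(2) ..
   moreover have "sq (av D v) <= ennreal (r + \<delta> k)"
    unfolding sq_def D_def lift_mid using A B lm by (intro nsq_midpoint) (auto simp: sq_def)
   ultimately show ?thesis unfolding C_def by (metis (mono_tags, lifting) mem_Collect_eq)
  qed
  show "nsq \<Omega> f <= ennreal (r + \<delta> 0)" if "f : C 0" for f using that by (auto simp: C_def sq_def)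
 qed blast
 have "ALL k. EX A. A : S & x' k = lift (av A v) & sq (av A v) <= ennreal (r + \<delta> k)" using x'(1) by (auto simp: C_def)
 then obtain A where A: "!!k. A k : S" "!!k. x' k = lift (av (A k) v)" "!!k. sq (av (A k) v) <= ennreal (r + \<delta> k)" by metis
 define a where "a k = av (A k) v" for k
 have a: "eqv (a k)" for k unfolding a_def by (rule eqv_av[OF N(1) SA[OF A(1)] v])
 define x where "x g z = lim (%k. a k g z)" for g z
 have eqx: "eqv x" unfolding eqv_def
 proof (intro conjI ballI)
  show "(%g. x g z) : borel_measurable \<B>" if "z : Z" for z
   unfolding x_def by (rule borel_measurable_lim_metric) (rule eqv_meas[OF a that])
  show "x (g \<otimes> \<gamma>) z = x g (act \<gamma> z)" if "g : carrier P" "\<gamma> : \<Delta>" "z : Z" for g \<gamma> z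
   unfolding x_def using eqv_act[OF a that] by simp
 qed
 have conv: "AE y in \<Omega>. (%k. lift (a k) y) \<longlonglongrightarrow> lift x y" using x'(2)
 proof eventually_elim
  case (elim y)
  hence "convergent (%k. lift (a k) y)" by (simp add: A(2) a_def)
  thus ?case by (cases y) (simp add: convergent_LIMSEQ_iff x_def lift_def)
 qed
 note lma = lift_meas[OF a] note lmx = lift_meas[OF eqx]
 \<comment> \<open>Fatou's lemma: the distance to the limit is bounded by the distances along the
  sequence\<close>
 have dist: "nsq \<Omega> (%y. lift x y - lift (a k) y) <= ennreal (\<delta> k)" for k
 proof -
  have "nsq \<Omega> (%y. lift x y - lift (a k) y) = (\<integral>\<^sup>+y. liminf (%j. ennreal ((lift (a j) y - lift (a k) y)\<^sup>2)) \<partial>\<Omega>)"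
   unfolding nsq_def
  proof (rule nn_integral_cong_AE, use conv in eventually_elim)
   case (elim y)
   hence "(%j. ennreal ((lift (a j) y - lift (a k) y)\<^sup>2)) \<longlonglongrightarrow> ennreal ((lift x y - lift (a k) y)\<^sup>2)"
    by (intro tendsto_ennrealI tendsto_power tendsto_diff tendsto_const)
   thus ?case by (rule lim_imp_Liminf[OF sequentially_bot, symmetric])
  qed
  also have "... <= liminf (%j. nsq \<Omega> (%y. lift (a j) y - lift (a k) y))"
   unfolding nsq_def using lma by (intro nn_integral_liminf) measurable
  also have "... <= ennreal (\<delta> k)"
  proof -
   have "\<forall>\<^sub>F j in sequentially. nsq \<Omega> (%y. lift (a j) y - lift (a k) y) <= ennreal (\<delta> k)"
    unfolding eventually_sequentially using x'(3)[of k] A(2) by (auto simp: a_def \<delta>_def)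
   hence "Liminf sequentially (%j. nsq \<Omega> (%y. lift (a j) y - lift (a k) y)) <= Liminf sequentially (%j. ennreal (\<delta> k))"
    by (rule Liminf_mono)
   thus ?thesis by (simp add: Liminf_const)
  qed
  finally show ?thesis .
 qed
 have dlim: "\<delta> \<longlonglongrightarrow> 0" unfolding \<delta>_def by (rule LIMSEQ_power_zero) simp
 have "sq x <= 2 * nsq \<Omega> (%y. lift x y - lift (a 0) y) + 2 * nsq \<Omega> (lift (a 0))"
 proof -
  have "sq x = nsq \<Omega> (%y. (lift x y - lift (a 0) y) + lift (a 0) y)" by (simp add: sq_def)
  also have "... <= 2 * nsq \<Omega> (%y. lift x y - lift (a 0) y) + 2 * nsq \<Omega> (lift (a 0))"
   using lma lmx by (intro nsq_add_le) measurable
  finally show ?thesis .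
 qed
 also have "... <= 2 * ennreal (\<delta> 0) + 2 * ennreal (r + \<delta> 0)"
  using A(3)[of 0] dist[of 0] by (intro add_mono mult_left_mono) (auto simp: a_def sq_def)
 also have "... < \<infinity>" by (simp add: ennreal_mult_less_top)
 finally have finx: "sq x < \<infinity>" .
 have nz: "sq x ~= 0"
 proof
  assume z: "sq x = 0"
  have "r <= 2 * \<delta> k" for k
  proof -
   have "ennreal r <= sq (a k)" using r_le[OF A(1)[of k]] val(1)[OF A(1)[of k]] by (simp add: a_def ennreal_leI)
   also have "... = nsq \<Omega> (%y. (lift (a k) y - lift x y) + lift x y)" by (simp add: sq_def)
   also have "... <= 2 * nsq \<Omega> (%y. lift (a k) y - lift x y) + 2 * nsq \<Omega> (lift x)"
    using lma lmx by (intro nsq_add_le) measurable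
   also have "nsq \<Omega> (%y. lift (a k) y - lift x y) = nsq \<Omega> (%y. lift x y - lift (a k) y)"
    by (simp add: nsq_def power2_commute)
   also have "2 * nsq \<Omega> (%y. lift x y - lift (a k) y) + 2 * nsq \<Omega> (lift x) <= 2 * ennreal (\<delta> k)"
    using z dist[of k] by (auto simp: sq_def intro!: mult_left_mono)
   also have "... = ennreal (2 * \<delta> k)" by (simp add: ennreal_mult')
   finally show ?thesis using d(1)[of k] by (simp add: ennreal_le_iff)
  qed
  hence "r <= 2 * 0" by (intro LIMSEQ_le_const[OF tendsto_mult[OF tendsto_const dlim]]) auto
  thus False using r by simp
 qed
 have inv: "AE g in \<nu>. ALL z:Z. x (w \<otimes> g) z = x g z" if w: "w : N" for w
 proof -
  have wP: "w : carrier P" using w N(1) by auto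
  define wx wa where "wx = (%g. x (w \<otimes> g))" and "wa k = (%g. a k (w \<otimes> g))" for k
  have eqw: "eqv wx" "eqv (wa k)" for k unfolding wx_def wa_def by (auto intro: eqv_shift eqx a wP)
  note lmw = lift_meas[OF eqw(1)] lift_meas[OF eqw(2)]
  \<comment> \<open>the midpoint of the average and its translate is again an average, so its norm is
   not below the minimum\<close>
  have near: "nsq \<Omega> (%y. lift (wa k) y - lift (a k) y) <= ennreal (4 * \<delta> k)" for k
  proof -
   obtain B where B: "avg N B" "ALL f. ALL x:carrier P. A k f (w \<otimes> x) = B f x"
    using avg_shift[OF N(1) SA[OF A(1)] w N(3)] by blast
   have "lift (wa k) (z, C) = lift (av B v) (z, C)" if "C : Q" for z C
    using B(2) sec(3)[OF that] by (simp add: lift_def wa_def a_def av_def)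
   hence eqB: "(lift (wa k) y + lift (a k) y) / 2 = lift (av (%f x. (B f x + A k f x) / 2) v) y" if "y : space \<Omega>" for y
    using that by (cases y) (auto simp: lift_mid a_def space_pair_measure space_mu)
   have DS: "(%f x. (B f x + A k f x) / 2) : S" using avg.mid[OF B(1) SA[OF A(1)]] by (simp add: S_def)
   have "ennreal (r - 0) <= sq (av (%f x. (B f x + A k f x) / 2) v)"
    using r_le[OF DS] val(1)[OF DS] by (simp add: ennreal_leI)
   also have "... = nsq \<Omega> (%y. (lift (wa k) y + lift (a k) y) / 2)"
    unfolding sq_def nsq_def by (rule nn_integral_cong) (simp add: eqB)
   finally have "ennreal (r - 0) <= nsq \<Omega> (%y. (lift (wa k) y + lift (a k) y) / 2)" .
   moreover have "nsq \<Omega> (lift (wa k)) <= ennreal (r + \<delta> k)"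
    using sq_shift[OF a wP, of k] A(3)[of k] by (simp add: sq_def wa_def a_def)
   moreover have "nsq \<Omega> (lift (a k)) <= ennreal (r + \<delta> k)" using A(3)[of k] by (simp add: sq_def a_def)
   ultimately have "nsq \<Omega> (%y. lift (wa k) y - lift (a k) y) <= ennreal (4 * (\<delta> k + 0))"
    using lmw(2) lma r d(1)[of k] by (intro nsq_near_minimum[where r = r]) auto
   thus ?thesis by simp
  qed
  have dw: "nsq \<Omega> (%y. lift wx y - lift (wa k) y) <= ennreal (\<delta> k)" for k
  proof -
   have e: "eqv (%g z. x g z - a k g z)"
    using eqx a[of k] unfolding eqv_def by (auto intro!: borel_measurable_diff)
   have "nsq \<Omega> (%y. lift wx y - lift (wa k) y) = sq (%g. (%g z. x g z - a k g z) (w \<otimes> g))"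
    by (simp add: sq_def lift_def wx_def wa_def case_prod_unfold)
   also have "... = sq (%g z. x g z - a k g z)" by (rule sq_shift[OF e wP])
   also have "... = nsq \<Omega> (%y. lift x y - lift (a k) y)" by (simp add: sq_def lift_def case_prod_unfold)
   finally show ?thesis using dist[of k] by simp
  qed
  have "nsq \<Omega> (%y. lift wx y - lift x y) <= ennreal (22 * \<delta> k)" for k
  proof -
   have "nsq \<Omega> (%y. lift wx y - lift x y) =
     nsq \<Omega> (%y. (lift wx y - lift (wa k) y) + ((lift (wa k) y - lift (a k) y) + (lift (a k) y - lift x y)))" by simp
   also have "... <= 2 * nsq \<Omega> (%y. lift wx y - lift (wa k) y) +
     2 * nsq \<Omega> (%y. (lift (wa k) y - lift (a k) y) + (lift (a k) y - lift x y))"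
    by (intro nsq_add_le borel_measurable_add borel_measurable_diff lma lmx lmw)
   also have "nsq \<Omega> (%y. (lift (wa k) y - lift (a k) y) + (lift (a k) y - lift x y)) \<le>
     2 * nsq \<Omega> (%y. lift (wa k) y - lift (a k) y) + 2 * nsq \<Omega> (%y. lift (a k) y - lift x y)"
    by (intro nsq_add_le borel_measurable_add borel_measurable_diff lma lmx lmw)
   also have "nsq \<Omega> (%y. lift (a k) y - lift x y) = nsq \<Omega> (%y. lift x y - lift (a k) y)"
    by (simp add: nsq_def power2_commute)
   finally have "nsq \<Omega> (%y. lift wx y - lift x y) <= 2 * nsq \<Omega> (%y. lift wx y - lift (wa k) y) +
     2 * (2 * nsq \<Omega> (%y. lift (wa k) y - lift (a k) y) + 2 * nsq \<Omega> (%y. lift x y - lift (a k) y))"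
    by (simp add: add_left_mono mult_left_mono)
   also have "... <= 2 * ennreal (\<delta> k) + 2 * (2 * ennreal (4 * \<delta> k) + 2 * ennreal (\<delta> k))"
    by (intro add_mono mult_left_mono near dw dist) auto
   also have "... = ennreal (22 * \<delta> k)" using d(1)[of k] by (simp add: ennreal_mult'[symmetric] ennreal_plus[symmetric] del: ennreal_plus flip: ennreal_numeral)
   finally show ?thesis .
  qed
  hence "nsq \<Omega> (%y. lift wx y - lift x y) <= ennreal (22 * 0)"
   by (intro LIMSEQ_le_const[OF tendsto_ennrealI[OF tendsto_mult[OF tendsto_const dlim]]]) auto
  hence "(\<integral>\<^sup>+y. ennreal ((lift wx y - lift x y)\<^sup>2) \<partial>\<Omega>) = 0" by (simp add: nsq_def)
  hence "AE y in \<Omega>. ennreal ((lift wx y - lift x y)\<^sup>2) = 0"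
   using lmx lmw by (subst (asm) nn_integral_0_iff_AE) measurable
  hence "AE y in \<Omega>. (%z g. wx g z = x g z) (fst y) (sec (snd y))"
   by (rule AE_mp) (intro AE_I2 impI, auto simp: lift_def split: prod.splits)
  hence "AE g in \<nu>. ALL z:Z. wx g z = x g z"
  proof (rule AE_Omega)
   show "wx (g \<otimes> \<gamma>) z = x (g \<otimes> \<gamma>) z" if "g : carrier P" "\<gamma> : \<Delta>" "z : Z" "wx g (act \<gamma> z) = x g (act \<gamma> z)" for g \<gamma> z
    using eqv_act[OF eqw(1) that(1-3)] eqv_act[OF eqx that(1-3)] that(4) by simp
  qed
  thus ?thesis by (simp add: wx_def)
 qed
 show ?thesis using eqx finx nz inv by blast
qed

end

context equivariant
begin

text \<open>If the averages of \<open>v\<close> do come close to zero, they do so along averages for which countably many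
 given bounded functions converge as well: pass to convex combinations.\<close>

proposition convergent_averages:
 fixes f :: "nat => 'g => real"
 assumes N: "N <= carrier P" and v: "eqv v"
  and small: "!!e. e > 0 ==> EX A. avg N A & sq (av A v) <= ennreal e"
  and f: "!!j. f j : borel_measurable \<B>" "!!j x. x : carrier P ==> 0 <= f j x & f j x <= 1"
 shows "EX A. (ALL k. avg N (A k)) & (AE x in \<nu>. ALL j. convergent (%k. A k (f j) x)) &
  (AE x in \<nu>. ALL z:Z. (%k. av (A k) v x z) \<longlonglongrightarrow> 0)"
proof -
 \<comment> \<open>a finite measure equivalent to \<open>\<nu>\<close>; with the weights \<open>(1/2) ^ j\<close> all averages
  of the \<open>f j\<close> together are a bounded set of square integrable functions\<close>
 obtain h where h: "h : borel_measurable \<nu>" "integral\<^sup>N \<nu> h ~= \<infinity>" "!!x. x : space \<nu> ==> 0 < h x & h x < \<infinity>"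
  using nu.Ex_finite_integrable_function by blast
 define \<nu>' where "\<nu>' = density \<nu> h"
 have sp: "space \<nu>' = carrier P" and st: "sets \<nu>' = sets \<B>" by (simp_all add: \<nu>'_def space_nu sets_nu)
 have fin: "emeasure \<nu>' (carrier P) < \<infinity>"
 proof -
  have "emeasure \<nu>' (space \<nu>) = (\<integral>\<^sup>+x. h x * indicator (space \<nu>) x \<partial>\<nu>)"
   unfolding \<nu>'_def by (rule emeasure_density[OF h(1)]) simp
  also have "... = integral\<^sup>N \<nu> h" by (rule nn_integral_cong) simp
  finally show ?thesis using h(2) by (simp add: space_nu less_top[symmetric])
 qed
 hence fm: "finite_measure \<nu>'" by (intro finite_measureI) (simp add: sp)
 interpret f': finite_measure \<nu>' by (rule fm)
 have sfp: "pair_sigma_finite (count_space (UNIV :: nat set)) \<nu>'"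
  using sigma_finite_measure_count_space_countable[of "UNIV :: nat set"]
  by (simp add: pair_sigma_finite_def f'.sigma_finite_measure_axioms)
 define M where "M = count_space (UNIV :: nat set) \<Otimes>\<^sub>M \<nu>'"
 define F where "F A = (%(j, x). (1/2) ^ j * A (f j) x)" for A :: "('g => real) => 'g => real"
 have Fm: "F A : borel_measurable M" if A: "avg N A" for A unfolding F_def M_def
 proof (rule measurable_pair_measure_countable1)
  fix j :: nat
  have "A (f j) : borel_measurable \<nu>'" using avg_meas[OF N A f(1)] by (simp add: measurable_cong_sets[OF st refl])
  thus "(%y. case (j, y) of (j, x) => (1/2) ^ j * A (f j) x) : borel_measurable \<nu>'" by simp
 qed simp
 have Fb: "nsq M (F A) <= ennreal (2 * measure \<nu>' (carrier P))" if A: "avg N A" for A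
 proof -
  have m: "(%y. ennreal ((F A y)\<^sup>2)) : borel_measurable (count_space UNIV \<Otimes>\<^sub>M \<nu>')"
   using Fm[OF A] by (simp add: M_def)
  have "nsq M (F A) = (\<integral>\<^sup>+j. (\<integral>\<^sup>+x. ennreal ((F A (j, x))\<^sup>2) \<partial>\<nu>') \<partial>count_space UNIV)"
   unfolding nsq_def M_def using f'.nn_integral_fst[OF m] by simp
  also have "... <= (\<integral>\<^sup>+j. ennreal ((1/2) ^ j * measure \<nu>' (carrier P)) \<partial>count_space UNIV)"
  proof (rule nn_integral_mono)
   fix j :: nat
   have "(\<integral>\<^sup>+x. ennreal ((F A (j, x))\<^sup>2) \<partial>\<nu>') <= (\<integral>\<^sup>+x. ennreal ((1/2) ^ j) \<partial>\<nu>')"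
   proof (rule nn_integral_mono, rule ennreal_leI)
    fix x assume "x : space \<nu>'"
    hence x: "x : carrier P" by (simp add: sp)
    have "0 <= A (f j) x" using avg_mono[OF N A x, of "%_. 0" "f j"] f(2) by (simp add: avg_const[OF N A])
    moreover have "A (f j) x <= 1" using avg_mono[OF N A x, of "f j" "%_. 1"] f(2) by (simp add: avg_const[OF N A])
    ultimately have "(A (f j) x)\<^sup>2 <= 1" by (simp add: power_le_one)
    moreover have "((1/2::real) ^ j)\<^sup>2 <= (1/2) ^ j" by (simp add: power2_eq_square power_le_one mult_left_le)
    ultimately have "((1/2) ^ j)\<^sup>2 * (A (f j) x)\<^sup>2 <= (1/2) ^ j * 1" by (intro mult_mono) auto
    thus "(F A (j, x))\<^sup>2 <= (1/2) ^ j" by (simp add: F_def power_mult_distrib)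
   qed
   also have "... = ennreal ((1/2) ^ j) * emeasure \<nu>' (space \<nu>')" by simp
   also have "... = ennreal ((1/2) ^ j * measure \<nu>' (carrier P))"
    by (simp add: f'.emeasure_eq_measure sp ennreal_mult)
   finally show "(\<integral>\<^sup>+x. ennreal ((F A (j, x))\<^sup>2) \<partial>\<nu>') <= ennreal ((1/2) ^ j * measure \<nu>' (carrier P))" .
  qed
  also have "... = (\<Sum>j. ennreal ((1/2) ^ j * measure \<nu>' (carrier P)))" by (rule nn_integral_count_space_nat)
  also have "... = ennreal (\<Sum>j. (1/2) ^ j * measure \<nu>' (carrier P))"
   by (rule suminf_ennreal2) (auto intro!: summable_mult2 summable_geometric)
  also have "(\<Sum>j. (1/2::real) ^ j * measure \<nu>' (carrier P)) = 2 * measure \<nu>' (carrier P)"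
   by (subst suminf_mult2[symmetric]) (auto simp: suminf_geometric intro!: summable_geometric)
  finally show ?thesis .
 qed
 define C where "C k = {F A | A. avg N A & sq (av A v) <= ennreal ((1/16) ^ k)}" for k :: nat
 have lm: "lift (av A v) : borel_measurable \<Omega>" if "avg N A" for A by (rule lift_meas[OF eqv_av[OF N that v]])
 obtain x' where x': "!!k. x' k : C k" "AE y in M. convergent (%k. x' k y)"
 proof (rule convex_selection[of C M "2 * measure \<nu>' (carrier P)"])
  show "g : borel_measurable M" if "g : C 0" for g using that Fm by (auto simp: C_def)
  show "decseq C"
  proof (unfold decseq_def, intro allI impI)
   fix m n :: nat assume "m <= n"
   hence "ennreal ((1/16) ^ n) <= ennreal ((1/16) ^ m)" by (intro ennreal_leI power_decreasing) auto
   thus "C n <= C m" unfolding C_def using order_trans by blast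
  qed
  show "C k ~= {}" for k using small[of "(1/16) ^ k"] by (auto simp: C_def)
  show "(%y. (g y + g' y) / 2) : C k" if gg: "g : C k" "g' : C k" for k g g'
  proof -
   obtain A where A: "avg N A" "g = F A" "sq (av A v) <= ennreal ((1/16) ^ k)" using gg(1) unfolding C_def by blast
   obtain B where B: "avg N B" "g' = F B" "sq (av B v) <= ennreal ((1/16) ^ k)" using gg(2) unfolding C_def by blast
   define D where "D = (%f x. (A f x + B f x) / 2)"
   have "avg N D" using avg.mid[OF A(1) B(1)] by (simp add: D_def)
   moreover have "F D = (%y. (g y + g' y) / 2)" by (auto simp: F_def D_def A B field_simps)
   moreover have "sq (av D v) <= ennreal ((1/16) ^ k)"
    unfolding sq_def D_def lift_mid using A B lm by (intro nsq_midpoint) (auto simp: sq_def)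
   ultimately show ?thesis unfolding C_def by (metis (mono_tags, lifting) mem_Collect_eq)
  qed
  show "nsq M g <= ennreal (2 * measure \<nu>' (carrier P))" if "g : C 0" for g using that Fb by (auto simp: C_def)
 qed blast
 have "ALL k. EX A. avg N A & x' k = F A & sq (av A v) <= ennreal ((1/16) ^ k)" using x'(1) unfolding C_def by blast
 then obtain A where A: "!!k. avg N (A k)" "!!k. x' k = F (A k)" "!!k. sq (av (A k) v) <= ennreal ((1/16) ^ k)" by metis
 have "AE x in \<nu>. ALL j. convergent (%k. A k (f j) x)"
 proof -
  have "AE y in count_space UNIV \<Otimes>\<^sub>M \<nu>'. convergent (%k. F (A k) y)" using x'(2) unfolding A(2) M_def .
  from pair_sigma_finite.AE_pair[OF sfp this]
  have "ALL j. AE x in \<nu>'. convergent (%k. F (A k) (j, x))" by (simp add: AE_count_space)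
  hence "AE x in \<nu>'. ALL j. convergent (%k. F (A k) (j, x))" by (simp add: AE_all_countable)
  hence "AE x in \<nu>. 0 < h x --> (ALL j. convergent (%k. F (A k) (j, x)))" unfolding \<nu>'_def AE_density[OF h(1)] .
  thus ?thesis
   by (rule AE_mp) (intro AE_I2 impI, use h(3) in "simp add: F_def convergent_mult_const_iff")
 qed
 moreover have "AE x in \<nu>. ALL z:Z. (%k. av (A k) v x z) \<longlonglongrightarrow> 0"
 proof (rule AE_Omega)
  have "AE y in \<Omega>. (%k. lift (av (A k) v) y) \<longlonglongrightarrow> 0"
   using A(3) lm[OF A(1)] by (intro AE_tendsto_zero_of_summable_squares) (simp_all add: sq_def)
  thus "AE y in \<Omega>. (%k. av (A k) v (sec (snd y)) (fst y)) \<longlonglongrightarrow> 0"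
   by (simp add: lift_def case_prod_unfold)
  show "(%k. av (A k) v (x \<otimes> \<gamma>) z) \<longlonglongrightarrow> 0"
   if "x : carrier P" "\<gamma> : \<Delta>" "z : Z" "(%k. av (A k) v x (act \<gamma> z)) \<longlonglongrightarrow> 0" for x \<gamma> z
   using eqv_act[OF eqv_av[OF N A(1) v] that(1-3)] that(4) by simp
 qed
 ultimately show ?thesis using A(1) by blast
qed

end

context equivariant
begin

text \<open>The places where an invariant vector is large form an equivariant family of finite sets. One of
 the countably many finite sets occurs with positive measure.\<close>

lemma invariant_finite_set:
 assumes x: "eqv x" and fin: "sq x < \<infinity>" and nz: "sq x ~= 0"
  and inv: "!!w. w : N ==> AE g in \<nu>. ALL z:Z. x (w \<otimes> g) z = x g z" and N: "N <= carrier P"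
 shows "EX F E. finite F & F ~= {} & F <= Z & E : sets \<B> & ~ (AE g in \<nu>. g ~: E) &
  (ALL w:N. AE g in \<nu>. (w \<otimes> g : E) = (g : E)) &
  (ALL g:carrier P. ALL \<gamma>:\<Delta>. g : E --> g \<otimes> \<gamma> : E --> act \<gamma> ` F = F)"
proof -
 have "EX c>0. ~ (AE g in \<nu>. ALL z:Z. \<bar>x g z\<bar> <= c)"
 proof (rule ccontr)
  assume "~ ?thesis"
  hence "AE g in \<nu>. ALL z:Z. \<bar>x g z\<bar> <= c" if "c > 0" for c using that by blast
  from this[of "1 / real (Suc n)" for n] have "ALL n. AE g in \<nu>. ALL z:Z. \<bar>x g z\<bar> <= 1 / real (Suc n)"
   by (intro allI) simp
  hence "AE g in \<nu>. ALL n. ALL z:Z. \<bar>x g z\<bar> <= 1 / real (Suc n)" unfolding AE_all_countable .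
  hence "AE C in \<mu>. ALL g:C. ALL n. ALL z:Z. \<bar>x g z\<bar> <= 1 / real (Suc n)" unfolding AE_nu_iff .
  hence ae: "AE C in \<mu>. (\<integral>\<^sup>+z. ennreal ((x (sec C) z)\<^sup>2) \<partial>count_space Z) = 0"
  proof (rule AE_mp, intro AE_I2 impI)
   fix C assume C: "C : space \<mu>" "ALL g:C. ALL n. ALL z:Z. \<bar>x g z\<bar> <= 1 / real (Suc n)"
   have "x (sec C) z = 0" if z: "z : Z" for z
   proof (rule ccontr)
    assume "x (sec C) z ~= 0"
    then obtain n where "1 / real (Suc n) < \<bar>x (sec C) z\<bar>" using reals_Archimedean[of "\<bar>x (sec C) z\<bar>"] by (auto simp: inverse_eq_divide)
    moreover have "sec C : C" using C(1) sec(1) by (simp add: space_mu)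
    ultimately show False using C(2) z by (auto simp: not_less[symmetric])
   qed
   hence "(\<integral>\<^sup>+z. ennreal ((x (sec C) z)\<^sup>2) \<partial>count_space Z) = (\<integral>\<^sup>+z. 0 \<partial>count_space Z)"
    by (intro nn_integral_cong) simp
   thus "(\<integral>\<^sup>+z. ennreal ((x (sec C) z)\<^sup>2) \<partial>count_space Z) = 0" by simp
  qed
  have "sq x = (\<integral>\<^sup>+C. 0 \<partial>\<mu>)" unfolding sq_iterated(1)[OF x] by (rule nn_integral_cong_AE[OF ae])
  thus False using nz by simp
 qed
 then obtain c where c: "c > 0" "~ (AE g in \<nu>. ALL z:Z. \<bar>x g z\<bar> <= c)" by blast
 define A where "A g = {z : Z. c < \<bar>x g z\<bar>}" for g
 have Aeq: "act \<gamma> ` A (g \<otimes> \<gamma>) = A g" if g: "g : carrier P" "\<gamma> : \<Delta>" for g \<gamma>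
 proof -
  have "A (g \<otimes> \<gamma>) = {z : Z. act \<gamma> z : A g}"
   using eqv_act[OF x g] act_bij[OF g(2)] by (auto simp: A_def bij_betw_def)
  also have "act \<gamma> ` {z : Z. act \<gamma> z : A g} = A g"
   using act_bij[OF g(2)] by (auto simp: A_def bij_betw_def)
  finally show ?thesis .
 qed
 have finA: "AE g in \<nu>. finite (A g)" unfolding AE_nu_iff
 proof -
  have "AE C in \<mu>. (\<integral>\<^sup>+z. ennreal ((x (sec C) z)\<^sup>2) \<partial>count_space Z) ~= \<infinity>"
   using fin unfolding sq_iterated(1)[OF x] by (intro nn_integral_PInf_AE sq_iterated(2)[OF x]) auto
  thus "AE C in \<mu>. ALL g:C. finite (A g)"
  proof (rule AE_mp, intro AE_I2 impI ballI)
   fix C g assume C: "C : space \<mu>" "(\<integral>\<^sup>+z. ennreal ((x (sec C) z)\<^sup>2) \<partial>count_space Z) ~= \<infinity>" "g : C"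
   hence CQ: "C : Q" by (simp add: space_mu)
   have "ennreal (c\<^sup>2) * emeasure (count_space Z) (A (sec C)) = (\<integral>\<^sup>+z. ennreal (c\<^sup>2) * indicator (A (sec C)) z \<partial>count_space Z)"
    by (rule nn_integral_cmult_indicator[symmetric]) (auto simp: A_def)
   also have "... <= (\<integral>\<^sup>+z. ennreal ((x (sec C) z)\<^sup>2) \<partial>count_space Z)"
   proof (rule nn_integral_mono)
    fix z
    have "c\<^sup>2 <= (x (sec C) z)\<^sup>2" if "z : A (sec C)" using that c(1) by (simp add: A_def abs_le_square_iff[symmetric])
    thus "ennreal (c\<^sup>2) * indicator (A (sec C)) z <= ennreal ((x (sec C) z)\<^sup>2)"
     by (auto simp: indicator_def intro!: ennreal_leI)
   qed
   finally have "ennreal (c\<^sup>2) * emeasure (count_space Z) (A (sec C)) ~= \<infinity>" using C(2) by (auto simp: top_unique)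
   hence "emeasure (count_space Z) (A (sec C)) ~= \<infinity>" using c(1) by (auto simp: ennreal_mult_eq_top_iff)
   hence fs: "finite (A (sec C))" by (auto simp: emeasure_count_space A_def split: if_splits)
   define \<gamma> where "\<gamma> = inv g \<otimes> sec C"
   have g: "g : carrier P" "\<gamma> : \<Delta>" using Q_carrier[OF CQ C(3)] Q_rel[OF CQ C(3) sec(1)[OF CQ]] by (auto simp: \<gamma>_def)
   have "g \<otimes> \<gamma> = sec C" using g(1) sec(3)[OF CQ] by (simp add: \<gamma>_def m_assoc[symmetric])
   thus "finite (A g)" using Aeq[OF g] fs by (metis finite_imageI)
  qed
 qed
 define E where "E F = {g : carrier P. A g = F}" for F
 have Em: "E F : sets \<B>" if F: "F <= Z" for F
 proof -
  have m: "{g : carrier P. c < \<bar>x g z\<bar>} : sets \<B>" if "z : Z" for z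
  proof -
   have "{g : space \<B>. c < \<bar>x g z\<bar>} : sets \<B>" using eqv_meas[OF x that] by measurable
   thus ?thesis by (simp add: topspace)
  qed
  have "{g : space \<B>. ALL z:Z. (c < \<bar>x g z\<bar>) = (z : F)} : sets \<B>"
  proof (rule sets.sets_Collect_countable_All'[OF _ Z_countable])
   fix z assume z: "z : Z"
   have "{g : space \<B>. (c < \<bar>x g z\<bar>) = (z : F)} = (if z : F then {g : carrier P. c < \<bar>x g z\<bar>} else carrier P - {g : carrier P. c < \<bar>x g z\<bar>})"
    by (auto simp: topspace)
   thus "{g : space \<B>. (c < \<bar>x g z\<bar>) = (z : F)} : sets \<B>" using m[OF z] sets.compl_sets[OF m[OF z]] by (auto simp: topspace)
  qed
  also have "{g : space \<B>. ALL z:Z. (c < \<bar>x g z\<bar>) = (z : F)} = E F"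
   using F by (auto simp: E_def A_def topspace)
  finally show ?thesis .
 qed
 have "EX F. finite F & F ~= {} & F <= Z & ~ (AE g in \<nu>. g ~: E F)"
 proof (rule ccontr)
  assume n: "~ ?thesis"
  have "countable {F. finite F & F <= Z}" by (rule countable_Collect_finite_subset[OF Z_countable])
  hence "countable {F. F <= Z & finite F & F ~= {}}" by (rule countable_subset[rotated]) auto
  hence "(AE g in \<nu>. ALL F:{F. F <= Z & finite F & F ~= {}}. g ~: E F) \<longleftrightarrow>
    (ALL F:{F. F <= Z & finite F & F ~= {}}. AE g in \<nu>. g ~: E F)" by (rule AE_ball_countable)
  moreover have "ALL F:{F. F <= Z & finite F & F ~= {}}. AE g in \<nu>. g ~: E F" using n by blast
  ultimately have "AE g in \<nu>. ALL F:{F. F <= Z & finite F & F ~= {}}. g ~: E F" by (rule iffD2)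
  with finA AE_space have "AE g in \<nu>. ALL z:Z. \<bar>x g z\<bar> <= c"
  proof eventually_elim
   case (elim g)
   have "A g = {}"
   proof (rule ccontr)
    assume "A g ~= {}"
    hence "A g : {F. F <= Z & finite F & F ~= {}}" using elim(1) by (auto simp: A_def)
    thus False using elim by (auto simp: E_def space_nu)
   qed
   thus ?case by (auto simp: A_def not_less[symmetric])
  qed
  thus False using c(2) by blast
 qed
 then obtain F where F: "finite F" "F ~= {}" "F <= Z" "~ (AE g in \<nu>. g ~: E F)" by blast
 moreover have "AE g in \<nu>. (w \<otimes> g : E F) = (g : E F)" if w: "w : N" for w
  using inv[OF w] AE_space
 proof eventually_elim
  case (elim g)
  hence "A (w \<otimes> g) = A g" by (auto simp: A_def)
  thus ?case using elim w N by (auto simp: E_def space_nu)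
 qed
 moreover have "act \<gamma> ` F = F" if g: "g : carrier P" "\<gamma> : \<Delta>" "g : E F" "g \<otimes> \<gamma> : E F" for g \<gamma>
  using Aeq[OF g(1,2)] g(3,4) by (simp add: E_def)
 ultimately show ?thesis using Em[OF F(3)] by (intro exI[of _ F] exI[of _ "E F"]) simp
qed

end

section \<open>Centers of triples of disjoint translates\<close>

text \<open>Two applications of Ramsey's theorem for two colours. The colours may overlap.\<close>

lemma ramsey_three:
 "EX r. ALL (V::'a set) P1 P2 P3. finite V & r <= card V & symp P1 & symp P2 & symp P3 &
  (ALL x:V. ALL y:V. x ~= y --> P1 x y | P2 x y | P3 x y) -->
  (\<exists>R\<subseteq>V. card R = K & (pairwise P1 R | pairwise P2 R | pairwise P3 R))"
proof -
 obtain r2 where "ALL (V::'a set) E. finite V & r2 <= card V -->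
   (\<exists>R\<subseteq>V. card R = K & clique R E | card R = K & indep R E)" using ramsey2[of K K] by (elim exE conjE)
 note r2 = this[rule_format, OF conjI]
 obtain r1 where "ALL (V::'a set) E. finite V & r1 <= card V -->
   (\<exists>R\<subseteq>V. card R = K & clique R E | card R = r2 & indep R E)" using ramsey2[of K r2] by (elim exE conjE)
 note r1 = this[rule_format, OF conjI]
 have cl: "pairwise P R" if "clique R {{x, y} |x y. P x y}" "symp P" for P and R :: "'a set"
  using that unfolding clique_def pairwise_def by (auto simp: doubleton_eq_iff dest: sympD)
 have ind: "~ P x y" if "indep R {{x, y} |x y. P x y}" "x : R" "y : R" "x ~= y" for P and R :: "'a set" and x y
  using that unfolding indep_def by auto
 show ?thesis
 proof (intro exI[of _ r1] allI impI, elim conjE)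
  fix V :: "'a set" and P1 P2 P3
  assume V: "finite V" "r1 <= card V" and s: "symp P1" "symp P2" "symp P3"
   and P: "ALL x:V. ALL y:V. x ~= y --> P1 x y | P2 x y | P3 x y"
  obtain R where R: "R <= V" "card R = K & clique R {{x, y} |x y. P1 x y} | card R = r2 & indep R {{x, y} |x y. P1 x y}"
   using r1[OF V, of "{{x, y} |x y. P1 x y}"] by (elim exE conjE)
  from R(2) show "\<exists>R\<subseteq>V. card R = K & (pairwise P1 R | pairwise P2 R | pairwise P3 R)"
  proof
   assume "card R = K & clique R {{x, y} |x y. P1 x y}"
   thus ?thesis using cl[OF _ s(1)] R(1) by blast
  next
   assume i: "card R = r2 & indep R {{x, y} |x y. P1 x y}"
   have "finite R" using R(1) V(1) finite_subset by blast
   then obtain R' where R': "R' <= R" "card R' = K & clique R' {{x, y} |x y. P2 x y} | card R' = K & indep R' {{x, y} |x y. P2 x y}"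
    using r2[of R "{{x, y} |x y. P2 x y}"] i by auto
   from R'(2) show ?thesis
   proof
    assume "card R' = K & clique R' {{x, y} |x y. P2 x y}"
    thus ?thesis using cl[OF _ s(2)] R(1) R'(1) by blast
   next
    assume i': "card R' = K & indep R' {{x, y} |x y. P2 x y}"
    have "pairwise P3 R'"
    proof (rule pairwiseI)
     fix x y assume xy: "x : R'" "y : R'" "x ~= y"
     have "~ P2 x y" using ind[of R' P2] i' xy by blast
     moreover have "~ P1 x y" using ind[of R P1] i xy R'(1) by blast
     moreover have "x : V" "y : V" using xy R(1) R'(1) by auto
     ultimately show "P3 x y" using P xy(3) by blast
    qed
    thus ?thesis using i' R(1) R'(1) by blast
   qed
  qed
 qed
qed

lemma card_ge_3_obtain:
 assumes "finite S" "3 <= card S"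
 obtains a b c where "a : S" "b : S" "c : S" "a ~= b" "a ~= c" "b ~= c"
proof -
 obtain W where W: "W <= S" "card W = 3" using assms obtain_subset_with_card_n by metis
 then obtain a b c where "W = {a, b, c}" "a ~= b" "b ~= c" "a ~= c" by (auto simp: card_3_iff)
 thus thesis using that W(1) by blast
qed

text \<open>The lattice acts on \<open>X\<close> and preserves a symmetric ternary operation, later the median.\<close>

locale capacities = lattice_measure P T \<Delta> \<mu>
 for P :: "'g monoid" (structure) and T \<Delta> \<mu> +
 fixes X :: "'x set" and \<phi> :: "'g => 'x => 'x" and med3 :: "'x => 'x => 'x => 'x"
 assumes phi_closed: "!!\<gamma> x. \<gamma> : \<Delta> ==> x : X ==> \<phi> \<gamma> x : X"
  and phi_mult: "!!\<gamma> \<delta> x. \<gamma> : \<Delta> ==> \<delta> : \<Delta> ==> x : X ==> \<phi> (\<gamma> \<otimes> \<delta>) x = \<phi> \<gamma> (\<phi> \<delta> x)"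
  and phi_one: "!!x. x : X ==> \<phi> \<one> x = x"
  and med_closed: "!!a b c. a : X ==> b : X ==> c : X ==> med3 a b c : X"
  and med_12: "!!a b c. a : X ==> b : X ==> c : X ==> med3 a b c = med3 b a c"
  and med_23: "!!a b c. a : X ==> b : X ==> c : X ==> med3 a b c = med3 a c b"
  and med_phi: "!!\<gamma> a b c. \<gamma> : \<Delta> ==> a : X ==> b : X ==> c : X ==>
   \<phi> \<gamma> (med3 a b c) = med3 (\<phi> \<gamma> a) (\<phi> \<gamma> b) (\<phi> \<gamma> c)"
begin

lemma D_mult: "\<gamma> : \<Delta> ==> \<delta> : \<Delta> ==> \<gamma> \<otimes> \<delta> : \<Delta>" by (rule subgroup.m_closed[OF sub])
lemma D_inv: "\<gamma> : \<Delta> ==> inv \<gamma> : \<Delta>" by (rule subgroup.m_inv_closed[OF sub])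
lemma D_one: "\<one> : \<Delta>" by (rule subgroup.one_closed[OF sub])

lemma phi_inv: assumes "\<gamma> : \<Delta>" "x : X" shows "\<phi> (inv \<gamma>) (\<phi> \<gamma> x) = x" "\<phi> \<gamma> (\<phi> (inv \<gamma>) x) = x"
 using phi_mult[OF D_inv[OF assms(1)] assms(1,2)] phi_mult[OF assms(1) D_inv[OF assms(1)] assms(2)]
  phi_one[OF assms(2)] D_sub[OF assms(1)] by simp_all

lemma phi_image_mult: assumes "\<gamma> : \<Delta>" "\<delta> : \<Delta>" "h <= X" shows "\<phi> (\<gamma> \<otimes> \<delta>) ` h = \<phi> \<gamma> ` \<phi> \<delta> ` h"
 unfolding image_image by (rule image_cong[OF refl]) (use phi_mult assms in blast)

lemma phi_inj: assumes "\<gamma> : \<Delta>" shows "inj_on (\<phi> \<gamma>) X"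
 using phi_inv(1)[OF assms] by (rule inj_on_inverseI)

lemma phi_image_sub: "\<gamma> : \<Delta> ==> h <= X ==> \<phi> \<gamma> ` h <= X" using phi_closed by blast

definition dj :: "'x set => 'g => 'g => bool" where "dj h \<gamma> \<delta> \<longleftrightarrow> \<phi> \<gamma> ` h \<inter> \<phi> \<delta> ` h = {}"

lemma dj_sym: "dj h \<gamma> \<delta> ==> dj h \<delta> \<gamma>" by (auto simp: dj_def)
lemma dj_symp: "symp (%x y. dj h (f x) (f y))" by (auto intro!: sympI dest: dj_sym)

lemma dj_mult:
 assumes "\<epsilon> : \<Delta>" "\<gamma> : \<Delta>" "\<delta> : \<Delta>" "h <= X" "dj h \<gamma> \<delta>"
 shows "dj h (\<epsilon> \<otimes> \<gamma>) (\<epsilon> \<otimes> \<delta>)"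
proof -
 have "\<phi> \<epsilon> ` (\<phi> \<gamma> ` h) \<inter> \<phi> \<epsilon> ` (\<phi> \<delta> ` h) = \<phi> \<epsilon> ` (\<phi> \<gamma> ` h \<inter> \<phi> \<delta> ` h)"
  by (rule inj_on_image_Int[OF phi_inj[OF assms(1)], symmetric]) (use assms phi_image_sub in auto)
 thus ?thesis using assms(5) phi_image_mult[OF assms(1) _ assms(4)] assms(2,3) by (simp add: dj_def)
qed

text \<open>Strong nesting, for nonempty sets.\<close>

definition nest :: "'x set => 'x set => bool" where
 "nest k h \<longleftrightarrow> k <= h & h <= X & k ~= {} &
  (ALL a:k. ALL a':k. ALL b:X - h. ALL c:X - h. med3 a b c = med3 a' b c)"

lemma nest_sub: "nest k h ==> k <= X" "nest k h ==> h <= X" "nest k h ==> k <= h" by (auto simp: nest_def)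

lemma nest_image:
 assumes n: "nest k h" and g: "\<gamma> : \<Delta>" and a: "a : \<phi> \<gamma> ` k" "a' : \<phi> \<gamma> ` k"
  and b: "b : X" "b ~: \<phi> \<gamma> ` h" "c : X" "c ~: \<phi> \<gamma> ` h"
 shows "med3 a b c = med3 a' b c"
proof -
 obtain x x' where x: "x : k" "x' : k" "a = \<phi> \<gamma> x" "a' = \<phi> \<gamma> x'" using a by auto
 define y z where yz: "y = \<phi> (inv \<gamma>) b" "z = \<phi> (inv \<gamma>) c"
 have yX: "y : X" "z : X" using yz phi_closed[OF D_inv[OF g]] b by auto
 have bc: "b = \<phi> \<gamma> y" "c = \<phi> \<gamma> z" using phi_inv(2)[OF g] b yz by auto
 hence "y ~: h" "z ~: h" using b by auto
 hence "med3 x y z = med3 x' y z" using n x yX unfolding nest_def by blast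
 hence "\<phi> \<gamma> (med3 x y z) = \<phi> \<gamma> (med3 x' y z)" by simp
 moreover have "x : X" "x' : X" using nest_sub(1)[OF n] x by auto
 ultimately show ?thesis unfolding x(3,4) bc using med_phi[OF g _ yX] by simp
qed

lemma dj_notin: "dj h \<gamma> \<delta> ==> k <= h ==> x : \<phi> \<gamma> ` k ==> x ~: \<phi> \<delta> ` h"
 unfolding dj_def by blast

text \<open>A triple of disjoint translates of \<open>h\<close> has a center: the median of any points of the smaller
 translates.\<close>

lemma center_const:
 assumes n: "nest k h" and g: "g1 : \<Delta>" "g2 : \<Delta>" "g3 : \<Delta>" and dj: "dj h g1 g2" "dj h g1 g3" "dj h g2 g3"
  and a: "a1 : \<phi> g1 ` k" "a2 : \<phi> g2 ` k" "a3 : \<phi> g3 ` k"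
  and b: "b1 : \<phi> g1 ` k" "b2 : \<phi> g2 ` k" "b3 : \<phi> g3 ` k"
 shows "med3 a1 a2 a3 = med3 b1 b2 b3"
proof -
 note kX = nest_sub(1)[OF n] and kh = nest_sub(3)[OF n]
 have im: "\<phi> g1 ` k <= X" "\<phi> g2 ` k <= X" "\<phi> g3 ` k <= X" using phi_image_sub[OF _ kX] g by simp_all
 have X: "a1 : X" "a2 : X" "a3 : X" "b1 : X" "b2 : X" "b3 : X"
  using subsetD[OF im(1)] subsetD[OF im(2)] subsetD[OF im(3)] a b by simp_all
 note out = dj_notin[OF dj(1) kh] dj_notin[OF dj(2) kh] dj_notin[OF dj(3) kh]
  dj_notin[OF dj_sym[OF dj(1)] kh] dj_notin[OF dj_sym[OF dj(2)] kh] dj_notin[OF dj_sym[OF dj(3)] kh]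
 have "med3 a1 a2 a3 = med3 b1 a2 a3"
  by (rule nest_image[OF n g(1) a(1) b(1) X(2) out(4)[OF a(2)] X(3) out(5)[OF a(3)]])
 also have "... = med3 a2 b1 a3" by (rule med_12[OF X(4,2,3)])
 also have "... = med3 b2 b1 a3"
  by (rule nest_image[OF n g(2) a(2) b(2) X(4) out(1)[OF b(1)] X(3) out(6)[OF a(3)]])
 also have "... = med3 b1 b2 a3" by (rule med_12[OF X(5,4,3)])
 also have "... = med3 b1 a3 b2" by (rule med_23[OF X(4,5,3)])
 also have "... = med3 a3 b1 b2" by (rule med_12[OF X(4,3,5)])
 also have "... = med3 b3 b1 b2"
  by (rule nest_image[OF n g(3) a(3) b(3) X(4) out(2)[OF b(1)] X(5) out(3)[OF b(2)]])
 also have "... = med3 b1 b3 b2" by (rule med_12[OF X(6,4,5)])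
 also have "... = med3 b1 b2 b3" by (rule med_23[OF X(4,6,5)])
 finally show ?thesis .
qed

text \<open>Centers of triples from \<open>S\<close>, computed from a base point \<open>b\<close> of the smaller set.\<close>

definition heavy :: "'x set => 'x => 'g set => 'x => bool" where
 "heavy h b S y \<longleftrightarrow> (EX g1:S. EX g2:S. EX g3:S. dj h g1 g2 & dj h g1 g3 & dj h g2 g3 & y = med3 (\<phi> g1 b) (\<phi> g2 b) (\<phi> g3 b))"

lemma heavyE:
 assumes "heavy h b S y"
 obtains g1 g2 g3 where "g1 : S" "g2 : S" "g3 : S" "dj h g1 g2" "dj h g1 g3" "dj h g2 g3" "y = med3 (\<phi> g1 b) (\<phi> g2 b) (\<phi> g3 b)"
 using assms unfolding heavy_def by (elim bexE conjE) (rule that)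

lemma heavy_shift:
 assumes "S <= \<Delta>" "h <= X" "b : X" "\<delta> : \<Delta>" "heavy h b S y"
 shows "heavy h b ((%\<gamma>. \<delta> \<otimes> \<gamma>) ` S) (\<phi> \<delta> y)"
 using assms(5)
proof (rule heavyE)
 fix g1 g2 g3 assume g: "g1 : S" "g2 : S" "g3 : S" "dj h g1 g2" "dj h g1 g3" "dj h g2 g3" "y = med3 (\<phi> g1 b) (\<phi> g2 b) (\<phi> g3 b)"
 have D: "g1 : \<Delta>" "g2 : \<Delta>" "g3 : \<Delta>" using g assms(1) by auto
 have "\<phi> \<delta> y = med3 (\<phi> (\<delta> \<otimes> g1) b) (\<phi> (\<delta> \<otimes> g2) b) (\<phi> (\<delta> \<otimes> g3) b)"
  using med_phi[OF assms(4)] phi_closed[OF _ assms(3)] D phi_mult[OF assms(4) _ assms(3)] g(7) by simp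
 moreover have "dj h (\<delta> \<otimes> g1) (\<delta> \<otimes> g2)" "dj h (\<delta> \<otimes> g1) (\<delta> \<otimes> g3)" "dj h (\<delta> \<otimes> g2) (\<delta> \<otimes> g3)"
  using dj_mult[OF assms(4) _ _ assms(2)] D g(4-6) by simp_all
 ultimately show ?thesis unfolding heavy_def using g(1-3) by blast
qed

text \<open>By Ramsey's theorem many centers yield many disjoint translates: where all three pairs of sets of
 two triples intersect, the centers agree.\<close>

lemma heavy_bound:
 assumes n: "nest k h" and b: "b : k"
 shows "EX R. \<forall>S\<subseteq>\<Delta>. (\<forall>E\<subseteq>S. finite E --> pairwise (dj k) E --> card E <= N) -->
  finite {y. heavy h b S y} & card {y. heavy h b S y} <= R"
proof -
 obtain R where R: "ALL (V::'x set) P1 P2 P3. finite V & R <= card V & symp P1 & symp P2 & symp P3 &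
  (ALL x:V. ALL y:V. x ~= y --> P1 x y | P2 x y | P3 x y) -->
  (\<exists>R\<subseteq>V. card R = Suc N & (pairwise P1 R | pairwise P2 R | pairwise P3 R))" using ramsey_three[of "Suc N"] by (elim exE)
 have "finite {y. heavy h b S y} & card {y. heavy h b S y} <= R"
  if S: "S <= \<Delta>" "\<forall>E\<subseteq>S. finite E --> pairwise (dj k) E --> card E <= N" for S
 proof (rule finite_if_finite_subsets_card_bdd)
  fix V assume V: "V <= {y. heavy h b S y}" "finite V"
  show "card V <= R"
  proof (rule ccontr)
   assume big: "~ card V <= R"
   define D where "D y g1 g2 g3 \<longleftrightarrow> g1 : S & g2 : S & g3 : S & dj h g1 g2 & dj h g1 g3 & dj h g2 g3 &
    y = med3 (\<phi> g1 b) (\<phi> g2 b) (\<phi> g3 b)" for y g1 g2 g3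
   have "ALL y:V. EX g1 g2 g3. D y g1 g2 g3"
   proof
    fix y assume "y : V"
    hence "heavy h b S y" using V by auto
    thus "EX g1 g2 g3. D y g1 g2 g3" unfolding D_def by (rule heavyE) blast
   qed
   from bchoice[OF this] obtain t1 where "ALL y:V. EX g2 g3. D y (t1 y) g2 g3" by (rule exE)
   from bchoice[OF this] obtain t2 where "ALL y:V. EX g3. D y (t1 y) (t2 y) g3" by (rule exE)
   from bchoice[OF this] obtain t3 where t: "ALL y:V. D y (t1 y) (t2 y) (t3 y)" by (rule exE)
   have tS: "t1 y : S" "t2 y : S" "t3 y : S" and tdj: "dj h (t1 y) (t2 y)" "dj h (t1 y) (t3 y)" "dj h (t2 y) (t3 y)"
    and ty: "y = med3 (\<phi> (t1 y) b) (\<phi> (t2 y) b) (\<phi> (t3 y) b)" if "y : V" for y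
    using bspec[OF t that] by (simp_all add: D_def)
   have tD: "t1 y : \<Delta>" "t2 y : \<Delta>" "t3 y : \<Delta>" if "y : V" for y using tS[OF that] S(1) by auto
   have ne: "dj k (t1 x) (t1 y) | dj k (t2 x) (t2 y) | dj k (t3 x) (t3 y)" if xy: "x : V" "y : V" "x ~= y" for x y
   proof (rule ccontr)
    assume "~ ?thesis"
    then obtain a1 a2 a3 where a: "a1 : \<phi> (t1 x) ` k" "a1 : \<phi> (t1 y) ` k" "a2 : \<phi> (t2 x) ` k" "a2 : \<phi> (t2 y) ` k"
     "a3 : \<phi> (t3 x) ` k" "a3 : \<phi> (t3 y) ` k" unfolding dj_def by blast
    have "x = med3 a1 a2 a3"
     using center_const[OF n tD[OF xy(1)] tdj[OF xy(1)] imageI[OF b] imageI[OF b] imageI[OF b] a(1,3,5)] ty[OF xy(1)] by simp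
    moreover have "y = med3 a1 a2 a3"
     using center_const[OF n tD[OF xy(2)] tdj[OF xy(2)] imageI[OF b] imageI[OF b] imageI[OF b] a(2,4,6)] ty[OF xy(2)] by simp
    ultimately show False using xy(3) by simp
   qed
   have False if W: "W <= V" "card W = Suc N" "pairwise (%x y. dj k (u x) (u y)) W" and u: "!!y. y : V ==> u y : S" for W u
   proof -
    have inj: "inj_on u W"
    proof (rule inj_onI, rule ccontr)
     fix x y assume xy: "x : W" "y : W" "u x = u y" "x ~= y"
     have "dj k (u x) (u y)" by (rule pairwiseD[OF W(3) xy(1,2,4)])
     thus False using xy(3) b by (auto simp: dj_def)
    qed
    have "pairwise (dj k) (u ` W)"
    proof (rule pairwiseI)
     fix p q assume "p : u ` W" "q : u ` W" "p ~= q"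
     then obtain x y where xy: "p = u x" "q = u y" "x : W" "y : W" "x ~= y" by auto
     show "dj k p q" unfolding xy(1,2) by (rule pairwiseD[OF W(3) xy(3-5)])
    qed
    moreover have "u ` W <= S" using u subsetD[OF W(1)] by (intro image_subsetI) simp
    moreover have "finite (u ` W)" using W(1) V(2) finite_subset by blast
    ultimately have "card (u ` W) <= N" using S(2) by blast
    thus False using card_image[OF inj] W(2) by simp
   qed
   note no = this
   have "\<exists>W\<subseteq>V. card W = Suc N & (pairwise (%x y. dj k (t1 x) (t1 y)) W |
     pairwise (%x y. dj k (t2 x) (t2 y)) W | pairwise (%x y. dj k (t3 x) (t3 y)) W)"
    by (rule R[rule_format]) (use V(2) big ne dj_symp in auto)
   then obtain W where W: "W <= V" "card W = Suc N" "pairwise (%x y. dj k (t1 x) (t1 y)) W |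
     pairwise (%x y. dj k (t2 x) (t2 y)) W | pairwise (%x y. dj k (t3 x) (t3 y)) W" by (elim exE conjE)
   from W(3) show False using no[OF W(1,2) _ tS(1)] no[OF W(1,2) _ tS(2)] no[OF W(1,2) _ tS(3)] by (elim disjE)
  qed
 qed
 thus ?thesis by blast
qed

end

section \<open>Capacities\<close>

context capacities
begin

text \<open>Think of an equivariant family of measures of total mass one on \<open>X\<close> and of the mass that it
 gives to a fixed set: the masses of two sets that cover \<open>X\<close> add up to at least one, and
 those of disjoint sets to at most one. Averaging in the sense of \<open>averaging_step\<close> loses
 additivity but preserves the weaker bound two for disjoint translates.\<close>

definition cap :: "('g => real) => bool" where
 "cap U \<longleftrightarrow> U : borel_measurable \<B> & (ALL x:carrier P. 0 <= U x & U x <= 1)"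

definition c1 :: "'g => ('g => real) => bool" where
 "c1 \<gamma> U \<longleftrightarrow> (AE x in \<nu>. 1 <= U x + U (x \<otimes> \<gamma>))"

definition c2 :: "'x set => ('g => real) => bool" where
 "c2 h U \<longleftrightarrow> (\<forall>E\<subseteq>\<Delta>. finite E --> pairwise (dj h) E --> (AE x in \<nu>. (\<Sum>\<gamma>\<in>E. U (x \<otimes> \<gamma>)) <= 2))"

definition invar :: "'g set => ('g => real) => bool" where
 "invar L U \<longleftrightarrow> (ALL l:L. AE x in \<nu>. U (l \<otimes> x) = U x)"

text \<open>The alternative to a new capacity: an \<open>N\<close>-invariant set \<open>E\<close> of positive measure such that
 lattice elements that lead from a point of \<open>E\<close> to another one preserve \<open>F\<close>.\<close>

definition fixed_finite :: "'g set => bool" where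
 "fixed_finite N \<longleftrightarrow> (EX F E. finite F & F ~= {} & F <= X & E : sets \<B> & ~ (AE g in \<nu>. g ~: E) &
  (ALL w:N. AE g in \<nu>. (w \<otimes> g : E) = (g : E)) &
  (ALL g:carrier P. ALL \<gamma>:\<Delta>. g : E --> g \<otimes> \<gamma> : E --> \<phi> \<gamma> ` F = F))"

lemma heavy_mono: "S <= S' ==> heavy h b S y ==> heavy h b S' y" unfolding heavy_def by (meson subsetD)

definition centers :: "'x => 'x set" where
 "centers b = (%(g1, g2, g3). med3 (\<phi> g1 b) (\<phi> g2 b) (\<phi> g3 b)) ` (\<Delta> \<times> \<Delta> \<times> \<Delta>)"

abbreviation "icenters b == centers b \<times> (UNIV :: nat set)"

lemma centers_countable: "countable (centers b)"
 unfolding centers_def using D_countable by (intro countable_image countable_SIGMA) auto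

lemma centers_sub: "b : X ==> centers b <= X"
 by (auto simp: centers_def intro!: med_closed phi_closed)

lemma centers_phi: assumes "b : X" "\<gamma> : \<Delta>" "y : centers b" shows "\<phi> \<gamma> y : centers b"
proof -
 obtain g1 g2 g3 where g: "g1 : \<Delta>" "g2 : \<Delta>" "g3 : \<Delta>" "y = med3 (\<phi> g1 b) (\<phi> g2 b) (\<phi> g3 b)"
  using assms(3) by (auto simp: centers_def)
 have "\<phi> \<gamma> y = (%(g1, g2, g3). med3 (\<phi> g1 b) (\<phi> g2 b) (\<phi> g3 b)) (\<gamma> \<otimes> g1, \<gamma> \<otimes> g2, \<gamma> \<otimes> g3)"
  using g assms(1,2) by (simp add: med_phi phi_closed phi_mult)
 moreover have "(\<gamma> \<otimes> g1, \<gamma> \<otimes> g2, \<gamma> \<otimes> g3) : \<Delta> \<times> \<Delta> \<times> \<Delta>" using D_mult[OF assms(2)] g by simp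
 ultimately show ?thesis unfolding centers_def by (rule image_eqI)
qed

lemma equivariant_centers:
 assumes b: "b : X"
 shows "equivariant P T \<Delta> \<mu> (icenters b) (%\<gamma> (y, j). (\<phi> \<gamma> y, j))"
proof (unfold_locales)
 show "countable (icenters b)" using centers_countable by (intro countable_SIGMA) auto
 fix \<gamma> assume g: "\<gamma> : \<Delta>"
 have y: "y : X" if "y : centers b" for y using that centers_sub[OF b] by auto
 show "bij_betw (%(y, j). (\<phi> \<gamma> y, j)) (icenters b) (icenters b)"
 proof (rule bij_betw_byWitness[where f' = "%(y, j). (\<phi> (inv \<gamma>) y, j)"])
  show "ALL a:icenters b. (%(y, j). (\<phi> (inv \<gamma>) y, j)) ((%(y, j). (\<phi> \<gamma> y, j)) a) = a"
   using phi_inv(1)[OF g y] by auto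
  show "ALL a:icenters b. (%(y, j). (\<phi> \<gamma> y, j)) ((%(y, j). (\<phi> (inv \<gamma>) y, j)) a) = a"
   using phi_inv(2)[OF g y] by auto
  show "(%(y, j). (\<phi> \<gamma> y, j)) ` icenters b <= icenters b"
   using centers_phi[OF b g] by auto
  show "(%(y, j). (\<phi> (inv \<gamma>) y, j)) ` icenters b <= icenters b"
   using centers_phi[OF b D_inv[OF g]] by auto
 qed
qed

text \<open>The starting capacity: \<open>x \<mapsto> \<phi> (lat x) o'\<close> is an equivariant map from the group to \<open>X\<close>, where
 \<open>lat x\<close> leads from \<open>x\<close> to the representative of its coset, and the capacity is one where the image
 lies in \<open>k\<close>.\<close>

lemma initial_capacity:
 assumes o: "o' : X" and g0: "\<gamma>0 : \<Delta>" and k: "k <= X" "k \<union> \<phi> \<gamma>0 ` k = X"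
 shows "EX U. cap U & c1 \<gamma>0 U & c2 k U"
proof -
 define lat where "lat x = inv x \<otimes> sec (x <# \<Delta>)" for x
 have lat: "lat x : \<Delta>" if x: "x : carrier P" for x
  unfolding lat_def by (rule Q_rel[OF coset_Q[OF x] lcos_self[OF x sub] sec(1)[OF coset_Q[OF x]]])
 have lat_right: "lat (x \<otimes> \<gamma>) = inv \<gamma> \<otimes> lat x" if x: "x : carrier P" and g: "\<gamma> : \<Delta>" for x \<gamma>
 proof -
  have "x \<otimes> \<gamma> : x <# \<Delta>" using g by (auto simp: l_coset_def)
  hence "(x \<otimes> \<gamma>) <# \<Delta> = x <# \<Delta>" using Q_coset[OF coset_Q[OF x]] by simp
  thus ?thesis using x D_sub[OF g] sec(3)[OF coset_Q[OF x]] by (simp add: lat_def inv_mult_group m_assoc)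
 qed
 define hit where "hit = {x : carrier P. \<phi> (lat x) o' : k}"
 define U where "U = (indicator hit :: 'g => real)"
 have "hit : sets \<B>"
 proof -
  have "openin (subtopology T \<Delta>) {\<delta> : \<Delta>. \<phi> \<delta> o' : k}" by (simp add: disc)
  then obtain W where W: "openin T W" "{\<delta> : \<Delta>. \<phi> \<delta> o' : k} = W \<inter> \<Delta>" unfolding openin_subtopology by (elim exE conjE)
  have "(%x. (x, sec (x <# \<Delta>))) : measurable \<B> (\<B> \<Otimes>\<^sub>M \<B>)"
   by (intro measurable_Pair measurable_ident_sets[OF refl] measurable_compose[OF meas_coset meas_sec])
  from measurable_compose[OF this continuous_map_prod_bor[OF sc sc cont_quot]]
  have "lat : measurable \<B> \<B>" by (simp add: lat_def[abs_def])
  hence "lat -` W \<inter> space \<B> : sets \<B>" using open_in_bor[OF W(1)] by (rule measurable_sets)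
  moreover have "(\<phi> (lat x) o' : k) = (lat x : W)" if "x : carrier P" for x using lat[OF that] W(2) by blast
  ultimately show ?thesis by (simp add: hit_def vimage_def Int_def topspace conj_commute cong: conj_cong)
 qed
 hence "cap U" by (auto simp: cap_def U_def)
 moreover have "c1 \<gamma>0 U" unfolding c1_def
 proof (rule AE_I2)
  fix x assume "x : space \<nu>"
  hence x: "x : carrier P" by (simp add: space_nu)
  have "\<phi> (lat x) o' : k \<union> \<phi> \<gamma>0 ` k" unfolding k(2) by (rule phi_closed[OF lat[OF x] o])
  moreover have "\<phi> (lat (x \<otimes> \<gamma>0)) o' = y" if "\<phi> (lat x) o' = \<phi> \<gamma>0 y" "y : k" for y
   using phi_mult[OF D_inv[OF g0] lat[OF x] o] that phi_inv(1)[OF g0] k(1) by (auto simp: lat_right[OF x g0])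
  ultimately have "x : hit | x \<otimes> \<gamma>0 : hit" using x D_sub[OF g0] by (auto simp: hit_def)
  thus "1 <= U x + U (x \<otimes> \<gamma>0)" by (auto simp: U_def indicator_def)
 qed
 moreover have "c2 k U" unfolding c2_def
 proof (intro allI impI AE_I2)
  fix E x assume E: "E <= \<Delta>" "finite E" "pairwise (dj k) E" and "x : space \<nu>"
  hence x: "x : carrier P" by (simp add: space_nu)
  have in_im: "\<phi> (lat x) o' : \<phi> \<gamma> ` k" if g: "\<gamma> : E" "x \<otimes> \<gamma> : hit" for \<gamma>
  proof -
   have gD: "\<gamma> : \<Delta>" using g E by auto
   have "\<phi> (inv \<gamma>) (\<phi> (lat x) o') : k"
    using g(2) phi_mult[OF D_inv[OF gD] lat[OF x] o] by (simp add: hit_def lat_right[OF x gD])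
   from imageI[OF this, of "\<phi> \<gamma>"] show ?thesis using phi_inv(2)[OF gD phi_closed[OF lat[OF x] o]] by simp
  qed
  have "card {\<gamma> : E. x \<otimes> \<gamma> : hit} <= 1"
  proof (rule ccontr)
   assume "~ ?thesis"
   then obtain \<gamma> \<gamma>' where g: "\<gamma> : E" "x \<otimes> \<gamma> : hit" "\<gamma>' : E" "x \<otimes> \<gamma>' : hit" "\<gamma> ~= \<gamma>'"
    using E(2) card_le_Suc0_iff_eq[of "{\<gamma> : E. x \<otimes> \<gamma> : hit}"] by auto
   have "dj k \<gamma> \<gamma>'" by (rule pairwiseD[OF E(3) g(1,3,5)])
   thus False using in_im[OF g(1,2)] in_im[OF g(3,4)] by (auto simp: dj_def)
  qed
  moreover have "(\<Sum>\<gamma>\<in>E. U (x \<otimes> \<gamma>)) = (\<Sum>\<gamma>\<in>{\<gamma> : E. x \<otimes> \<gamma> : hit}. 1)"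
   by (rule sum.mono_neutral_cong_right[OF E(2)]) (auto simp: U_def indicator_def)
  ultimately show "(\<Sum>\<gamma>\<in>E. U (x \<otimes> \<gamma>)) <= 2" by simp
 qed
 ultimately show ?thesis by blast
qed

end

text \<open>The situation of one averaging step: \<open>K\<close> is a countable dense subgroup of one factor and \<open>N\<close>
 is one of the product of the other factors. The capacity \<open>U\<close> is already invariant under \<open>L\<close>,
 and it is to become invariant under \<open>K\<close>. The price is that \<open>k\<close> is replaced by \<open>h\<close>.\<close>

locale capacity_step = capacities P T \<Delta> \<mu> X \<phi> med3
 for P :: "'g monoid" (structure) and T \<Delta> \<mu> and X :: "'x set" and \<phi> med3 +
 fixes K N L :: "'g set" and \<gamma>0 :: 'g and k h :: "'x set" and U :: "'g => real" and b :: 'x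
 assumes nest: "nest k h" and bk: "b : k" and g0: "\<gamma>0 : \<Delta>"
  and K_sub: "K <= carrier P" and K_one: "\<one> : K" and K_countable: "countable K"
  and K_mult: "!!x y. x : K ==> y : K ==> x \<otimes> y : K" and K_inv: "!!x. x : K ==> inv x : K"
  and N_sub: "N <= carrier P" and N_ne: "N ~= {}" and N_mult: "!!x y. x : N ==> y : N ==> x \<otimes> y : N"
  and L_sub: "L <= carrier P"
  and KN: "!!x w. x : K ==> w : N ==> w \<otimes> x = x \<otimes> w"
  and KL: "!!x l. x : K ==> l : L ==> l \<otimes> x = x \<otimes> l"
  and NL: "!!w l. w : N ==> l : L ==> EX l':L. w \<otimes> l = l' \<otimes> w"
  and capU: "cap U" and c1U: "c1 \<gamma>0 U" and c2U: "c2 k U" and invU: "invar L U"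
begin

lemma kX: "k <= X" and hX: "h <= X" and bX: "b : X" using nest_sub[OF nest] bk by auto

text \<open>An exhaustion of \<open>K\<close> by finite sets.\<close>

definition SS :: "nat => 'g set" where "SS j = insert \<one> (from_nat_into K ` {..j})"

lemma SS: "finite (SS j)" "\<one> : SS j" "SS j <= K" "i <= j ==> SS i <= SS j"
 using K_one from_nat_into[of K] by (auto simp: SS_def)

lemma SS_exhaust: assumes "s : K" shows "EX j. s : SS j"
proof -
 have "range (from_nat_into K) = K" using K_countable K_one by (intro range_from_nat_into) auto
 then obtain n where "s = from_nat_into K n" using assms by blast
 thus ?thesis by (intro exI[of _ n]) (auto simp: SS_def)
qed

text \<open>Thresholds that decrease to zero. The first one is below one half, so one of two numbers
 whose sum is at least one exceeds it.\<close>

definition th :: "nat => real" where "th j = 1 / (real j + 3)"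

lemma th: "0 < th j" "i <= j ==> th j <= th i" "th j < 1/2" by (auto simp: th_def field_simps)

text \<open>For large \<open>j\<close> these sets hardly distinguish \<open>x\<close> from \<open>s \<otimes> x\<close> with \<open>s\<close> in \<open>K\<close>, which
 makes the new capacity invariant under \<open>K\<close>.\<close>

definition BB :: "nat => 'g set" where "BB j = {x : carrier P. EX s:SS j. th j < U (s \<otimes> x)}"

lemma BB_mono: assumes "i <= j" shows "BB i <= BB j"
proof
 fix x assume "x : BB i"
 then obtain s where s: "x : carrier P" "s : SS i" "th i < U (s \<otimes> x)" by (auto simp: BB_def)
 have "s : SS j" using SS(4)[OF assms] s(2) by auto
 moreover have "th j < U (s \<otimes> x)" using th(2)[OF assms] s(3) by simp
 ultimately show "x : BB j" using s(1) by (auto simp: BB_def)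
qed

lemma BB_meas: "BB j : sets \<B>"
proof -
 have "{x : space \<B>. th j < U (s \<otimes> x)} : sets \<B>" if "s : SS j" for s
 proof -
  have "s : carrier P" using that SS(3) K_sub by auto
  hence "(%x. U (s \<otimes> x)) : borel_measurable \<B>" using capU by (intro measurable_compose[OF meas_left]) (auto simp: cap_def)
  thus ?thesis by measurable
 qed
 moreover have "BB j = (\<Union>s\<in>SS j. {x : space \<B>. th j < U (s \<otimes> x)})" by (auto simp: BB_def topspace)
 ultimately show ?thesis using SS(1) by auto
qed

text \<open>The lattice elements whose translates of \<open>h\<close> count as charged at \<open>x\<close>.\<close>

definition Sg :: "nat => 'g => 'g set" where "Sg j x = {\<gamma> : \<Delta>. x \<otimes> \<gamma> : BB j}"

abbreviation "hcs j x == {y. heavy h b (Sg j x) y}"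

lemma Sg_sub: "Sg j x <= \<Delta>" by (auto simp: Sg_def)

lemma heavy_right_imp:
 assumes "x : carrier P" "\<gamma> : \<Delta>" "heavy h b (Sg j (x \<otimes> \<gamma>)) y"
 shows "heavy h b (Sg j x) (\<phi> \<gamma> y)"
proof (rule heavy_mono[OF _ heavy_shift[OF Sg_sub hX bX assms(2,3)]])
 show "(\<otimes>) \<gamma> ` Sg j (x \<otimes> \<gamma>) <= Sg j x"
  using assms(1,2) D_sub D_mult by (auto simp: Sg_def m_assoc)
qed

lemma heavy_right:
 assumes x: "x : carrier P" "\<gamma> : \<Delta>" and y: "y : X"
 shows "heavy h b (Sg j (x \<otimes> \<gamma>)) y \<longleftrightarrow> heavy h b (Sg j x) (\<phi> \<gamma> y)"
proof
 assume "heavy h b (Sg j x) (\<phi> \<gamma> y)"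
 hence "heavy h b (Sg j ((x \<otimes> \<gamma>) \<otimes> inv \<gamma>)) (\<phi> \<gamma> y)" using x D_sub by (simp add: m_assoc)
 from heavy_right_imp[OF _ D_inv[OF x(2)] this] show "heavy h b (Sg j (x \<otimes> \<gamma>)) y"
  using x D_sub phi_inv(1)[OF x(2) y] by simp
qed (rule heavy_right_imp[OF x])

lemma heavy_meas: "{x : carrier P. heavy h b (Sg j x) y} : sets \<B>"
proof -
 define A where "A \<gamma> = {x : carrier P. x \<otimes> \<gamma> : BB j}" for \<gamma>
 define B where "B g1 g2 g3 = (if dj h g1 g2 & dj h g1 g3 & dj h g2 g3 & y = med3 (\<phi> g1 b) (\<phi> g2 b) (\<phi> g3 b)
   then A g1 \<inter> A g2 \<inter> A g3 else {})" for g1 g2 g3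
 have "A \<gamma> : sets \<B>" if "\<gamma> : \<Delta>" for \<gamma>
  using measurable_sets[OF meas_right[OF D_sub[OF that]] BB_meas]
  by (simp add: A_def vimage_def Int_def topspace conj_commute)
 hence "(\<Union>g1\<in>\<Delta>. \<Union>g2\<in>\<Delta>. \<Union>g3\<in>\<Delta>. B g1 g2 g3) : sets \<B>"
  unfolding B_def by (intro sets.countable_UN'' D_countable) auto
 also have "(\<Union>g1\<in>\<Delta>. \<Union>g2\<in>\<Delta>. \<Union>g3\<in>\<Delta>. B g1 g2 g3) = {x : carrier P. heavy h b (Sg j x) y}"
  unfolding B_def A_def heavy_def Sg_def by (auto split: if_splits)
 finally show ?thesis .
qed

lemma finite_subsets_countable: "countable {E. finite E & E <= \<Delta>}"
 by (rule countable_Collect_finite_subset[OF D_countable])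

lemma c2_everywhere:
 "AE x in \<nu>. ALL s:K. ALL E:{E. finite E & E <= \<Delta>}. pairwise (dj k) E --> (\<Sum>\<gamma>\<in>E. U (s \<otimes> (x \<otimes> \<gamma>))) <= 2"
 unfolding AE_ball_countable[OF K_countable] AE_ball_countable[OF finite_subsets_countable]
proof (intro ballI)
 fix s E assume s: "s : K" and E: "E : {E. finite E & E <= \<Delta>}"
 have sP: "s : carrier P" using s K_sub by auto
 show "AE x in \<nu>. pairwise (dj k) E --> (\<Sum>\<gamma>\<in>E. U (s \<otimes> (x \<otimes> \<gamma>))) <= 2"
 proof (cases "pairwise (dj k) E")
  case True
  hence "AE x in \<nu>. (\<Sum>\<gamma>\<in>E. U (x \<otimes> \<gamma>)) <= 2" using c2U E by (auto simp: c2_def)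
  from AE_left[OF sP this] AE_space show ?thesis
  proof eventually_elim
   case (elim x)
   have "(\<Sum>\<gamma>\<in>E. U (s \<otimes> (x \<otimes> \<gamma>))) = (\<Sum>\<gamma>\<in>E. U (s \<otimes> x \<otimes> \<gamma>))"
    using E D_sub sP elim(2) by (intro sum.cong refl) (auto simp: space_nu m_assoc)
   thus ?case using elim(1) by simp
  qed
 qed simp
qed

text \<open>The second capacity inequality, applied to finitely many translates of \<open>U\<close>, bounds the size
 of disjoint families in \<open>Sg j x\<close>, and so the number of heavy centers.\<close>

lemma heavy_count: "EX R. AE x in \<nu>. ALL j. finite (hcs j x) & card (hcs j x) <= R j"
proof -
 define NN where "NN j = nat \<lceil>2 * real (card (SS j)) * (real j + 3)\<rceil>" for j
 have "ALL j. EX R. \<forall>S\<subseteq>\<Delta>. (\<forall>E\<subseteq>S. finite E --> pairwise (dj k) E --> card E <= NN j) -->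
  finite {y. heavy h b S y} & card {y. heavy h b S y} <= R" using heavy_bound[OF nest bk] by blast
 then obtain R where R: "ALL j. \<forall>S\<subseteq>\<Delta>. (\<forall>E\<subseteq>S. finite E --> pairwise (dj k) E --> card E <= NN j) -->
  finite {y. heavy h b S y} & card {y. heavy h b S y} <= R j" by (rule choice[THEN exE])
 have "AE x in \<nu>. ALL j. finite (hcs j x) & card (hcs j x) <= R j"
  using c2_everywhere AE_space
 proof eventually_elim
  case (elim x)
  show ?case
  proof
   fix j
   have "card E <= NN j" if E: "E <= Sg j x" "finite E" "pairwise (dj k) E" for E
   proof -
    have ED: "E <= \<Delta>" using E(1) Sg_sub by blast
    have nn: "0 <= U (s \<otimes> (x \<otimes> \<gamma>))" if "s : SS j" "\<gamma> : E" for s \<gamma>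
     using capU that SS(3) K_sub ED D_sub elim(2) by (auto simp: cap_def space_nu subset_eq)
    have "real (card E) * th j <= (\<Sum>\<gamma>\<in>E. \<Sum>s\<in>SS j. U (s \<otimes> (x \<otimes> \<gamma>)))"
    proof (rule sum_bounded_below)
     fix \<gamma> assume g: "\<gamma> : E"
     then obtain s where s: "s : SS j" "th j < U (s \<otimes> (x \<otimes> \<gamma>))" using E(1) by (auto simp: Sg_def BB_def)
     have "U (s \<otimes> (x \<otimes> \<gamma>)) <= (\<Sum>s\<in>SS j. U (s \<otimes> (x \<otimes> \<gamma>)))"
      by (rule member_le_sum[OF s(1) _ SS(1)]) (use nn g in auto)
     thus "th j <= (\<Sum>s\<in>SS j. U (s \<otimes> (x \<otimes> \<gamma>)))" using s(2) by simp
    qed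
    also have "... = (\<Sum>s\<in>SS j. \<Sum>\<gamma>\<in>E. U (s \<otimes> (x \<otimes> \<gamma>)))" by (rule sum.swap)
    also have "... <= real (card (SS j)) * 2"
    proof (rule sum_bounded_above)
     fix s assume "s : SS j"
     hence "s : K" using SS(3) by auto
     thus "(\<Sum>\<gamma>\<in>E. U (s \<otimes> (x \<otimes> \<gamma>))) <= 2" using elim(1) E ED by auto
    qed
    finally have "real (card E) <= 2 * real (card (SS j)) * (real j + 3)" by (simp add: th_def field_simps)
    thus ?thesis unfolding NN_def by linarith
   qed
   thus "finite (hcs j x) & card (hcs j x) <= R j"
    using R Sg_sub by blast
  qed
 qed
 thus ?thesis by blast
qed

end

section \<open>One averaging step\<close>

context capacity_step
begin

interpretation E: equivariant P T \<Delta> \<mu> "icenters b" "%\<gamma> (y, j). (\<phi> \<gamma> y, j)"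
 by (rule equivariant_centers[OF bX])

definition RR :: "nat => nat" where
 "RR = (SOME R. AE x in \<nu>. ALL j. finite (hcs j x) & card (hcs j x) <= R j)"

lemma RR: "AE x in \<nu>. ALL j. finite (hcs j x) & card (hcs j x) <= RR j"
 unfolding RR_def by (rule someI_ex[OF heavy_count])

text \<open>Weights that make the vector of heavy centers square integrable, whatever the bounds \<open>RR j\<close>
 are.\<close>

definition cc :: "nat => real" where "cc j = (1/2) ^ j / (real (RR j) + 1)"

lemma cc: "cc j > 0" "(cc j)\<^sup>2 * real (RR j) <= (1/2) ^ j"
proof -
 show "cc j > 0" by (simp add: cc_def)
 have a: "0 <= real (RR j)" "((1/2::real) ^ j)\<^sup>2 <= (1/2) ^ j"
  by (simp_all add: power2_eq_square power_le_one mult_left_le)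
 have "(cc j)\<^sup>2 * real (RR j) = ((1/2) ^ j)\<^sup>2 * (real (RR j) / (real (RR j) + 1)\<^sup>2)" by (simp add: cc_def power_divide power_mult_distrib)
 also have "... <= (1/2) ^ j * 1"
 proof (rule mult_mono[OF a(2)])
  have "real (RR j) <= (real (RR j) + 1)\<^sup>2" using a(1) by (simp add: power2_eq_square algebra_simps)
  thus "real (RR j) / (real (RR j) + 1)\<^sup>2 <= 1" by (simp add: divide_le_eq)
 qed auto
 finally show "(cc j)\<^sup>2 * real (RR j) <= (1/2) ^ j" by simp
qed

text \<open>The vector that records the centers of heavy triples.\<close>

definition vv :: "'g => 'x \<times> nat => real" where
 "vv x = (%(y, j). cc j * of_bool (x : carrier P & heavy h b (Sg j x) y))"

lemma vv_eqv: "E.eqv vv" unfolding E.eqv_def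
proof (intro conjI ballI)
 fix z assume "z : icenters b"
 obtain y j where z: "z = (y, j)" by (cases z)
 have "(%x. vv x z) = (%x. cc j * indicator {x : carrier P. heavy h b (Sg j x) y} x)"
  by (auto simp: vv_def z indicator_def)
 also have "... : borel_measurable \<B>" using heavy_meas[of j y] by (intro borel_measurable_times borel_measurable_indicator) auto
 finally show "(%x. vv x z) : borel_measurable \<B>" .
next
 fix x \<gamma> z assume x: "x : carrier P" "\<gamma> : \<Delta>" "z : icenters b"
 obtain y j where z: "z = (y, j)" by (cases z)
 have "y : X" using x(3) z centers_sub[OF bX] by auto
 thus "vv (x \<otimes> \<gamma>) z = vv x ((%(y, j). (\<phi> \<gamma> y, j)) z)"
  using heavy_right[OF x(1,2)] x(1,2) D_sub by (simp add: vv_def z)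
qed

lemma vv_finite: "E.sq vv < \<infinity>"
proof -
 have "AE C in \<mu>. (\<integral>\<^sup>+z. ennreal ((vv (sec C) z)\<^sup>2) \<partial>count_space (icenters b)) <= ennreal 2"
 proof -
  have "AE C in \<mu>. ALL x:C. ALL j. finite (hcs j x) & card (hcs j x) <= RR j"
   using RR unfolding AE_nu_iff .
  thus ?thesis
  proof (rule AE_mp, intro AE_I2 impI)
   fix C assume C: "C : space \<mu>" "ALL x:C. ALL j. finite (hcs j x) & card (hcs j x) <= RR j"
   define x where "x = sec C"
   have "x : C" using C(1) sec(1) by (simp add: x_def space_mu)
   hence fin: "finite (hcs j x)" "card (hcs j x) <= RR j" for j using C(2) by auto
   have "(\<integral>\<^sup>+z. ennreal ((vv x z)\<^sup>2) \<partial>count_space (icenters b)) <= (\<integral>\<^sup>+z. ennreal ((vv x z)\<^sup>2) \<partial>count_space UNIV)"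
    by (subst nn_integral_count_space_indicator) (auto intro!: nn_integral_mono simp: indicator_def)
   also have "... = (\<integral>\<^sup>+j. (\<integral>\<^sup>+y. ennreal ((vv x (y, j))\<^sup>2) \<partial>count_space UNIV) \<partial>count_space UNIV)"
    by (rule nn_integral_snd_count_space[symmetric])
   also have "... <= (\<integral>\<^sup>+j. ennreal ((1/2) ^ j) \<partial>count_space UNIV)"
   proof (rule nn_integral_mono)
    fix j :: nat
    have "(\<integral>\<^sup>+y. ennreal ((vv x (y, j))\<^sup>2) \<partial>count_space UNIV) \<le>
      (\<integral>\<^sup>+y. ennreal ((cc j)\<^sup>2) * indicator (hcs j x) y \<partial>count_space UNIV)"
     by (rule nn_integral_mono) (auto simp: vv_def indicator_def)
    also have "... = ennreal ((cc j)\<^sup>2) * emeasure (count_space UNIV) (hcs j x)"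
     by (rule nn_integral_cmult_indicator) simp
    also have "... = ennreal ((cc j)\<^sup>2 * real (card (hcs j x)))"
     using fin(1)[of j] by (simp add: ennreal_mult ennreal_of_nat_eq_real_of_nat)
    also have "... <= ennreal ((1/2) ^ j)"
    proof (rule ennreal_leI)
     have "(cc j)\<^sup>2 * real (card (hcs j x)) <= (cc j)\<^sup>2 * real (RR j)"
      using fin(2)[of j] by (intro mult_left_mono) auto
     thus "(cc j)\<^sup>2 * real (card (hcs j x)) <= (1/2) ^ j" using cc(2)[of j] by simp
    qed
    finally show "(\<integral>\<^sup>+y. ennreal ((vv x (y, j))\<^sup>2) \<partial>count_space UNIV) <= ennreal ((1/2) ^ j)" .
   qed
   also have "... = (\<Sum>j. ennreal ((1/2) ^ j))" by (rule nn_integral_count_space_nat)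
   also have "... = ennreal (\<Sum>j. (1/2) ^ j)" by (rule suminf_ennreal2) (auto intro!: summable_geometric)
   also have "(\<Sum>j. (1/2::real) ^ j) = 2" by (simp add: suminf_geometric)
   finally show "(\<integral>\<^sup>+z. ennreal ((vv (sec C) z)\<^sup>2) \<partial>count_space (icenters b)) <= ennreal 2"
    by (simp add: x_def)
  qed
 qed
 hence "E.sq vv <= (\<integral>\<^sup>+C. ennreal 2 \<partial>\<mu>)"
  unfolding E.sq_iterated(1)[OF vv_eqv] by (rule nn_integral_mono_AE)
 also have "... < \<infinity>" using emeasure_finite[of "space \<mu>"] by (simp add: ennreal_mult_eq_top_iff less_top[symmetric])
 finally show ?thesis .
qed

definition ff :: "nat => 'g => real" where "ff j = indicator (BB j)"

lemma ff: "ff j : borel_measurable \<B>" "0 <= ff j x" "ff j x <= 1" "i <= j ==> ff i x <= ff j x"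
 using BB_meas[of j] BB_mono[of i j] by (auto simp: ff_def indicator_def)

text \<open>Either the averages of the vector of heavy centers come close to zero, or there is an
 invariant vector, which gives a finite set of points that are fixed in the required sense.\<close>

lemma alternative:
 assumes nf: "~ fixed_finite N"
 shows "EX A. (ALL k. avg N (A k)) & (AE x in \<nu>. ALL j. convergent (%k. A k (ff j) x)) &
  (AE x in \<nu>. ALL z:icenters b. (%k. E.av (A k) vv x z) \<longlonglongrightarrow> 0)"
proof (rule E.convergent_averages[OF N_sub vv_eqv])
 fix e :: real assume e: "e > 0"
 show "EX A. avg N A & E.sq (E.av A vv) <= ennreal e"
 proof (rule ccontr)
  assume "~ ?thesis"
  hence pos: "ennreal e <= E.sq (E.av A vv)" if "avg N A" for A using that by (meson linear)
  obtain x where x: "E.eqv x" "E.sq x < \<infinity>" "E.sq x ~= 0"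
   "ALL w:N. AE g in \<nu>. ALL z:icenters b. x (w \<otimes> g) z = x g z"
   using E.invariant_vector[OF N_sub N_ne N_mult vv_eqv vv_finite e pos] by blast
  have "EX F E. finite F & F ~= {} & F <= icenters b & E : sets \<B> & ~ (AE g in \<nu>. g ~: E) &
   (ALL w:N. AE g in \<nu>. (w \<otimes> g : E) = (g : E)) &
   (ALL g:carrier P. ALL \<gamma>:\<Delta>. g : E --> g \<otimes> \<gamma> : E --> (%(y, j). (\<phi> \<gamma> y, j)) ` F = F)"
   by (rule E.invariant_finite_set[OF x(1-3) bspec[OF x(4)] N_sub])
  then obtain F E where FE: "finite F" "F ~= {}" "F <= icenters b" "E : sets \<B>" "~ (AE g in \<nu>. g ~: E)"
   "ALL w:N. AE g in \<nu>. (w \<otimes> g : E) = (g : E)"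
   "ALL g:carrier P. ALL \<gamma>:\<Delta>. g : E --> g \<otimes> \<gamma> : E --> (%(y, j). (\<phi> \<gamma> y, j)) ` F = F"
   by (elim exE conjE)
  have "\<phi> \<gamma> ` fst ` F = fst ` F" if "g : carrier P" "\<gamma> : \<Delta>" "g : E" "g \<otimes> \<gamma> : E" for g \<gamma>
  proof -
   have "(%(y, j). (\<phi> \<gamma> y, j)) ` F = F" using FE(7) that by blast
   hence "fst ` F = fst ` (%(y, j). (\<phi> \<gamma> y, j)) ` F" by simp
   also have "... = \<phi> \<gamma> ` fst ` F" by (simp add: image_image case_prod_unfold)
   finally show ?thesis by simp
  qed
  moreover have "fst ` F <= X" using FE(3) centers_sub[OF bX] by auto
  ultimately have "fixed_finite N"
   unfolding fixed_finite_def using FE(1,2,4-6) by (intro exI[of _ "fst ` F"] exI[of _ E]) simp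
  thus False using nf by simp
 qed
qed (use ff in auto)

text \<open>A family of disjoint translates that carries more than two of the points gives a heavy center, and
 the heavy centers disappear in the average.\<close>

lemma count_bound:
 assumes x: "x : carrier P" and E: "E <= \<Delta>" "finite E" "pairwise (dj h) E"
 shows "(\<Sum>\<gamma>\<in>E. ff j (x \<otimes> \<gamma>)) \<le>
  2 + real (card E) / cc j * (\<Sum>y\<in>(%(g1, g2, g3). med3 (\<phi> g1 b) (\<phi> g2 b) (\<phi> g3 b)) ` (E \<times> E \<times> E). vv x (y, j))"
proof -
 let ?Y = "(%(g1, g2, g3). med3 (\<phi> g1 b) (\<phi> g2 b) (\<phi> g3 b)) ` (E \<times> E \<times> E)"
 define S where "S = {\<gamma> : E. x \<otimes> \<gamma> : BB j}"
 have fS: "finite S" using E(2) by (simp add: S_def)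
 have "(\<Sum>\<gamma>\<in>E. ff j (x \<otimes> \<gamma>)) = (\<Sum>\<gamma>\<in>S. 1)"
  unfolding S_def by (rule sum.mono_neutral_cong_right[OF E(2)]) (auto simp: ff_def indicator_def)
 hence sum: "(\<Sum>\<gamma>\<in>E. ff j (x \<otimes> \<gamma>)) = real (card S)" by simp
 have nn: "0 <= vv x (y, j)" for y using cc(1)[of j] by (simp add: vv_def)
 have fY: "finite ?Y" using E(2) by auto
 show ?thesis
 proof (cases "card S <= 2")
  case True
  have "0 <= real (card E) / cc j * (\<Sum>y\<in>?Y. vv x (y, j))" using cc(1)[of j] nn by (intro mult_nonneg_nonneg sum_nonneg) auto
  thus ?thesis using True sum by simp
 next
  case False
  hence "3 <= card S" by simp
  from card_ge_3_obtain[OF fS this] obtain g1 g2 g3 where g: "g1 : S" "g2 : S" "g3 : S" "g1 ~= g2" "g1 ~= g3" "g2 ~= g3" .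
  have gE: "g1 : E" "g2 : E" "g3 : E" using g by (auto simp: S_def)
  define y where "y = med3 (\<phi> g1 b) (\<phi> g2 b) (\<phi> g3 b)"
  have "y : ?Y" unfolding y_def using gE by (intro image_eqI[of _ _ "(g1, g2, g3)"]) auto
  have gS: "g1 : Sg j x" "g2 : Sg j x" "g3 : Sg j x" using g E(1) by (auto simp: S_def Sg_def)
  have "dj h g1 g2" "dj h g1 g3" "dj h g2 g3" using pairwiseD[OF E(3)] gE g(4-6) by simp_all
  hence "heavy h b (Sg j x) y" unfolding heavy_def y_def using gS by blast
  hence "vv x (y, j) = cc j" using x by (simp add: vv_def)
  moreover have "vv x (y, j) <= (\<Sum>y\<in>?Y. vv x (y, j))" using `y : ?Y` fY nn by (intro member_le_sum) auto
  ultimately have "cc j <= (\<Sum>y\<in>?Y. vv x (y, j))" by simp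
  hence "real (card E) / cc j * cc j <= real (card E) / cc j * (\<Sum>y\<in>?Y. vv x (y, j))"
   using cc(1)[of j] by (intro mult_left_mono) auto
  moreover have "card S <= card E" using E(2) by (intro card_mono) (auto simp: S_def)
  ultimately show ?thesis using sum cc(1)[of j] by simp
 qed
qed

text \<open>The new capacity is the increasing limit over \<open>j\<close> of the limits of the averages over \<open>N\<close> of
 the indicators of \<open>BB j\<close>. The first inequality holds because it already holds for \<open>BB 0\<close>,
 the second one by \<open>count_bound\<close>, since the contribution of the heavy centers tends to zero.
 Invariance under \<open>L\<close> is inherited, and invariance under \<open>K\<close> holds because \<open>K\<close> commutes with
 \<open>N\<close> and translation by an element of \<open>K\<close> maps \<open>BB j\<close> into some later \<open>BB j'\<close>.\<close>

proposition averaging_step: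
 assumes nf: "~ fixed_finite N"
 shows "EX U'. cap U' & c1 \<gamma>0 U' & c2 h U' & invar L U' & invar K U'"
proof -
 obtain A where A: "!!k. avg N (A k)" and conv: "AE x in \<nu>. ALL j. convergent (%k. A k (ff j) x)"
  and zero: "AE x in \<nu>. ALL z:icenters b. (%k. E.av (A k) vv x z) \<longlonglongrightarrow> 0"
  using alternative[OF nf] by blast
 define Fl where "Fl j x = max 0 (min 1 (lim (%k. A k (ff j) x)))" for j x
 define U' where "U' x = (SUP j. Fl j x)" for x
 have Flb: "0 <= Fl j x" "Fl j x <= 1" for j x by (auto simp: Fl_def)
 have bdd: "bdd_above (range (%j. Fl j x))" for x using Flb by (intro bdd_aboveI[of _ 1]) auto
 have FU: "Fl j x <= U' x" for j x unfolding U'_def by (rule cSUP_upper[OF UNIV_I bdd])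
 have Flm: "Fl j : borel_measurable \<B>" for j
 proof -
  have "(%x. lim (%k. A k (ff j) x)) : borel_measurable \<B>"
   by (rule borel_measurable_lim_metric) (rule avg_meas[OF N_sub A ff(1)])
  thus ?thesis unfolding Fl_def by measurable
 qed
 have Um: "U' : borel_measurable \<B>" unfolding U'_def by (rule borel_measurable_cSUP) (auto intro: Flm bdd)
 have U0: "0 <= U' x" for x using Flb(1)[of 0 x] FU[of 0 x] by linarith
 have U1: "U' x <= 1" for x unfolding U'_def by (rule cSUP_least) (auto intro: Flb)
 have "cap U'" using Um U0 U1 by (simp add: cap_def)
 have Ab: "0 <= A k (ff j) x" "A k (ff j) x <= 1" if x: "x : carrier P" for k j x
  using avg_mono[OF N_sub A[of k] x, where f = "%_. 0" and g = "ff j"]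
   avg_mono[OF N_sub A[of k] x, where f = "ff j" and g = "%_. 1"] ff
  by (simp_all add: avg_const[OF N_sub A])
 have lim: "AE x in \<nu>. ALL j. (%k. A k (ff j) x) \<longlonglongrightarrow> Fl j x"
  using conv AE_space
 proof eventually_elim
  case (elim x)
  hence x: "x : carrier P" by (simp add: space_nu)
  show ?case
  proof
   fix j
   have l: "(%k. A k (ff j) x) \<longlonglongrightarrow> lim (%k. A k (ff j) x)" using elim(1) by (simp add: convergent_LIMSEQ_iff)
   have "0 <= lim (%k. A k (ff j) x)" using Ab(1)[OF x] by (intro LIMSEQ_le_const[OF l]) auto
   moreover have "lim (%k. A k (ff j) x) <= 1" using Ab(2)[OF x] by (intro LIMSEQ_le_const2[OF l]) auto
   ultimately show "(%k. A k (ff j) x) \<longlonglongrightarrow> Fl j x" using l by (simp add: Fl_def)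
  qed
 qed
 have "c1 \<gamma>0 U'" unfolding c1_def
 proof -
  have "AE y in \<nu>. 1 <= ff 0 y + ff 0 (y \<otimes> \<gamma>0)"
   using c1U[unfolded c1_def] AE_space
  proof eventually_elim
   case (elim y)
   have y: "y : carrier P" "y \<otimes> \<gamma>0 : carrier P" using elim(2) D_sub[OF g0] by (auto simp: space_nu)
   have "1/2 <= U y | 1/2 <= U (y \<otimes> \<gamma>0)" using elim(1) by linarith
   hence "y : BB 0 | y \<otimes> \<gamma>0 : BB 0"
    using y SS(2)[of 0] th(3)[of 0] by (auto simp: BB_def intro!: bexI[of _ \<one>])
   thus ?case using ff(2)[of 0 y] ff(2)[of 0 "y \<otimes> \<gamma>0"] by (auto simp: ff_def)
  qed
  from avg_mono_AE[OF N_sub A this] have "ALL k. AE x in \<nu>. A k (%_. 1) x <= A k (%y. ff 0 y + ff 0 (y \<otimes> \<gamma>0)) x" by blast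
  hence "AE x in \<nu>. ALL k. A k (%_. 1) x <= A k (%y. ff 0 y + ff 0 (y \<otimes> \<gamma>0)) x" unfolding AE_all_countable .
  with lim AE_right[OF g0 lim] AE_space show "AE x in \<nu>. 1 <= U' x + U' (x \<otimes> \<gamma>0)"
  proof eventually_elim
   case (elim x)
   hence x: "x : carrier P" by (simp add: space_nu)
   have "1 <= A k (ff 0) x + A k (ff 0) (x \<otimes> \<gamma>0)" for k
    using elim(4)[rule_format, of k] avg_add[OF N_sub A[of k], where f = "ff 0" and g = "%y. ff 0 (y \<otimes> \<gamma>0)" and x = x]
     avg_right[OF N_sub A[of k] x D_sub[OF g0], where f = "ff 0"] by (simp add: avg_const[OF N_sub A])
   moreover have "(%k. A k (ff 0) x + A k (ff 0) (x \<otimes> \<gamma>0)) \<longlonglongrightarrow> Fl 0 x + Fl 0 (x \<otimes> \<gamma>0)"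
    using elim(1,2) by (intro tendsto_add) auto
   ultimately have "1 <= Fl 0 x + Fl 0 (x \<otimes> \<gamma>0)" by (intro LIMSEQ_le_const) auto
   thus ?case using FU[of 0 x] FU[of 0 "x \<otimes> \<gamma>0"] by linarith
  qed
 qed
 moreover have "c2 h U'" unfolding c2_def
 proof (intro allI impI)
  fix E assume E: "E <= \<Delta>" "finite E" "pairwise (dj h) E"
  let ?Y = "(%(g1, g2, g3). med3 (\<phi> g1 b) (\<phi> g2 b) (\<phi> g3 b)) ` (E \<times> E \<times> E)"
  have Yc: "?Y <= centers b" unfolding centers_def by (intro image_mono Sigma_mono) (use E(1) in auto)
  have limE: "AE x in \<nu>. ALL \<gamma>:E. ALL j. (%k. A k (ff j) (x \<otimes> \<gamma>)) \<longlonglongrightarrow> Fl j (x \<otimes> \<gamma>)"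
   unfolding AE_ball_countable[OF countable_finite[OF E(2)]] using AE_right[OF _ lim] E(1) by auto
  show "AE x in \<nu>. (\<Sum>\<gamma>\<in>E. U' (x \<otimes> \<gamma>)) <= 2"
   using limE zero AE_space
  proof eventually_elim
   case (elim x)
   hence x: "x : carrier P" by (simp add: space_nu)
   have F2: "(\<Sum>\<gamma>\<in>E. Fl j (x \<otimes> \<gamma>)) <= 2" for j
   proof -
    let ?c = "real (card E) / cc j"
    have "(\<Sum>\<gamma>\<in>E. A k (ff j) (x \<otimes> \<gamma>)) <= 2 + ?c * (\<Sum>y\<in>?Y. E.av (A k) vv x (y, j))" for k
    proof -
     have "(\<Sum>\<gamma>\<in>E. A k (ff j) (x \<otimes> \<gamma>)) = (\<Sum>\<gamma>\<in>E. A k (%z. ff j (z \<otimes> \<gamma>)) x)"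
      by (rule sum.cong[OF refl]) (rule avg_right[OF N_sub A x], use E(1) D_sub in auto)
     also have "... = A k (%z. \<Sum>\<gamma>\<in>E. ff j (z \<otimes> \<gamma>)) x" by (rule avg_sum[OF N_sub A, symmetric])
     also have "... <= A k (%z. 2 + ?c * (\<Sum>y\<in>?Y. vv z (y, j))) x"
      by (rule avg_mono[OF N_sub A x]) (rule count_bound[OF _ E])
     also have "... = 2 + ?c * (\<Sum>y\<in>?Y. A k (%z. vv z (y, j)) x)"
      by (simp only: avg_add[OF N_sub A] avg_cmult[OF N_sub A] avg_sum[OF N_sub A] avg_const[OF N_sub A])
     finally show ?thesis by (simp add: E.av_def)
    qed
    moreover have "(%k. \<Sum>\<gamma>\<in>E. A k (ff j) (x \<otimes> \<gamma>)) \<longlonglongrightarrow> (\<Sum>\<gamma>\<in>E. Fl j (x \<otimes> \<gamma>))"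
     using elim(1) by (intro tendsto_sum) auto
    moreover have "(%k. 2 + ?c * (\<Sum>y\<in>?Y. E.av (A k) vv x (y, j))) \<longlonglongrightarrow> 2 + ?c * (\<Sum>y\<in>?Y. 0)"
    proof (intro tendsto_add tendsto_mult tendsto_const tendsto_sum)
     fix y assume "y : ?Y"
     hence "(y, j) : icenters b" using subsetD[OF Yc] by simp
     thus "(%k. E.av (A k) vv x (y, j)) \<longlonglongrightarrow> 0" by (rule bspec[OF elim(2)])
    qed
    ultimately have "(\<Sum>\<gamma>\<in>E. Fl j (x \<otimes> \<gamma>)) <= 2 + ?c * (\<Sum>y\<in>?Y. 0)" by (intro LIMSEQ_le) auto
    thus ?thesis by simp
   qed
   have "(%j. Fl j (x \<otimes> \<gamma>)) \<longlonglongrightarrow> U' (x \<otimes> \<gamma>)" if g: "\<gamma> : E" for \<gamma>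
    unfolding U'_def
   proof (rule LIMSEQ_incseq_SUP[OF bdd])
    have xg: "x \<otimes> \<gamma> : carrier P" using x g E(1) D_sub by auto
    show "incseq (%j. Fl j (x \<otimes> \<gamma>))"
    proof (unfold incseq_def, intro allI impI)
     fix i j :: nat assume ij: "i <= j"
     have "A k (ff i) (x \<otimes> \<gamma>) <= A k (ff j) (x \<otimes> \<gamma>)" for k by (rule avg_mono[OF N_sub A xg ff(4)[OF ij]])
     thus "Fl i (x \<otimes> \<gamma>) <= Fl j (x \<otimes> \<gamma>)"
      by (intro LIMSEQ_le[OF elim(1)[rule_format, OF g, of i] elim(1)[rule_format, OF g, of j]]) auto
    qed
   qed
   hence "(%j. \<Sum>\<gamma>\<in>E. Fl j (x \<otimes> \<gamma>)) \<longlonglongrightarrow> (\<Sum>\<gamma>\<in>E. U' (x \<otimes> \<gamma>))" by (intro tendsto_sum)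
   thus ?case using F2 by (intro LIMSEQ_le_const2) auto
  qed
 qed
 moreover have "invar L U'" unfolding invar_def
 proof
  fix l assume l: "l : L"
  have fi: "AE x in \<nu>. ff j (l \<otimes> x) = ff j x" if l: "l : L" for j l
  proof -
   have lP: "l : carrier P" using l L_sub by auto
   have "ALL s:SS j. AE x in \<nu>. U (l \<otimes> (s \<otimes> x)) = U (s \<otimes> x)"
   proof
    fix s assume "s : SS j"
    hence "s : carrier P" using SS(3) K_sub by blast
    moreover have "AE x in \<nu>. U (l \<otimes> x) = U x" using invU l unfolding invar_def by (rule bspec)
    ultimately show "AE x in \<nu>. U (l \<otimes> (s \<otimes> x)) = U (s \<otimes> x)" by (rule AE_left)
   qed
   hence "AE x in \<nu>. ALL s:SS j. U (l \<otimes> (s \<otimes> x)) = U (s \<otimes> x)"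
    unfolding AE_ball_countable[OF countable_finite[OF SS(1)]] .
   with AE_space show ?thesis
   proof eventually_elim
    case (elim x)
    hence x: "x : carrier P" by (simp add: space_nu)
    have "U (s \<otimes> (l \<otimes> x)) = U (s \<otimes> x)" if s: "s : SS j" for s
    proof -
     have sK: "s : K" "s : carrier P" using s SS(3) K_sub by auto
     have "s \<otimes> (l \<otimes> x) = l \<otimes> (s \<otimes> x)" using KL[OF sK(1) l] sK lP x by (simp add: m_assoc[symmetric])
     thus ?thesis using elim(2) s by simp
    qed
    hence "(l \<otimes> x : BB j) = (x : BB j)" using x lP by (auto simp: BB_def)
    thus ?case by (simp add: ff_def indicator_def)
   qed
  qed
  have "ALL l:L. AE x in \<nu>. A k (ff j) (l \<otimes> x) = A k (ff j) x" for k j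
   by (rule avg_invariant[OF N_sub L_sub A NL fi])
  hence "ALL j k. AE x in \<nu>. A k (ff j) (l \<otimes> x) = A k (ff j) x" using l by blast
  hence "AE x in \<nu>. ALL j k. A k (ff j) (l \<otimes> x) = A k (ff j) x" unfolding AE_all_countable .
  thus "AE x in \<nu>. U' (l \<otimes> x) = U' x" by eventually_elim (simp add: U'_def Fl_def)
 qed
 moreover have "invar K U'"
 proof -
  have le: "AE x in \<nu>. U' (s \<otimes> x) <= U' x" if s: "s : K" for s
  proof -
   have sP: "s : carrier P" using s K_sub by auto
   have ex: "EX j'. ALL y:carrier P. ff j (s \<otimes> y) <= ff j' y" for j
   proof -
    have "EX i. ALL t:SS j. t \<otimes> s : SS i"
    proof -
     have "ALL t:SS j. EX i. t \<otimes> s : SS i" using SS_exhaust K_mult s SS(3) by blast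
     then obtain i where i: "ALL t:SS j. t \<otimes> s : SS (i t)" by (rule bchoice[THEN exE])
     have "t \<otimes> s : SS (Max (i ` SS j))" if t: "t : SS j" for t
     proof -
      have "i t <= Max (i ` SS j)" using t SS(1) by (intro Max_ge) auto
      thus ?thesis using i t SS(4) by blast
     qed
     thus ?thesis by blast
    qed
    then obtain i where i: "ALL t:SS j. t \<otimes> s : SS i" by blast
    have "y : BB (max i j)" if y: "y : carrier P" "s \<otimes> y : BB j" for y
    proof -
     obtain t where t: "t : SS j" "th j < U (t \<otimes> (s \<otimes> y))" using y(2) by (auto simp: BB_def)
     have tP: "t : carrier P" using t(1) SS(3) K_sub by auto
     have "t \<otimes> s : SS (max i j)" using i t(1) SS(4)[of i "max i j"] by auto
     moreover have "th (max i j) < U ((t \<otimes> s) \<otimes> y)" using t(2) th(2)[of j "max i j"] tP sP y(1) by (simp add: m_assoc)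
     ultimately show ?thesis using y(1) unfolding BB_def by blast
    qed
    hence "ALL y:carrier P. ff j (s \<otimes> y) <= ff (max i j) y" by (auto simp: ff_def indicator_def)
    thus ?thesis by blast
   qed
   hence "ALL j. EX j'. ALL y:carrier P. ff j (s \<otimes> y) <= ff j' y" by blast
   then obtain j' where "ALL j. ALL y:carrier P. ff j (s \<otimes> y) <= ff (j' j) y" by (rule choice[THEN exE])
   hence j': "!!j y. y : carrier P ==> ff j (s \<otimes> y) <= ff (j' j) y" by blast
   show ?thesis using lim AE_left[OF sP lim] AE_space
   proof eventually_elim
    case (elim x)
    hence x: "x : carrier P" by (simp add: space_nu)
    have "Fl j (s \<otimes> x) <= U' x" for j
    proof -
     have "A k (ff j) (s \<otimes> x) <= A k (ff (j' j)) x" for k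
     proof -
      have "A k (ff j) (s \<otimes> x) = A k (%y. ff j (s \<otimes> y)) x" by (rule avg_commute[OF N_sub A sP KN[OF s] x])
      also have "... <= A k (ff (j' j)) x" by (rule avg_mono[OF N_sub A x j'])
      finally show ?thesis .
     qed
     hence "Fl j (s \<otimes> x) <= Fl (j' j) x"
      by (intro LIMSEQ_le[OF elim(2)[rule_format, of j] elim(1)[rule_format, of "j' j"]]) auto
     thus ?thesis using FU[of "j' j" x] by linarith
    qed
    thus ?case unfolding U'_def[of "s \<otimes> x"] by (intro cSUP_least) auto
   qed
  qed
  show ?thesis unfolding invar_def
  proof
   fix s assume s: "s : K"
   have sP: "s : carrier P" using s K_sub by auto
   show "AE x in \<nu>. U' (s \<otimes> x) = U' x"
    using le[OF s] AE_left[OF sP le[OF K_inv[OF s]]] AE_space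
   proof eventually_elim
    case (elim x)
    have "inv s \<otimes> (s \<otimes> x) = x" using sP elim(3) by (simp add: space_nu m_assoc[symmetric])
    thus ?case using elim(1,2) by simp
   qed
  qed
 qed
 ultimately show ?thesis using `cap U'` by blast
qed

end

section \<open>Products of topological groups\<close>

lemma second_countable_product:
 assumes I: "finite I" and T: "!!i. i : I ==> second_countable (T i)"
 shows "second_countable (product_topology T I)"
proof -
 have "ALL i:I. EX B. countable B & (ALL V:B. openin (T i) V) &
   (ALL U x. openin (T i) U & x : U --> (EX V:B. x : V & V <= U))"
  using T unfolding second_countable_def by blast
 then obtain B where "ALL i:I. countable (B i) & (ALL V:B i. openin (T i) V) &
   (ALL U x. openin (T i) U & x : U --> (EX V:B i. x : V & V <= U))" by (rule bchoice[THEN exE])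
 hence B: "!!i. i : I ==> countable (B i)" "!!i V. i : I ==> V : B i ==> openin (T i) V"
  "!!i U x. i : I ==> openin (T i) U ==> x : U ==> EX V:B i. x : V & V <= U" by blast+
 define BB where "BB = PiE I ` (PiE I B)"
 have "countable BB" unfolding BB_def using I B(1) by (intro countable_image countable_PiE)
 moreover have "openin (product_topology T I) V" if "V : BB" for V
  using that B(2) I by (auto simp: BB_def openin_PiE_gen PiE_mem)
 moreover have "EX V:BB. x : V & V <= U" if U: "openin (product_topology T I) U" "x : U" for U x
 proof -
  obtain W where W: "ALL i:I. openin (T i) (W i)" "x : PiE I W" "PiE I W <= U"
   using U unfolding openin_product_topology_alt by blast
  have "ALL i:I. EX V. V : B i & x i : V & V <= W i" using B(3) W(1) PiE_mem[OF W(2)] by blast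
  then obtain V where V: "ALL i:I. V i : B i & x i : V i & V i <= W i" by (rule bchoice[THEN exE])
  define V' where "V' = restrict V I"
  have eq: "PiE I V' = PiE I V" unfolding V'_def by (rule PiE_cong) simp
  have "PiE I V' : BB" unfolding BB_def using V by (intro imageI) (auto simp: V'_def)
  moreover have "x : PiE I V'" unfolding eq using V W(2) by (auto simp: PiE_iff)
  moreover have "PiE I V' <= U" unfolding eq using V W(3) PiE_mono[of I V W] by blast
  ultimately show ?thesis by blast
 qed
 ultimately show ?thesis unfolding second_countable_def by (intro exI[of _ BB]) simp
qed

lemma topological_group_product:
 fixes G :: "'i => ('g, 'm) monoid_scheme"
 assumes tg: "!!i. i : I ==> topological_group (G i) (T i)"
 shows "topological_group (product_group I G) (product_topology T I)"
proof -
 have gr: "group (G i)" and ts: "topspace (T i) = carrier (G i)" if "i : I" for i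
  using tg[OF that] by (auto simp: topological_group_def)
 let ?P = "product_topology T I"
 have proj: "continuous_map ?P (T i) (%x. x i)" if "i : I" for i by (rule continuous_map_product_projection[OF that])
 have top: "topspace ?P = (\<Pi>\<^sub>E i\<in>I. carrier (G i))" using ts by (auto intro: PiE_cong)
 have "continuous_map (prod_topology ?P ?P) ?P (%z. \<lambda>i\<in>I. fst z i \<otimes>\<^bsub>G i\<^esub> snd z i)"
  unfolding continuous_map_componentwise
 proof (intro conjI ballI)
  fix i assume i: "i : I"
  have "continuous_map (prod_topology ?P ?P) (T i) (%z. fst z i \<otimes>\<^bsub>G i\<^esub> snd z i)"
  proof -
   have m: "continuous_map (prod_topology (T i) (T i)) (T i) (%(x, y). x \<otimes>\<^bsub>G i\<^esub> y)"
    using tg[OF i] by (simp add: topological_group_def)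
   have "continuous_map (prod_topology ?P ?P) (prod_topology (T i) (T i)) (%z. (fst z i, snd z i))"
    using continuous_map_compose[OF continuous_map_fst proj[OF i]] continuous_map_compose[OF continuous_map_snd proj[OF i]]
    by (intro continuous_map_pairedI) (simp_all add: o_def)
   from continuous_map_compose[OF this m] show ?thesis by (simp add: o_def)
  qed
  thus "continuous_map (prod_topology ?P ?P) (T i) (%z. (\<lambda>i\<in>I. fst z i \<otimes>\<^bsub>G i\<^esub> snd z i) i)" using i by simp
 qed auto
 moreover have "(%(x, y). x \<otimes>\<^bsub>product_group I G\<^esub> y) = (%z. \<lambda>i\<in>I. fst z i \<otimes>\<^bsub>G i\<^esub> snd z i)" by auto
 ultimately have "continuous_map (prod_topology ?P ?P) ?P (%(x, y). x \<otimes>\<^bsub>product_group I G\<^esub> y)" by (simp only:)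
 moreover have "continuous_map ?P ?P (%x. inv\<^bsub>product_group I G\<^esub> x)"
 proof (rule continuous_map_eq)
  show "continuous_map ?P ?P (%x. \<lambda>i\<in>I. inv\<^bsub>G i\<^esub> x i)"
   unfolding continuous_map_componentwise
  proof (intro conjI ballI)
   fix i assume i: "i : I"
   have "continuous_map (T i) (T i) (%x. inv\<^bsub>G i\<^esub> x)" using tg[OF i] by (simp add: topological_group_def)
   from continuous_map_compose[OF proj[OF i] this] show "continuous_map ?P (T i) (%x. (\<lambda>i\<in>I. inv\<^bsub>G i\<^esub> x i) i)"
    using i by (simp add: o_def)
  qed auto
  show "(\<lambda>i\<in>I. inv\<^bsub>G i\<^esub> x i) = inv\<^bsub>product_group I G\<^esub> x" if "x : topspace ?P" for x
   using that gr unfolding top by (subst inv_product_group) auto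
 qed
 ultimately show ?thesis using gr top by (simp add: topological_group_def)
qed

section \<open>Lattices in products\<close>

locale product_capacities = capacities P T \<Delta> \<mu> X \<phi> med3
 for P :: "('i => 'b) monoid" (structure) and T \<Delta> \<mu> and X :: "'x set" and \<phi> med3 +
 fixes I :: "'i set" and G :: "'i => 'b monoid" and S :: "'i => 'b topology"
 assumes P: "P = product_group I G" and T: "T = product_topology S I"
  and finI: "finite I" and two: "!!i. i : I ==> EX j:I. j ~= i"
  and tgi: "!!i. i : I ==> topological_group (G i) (S i)"
  and dense: "!!i. i : I ==> product_topology S (I - {i}) closure_of ((%g. restrict g (I - {i})) ` \<Delta>) =
   topspace (product_topology S (I - {i}))"
begin

lemma grp: "i : I ==> group (G i)" using tgi by (simp add: topological_group_def)
lemma tsp: "i : I ==> topspace (S i) = carrier (G i)" using tgi by (simp add: topological_group_def)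

lemma P_carrier: "carrier P = (\<Pi>\<^sub>E i\<in>I. carrier (G i))" by (simp add: P)
lemma P_mult: "x \<otimes> y = (\<lambda>i\<in>I. x i \<otimes>\<^bsub>G i\<^esub> y i)" by (simp add: P)
lemma P_one: "\<one> = (\<lambda>i\<in>I. \<one>\<^bsub>G i\<^esub>)" by (simp add: P)
lemma P_inv: "x : carrier P ==> inv x = (\<lambda>i\<in>I. inv\<^bsub>G i\<^esub> (x i))" using grp by (simp add: P)

lemma comp_closed: "x : carrier P ==> i : I ==> x i : carrier (G i)" by (auto simp: P_carrier)
lemma G_one: "i : I ==> \<one>\<^bsub>G i\<^esub> : carrier (G i)" using grp by (simp add: group.is_monoid)

lemma P_eqI: "x : carrier P ==> y : carrier P ==> (!!i. i : I ==> x i = y i) ==> x = y"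
 unfolding P_carrier by (rule PiE_ext)

lemma G_simps: assumes "i : I" "a : carrier (G i)"
 shows "a \<otimes>\<^bsub>G i\<^esub> \<one>\<^bsub>G i\<^esub> = a" "\<one>\<^bsub>G i\<^esub> \<otimes>\<^bsub>G i\<^esub> a = a"
 using group.is_monoid[OF grp[OF assms(1)]] assms(2) by (simp_all add: monoid.l_one monoid.r_one)

text \<open>The projection to the factors in \<open>J\<close>, as an endomorphism of the full product.\<close>

definition part :: "'i set => ('i => 'b) => ('i => 'b)" where
 "part J x = (\<lambda>i\<in>I. if i : J then x i else \<one>\<^bsub>G i\<^esub>)"

lemma part_closed: "x : carrier P ==> part J x : carrier P"
 using G_one by (auto simp: part_def P_carrier)

lemma part_cont: "continuous_map T T (part J)" unfolding T part_def continuous_map_componentwise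
proof (intro conjI ballI)
 fix i assume i: "i : I"
 show "continuous_map (product_topology S I) (S i) (%x. (\<lambda>i\<in>I. if i : J then x i else \<one>\<^bsub>G i\<^esub>) i)"
  using i continuous_map_product_projection[OF i, of S] G_one[OF i] tsp[OF i] by (cases "i : J") auto
qed auto

lemma part_mult: assumes "x : carrier P" "y : carrier P" shows "part J (x \<otimes> y) = part J x \<otimes> part J y"
 using G_simps[OF _ G_one] by (auto simp: part_def P_mult)

lemma part_part: "part J (part J x) = part J x" by (auto simp: part_def)

lemma part_disjoint_mult: assumes "x : carrier P" "J \<inter> J' = {}" shows "part J x \<otimes> part J' x = part (J \<union> J') x"
 unfolding part_def P_mult using G_simps comp_closed[OF assms(1)] G_one assms(2) by (intro restrict_ext) auto

lemma part_all: "x : carrier P ==> part I x = x"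
 by (rule P_eqI) (auto simp: part_closed, simp add: part_def)

definition coords :: "'i => 'b set" where "coords j = (%\<gamma>. \<gamma> j) ` \<Delta>"

text \<open>A countable dense subgroup of the product of the factors in \<open>J\<close>, with coordinates from the
 projections of the lattice.\<close>

definition Hs :: "'i set => ('i => 'b) set" where
 "Hs J = {h : carrier P. ALL i:I. (i : J --> h i : coords i) & (i ~: J --> h i = \<one>\<^bsub>G i\<^esub>)}"

lemma Hs_sub: "Hs J <= carrier P" by (auto simp: Hs_def)

lemma coords_one: "i : I ==> \<one>\<^bsub>G i\<^esub> : coords i"
 using D_one by (auto simp: coords_def P_one intro!: image_eqI[of _ _ "\<one>"])

lemma coords_mult: assumes "i : I" "a : coords i" "b : coords i" shows "a \<otimes>\<^bsub>G i\<^esub> b : coords i"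
proof -
 obtain x y where xy: "x : \<Delta>" "y : \<Delta>" "a = x i" "b = y i" using assms by (auto simp: coords_def)
 hence "a \<otimes>\<^bsub>G i\<^esub> b = (x \<otimes> y) i" using assms(1) by (simp add: P_mult)
 thus ?thesis using D_mult[OF xy(1,2)] by (auto simp: coords_def)
qed

lemma coords_inv: assumes "i : I" "a : coords i" shows "inv\<^bsub>G i\<^esub> a : coords i"
proof -
 obtain x where x: "x : \<Delta>" "a = x i" using assms by (auto simp: coords_def)
 hence "inv\<^bsub>G i\<^esub> a = (inv x) i" using assms(1) D_sub by (simp add: P_inv)
 thus ?thesis using D_inv[OF x(1)] by (auto simp: coords_def)
qed

lemma Hs_one: "\<one> : Hs J" using coords_one by (auto simp: Hs_def P_one P_carrier G_one)

lemma Hs_mult: assumes "x : Hs J" "y : Hs J" shows "x \<otimes> y : Hs J"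
proof -
 have "x \<otimes> y : carrier P" using assms Hs_sub by auto
 thus ?thesis using assms coords_mult G_simps[OF _ G_one] by (auto simp: Hs_def P_mult)
qed

lemma Hs_inv: assumes "x : Hs J" shows "inv x : Hs J"
proof -
 have x: "x : carrier P" using assms Hs_sub by auto
 have "inv\<^bsub>G i\<^esub> \<one>\<^bsub>G i\<^esub> = \<one>\<^bsub>G i\<^esub>" if "i : I" for i using group.inv_equality[OF grp[OF that]] G_one[OF that] G_simps[OF that] by simp
 thus ?thesis using assms x coords_inv inv_closed[OF x] unfolding Hs_def by (auto simp: P_inv[OF x])
qed

lemma Hs_countable: "countable (Hs J)"
proof (rule countable_subset)
 show "Hs J <= (\<Pi>\<^sub>E i\<in>I. coords i)"
 proof
  fix x assume x: "x : Hs J"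
  hence xP: "x : (\<Pi>\<^sub>E i\<in>I. carrier (G i))" by (simp add: Hs_def P_carrier)
  show "x : (\<Pi>\<^sub>E i\<in>I. coords i)"
  proof (rule PiE_I)
   show "x i : coords i" if "i : I" for i using x that coords_one[OF that] by (cases "i : J") (auto simp: Hs_def)
   show "x i = undefined" if "i ~: I" for i using PiE_arb[OF xP that] .
  qed
 qed
 show "countable (\<Pi>\<^sub>E i\<in>I. coords i)" using finI D_countable by (intro countable_PiE) (auto simp: coords_def)
qed

lemma Hs_commute: assumes "x : Hs J" "y : Hs J'" "J \<inter> J' = {}" shows "y \<otimes> x = x \<otimes> y"
proof -
 have c: "x : carrier P" "y : carrier P" using assms Hs_sub by auto
 have "y i \<otimes>\<^bsub>G i\<^esub> x i = x i \<otimes>\<^bsub>G i\<^esub> y i" if i: "i : I" for i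
 proof -
  have "x i = \<one>\<^bsub>G i\<^esub> | y i = \<one>\<^bsub>G i\<^esub>" using assms i by (auto simp: Hs_def)
  thus ?thesis using G_simps[OF i] comp_closed[OF c(1) i] comp_closed[OF c(2) i] by auto
 qed
 thus ?thesis by (simp add: P_mult cong: restrict_cong)
qed

lemma Hs_normal: assumes "w : Hs J" "l : Hs J'" shows "EX l':Hs J'. w \<otimes> l = l' \<otimes> w"
proof
 have c: "w : carrier P" "l : carrier P" using assms Hs_sub by auto
 show "w \<otimes> l = (w \<otimes> l \<otimes> inv w) \<otimes> w" using c by (simp add: m_assoc)
 have w: "w i : coords i" if "i : I" for i using assms(1) that coords_one by (cases "i : J") (auto simp: Hs_def)
 have "(w \<otimes> l \<otimes> inv w) i = (w i \<otimes>\<^bsub>G i\<^esub> l i) \<otimes>\<^bsub>G i\<^esub> inv\<^bsub>G i\<^esub> (w i)" if "i : I" for i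
  using that by (simp add: P_mult P_inv[OF c(1)])
 moreover have "(w i \<otimes>\<^bsub>G i\<^esub> l i) \<otimes>\<^bsub>G i\<^esub> inv\<^bsub>G i\<^esub> (w i) : coords i" if "i : I" "i : J'" for i
  using that w assms(2) coords_mult coords_inv by (auto simp: Hs_def)
 moreover have "(w i \<otimes>\<^bsub>G i\<^esub> l i) \<otimes>\<^bsub>G i\<^esub> inv\<^bsub>G i\<^esub> (w i) = \<one>\<^bsub>G i\<^esub>" if i: "i : I" "i ~: J'" for i
 proof -
  have "l i = \<one>\<^bsub>G i\<^esub>" using assms(2) i by (auto simp: Hs_def)
  thus ?thesis using G_simps[OF i(1) comp_closed[OF c(1) i(1)]] group.r_inv[OF grp[OF i(1)] comp_closed[OF c(1) i(1)]] by simp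
 qed
 moreover have "w \<otimes> l \<otimes> inv w : carrier P" using c by simp
 ultimately show "w \<otimes> l \<otimes> inv w : Hs J'" unfolding Hs_def by simp
qed

text \<open>There are at least two factors, so the lattice projects densely to each of them.\<close>

lemma coords_dense: assumes j: "j : I" and V: "openin (S j) V" "v : V" shows "EX a:coords j. a : V"
proof -
 obtain i where i: "i : I" "i ~= j" using two[OF j] by auto
 let ?J = "I - {i}"
 have jJ: "j : ?J" using i j by auto
 define O' where "O' = {y : topspace (product_topology S ?J). y j : V}"
 have "openin (product_topology S ?J) O'"
  unfolding O'_def by (rule openin_continuous_map_preimage[OF continuous_map_product_projection[OF jJ, where X = S] V(1)])
 moreover have "(\<lambda>i\<in>?J. if i = j then v else \<one>\<^bsub>G i\<^esub>) : O'"
 proof -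
  have "v : topspace (S j)" using openin_subset[OF V(1)] V(2) by auto
  moreover have "\<one>\<^bsub>G l\<^esub> : topspace (S l)" if "l : ?J" for l using that tsp[of l] G_one[of l] by simp
  ultimately have "(\<lambda>l\<in>?J. if l = j then v else \<one>\<^bsub>G l\<^esub>) : (\<Pi>\<^sub>E l\<in>?J. topspace (S l))"
   by (intro restrict_PiE_iff[THEN iffD2] ballI) simp
  thus ?thesis using jJ V(2) by (simp add: O'_def)
 qed
 hence "O' ~= {}" by blast
 ultimately have "(%g. restrict g ?J) ` \<Delta> \<inter> O' ~= {}"
  using dense[OF i(1), unfolded dense_intersects_open, rule_format, of O'] by blast
 then obtain \<gamma> where "\<gamma> : \<Delta>" "restrict \<gamma> ?J : O'" by auto
 thus ?thesis using jJ by (auto simp: O'_def coords_def intro!: bexI[of _ "\<gamma> j"])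
qed

lemma Hs_dense: assumes w: "w : carrier P" and U: "openin T U" "part J w : U" shows "Hs J \<inter> U ~= {}"
proof -
 obtain V where V: "ALL i:I. openin (S i) (V i)" "part J w : PiE I V" "PiE I V <= U"
  using U unfolding T openin_product_topology_alt by blast
 have "ALL i:I. EX a. a : V i & (i : J --> a : coords i) & (i ~: J --> a = \<one>\<^bsub>G i\<^esub>)"
 proof
  fix i assume i: "i : I"
  have pi: "part J w i : V i" using PiE_mem[OF V(2) i] .
  show "EX a. a : V i & (i : J --> a : coords i) & (i ~: J --> a = \<one>\<^bsub>G i\<^esub>)"
  proof (cases "i : J")
   case True
   thus ?thesis using coords_dense[OF i _ pi] V(1) i by blast
  next
   case False
   thus ?thesis using pi i by (auto simp: part_def)
  qed
 qed
 then obtain a where a: "ALL i:I. a i : V i & (i : J --> a i : coords i) & (i ~: J --> a i = \<one>\<^bsub>G i\<^esub>)"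
  by (rule bchoice[THEN exE])
 define h where "h = restrict a I"
 have "h : U" using a V(3) by (auto simp: h_def)
 moreover have "a i : carrier (G i)" if "i : I" for i
  using a that openin_subset[of "S i" "V i"] V(1) tsp[OF that] by auto
 hence "h : Hs J" using a by (auto simp: Hs_def h_def P_carrier)
 ultimately show ?thesis by blast
qed

lemma dense_part_Hs: "dense_part P T \<Delta> \<mu> (part J) (Hs J)"
 by unfold_locales (use part_cont part_mult Hs_sub Hs_dense in auto)

lemma split_part_Hs: "i : I ==> split_part P T \<Delta> \<mu> (part (I - {i})) (Hs (I - {i})) (part {i})"
 unfolding split_part_def split_part_axioms_def
 using dense_part_Hs part_cont part_mult part_part part_disjoint_mult[of _ "{i}" "I - {i}"] part_all
 by (auto simp: insert_absorb)

text \<open>An invariant set of positive measure meets its translates by all lattice elements with small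
 coordinate \<open>i\<close>, no matter what the other coordinates are.\<close>

lemma fixed_set_of_invariant:
 assumes i: "i : I" and ff: "fixed_finite (Hs (I - {i}))"
 shows "EX F V. finite F & F ~= {} & F <= X & openin (S i) V & \<one>\<^bsub>G i\<^esub> : V & (ALL \<gamma>:\<Delta>. \<gamma> i : V --> \<phi> \<gamma> ` F = F)"
proof -
 interpret sp: split_part P T \<Delta> \<mu> "part (I - {i})" "Hs (I - {i})" "part {i}" by (rule split_part_Hs[OF i])
 obtain F E where F: "finite F" "F ~= {}" "F <= X" and E: "E : sets \<B>" "~ (AE g in \<nu>. g ~: E)"
  "ALL w:Hs (I - {i}). AE g in \<nu>. (w \<otimes> g : E) = (g : E)"
  "ALL g:carrier P. ALL \<gamma>:\<Delta>. g : E --> g \<otimes> \<gamma> : E --> \<phi> \<gamma> ` F = F"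
  using ff unfolding fixed_finite_def by (elim exE conjE)
 have "EX V. openin T V & \<one> : V & (ALL \<gamma>:carrier P. part {i} \<gamma> : V --> ~ (AE x in \<nu>. ~ (x : E & x \<otimes> \<gamma> : E)))"
  by (rule sp.small_part_translate_meets[OF E(1) bspec[OF E(3)] E(2)])
 then obtain V where V: "openin T V" "\<one> : V" "ALL \<gamma>:carrier P. part {i} \<gamma> : V --> ~ (AE x in \<nu>. ~ (x : E & x \<otimes> \<gamma> : E))"
  by (elim exE conjE)
 define sg where "sg a = (\<lambda>j\<in>I. if j = i then a else \<one>\<^bsub>G j\<^esub>)" for a
 have "continuous_map (S i) T sg" unfolding T sg_def continuous_map_componentwise
 proof (intro conjI ballI)
  fix j assume j: "j : I"
  show "continuous_map (S i) (S j) (%x. (\<lambda>j\<in>I. if j = i then x else \<one>\<^bsub>G j\<^esub>) j)"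
   using j G_one[OF j] tsp[OF j] by (cases "j = i") auto
 qed auto
 hence "openin (S i) {a : topspace (S i). sg a : V}" using V(1) by (rule openin_continuous_map_preimage)
 moreover have "\<one>\<^bsub>G i\<^esub> : {a : topspace (S i). sg a : V}"
 proof -
  have "sg \<one>\<^bsub>G i\<^esub> = \<one>" by (auto simp: sg_def P_one)
  thus ?thesis using V(2) G_one[OF i] tsp[OF i] by simp
 qed
 moreover have "\<phi> \<gamma> ` F = F" if g: "\<gamma> : \<Delta>" "\<gamma> i : {a : topspace (S i). sg a : V}" for \<gamma>
 proof -
  have "part {i} \<gamma> = sg (\<gamma> i)" by (auto simp: part_def sg_def)
  hence "~ (AE x in \<nu>. ~ (x : E & x \<otimes> \<gamma> : E))" using V(3) D_sub[OF g(1)] g(2) by simp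
  hence "EX x:carrier P. x : E & x \<otimes> \<gamma> : E"
   by (rule contrapos_np) (rule AE_I2, simp add: space_nu)
  thus ?thesis using E(4) g(1) by blast
 qed
 ultimately show ?thesis using F by (intro exI[of _ F] exI[of _ "{a : topspace (S i). sg a : V}"]) simp
qed

text \<open>Averaging over the factors one after the other makes the capacity constant. Each step costs
 one nesting step, which is why the flip is applied to the innermost set and the disjoint
 translates are those of the outermost one. The constant would be at least one half by the
 first inequality and at most two fifths by the second one.\<close>

theorem finite_set_fixed_by_neighbourhood:
 assumes nest: "!!q. nest (h (Suc q)) (h q)"
  and g0: "\<gamma>0 : \<Delta>" "h (card I) \<union> \<phi> \<gamma>0 ` h (card I) = X"
  and E5: "E5 <= \<Delta>" "card E5 = 5" "pairwise (dj (h 0)) E5"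
 shows "EX i:I. EX F V. finite F & F ~= {} & F <= X & openin (S i) V & \<one>\<^bsub>G i\<^esub> : V & (ALL \<gamma>:\<Delta>. \<gamma> i : V --> \<phi> \<gamma> ` F = F)"
proof (rule ccontr)
 assume neg: "~ ?thesis"
 have nf: "~ fixed_finite (Hs (I - {i}))" if "i : I" for i
  using neg fixed_set_of_invariant[OF that] that by (metis (no_types))
 have hX: "h q <= X" and hne: "h (Suc q) ~= {}" for q using nest[of q] by (auto simp: nest_def)
 obtain o' where o: "o' : X" using hX[of 1] hne[of 0] by auto
 have step: "EX U. cap U & c1 \<gamma>0 U & c2 (h (card I - card J)) U & (ALL j:J. invar (Hs {j}) U)" if "finite J" "J <= I" for J
  using that
 proof (induction J rule: finite_induct)
  case empty
  thus ?case using initial_capacity[OF o g0(1) hX g0(2)] by simp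
 next
  case (insert i J)
  then obtain U where U: "cap U" "c1 \<gamma>0 U" "c2 (h (card I - card J)) U" "ALL j:J. invar (Hs {j}) U" by auto
  have iI: "i : I" using insert.prems by auto
  have "card (insert i J) <= card I" using insert.prems finI by (intro card_mono)
  hence q: "card I - card J = Suc (card I - card (insert i J))" using insert.hyps by simp
  define k h' where "k = h (card I - card J)" and "h' = h (card I - card (insert i J))"
  have n: "nest k h'" using nest unfolding k_def h'_def q .
  obtain b where b: "b : k" using n by (auto simp: nest_def)
  let ?L = "\<Union>j\<in>J. Hs {j}"
  have "capacity_step P T \<Delta> \<mu> X \<phi> med3 (Hs {i}) (Hs (I - {i})) ?L \<gamma>0 k h' U b"
  proof unfold_locales
   show "nest k h'" "b : k" "\<gamma>0 : \<Delta>" by fact+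
   show "Hs {i} <= carrier P" "Hs (I - {i}) <= carrier P" "?L <= carrier P" using Hs_sub by blast+
   show "\<one> : Hs {i}" "countable (Hs {i})" by (rule Hs_one, rule Hs_countable)
   show "Hs (I - {i}) ~= {}" using Hs_one by blast
   show "x \<otimes> y : Hs {i}" if "x : Hs {i}" "y : Hs {i}" for x y using that by (rule Hs_mult)
   show "inv x : Hs {i}" if "x : Hs {i}" for x using that by (rule Hs_inv)
   show "x \<otimes> y : Hs (I - {i})" if "x : Hs (I - {i})" "y : Hs (I - {i})" for x y using that by (rule Hs_mult)
   show "w \<otimes> x = x \<otimes> w" if "x : Hs {i}" "w : Hs (I - {i})" for x w using that by (rule Hs_commute) auto
   show "l \<otimes> x = x \<otimes> l" if xl: "x : Hs {i}" "l : ?L" for x l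
   proof -
    obtain j where "j : J" "l : Hs {j}" using xl(2) by auto
    thus ?thesis using Hs_commute[OF xl(1), of l "{j}"] insert.hyps by auto
   qed
   show "EX l':?L. w \<otimes> l = l' \<otimes> w" if wl: "w : Hs (I - {i})" "l : ?L" for w l
   proof -
    obtain j where j: "j : J" "l : Hs {j}" using wl(2) by auto
    from Hs_normal[OF wl(1) j(2)] obtain l' where "l' : Hs {j}" "w \<otimes> l = l' \<otimes> w" by blast
    thus ?thesis using j(1) by (intro bexI[of _ l']) auto
   qed
   show "cap U" "c1 \<gamma>0 U" by fact+
   show "c2 k U" using U(3) by (simp add: k_def)
   show "invar ?L U" using U(4) by (auto simp: invar_def)
  qed
  from capacity_step.averaging_step[OF this nf[OF iI]] obtain U' where U': "cap U'" "c1 \<gamma>0 U'" "c2 h' U'" "invar ?L U'" "invar (Hs {i}) U'"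
   by blast
  have "ALL j:insert i J. invar (Hs {j}) U'" using U'(4,5) by (auto simp: invar_def)
  thus ?case using U'(1-3) unfolding h'_def by blast
 qed
 obtain U where U: "cap U" "c1 \<gamma>0 U" "c2 (h 0) U" "ALL j:I. invar (Hs {j}) U"
  using step[OF finI subset_refl] by auto
 have inv: "invar (Hs J) U" if "finite J" "J <= I" for J using that
 proof (induction J rule: finite_induct)
  case empty
  have "Hs {} <= {\<one>}"
  proof
   fix x assume "x : Hs {}"
   thus "x : {\<one>}" by (auto simp: Hs_def P_one intro: P_eqI[unfolded P_one] simp: P_carrier G_one)
  qed
  hence "AE x in \<nu>. U (l \<otimes> x) = U x" if "l : Hs {}" for l
   using that by (intro AE_I2) (auto simp: space_nu)
  thus ?case by (simp add: invar_def)
 next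
  case (insert i J)
  have iI: "i : I" using insert.prems by auto
  show ?case unfolding invar_def
  proof
   fix l assume l: "l : Hs (insert i J)"
   have lP: "l : carrier P" using l Hs_sub by auto
   have a: "part {i} l : Hs {i}" "part J l : Hs J"
    unfolding Hs_def by (intro CollectI conjI part_closed[OF lP]; use l in "auto simp: Hs_def part_def")+
   have "part {i} l \<otimes> part J l = part (insert i J) l"
    using part_disjoint_mult[OF lP, of "{i}" J] insert.hyps by simp
   also have "... = l"
    by (rule P_eqI[OF part_closed[OF lP] lP]) (use l in "auto simp: part_def Hs_def")
   finally have eq: "part {i} l \<otimes> part J l = l" .
   have pP: "part {i} l : carrier P" "part J l : carrier P" using part_closed[OF lP] by simp_all
   have 1: "AE x in \<nu>. U (part {i} l \<otimes> x) = U x" using U(4) iI a(1) unfolding invar_def by blast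
   have 2: "AE x in \<nu>. U (part J l \<otimes> x) = U x" using insert.IH insert.prems a(2) unfolding invar_def by blast
   show "AE x in \<nu>. U (l \<otimes> x) = U x" using 2 AE_left[OF pP(2) 1] AE_space
   proof eventually_elim
    case (elim x)
    have "part {i} l \<otimes> (part J l \<otimes> x) = l \<otimes> x"
     using elim(3) pP m_assoc[of "part {i} l" "part J l" x] by (simp add: eq space_nu)
    thus ?case using elim(1,2) by simp
   qed
  qed
 qed
 define E where "E = {x : carrier P. 1/2 <= U x}"
 have Em: "E : sets \<B>"
 proof -
  have "U : borel_measurable \<B>" using U(1) by (simp add: cap_def)
  hence "{x : space \<B>. 1/2 <= U x} : sets \<B>" by measurable
  thus ?thesis by (simp add: E_def topspace)
 qed
 interpret dp: dense_part P T \<Delta> \<mu> "part I" "Hs I" by (rule dense_part_Hs)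
 have "(AE x in \<nu>. x : E) | (AE x in \<nu>. x ~: E)"
 proof (rule dp.invariant_set_trivial[OF part_all Em])
  fix l assume l: "l : Hs I"
  hence lP: "l : carrier P" using Hs_sub by auto
  have "AE x in \<nu>. U (l \<otimes> x) = U x" using inv[OF finI subset_refl] l by (simp add: invar_def)
  with AE_space show "AE x in \<nu>. (l \<otimes> x : E) = (x : E)"
   by eventually_elim (use lP in "simp add: E_def space_nu")
 qed
 moreover have "~ (AE x in \<nu>. x ~: E)"
 proof
  assume n: "AE x in \<nu>. x ~: E"
  have "AE x in \<nu>. False" using n AE_right[OF g0(1) n] U(2)[unfolded c1_def] AE_space
   by eventually_elim (use D_sub[OF g0(1)] in "auto simp: E_def space_nu")
  thus False using nu_not_null by simp
 qed
 ultimately have ae: "AE x in \<nu>. x : E" by blast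
 have fin5: "finite E5" using E5(2) by (metis card.infinite zero_neq_numeral)
 have "ALL \<gamma>:E5. AE x in \<nu>. x \<otimes> \<gamma> : E" using AE_right[OF _ ae] E5(1) by blast
 hence "AE x in \<nu>. ALL \<gamma>:E5. x \<otimes> \<gamma> : E" unfolding AE_ball_countable[OF countable_finite[OF fin5]] .
 moreover have "AE x in \<nu>. (\<Sum>\<gamma>\<in>E5. U (x \<otimes> \<gamma>)) <= 2" using U(3) E5 fin5 by (simp add: c2_def)
 ultimately have "AE x in \<nu>. False"
 proof eventually_elim
  case (elim x)
  have "real (card E5) * (1/2) <= (\<Sum>\<gamma>\<in>E5. U (x \<otimes> \<gamma>))"
   by (rule sum_bounded_below) (use elim(1) in "auto simp: E_def")
  thus ?case using elim(2) E5(2) by simp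
 qed
 thus False using nu_not_null by simp
qed

end

section \<open>Centers of walls and extension of the action\<close>

lemma (in group) cancel_inv:
 "x : carrier G ==> y : carrier G ==> x \<otimes> (inv x \<otimes> y) = y"
 "x : carrier G ==> y : carrier G ==> inv x \<otimes> (x \<otimes> y) = y"
 by (simp_all add: m_assoc[symmetric])

context median
begin

text \<open>Exchange one point at a time; the other two are off the larger set around it.\<close>

lemma SN_center:
 assumes k: "SN k1 h1" "SN k2 h2" "SN k3 h3" and dj: "h1 \<inter> h2 = {}" "h1 \<inter> h3 = {}" "h2 \<inter> h3 = {}"
  and a: "a1 : k1" "a2 : k2" "a3 : k3" and b: "b1 : k1" "b2 : k2" "b3 : k3"
 shows "m a1 a2 a3 = m b1 b2 b3"
proof -
 have s: "k1 <= h1" "h1 <= M" "k2 <= h2" "h2 <= M" "k3 <= h3" "h3 <= M" using k by (auto simp: SN_def)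
 have X: "a1 : M" "a2 : M" "a3 : M" "b1 : M" "b2 : M" "b3 : M" using a b s by auto
 have 1: "m a1 a2 a3 = m b1 a2 a3" by (rule SN_D[OF k(1) a(1) b(1)]) (use a s dj in auto)
 have 2: "m a2 b1 a3 = m b2 b1 a3" by (rule SN_D[OF k(2) a(2) b(2)]) (use a b s dj in auto)
 have 3: "m a3 b1 b2 = m b3 b1 b2" by (rule SN_D[OF k(3) a(3) b(3)]) (use b s dj in auto)
 have "m b1 a2 a3 = m a2 b1 a3" "m b2 b1 a3 = m b1 b2 a3" "m b1 b2 a3 = m a3 b1 b2" "m b3 b1 b2 = m b1 b2 b3"
  using X med_swap12 med_swap23 by metis+
 thus ?thesis using 1 2 3 by simp
qed

text \<open>Points that are medians of any three points of some three walls. Every isometry permutes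
 them.\<close>

definition wall_centers :: "'a set" where
 "wall_centers = {y : M. EX B1 B2 B3. wall B1 & wall B2 & wall B3 & (ALL a1:B1. ALL a2:B2. ALL a3:B3. m a1 a2 a3 = y)}"

lemma wall_centersE:
 assumes "y : wall_centers"
 obtains B1 B2 B3 where "wall B1" "wall B2" "wall B3" "!!a1 a2 a3. a1 : B1 ==> a2 : B2 ==> a3 : B3 ==> m a1 a2 a3 = y"
 using assms unfolding wall_centers_def by blast

inductive_set median_span :: "'a set" where
 base: "y : wall_centers ==> y : median_span"
| step: "a : median_span ==> b : median_span ==> c : median_span ==> m a b c : median_span"

lemma median_span_M: "y : median_span ==> y : M"
 by (induction rule: median_span.induct) (auto simp: wall_centers_def intro: med_props(4))

lemma iso_wall_centers: assumes f: "f : isometries M d" and y: "y : wall_centers" shows "f y : wall_centers"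
 using y
proof (rule wall_centersE)
 fix B1 B2 B3 assume B: "wall B1" "wall B2" "wall B3" "!!a1 a2 a3. a1 : B1 ==> a2 : B2 ==> a3 : B3 ==> m a1 a2 a3 = y"
 have s: "B1 <= M" "B2 <= M" "B3 <= M" using B wall_sub by auto
 have "m (f a1) (f a2) (f a3) = f y" if "a1 : B1" "a2 : B2" "a3 : B3" for a1 a2 a3
  using iso_med[OF f subsetD[OF s(1) that(1)] subsetD[OF s(2) that(2)] subsetD[OF s(3) that(3)]] B(4)[OF that] by simp
 hence "ALL a1:f ` B1. ALL a2:f ` B2. ALL a3:f ` B3. m a1 a2 a3 = f y" by simp
 moreover have "f y : M" using isoD(1)[OF f] y by (simp add: wall_centers_def)
 moreover note iso_wall[OF f B(1)] iso_wall[OF f B(2)] iso_wall[OF f B(3)]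
 ultimately show ?thesis unfolding wall_centers_def by blast
qed

lemma iso_median_span_sub: assumes f: "f : isometries M d" and y: "y : median_span" shows "f y : median_span"
 using y
proof (induction rule: median_span.induct)
 case (step a b c)
 have "f (m a b c) = m (f a) (f b) (f c)" by (rule iso_med[OF f]) (use step median_span_M in auto)
 thus ?case using median_span.step[OF step.IH] by simp
qed (rule median_span.base[OF iso_wall_centers[OF f]])

lemma iso_inverse: assumes f: "f : isometries M d" shows "restrict (inv_into M f) M : isometries M d"
proof -
 have "restrict (inv_into M f) M : Bij M" using restrict_inv_into_Bij f by (auto simp: isometries_def)
 moreover have "d (inv_into M f x) (inv_into M f y) = d x y" if "x : M" "y : M" for x y
 proof -
  have "inv_into M f x : M" "inv_into M f y : M" "f (inv_into M f x) = x" "f (inv_into M f y) = y"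
   using that isoD(3)[OF f] by (simp_all add: inv_into_into f_inv_into_f)
  thus ?thesis using isoD(2)[OF f, of "inv_into M f x" "inv_into M f y"] by simp
 qed
 ultimately show ?thesis by (simp add: isometries_def)
qed

lemma iso_median_span: assumes f: "f : isometries M d" shows "f ` median_span = median_span"
proof
 show "f ` median_span <= median_span" using iso_median_span_sub[OF f] by auto
 show "median_span <= f ` median_span"
 proof
  fix y assume y: "y : median_span"
  hence yM: "y : M" by (rule median_span_M)
  have "restrict (inv_into M f) M y : median_span" by (rule iso_median_span_sub[OF iso_inverse[OF f] y])
  hence "inv_into M f y : median_span" using yM by simp
  moreover have "y = f (inv_into M f y)" using yM isoD(3)[OF f] by (simp add: f_inv_into_f)
  ultimately show "y : f ` median_span" by (rule rev_image_eqI)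
 qed
qed

end

lemma (in irreducible_action) wall_centers_nonempty: "wall_centers ~= {}"
proof -
 obtain h G where h: "ALL q::nat. wall (h q) & SN (h (Suc q)) (h q)"
  and G: "G <= carrier \<Gamma>" "finite G" "card G = 5" "ALL g:G. ALL g':G. g ~= g' --> \<phi> g ` h 0 \<inter> \<phi> g' ` h 0 = {}"
  using strongly_nested_chain[of 0] by (elim exE conjE)
 have "3 <= card G" using G(3) by simp
 from card_ge_3_obtain[OF G(2) this] obtain g1 g2 g3 where g: "g1 : G" "g2 : G" "g3 : G" "g1 ~= g2" "g1 ~= g3" "g2 ~= g3" .
 have gc: "g1 : carrier \<Gamma>" "g2 : carrier \<Gamma>" "g3 : carrier \<Gamma>" using g G(1) by auto
 have w: "wall (h 1)" "SN (h 1) (h 0)" using h by (auto simp: One_nat_def)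
 have dj: "\<phi> g1 ` h 0 \<inter> \<phi> g2 ` h 0 = {}" "\<phi> g1 ` h 0 \<inter> \<phi> g3 ` h 0 = {}" "\<phi> g2 ` h 0 \<inter> \<phi> g3 ` h 0 = {}"
  using G(4) g by blast+
 note c = SN_center[OF iso_SN[OF iso[OF gc(1)] w(2)] iso_SN[OF iso[OF gc(2)] w(2)] iso_SN[OF iso[OF gc(3)] w(2)] dj]
 obtain o' where o: "o' : h 1" using wall_ne(1)[OF w(1)] by auto
 have oM: "o' : M" using o wall_sub[OF w(1)] by auto
 define y where "y = m (\<phi> g1 o') (\<phi> g2 o') (\<phi> g3 o')"
 have "ALL a1:\<phi> g1 ` h 1. ALL a2:\<phi> g2 ` h 1. ALL a3:\<phi> g3 ` h 1. m a1 a2 a3 = y"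
  unfolding y_def by (intro ballI c) (use o in auto)
 moreover have "y : M" unfolding y_def using gc oM act_M by (intro med_props(4)) auto
 moreover have "wall (\<phi> g1 ` h 1)" "wall (\<phi> g2 ` h 1)" "wall (\<phi> g3 ` h 1)" using act_wall gc w(1) by auto
 ultimately have "y : wall_centers" unfolding wall_centers_def by blast
 thus ?thesis by auto
qed

text \<open>A dense homomorphism \<open>p\<close> into a topological group such that the elements close to the identity
 preserve a finite set.\<close>

locale extension = irreducible_action M d r \<Gamma> \<phi>
 for M :: "'a set" and d r and \<Gamma> :: "('g, 'e) monoid_scheme" (structure) and \<phi> +
 fixes H :: "('h, 'f) monoid_scheme" and S :: "'h topology" and p :: "'g => 'h" and F :: "'a set" and V0 :: "'h set"
 assumes tgH: "topological_group H S"
  and p_hom: "p : hom \<Gamma> H"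
  and p_dense: "!!V v. openin S V ==> v : V ==> EX g:carrier \<Gamma>. p g : V"
  and F: "F ~= {}" "F <= M" "finite F"
  and V0: "openin S V0" "\<one>\<^bsub>H\<^esub> : V0" "!!g. g : carrier \<Gamma> ==> p g : V0 ==> \<phi> g ` F = F"
begin

abbreviation eH where "eH == \<one>\<^bsub>H\<^esub>"
abbreviation mH (infixl "\<cdot>" 70) where "x \<cdot> y == x \<otimes>\<^bsub>H\<^esub> y"

interpretation H: group H using tgH by (simp add: topological_group_def)

lemma topH: "topspace S = carrier H" using tgH by (simp add: topological_group_def)

lemma H_mult_cont: "continuous_map (prod_topology S S) S (%(x, y). x \<cdot> y)"
 using tgH by (simp add: topological_group_def)

lemma H_inv_cont: "continuous_map S S (%x. inv\<^bsub>H\<^esub> x)"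
 using tgH by (simp add: topological_group_def)

lemma p_closed: "g : carrier \<Gamma> ==> p g : carrier H" using p_hom by (auto simp: hom_def)
lemma p_mult: "g : carrier \<Gamma> ==> k : carrier \<Gamma> ==> p (g \<otimes> k) = p g \<cdot> p k" using p_hom by (auto simp: hom_def)

lemma p_group_hom: "group_hom \<Gamma> H p"
 by (simp add: group_hom_def group_hom_axioms_def Gm.group_axioms H.group_axioms p_hom)

lemma p_one: "p \<one> = eH" by (rule group_hom.hom_one[OF p_group_hom])
lemma p_inv: "g : carrier \<Gamma> ==> p (inv g) = inv\<^bsub>H\<^esub> (p g)" by (rule group_hom.hom_inv[OF p_group_hom])

lemma conj_open: assumes a: "a : carrier H" and V: "openin S V" "eH : V"
 shows "EX W. openin S W & eH : W & (ALL x:W. inv\<^bsub>H\<^esub> a \<cdot> x \<cdot> a : V)"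
proof -
 have c: "continuous_map S (prod_topology S S) (%x. (b, x))" "continuous_map S (prod_topology S S) (%x. (x, b))"
  if "b : carrier H" for b using that by (auto intro!: continuous_map_pairedI simp: topH)
 have "continuous_map S S (%x. inv\<^bsub>H\<^esub> a \<cdot> x)"
  using continuous_map_compose[OF c(1)[OF H.inv_closed[OF a]] H_mult_cont] by (simp add: o_def)
 from continuous_map_compose[OF this continuous_map_compose[OF c(2)[OF a] H_mult_cont]]
 have "continuous_map S S (%x. inv\<^bsub>H\<^esub> a \<cdot> x \<cdot> a)" by (simp add: o_def)
 from openin_continuous_map_preimage[OF this V(1)]
 show ?thesis using V(2) a by (intro exI[of _ "{x : topspace S. inv\<^bsub>H\<^esub> a \<cdot> x \<cdot> a : V}"]) (simp add: topH)
qed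

text \<open>The orbit map of \<open>y\<close> is locally constant with respect to the topology of \<open>H\<close>.\<close>

definition smooth :: "'a => bool" where
 "smooth y \<longleftrightarrow> (EX V. openin S V & eH : V & (ALL g:carrier \<Gamma>. p g : V --> \<phi> g y = y))"

text \<open>A translate of the finite set lies in a given wall, and small elements preserve the translate. So
 they move some point of the wall within the wall.\<close>

lemma wall_return:
 assumes B: "wall B"
 shows "EX a:B. EX W. openin S W & eH : W & (ALL g:carrier \<Gamma>. p g : W --> \<phi> g a : B)"
proof -
 obtain k where k: "k : carrier \<Gamma>" "\<phi> k ` F <= B" using push_finite_into[OF B F(3,2)] by auto
 obtain f where f: "f : F" using F(1) by auto
 obtain W where W: "openin S W" "eH : W" "ALL x:W. inv\<^bsub>H\<^esub> (p k) \<cdot> x \<cdot> p k : V0"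
  using conj_open[OF p_closed[OF k(1)] V0(1,2)] by blast
 have "\<phi> g (\<phi> k f) : B" if g: "g : carrier \<Gamma>" "p g : W" for g
 proof -
  have c: "inv k \<otimes> g \<otimes> k : carrier \<Gamma>" using g k by simp
  have "p (inv k \<otimes> g \<otimes> k) : V0" using W(3) g k by (simp add: p_mult p_inv)
  hence FF: "\<phi> (inv k \<otimes> g \<otimes> k) ` F = F" by (rule V0(3)[OF c])
  have "g \<otimes> k = k \<otimes> (inv k \<otimes> g \<otimes> k)" using g k by (simp add: Gm.m_assoc Gm.cancel_inv)
  hence "\<phi> g ` \<phi> k ` F = \<phi> k ` \<phi> (inv k \<otimes> g \<otimes> k) ` F"
   using act_mult_image[OF F(2) g(1) k(1)] act_mult_image[OF F(2) k(1) c] by simp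
  hence "\<phi> g ` \<phi> k ` F = \<phi> k ` F" by (simp only: FF)
  hence "\<phi> g (\<phi> k f) : \<phi> k ` F" using f by blast
  thus ?thesis using k(2) by auto
 qed
 thus ?thesis using W(1,2) k(2) f by (intro bexI[of _ "\<phi> k f"] exI[of _ W]) auto
qed

text \<open>A point of each of the three walls stays in its wall, and so the center does not move.\<close>

lemma smooth_span: "y : median_span ==> smooth y"
proof (induction rule: median_span.induct)
 case (base y)
 thus ?case
 proof (rule wall_centersE)
  fix B1 B2 B3 assume B: "wall B1" "wall B2" "wall B3" "!!a1 a2 a3. a1 : B1 ==> a2 : B2 ==> a3 : B3 ==> m a1 a2 a3 = y"
  obtain a1 W1 where 1: "a1 : B1" "openin S W1" "eH : W1" "ALL g:carrier \<Gamma>. p g : W1 --> \<phi> g a1 : B1"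
   using wall_return[OF B(1)] by (elim bexE exE conjE)
  obtain a2 W2 where 2: "a2 : B2" "openin S W2" "eH : W2" "ALL g:carrier \<Gamma>. p g : W2 --> \<phi> g a2 : B2"
   using wall_return[OF B(2)] by (elim bexE exE conjE)
  obtain a3 W3 where 3: "a3 : B3" "openin S W3" "eH : W3" "ALL g:carrier \<Gamma>. p g : W3 --> \<phi> g a3 : B3"
   using wall_return[OF B(3)] by (elim bexE exE conjE)
  have aM: "a1 : M" "a2 : M" "a3 : M"
   using subsetD[OF wall_sub[OF B(1)] 1(1)] subsetD[OF wall_sub[OF B(2)] 2(1)] subsetD[OF wall_sub[OF B(3)] 3(1)] by simp_all
  have "\<phi> g y = y" if g: "g : carrier \<Gamma>" "p g : W1 \<inter> W2 \<inter> W3" for g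
  proof -
   have "\<phi> g y = m (\<phi> g a1) (\<phi> g a2) (\<phi> g a3)" using iso_med[OF iso[OF g(1)] aM] B(4)[OF 1(1) 2(1) 3(1)] by simp
   also have "... = y" by (rule B(4)) (use 1(4) 2(4) 3(4) g in auto)
   finally show ?thesis .
  qed
  moreover have "openin S (W1 \<inter> W2 \<inter> W3)" using 1 2 3 by (intro openin_Int)
  ultimately show ?thesis using 1(3) 2(3) 3(3) unfolding smooth_def by (intro exI[of _ "W1 \<inter> W2 \<inter> W3"]) simp
 qed
next
 case (step a b c)
 obtain A where A: "openin S A" "eH : A" "ALL g:carrier \<Gamma>. p g : A --> \<phi> g a = a" using step.IH(1) unfolding smooth_def by blast
 obtain B where B: "openin S B" "eH : B" "ALL g:carrier \<Gamma>. p g : B --> \<phi> g b = b" using step.IH(2) unfolding smooth_def by blast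
 obtain C where C: "openin S C" "eH : C" "ALL g:carrier \<Gamma>. p g : C --> \<phi> g c = c" using step.IH(3) unfolding smooth_def by blast
 have "\<phi> g (m a b c) = m a b c" if g: "g : carrier \<Gamma>" "p g : A \<inter> B \<inter> C" for g
  using iso_med[OF iso[OF g(1)] median_span_M[OF step.hyps(1)] median_span_M[OF step.hyps(2)] median_span_M[OF step.hyps(3)]]
   A(3) B(3) C(3) g by simp
 moreover have "openin S (A \<inter> B \<inter> C)" using A B C by (intro openin_Int)
 ultimately show ?case using A(2) B(2) C(2) unfolding smooth_def by (intro exI[of _ "A \<inter> B \<inter> C"]) simp
qed

text \<open>The limit of \<open>\<phi> k y\<close> for \<open>p k\<close> tending to \<open>g\<close>, with values in the discrete space \<open>M\<close>.\<close>

definition lim_at :: "'h => 'a => 'a => bool" where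
 "lim_at g y z \<longleftrightarrow> (EX V. openin S V & g : V & (ALL k:carrier \<Gamma>. p k : V --> \<phi> k y = z))"

lemma span_act: "k : carrier \<Gamma> ==> y : median_span ==> \<phi> k y : median_span"
 by (rule iso_median_span_sub[OF iso])

lemma lim_at_ex: assumes g: "g : carrier H" and y: "y : median_span" shows "EX z:median_span. lim_at g y z"
proof -
 obtain V where V: "openin S V" "eH : V" "ALL k:carrier \<Gamma>. p k : V --> \<phi> k y = y"
  using smooth_span[OF y] unfolding smooth_def by blast
 have q: "continuous_map (prod_topology S S) S (%z. inv\<^bsub>H\<^esub> (fst z) \<cdot> snd z)"
  using continuous_map_compose[OF continuous_map_pairedI[OF
    continuous_map_compose[OF continuous_map_fst H_inv_cont] continuous_map_snd] H_mult_cont] by (simp add: o_def)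
 let ?Z = "{z : topspace (prod_topology S S). inv\<^bsub>H\<^esub> (fst z) \<cdot> snd z : V}"
 have "openin (prod_topology S S) ?Z" by (rule openin_continuous_map_preimage[OF q V(1)])
 moreover have "(g, g) : ?Z" using g V(2) by (simp add: topH)
 ultimately have "EX U1 U2. openin S U1 & openin S U2 & g : U1 & g : U2 & U1 \<times> U2 <= ?Z"
  by (simp only: openin_prod_topology_alt)
 then obtain U1 U2 where U: "openin S U1" "openin S U2" "g : U1" "g : U2" "U1 \<times> U2 <= ?Z" by (elim exE conjE)
 obtain k0 where k0: "k0 : carrier \<Gamma>" "p k0 : U1" using p_dense[OF U(1,3)] by auto
 have "\<phi> k y = \<phi> k0 y" if k: "k : carrier \<Gamma>" "p k : U2" for k
 proof -
  have "(p k0, p k) : ?Z" using subsetD[OF U(5), of "(p k0, p k)"] k0 k by blast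
  hence "p (inv k0 \<otimes> k) : V" using k0 k by (simp add: p_mult p_inv)
  hence "\<phi> (inv k0 \<otimes> k) y = y" using V(3) k0 k by simp
  hence "\<phi> k0 (\<phi> (inv k0 \<otimes> k) y) = \<phi> k0 y" by simp
  moreover have "\<phi> k0 (\<phi> (inv k0 \<otimes> k) y) = \<phi> (k0 \<otimes> (inv k0 \<otimes> k)) y"
   using composition_rule[OF median_span_M[OF y] k0(1), of "inv k0 \<otimes> k"] k0 k by simp
  ultimately show ?thesis using k0 k by (simp add: Gm.cancel_inv)
 qed
 hence "lim_at g y (\<phi> k0 y)" unfolding lim_at_def using U(2,4) by blast
 thus ?thesis using span_act[OF k0(1) y] by blast
qed

text \<open>Limits at one element are attained simultaneously, so the properties of the action pass to
 them.\<close>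

lemma lim_at_pair:
 assumes "lim_at g y z" "lim_at g y' z'"
 shows "EX k:carrier \<Gamma>. \<phi> k y = z & \<phi> k y' = z'"
proof -
 obtain V where V: "openin S V" "g : V" "ALL k:carrier \<Gamma>. p k : V --> \<phi> k y = z" using assms(1) unfolding lim_at_def by blast
 obtain W where W: "openin S W" "g : W" "ALL k:carrier \<Gamma>. p k : W --> \<phi> k y' = z'" using assms(2) unfolding lim_at_def by blast
 obtain k where "k : carrier \<Gamma>" "p k : V \<inter> W" using p_dense[of "V \<inter> W" g] V W by auto
 thus ?thesis using V(3) W(3) by auto
qed

lemma lim_at_unique: "lim_at g y z ==> lim_at g y z' ==> z = z'"
 using lim_at_pair[of g y z y z'] by auto

lemma lim_at_mult:
 assumes "g : carrier H" "g' : carrier H" and l: "lim_at g' y z'" "lim_at g z' z" "lim_at (g \<cdot> g') y w" and y: "y : M"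
 shows "w = z"
proof -
 obtain V' where V': "openin S V'" "g' : V'" "ALL k:carrier \<Gamma>. p k : V' --> \<phi> k y = z'" using l(1) unfolding lim_at_def by blast
 obtain V where V: "openin S V" "g : V" "ALL k:carrier \<Gamma>. p k : V --> \<phi> k z' = z" using l(2) unfolding lim_at_def by blast
 obtain W where W: "openin S W" "g \<cdot> g' : W" "ALL k:carrier \<Gamma>. p k : W --> \<phi> k y = w" using l(3) unfolding lim_at_def by blast
 let ?Z = "{z : topspace (prod_topology S S). (%(x, y). x \<cdot> y) z : W}"
 have "openin (prod_topology S S) ?Z" by (rule openin_continuous_map_preimage[OF H_mult_cont W(1)])
 moreover have "(g, g') : ?Z" using assms(1,2) W(2) by (simp add: topH)
 ultimately have "EX U1 U2. openin S U1 & openin S U2 & g : U1 & g' : U2 & U1 \<times> U2 <= ?Z"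
  by (simp only: openin_prod_topology_alt)
 then obtain A A' where A: "openin S A" "openin S A'" "g : A" "g' : A'" "A \<times> A' <= ?Z" by (elim exE conjE)
 obtain k where k: "k : carrier \<Gamma>" "p k : A \<inter> V" using p_dense[of "A \<inter> V" g] A V by auto
 obtain k' where k': "k' : carrier \<Gamma>" "p k' : A' \<inter> V'" using p_dense[of "A' \<inter> V'" g'] A V' by auto
 have "(p k, p k') : ?Z" using subsetD[OF A(5), of "(p k, p k')"] k k' by blast
 hence "p (k \<otimes> k') : W" using k k' by (simp add: p_mult)
 hence "\<phi> (k \<otimes> k') y = w" using W(3) k k' by simp
 moreover have "\<phi> (k \<otimes> k') y = \<phi> k (\<phi> k' y)" by (rule composition_rule[OF y k(1) k'(1)])
 ultimately show ?thesis using V(3) V'(3) k k' by simp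
qed

definition \<rho> :: "'h => 'a => 'a" where "\<rho> g = (\<lambda>y\<in>median_span. THE z. lim_at g y z)"

lemma rho_eq: "lim_at g y z ==> y : median_span ==> \<rho> g y = z"
 unfolding \<rho>_def using lim_at_unique by (auto intro!: the_equality)

lemma rho_lim: assumes "g : carrier H" "y : median_span" shows "lim_at g y (\<rho> g y)" "\<rho> g y : median_span"
 using lim_at_ex[OF assms] rho_eq[OF _ assms(2)] by auto

lemma rho_p: assumes k: "k : carrier \<Gamma>" and y: "y : median_span" shows "\<rho> (p k) y = \<phi> k y"
 using rho_lim(1)[OF p_closed[OF k] y] k unfolding lim_at_def by auto

lemma rho_mult: assumes "g : carrier H" "g' : carrier H" "y : median_span" shows "\<rho> (g \<cdot> g') y = \<rho> g (\<rho> g' y)"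
 by (rule lim_at_mult[OF assms(1,2) rho_lim(1)[OF assms(2,3)] rho_lim(1)[OF assms(1) rho_lim(2)[OF assms(2,3)]]
    rho_lim(1)[OF H.m_closed[OF assms(1,2)] assms(3)] median_span_M[OF assms(3)]])

lemma rho_one: "y : median_span ==> \<rho> eH y = y"
 using rho_p[OF Gm.one_closed] act_one[OF median_span_M] by (simp add: p_one)

lemma rho_iso: assumes "g : carrier H" "y : median_span" "y' : median_span" shows "d (\<rho> g y) (\<rho> g y') = d y y'"
proof -
 obtain k where "k : carrier \<Gamma>" "\<phi> k y = \<rho> g y" "\<phi> k y' = \<rho> g y'"
  using lim_at_pair[OF rho_lim(1)[OF assms(1,2)] rho_lim(1)[OF assms(1,3)]] by blast
 thus ?thesis using isoD(2)[OF iso, of k y y'] median_span_M assms by simp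
qed

lemma rho_Bij: assumes g: "g : carrier H" shows "\<rho> g : Bij median_span"
proof -
 have "bij_betw (\<rho> g) median_span median_span"
 proof (rule bij_betw_byWitness[where f' = "\<rho> (inv\<^bsub>H\<^esub> g)"])
  show "ALL a:median_span. \<rho> (inv\<^bsub>H\<^esub> g) (\<rho> g a) = a"
   using rho_mult[of "inv\<^bsub>H\<^esub> g" g] g rho_one by simp
  show "ALL a:median_span. \<rho> g (\<rho> (inv\<^bsub>H\<^esub> g) a) = a"
   using rho_mult[of g "inv\<^bsub>H\<^esub> g"] g rho_one by simp
  show "\<rho> g ` median_span <= median_span" using rho_lim(2)[OF g] by auto
  show "\<rho> (inv\<^bsub>H\<^esub> g) ` median_span <= median_span" using rho_lim(2)[OF H.inv_closed[OF g]] by auto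
 qed
 thus ?thesis by (simp add: Bij_def \<rho>_def)
qed

proposition extended_action: "isometric_action H median_span d \<rho>"
proof -
 have "\<rho> (g \<cdot> g') = compose median_span (\<rho> g) (\<rho> g')" if g: "g : carrier H" "g' : carrier H" for g g'
 proof (rule extensionalityI)
  show "\<rho> (g \<cdot> g') : extensional median_span" by (simp add: \<rho>_def)
  show "compose median_span (\<rho> g) (\<rho> g') : extensional median_span" by (simp add: compose_def)
  show "\<rho> (g \<cdot> g') y = compose median_span (\<rho> g) (\<rho> g') y" if "y : median_span" for y
   using rho_mult[OF g that] that by (simp add: compose_def)
 qed
 hence "\<rho> : hom H (BijGroup median_span)" using rho_Bij by (auto simp: hom_def BijGroup_def)
 hence "group_action H median_span \<rho>"
  by (simp add: group_action_def group_hom_def group_hom_axioms_def H.group_axioms group_BijGroup)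
 thus ?thesis using rho_Bij rho_iso by (simp add: isometric_action_def isometries_def)
qed

end

section \<open>Extension to one factor\<close>

theorem theorem3:
  fixes n :: nat
    and G :: "nat \<Rightarrow> 'g monoid" and T :: "nat \<Rightarrow> 'g topology"
    and \<Gamma> :: "(nat \<Rightarrow> 'g) set"
    and X :: "'x set" and d :: "'x \<Rightarrow> 'x \<Rightarrow> real"
    and \<phi> :: "(nat \<Rightarrow> 'g) \<Rightarrow> 'x \<Rightarrow> 'x"
  assumes "n \<ge> 2"
    and "\<And>i. i \<in> {1..n} \<Longrightarrow> lcsc_group (G i) (T i)"
    and "irreducible_lattice {1..n} G T \<Gamma>"
    and "median_space X d"
    and "Metric_space.mcomplete X d"
    and "separable_metric X d"
    and "median_irreducible X d"
    and "median_rank X d < \<infinity>"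
    and "isometric_action ((product_group {1..n} G)\<lparr>carrier := \<Gamma>\<rparr>) X d \<phi>"
    and "roller_minimal ((product_group {1..n} G)\<lparr>carrier := \<Gamma>\<rparr>) X d \<phi>"
    and "roller_nonelementary ((product_group {1..n} G)\<lparr>carrier := \<Gamma>\<rparr>) X d \<phi>"
  shows "\<exists>Y. median_subspace X d Y \<and> (\<forall>f\<in>isometries X d. f ` Y = Y) \<and>
           (\<exists>\<psi>. isometric_action (product_group {1..n} G) Y d \<psi> \<and>
              (\<forall>\<gamma>\<in>\<Gamma>. \<forall>y\<in>Y. \<psi> \<gamma> y = \<phi> \<gamma> y) \<and>
              (\<exists>i\<in>{1..n}. \<exists>\<rho>. isometric_action (G i) Y d \<rho> \<and>
                 (\<forall>g\<in>carrier (product_group {1..n} G). \<psi> g = \<rho> (g i))))"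
proof -
 define P where "P = product_group {1..n} G"
 define PT where "PT = product_topology T {1..n}"
 define R where "R = P\<lparr>carrier := \<Gamma>\<rparr>"
 have R: "carrier R = \<Gamma>" "mult R = mult P" "one R = one P" by (simp_all add: R_def)
 have tg: "topological_group (G i) (T i)" and sc: "second_countable (T i)" if "i : {1..n}" for i
  using assms(2)[OF that] by (simp_all add: lcsc_group_def)
 have lat: "lattice_subgroup P PT \<Gamma>"
  and dense: "!!i. i : {1..n} ==> product_topology T ({1..n} - {i}) closure_of ((%g. restrict g ({1..n} - {i})) ` \<Gamma>)
   = topspace (product_topology T ({1..n} - {i}))"
  using assms(3) by (simp_all add: irreducible_lattice_def P_def PT_def)
 obtain \<mu> where mu: "sets \<mu> = sets (coset_borel P PT \<Gamma>)" "finite_measure \<mu>" "emeasure \<mu> (space \<mu>) ~= 0"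
  "ALL g:carrier P. ALL A:sets \<mu>. emeasure \<mu> ((%C. l_coset P g C) ` A) = emeasure \<mu> A"
  using lat unfolding lattice_subgroup_def by (elim exE conjE)
 have lm: "lattice_measure P PT \<Gamma> \<mu>"
 proof (rule lattice_measure.intro)
  show "topological_group P PT" unfolding P_def PT_def by (rule topological_group_product[OF tg])
  show "second_countable PT" unfolding PT_def by (rule second_countable_product[OF _ sc]) simp
  show "subgroup \<Gamma> P" "subtopology PT \<Gamma> = discrete_topology \<Gamma>" using lat by (simp_all add: lattice_subgroup_def)
 qed (use mu in auto)
 interpret L: lattice_measure P PT \<Gamma> \<mu> by (rule lm)
 obtain r where r: "median_rank X d = enat r" using assms(8) by auto
 have "cmedian X d r"
 proof (intro cmedian.intro cmedian_axioms.intro)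
  show "median X d" using assms(4) by (rule median.intro)
  show "Metric_space.mcomplete X d" by fact
  fix H assume H: "finite H" "!!h. h : H ==> halfspace X d h" "pairwise (transverse X) H"
  have "enat (card H) <= median_rank X d" unfolding median_rank_def using H by (intro Sup_upper) blast
  thus "card H <= r" by (simp add: r)
 qed
 hence ia: "irreducible_action X d r R \<phi>"
 proof (intro irreducible_action.intro irreducible_action_axioms.intro median_action.intro median_action_axioms.intro)
  show "median_irreducible X d" by fact
  show "group_action R X \<phi>" using assms(9) by (simp add: isometric_action_def R_def P_def)
  show "\<phi> g : isometries X d" if "g : carrier R" for g
   using assms(9) that by (simp add: isometric_action_def R_def P_def)
  show "countable (carrier R)" using L.D_countable by (simp add: R)
  show "roller_minimal R X d \<phi>" "roller_nonelementary R X d \<phi>" using assms(10,11) by (simp_all add: R_def P_def)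
 qed
 interpret A: irreducible_action X d r R \<phi> by (rule ia)
 have "product_capacities P PT \<Gamma> \<mu> X \<phi> (med X d) {1..n} G T"
 proof (intro product_capacities.intro capacities.intro capacities_axioms.intro product_capacities_axioms.intro lm)
  show "\<phi> \<gamma> x : X" if "\<gamma> : \<Gamma>" "x : X" for \<gamma> x using A.act_M[of \<gamma> x] that by (simp add: R)
  show "\<phi> (\<gamma> \<otimes>\<^bsub>P\<^esub> \<delta>) x = \<phi> \<gamma> (\<phi> \<delta> x)" if "\<gamma> : \<Gamma>" "\<delta> : \<Gamma>" "x : X" for \<gamma> \<delta> x
   using A.composition_rule[of x \<gamma> \<delta>] that by (simp add: R)
  show "\<phi> \<one>\<^bsub>P\<^esub> x = x" if "x : X" for x using A.act_one[OF that] by (simp add: R)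
  show "med X d a b c : X" if "a : X" "b : X" "c : X" for a b c by (rule A.med_props(4)[OF that])
  show "med X d a b c = med X d b a c" if "a : X" "b : X" "c : X" for a b c by (rule A.med_swap12)
  show "med X d a b c = med X d a c b" if "a : X" "b : X" "c : X" for a b c by (rule A.med_swap23)
  show "\<phi> \<gamma> (med X d a b c) = med X d (\<phi> \<gamma> a) (\<phi> \<gamma> b) (\<phi> \<gamma> c)" if "\<gamma> : \<Gamma>" "a : X" "b : X" "c : X" for \<gamma> a b c
   by (rule A.iso_med[OF A.iso that(2-)]) (use that in "simp add: R")
  show "P = product_group {1..n} G" "PT = product_topology T {1..n}" by (simp_all add: P_def PT_def)
  show "EX j:{1..n}. j ~= i" if "i : {1..n}" for i
  proof (cases "i = 1")
   case True
   thus ?thesis using assms(1) by (intro bexI[of _ 2]) auto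
  next
   case False
   thus ?thesis using assms(1) by (intro bexI[of _ 1]) auto
  qed
 qed (use tg dense in auto)
 then interpret C: product_capacities P PT \<Gamma> \<mu> X \<phi> "med X d" "{1..n}" G T .
 obtain h where "(ALL q::nat. A.wall (h q) & A.SN (h (Suc q)) (h q)) & (EX g:carrier R. h n \<union> \<phi> g ` h n = X) &
   (\<exists>E\<subseteq>carrier R. finite E & card E = 5 & (ALL g:E. ALL g':E. g ~= g' --> \<phi> g ` h 0 \<inter> \<phi> g' ` h 0 = {}))"
  using A.strongly_nested_chain[of n] by (rule exE)
 note h = conjunct1[OF this] and fl = conjunct1[OF conjunct2[OF this]] and five = conjunct2[OF conjunct2[OF this]]
 obtain \<gamma>0 where g0: "\<gamma>0 : \<Gamma>" "h n \<union> \<phi> \<gamma>0 ` h n = X" using fl by (auto simp: R)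
 obtain E where E: "E <= \<Gamma>" "card E = 5" "ALL g:E. ALL g':E. g ~= g' --> \<phi> g ` h 0 \<inter> \<phi> g' ` h 0 = {}"
  using five unfolding R(1) by (elim exE conjE)
 have nest: "C.nest (h (Suc q)) (h q)" for q
 proof -
  have "A.SN (h (Suc q)) (h q)" "h (Suc q) ~= {}" using h A.wall_ne(1)[of "h (Suc q)"] by simp_all
  thus ?thesis unfolding C.nest_def A.SN_def by (elim conjE) (intro conjI)
 qed
 have pw: "pairwise (C.dj (h 0)) E" using E(3) by (simp add: pairwise_def C.dj_def)
 have "EX i:{1..n}. EX F V. finite F & F ~= {} & F <= X & openin (T i) V & \<one>\<^bsub>G i\<^esub> : V &
   (ALL \<gamma>:\<Gamma>. \<gamma> i : V --> \<phi> \<gamma> ` F = F)"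
  by (rule C.finite_set_fixed_by_neighbourhood[of h, OF nest g0(1) _ E(1,2) pw]) (simp add: g0(2))
 then obtain i F V where i: "i : {1..n}" and F: "finite F" "F ~= {}" "F <= X"
  and V: "openin (T i) V" "\<one>\<^bsub>G i\<^esub> : V" "ALL \<gamma>:\<Gamma>. \<gamma> i : V --> \<phi> \<gamma> ` F = F"
  by (elim bexE exE conjE)
 have "extension X d r R \<phi> (G i) (T i) (%\<gamma>. \<gamma> i) F V"
 proof (intro extension.intro extension_axioms.intro ia)
  show "topological_group (G i) (T i)" by (rule tg[OF i])
  show "(%\<gamma>. \<gamma> i) : hom R (G i)"
   using i C.comp_closed[OF L.D_sub i] by (auto simp: hom_def R C.P_mult)
  show "EX g:carrier R. g i : U" if "openin (T i) U" "v : U" for U v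
   using C.coords_dense[OF i that] by (auto simp: C.coords_def R)
 qed (use F V in "auto simp: R")
 then interpret X: extension X d r R \<phi> "G i" "T i" "%\<gamma>. \<gamma> i" F V .
 let ?Y = "A.median_span"
 have sub: "median_subspace X d ?Y"
  using A.median_span_M A.wall_centers_nonempty A.median_span.intros unfolding median_subspace_def by blast
 have rho: "isometric_action (G i) ?Y d X.\<rho>" by (rule X.extended_action)
 define \<psi> where "\<psi> g = X.\<rho> (g i)" for g :: "nat => 'g"
 have "isometric_action P ?Y d \<psi>"
 proof -
  have pr: "(%g. g i) : hom P (G i)" using i C.comp_closed[OF _ i] by (auto simp: hom_def C.P_mult)
  have "X.\<rho> : hom (G i) (BijGroup ?Y)"
   using rho by (simp add: isometric_action_def group_action_def group_hom_def group_hom_axioms_def)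
  from Group.hom_compose[OF pr this] have "\<psi> : hom P (BijGroup ?Y)" unfolding \<psi>_def[abs_def] o_def .
  hence "group_action P ?Y \<psi>"
   by (simp add: group_action_def group_hom_def group_hom_axioms_def L.group_axioms group_BijGroup)
  thus ?thesis using rho C.comp_closed[OF _ i] by (simp add: isometric_action_def \<psi>_def)
 qed
 moreover have "ALL \<gamma>:\<Gamma>. ALL y:?Y. \<psi> \<gamma> y = \<phi> \<gamma> y" using X.rho_p by (simp add: \<psi>_def R)
 ultimately have "isometric_action P ?Y d \<psi> & (ALL \<gamma>:\<Gamma>. ALL y:?Y. \<psi> \<gamma> y = \<phi> \<gamma> y) &
   (EX i:{1..n}. EX \<rho>. isometric_action (G i) ?Y d \<rho> & (ALL g:carrier P. \<psi> g = \<rho> (g i)))"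
  using rho i by (auto simp: \<psi>_def)
 moreover have "ALL f:isometries X d. f ` ?Y = ?Y" using A.iso_median_span by blast
 ultimately show ?thesis using sub unfolding P_def by blast
qed

end
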